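(* Let $\mathbb K$ be $\mathbb R$ or $\mathbb C$ and let $\theta$ be a symmetric subset of $\{1,\dots,d-1\}$. If $\Gamma\subset\mathsf{PGL}(d,\mathbb K)$ is $P_\theta$-transverse, then there exist $d_0\in\mathbb N$, a properly convex domain $\Omega\subset\mathbb P(\mathbb R^{d_0})$, a projectively visible subgroup $\Gamma_0\subset\mathrm{Aut}(\Omega)$, a faithful representation $\rho:\Gamma_0\to\mathsf{PGL}(d,\mathbb K)$ and a $\rho$-equivariant continuous map $\xi:\Lambda_\Omega(\Gamma_0)\to\mathcal F_\theta$ such that $\rho(\Gamma_0)=\Gamma$ and $\xi(\Lambda_\Omega(\Gamma_0))=\Lambda_\theta(\Gamma)$.
   Context: Transverse groups. For $g\in\mathsf{PGL}(d,\mathbb K)$ let $\sigma_1(g)\ge\dots\ge\sigma_d(g)>0$ be the singular values of a lift with determinant of modulus $1$, $\kappa(g)=\mathrm{diag}(\log\sigma_1(g),\dots,\log\sigma_d(g))$ and $\alpha_k(\kappa(g))=\log\frac{\sigma_k(g)}{\sigma_{k+1}(g)}$. Write $g=\ell am$ with $\ell,m$ in the maximal compact subgroup ($\mathsf{PO}(d)$ or $\mathsf{PU}(d)$) and $a$ diagonal with entries $\sigma_1(g),\dots,\sigma_d(g)$; if $\alpha_k(\kappa(g))>0$, the subspace $U_k(g)=\ell(\langle e_1,\dots,e_k\rangle)$ is well defined. A subset $\theta=\{k_1<\dots<k_r\}$ of $\{1,\dots,d-1\}$ is symmetric if $k\in\theta\iff d-k\in\theta$. $\mathcal F_\theta=\{F^{k_1}\subset\dots\subset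 F^{k_r}\subset\mathbb K^d:\dim F^{k_i}=k_i\}$. A subset $X\subset\mathcal F_\theta$ is transverse if for all distinct $F,G\in X$ and all $k\in\theta$, $F^k$ and $G^{d-k}$ are transverse. A subgroup $\Gamma\subset\mathsf{PGL}(d,\mathbb K)$ is $P_k$-divergent if $\alpha_k(\kappa(\gamma_n))\to\infty$ for every sequence $\{\gamma_n\}$ of pairwise distinct elements of $\Gamma$. If $\Gamma$ is $P_k$-divergent for all $k\in\theta$, then $U_\theta(\gamma)=(U_k(\gamma))_{k\in\theta}$ is defined for all but finitely many $\gamma\in\Gamma$, and $\Lambda_\theta(\Gamma)\subset\mathcal F_\theta$ is the set of all limits of $U_\theta(\gamma_n)$ along sequences of pairwise distinct elements. $\Gamma$ is $P_\theta$-transverse if it is $P_k$-divergent for all $k\in\theta$ and $\Lambda_\theta(\Gamma)$ is a transverse subset of $\mathcal F_\theta$. Projectively visible groups. A domain $\Omega\subset\mathbb P(\mathbb R^{d_0})$ is properly convex if it is a bounded convex subset of some affine chart; $\mathrm{Aut}(\Omega)\subset\mathsf{PGL}(d_0,\mathbb R)$ is its stabilizer. For $\Gamma_0\subset\mathrm{Aut}(\Omega)$, the full orbital limit set is $\Lambda_\Omega(\Gamma_0)=\{z\in\partial\Omega: z=\lim\gamma_n(x)\text{ for some }x\in\Omega,\ \{\gamma_n\}\subset\Gamma_0\}$. A discrete subgroup $\Gamma_0\subset\mathrm{Aut}(\Omega)$ is a projectively visible subgroup of $\mathrm{Aut}(\Omega)$ if every $x\in\Lambda_\Omega(\Gamma_0)$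 lies in a unique supporting hyperplane to $\Omega$, and for all distinct $x,y\in\Lambda_\Omega(\Gamma_0)$ the open projective line segment in $\overline\Omega$ joining $x$ and $y$ is contained in $\Omega$. *)

theory Defs
  imports "HOL-Analysis.Analysis" "HOL-Algebra.Coset"
    "Jordan_Normal_Form.Schur_Decomposition" "Jordan_Normal_Form.DL_Rank"
begin

section \<open>Quotient topologies\<close>

definition quotient_topology :: "'a topology \<Rightarrow> ('a \<Rightarrow> 'b) \<Rightarrow> 'b topology" where
  "quotient_topology X f =
     topology (\<lambda>U. U \<subseteq> f ` topspace X \<and> openin X {x \<in> topspace X. f x \<in> U})"

lemma openin_quotient_topology:
  "openin (quotient_topology X f) U \<longleftrightarrow>
     U \<subseteq> f ` topspace X \<and> openin X {x \<in> topspace X. f x \<in> U}"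
proof -
  have "istopology (\<lambda>U. U \<subseteq> f ` topspace X \<and> openin X {x \<in> topspace X. f x \<in> U})"
    unfolding istopology_def
  proof (intro conjI allI impI)
    fix S T
    assume "S \<subseteq> f ` topspace X \<and> openin X {x \<in> topspace X. f x \<in> S}"
      and "T \<subseteq> f ` topspace X \<and> openin X {x \<in> topspace X. f x \<in> T}"
    moreover have "{x \<in> topspace X. f x \<in> S \<inter> T} =
        {x \<in> topspace X. f x \<in> S} \<inter> {x \<in> topspace X. f x \<in> T}" by auto
    ultimately show "S \<inter> T \<subseteq> f ` topspace X" "openin X {x \<in> topspace X. f x \<in> S \<inter> T}"
      by auto
  next
    fix \<K>
    assume *: "\<forall>K\<in>\<K>. K \<subseteq> f ` topspace X \<and> openin X {x \<in> topspace X. f x \<in> K}"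
    then show "\<Union>\<K> \<subseteq> f ` topspace X" by blast
    have "{x \<in> topspace X. f x \<in> \<Union>\<K>} = (\<Union>K\<in>\<K>. {x \<in> topspace X. f x \<in> K})" by auto
    then show "openin X {x \<in> topspace X. f x \<in> \<Union>\<K>}" using * by auto
  qed
  then show ?thesis by (simp add: quotient_topology_def topology_inverse')
qed

lemma quotient_map_quotient_topology: "quotient_map X (quotient_topology X f) f"
proof -
  have "topspace (quotient_topology X f) = f ` topspace X"
    by (rule antisym)
      (auto simp: topspace_def openin_quotient_topology
        intro!: exI[of _ "f ` topspace X"] openin_subopen[THEN iffD2])
  then show ?thesis by (auto simp: quotient_map_def openin_quotient_topology)
qed


section \<open>The group PGL and Grassmannians\<close>

text \<open>Entrywise topology on \<open>m \<times> n\<close> matrices.\<close>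

definition mat_topology :: "nat \<Rightarrow> nat \<Rightarrow> 'k::topological_space mat topology" where
  "mat_topology m n = pullback_topology (carrier_mat m n)
     (\<lambda>A. \<lambda>p\<in>{..<m} \<times> {..<n}. A $$ p) (product_topology (\<lambda>_. euclidean) ({..<m} \<times> {..<n}))"

lemma topspace_mat_topology [simp]: "topspace (mat_topology m n) = carrier_mat m n"
  by (auto simp: mat_topology_def topspace_pullback_topology)

definition GL :: "nat \<Rightarrow> 'k::field mat monoid" where
  "GL n = units_of (ring_mat TYPE('k) n ())"

definition scalars :: "nat \<Rightarrow> 'k::field mat set" where
  "scalars n = {c \<cdot>\<^sub>m 1\<^sub>m n | c. c \<noteq> 0}"

definition PGL :: "nat \<Rightarrow> 'k::field mat set monoid" where
  "PGL n = GL n Mod scalars n"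

lemma group_GL: "group (GL n :: 'k::field mat monoid)"
  unfolding GL_def by (rule monoid.units_group) (rule ring.is_monoid[OF ring_mat])

lemma GL_simps [simp]: "A \<otimes>\<^bsub>GL n\<^esub> B = A * B" "\<one>\<^bsub>GL n\<^esub> = 1\<^sub>m n"
  by (simp_all add: GL_def units_of_def ring_mat_simps)

lemma carrier_GL: "carrier (GL n) = {A \<in> carrier_mat n n. det A \<noteq> (0::'k::field)}"
  using unit_imp_det_non_zero[where 'a='k and n=n and b="()"] det_non_zero_imp_unit[where 'a='k and n=n and b="()"]
  by (auto simp: GL_def units_of_def Units_def ring_mat_simps)

lemma scalars_normal: "scalars n \<lhd> (GL n :: 'k::field mat monoid)"
proof -
  interpret G: group "GL n :: 'k mat monoid" by (rule group_GL)
  have sub: "scalars n \<subseteq> carrier (GL n :: 'k mat monoid)"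
    by (auto simp: scalars_def carrier_GL)
  have m: "(c \<cdot>\<^sub>m 1\<^sub>m n) * (e \<cdot>\<^sub>m 1\<^sub>m n) = (c * e) \<cdot>\<^sub>m (1\<^sub>m n :: 'k mat)" for c e
    by (subst mult_smult_assoc_mat[where nr = n and n = n and nc = n]) (auto simp: mult.assoc)
  have "subgroup (scalars n) (GL n :: 'k mat monoid)"
  proof (rule G.subgroupI[OF sub])
    show "scalars n \<noteq> ({} :: 'k mat set)" by (auto simp: scalars_def intro: exI[of _ 1])
    fix a b :: "'k mat" assume a: "a \<in> scalars n" and b: "b \<in> scalars n"
    then show "a \<otimes>\<^bsub>GL n\<^esub> b \<in> scalars n" unfolding scalars_def GL_simps
      using m by clarsimp (metis mult_eq_0_iff)
    from a obtain c where c: "a = c \<cdot>\<^sub>m 1\<^sub>m n" "c \<noteq> 0" by (auto simp: scalars_def)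
    have "inv\<^bsub>GL n\<^esub> a = inverse c \<cdot>\<^sub>m 1\<^sub>m n"
      by (rule G.inv_equality) (use c m in \<open>auto simp: carrier_GL\<close>)
    then show "inv\<^bsub>GL n\<^esub> a \<in> scalars n" using c by (auto simp: scalars_def)
  qed
  moreover have "x \<otimes>\<^bsub>GL n\<^esub> h \<otimes>\<^bsub>GL n\<^esub> inv\<^bsub>GL n\<^esub> x = h"
    if x: "x \<in> carrier (GL n)" and h: "h \<in> scalars n" for x h :: "'k mat"
  proof -
    from h obtain c where c: "h = c \<cdot>\<^sub>m 1\<^sub>m n" by (auto simp: scalars_def)
    have xn: "x \<in> carrier_mat n n" using x by (simp add: carrier_GL)
    have "x * h = h * x"
      unfolding c mult_smult_assoc_mat[OF one_carrier_mat xn] mult_smult_distrib[OF xn one_carrier_mat]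
      using xn by simp
    then have "x \<otimes>\<^bsub>GL n\<^esub> h = h \<otimes>\<^bsub>GL n\<^esub> x" by simp
    then show ?thesis using x h sub by (metis G.inv_solve_right G.m_closed subsetD)
  qed
  ultimately show ?thesis by (simp add: G.normal_inv_iff)
qed

lemma group_PGL: "group (PGL n :: 'k::field mat set monoid)"
  unfolding PGL_def by (rule normal.factorgroup_is_group[OF scalars_normal])

definition PGL_topology :: "nat \<Rightarrow> 'k::{field, topological_space} mat set topology" where
  "PGL_topology n = quotient_topology (subtopology (mat_topology n n) (carrier (GL n)))
     (\<lambda>A. scalars n #>\<^bsub>GL n\<^esub> A)"

definition Gr :: "nat \<Rightarrow> nat \<Rightarrow> 'k::field vec set set" where
  "Gr n k = {W. VectorSpace.subspace class_ring W (module_vec TYPE('k) n) \<and>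
     vectorspace.dim class_ring (module_vec TYPE('k) n\<lparr>carrier := W\<rparr>) = k}"

text \<open>The Grassmannian carries the quotient topology of the space of \<open>k\<close>-frames, a frame being
  encoded as an \<open>n \<times> k\<close> matrix of rank \<open>k\<close>.\<close>

definition Gr_topology :: "nat \<Rightarrow> nat \<Rightarrow> 'k::{field, topological_space} vec set topology" where
  "Gr_topology n k = quotient_topology
     (subtopology (mat_topology n k) {A. vec_space.rank n A = k}) (vec_space.col_space n)"

lemma (in vec_space) subspace_basis:
  assumes W: "VectorSpace.subspace class_ring W V"
  obtains B where "finite B" "B \<subseteq> carrier_vec n" "lin_indpt B" "span B = W"
proof -
  have sub: "LinearCombinations.submodule class_ring W V" using W by (simp add: VectorSpace.subspace_def)
  then have Wn: "W \<subseteq> carrier_vec n" by (simp add: submodule_def)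
  let ?P = "\<lambda>B. B \<subseteq> W \<and> lin_indpt B"
  have "\<exists>B. finite B \<and> maximal B ?P"
    by (rule maximal_exists[where N = local.dim and B="{}"])
      (use Wn li_le_dim[OF fin_dim] in \<open>auto simp: lin_dep_def\<close>)
  then obtain B where B: "finite B" "B \<subseteq> W" "lin_indpt B"
    and max: "\<And>C. B \<subseteq> C \<Longrightarrow> ?P C \<Longrightarrow> C = B" unfolding maximal_def by auto
  have "w \<in> span B" if w: "w \<in> W" for w
  proof (rule ccontr)
    assume n: "w \<notin> span B"
    then have "w \<notin> B" using in_own_span[of B] B Wn by auto
    with lin_dep_iff_in_span[of B w] n B Wn w have "lin_indpt (B \<union> {w})" by auto
    then have "B \<union> {w} = B" using max[of "B \<union> {w}"] B w by auto
    then show False using \<open>w \<notin> B\<close> by auto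
  qed
  moreover have "span B \<subseteq> W" using span_is_subset[OF B(2) sub] .
  ultimately show ?thesis using that[OF B(1) _ B(3)] B Wn by auto
qed

lemma topspace_Gr_topology:
  "topspace (Gr_topology n k) = (Gr n k :: 'k::{field, topological_space} vec set set)"
proof -
  interpret vec_space "TYPE('k)" n .
  have "topspace (Gr_topology n k) = col_space ` {A \<in> carrier_mat n k. rank A = k}"
    unfolding Gr_topology_def
    by (subst quotient_imp_surjective_map[OF quotient_map_quotient_topology, symmetric])
      (simp add: Int_def)
  also have "\<dots> = Gr n k"
  proof (intro equalityI subsetI)
    fix W :: "'k vec set" assume "W \<in> col_space ` {A \<in> carrier_mat n k. rank A = k}"
    then obtain A where A: "A \<in> carrier_mat n k" "rank A = k" "W = col_space A" by auto
    have "set (cols A) \<subseteq> carrier_vec n" using A(1) cols_dim by blast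
    then show "W \<in> Gr n k"
      using A span_is_subspace by (auto simp: Gr_def col_space_def rank_def)
  next
    fix W :: "'k vec set" assume "W \<in> Gr n k"
    then have W: "VectorSpace.subspace class_ring W V" "vectorspace.dim class_ring (vs W) = k"
      by (auto simp: Gr_def)
    then obtain B where B: "finite B" "B \<subseteq> carrier_vec n" "lin_indpt B" "span B = W"
      using subspace_basis by blast
    have "maximal B (\<lambda>T. T \<subseteq> B \<and> lin_indpt T)" using B by (auto simp: maximal_def)
    then have k: "card B = k" using dim_span[OF B(2,1)] B W by auto
    obtain bs where bs: "set bs = B" "distinct bs" using finite_distinct_list[OF B(1)] by auto
    let ?A = "mat_of_cols n bs"
    have "cols ?A = bs" using bs B by (simp add: cols_mat_of_cols)
    moreover have "length bs = k" using k bs distinct_card by metis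
    ultimately show "W \<in> col_space ` {A \<in> carrier_mat n k. rank A = k}"
      using W B bs by (intro image_eqI[of _ _ ?A]) (auto simp: col_space_def rank_def)
  qed
  finally show ?thesis .
qed

text \<open>An element of PGL is a set of proportional matrices; they all have the same effect on a
  linear subspace.\<close>

definition act :: "'k::field mat set \<Rightarrow> 'k vec set \<Rightarrow> 'k vec set" where
  "act g W = {A *\<^sub>v w | A w. A \<in> g \<and> w \<in> W}"


section \<open>Singular values and the Cartan decomposition\<close>

definition unitary_mats :: "nat \<Rightarrow> 'k::conjugatable_field mat set" where
  "unitary_mats n = {A \<in> carrier_mat n n. mat_adjoint A * A = 1\<^sub>m n}"

text \<open>Square roots of the eigenvalues of \<open>A\<^sup>*A\<close> (nonnegative reals, hence equal to their norms) with
  multiplicity, in decreasing order; indices start at 1.\<close>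

definition singular_value :: "nat \<Rightarrow> 'k::{real_normed_field, conjugatable_field} mat \<Rightarrow> real" where
  "singular_value i A = rev (sorted_list_of_multiset
     (image_mset (\<lambda>x. sqrt (norm x)) (proots (char_poly (mat_adjoint A * A))))) ! (i - 1)"

definition norm_lift :: "'k::real_normed_field mat set \<Rightarrow> 'k mat" where
  "norm_lift g = (SOME A. A \<in> g \<and> norm (det A) = 1)"

definition sing :: "nat \<Rightarrow> 'k::{real_normed_field, conjugatable_field} mat set \<Rightarrow> real" where
  "sing i g = singular_value i (norm_lift g)"

definition root_val :: "nat \<Rightarrow> 'k::{real_normed_field, conjugatable_field} mat set \<Rightarrow> real" where
  "root_val k g = ln (sing k g / sing (k + 1) g)"

definition sing_diag :: "nat \<Rightarrow> 'k::{real_normed_field, conjugatable_field} mat set \<Rightarrow> 'k mat" where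
  "sing_diag n g = mat_diag n (\<lambda>i. of_real (sing (i + 1) g))"

text \<open>Only meaningful when \<open>root_val k g > 0\<close>, in which case the subspace does not depend on the
  decomposition.  The standard basis is indexed from 0.\<close>

definition cartan_subspace ::
    "nat \<Rightarrow> nat \<Rightarrow> 'k::{real_normed_field, conjugatable_field} mat set \<Rightarrow> 'k vec set" where
  "cartan_subspace n k g = (THE W. \<exists>l\<in>unitary_mats n. \<exists>m\<in>unitary_mats n.
     norm_lift g = l * sing_diag n g * m \<and>
     W = (\<lambda>v. l *\<^sub>v v) ` LinearCombinations.module.span class_ring (module_vec TYPE('k) n)
           (unit_vec n ` {..<k}))"


section \<open>Flags and transverse groups\<close>

definition symmetric_subset :: "nat \<Rightarrow> nat set \<Rightarrow> bool" where
  "symmetric_subset n \<theta> \<longleftrightarrow> \<theta> \<subseteq> {1..n - 1} \<and> (\<forall>k\<in>{1..n - 1}. k \<in> \<theta> \<longleftrightarrow> n - k \<in> \<theta>)"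

definition flags :: "nat \<Rightarrow> nat set \<Rightarrow> (nat \<Rightarrow> 'k::field vec set) set" where
  "flags n \<theta> = {F \<in> (\<Pi>\<^sub>E k\<in>\<theta>. Gr n k). \<forall>k\<in>\<theta>. \<forall>l\<in>\<theta>. k \<le> l \<longrightarrow> F k \<subseteq> F l}"

definition flag_topology ::
    "nat \<Rightarrow> nat set \<Rightarrow> (nat \<Rightarrow> 'k::{field, topological_space} vec set) topology" where
  "flag_topology n \<theta> = subtopology (product_topology (\<lambda>k. Gr_topology n k) \<theta>) (flags n \<theta>)"

definition act_flag ::
    "nat set \<Rightarrow> 'k::field mat set \<Rightarrow> (nat \<Rightarrow> 'k vec set) \<Rightarrow> (nat \<Rightarrow> 'k vec set)" where
  "act_flag \<theta> g F = (\<lambda>k\<in>\<theta>. act g (F k))"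

text \<open>Since \<open>F k\<close> and \<open>G (n - k)\<close> have complementary dimensions, they are transverse iff they meet
  trivially.\<close>

definition transverse_flags :: "nat \<Rightarrow> nat set \<Rightarrow> (nat \<Rightarrow> 'k::field vec set) set \<Rightarrow> bool" where
  "transverse_flags n \<theta> X \<longleftrightarrow>
     (\<forall>F\<in>X. \<forall>G\<in>X. F \<noteq> G \<longrightarrow> (\<forall>k\<in>\<theta>. F k \<inter> G (n - k) = {0\<^sub>v n}))"

definition divergent ::
    "nat \<Rightarrow> 'k::{real_normed_field, conjugatable_field} mat set set \<Rightarrow> bool" where
  "divergent k \<Gamma> \<longleftrightarrow> (\<forall>\<gamma> :: nat \<Rightarrow> 'k mat set. inj \<gamma> \<and> range \<gamma> \<subseteq> \<Gamma> \<longrightarrow>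
     filterlim (\<lambda>i. root_val k (\<gamma> i)) at_top sequentially)"

definition limit_set :: "nat \<Rightarrow> nat set \<Rightarrow>
    'k::{real_normed_field, conjugatable_field} mat set set \<Rightarrow> (nat \<Rightarrow> 'k vec set) set" where
  "limit_set n \<theta> \<Gamma> = {F. \<exists>\<gamma> :: nat \<Rightarrow> 'k mat set. inj \<gamma> \<and> range \<gamma> \<subseteq> \<Gamma> \<and>
     limitin (flag_topology n \<theta>) (\<lambda>i. \<lambda>k\<in>\<theta>. cartan_subspace n k (\<gamma> i)) F sequentially}"

definition transverse_group ::
    "nat \<Rightarrow> nat set \<Rightarrow> 'k::{real_normed_field, conjugatable_field} mat set set \<Rightarrow> bool" where
  "transverse_group n \<theta> \<Gamma> \<longleftrightarrow> subgroup \<Gamma> (PGL n) \<and> (\<forall>k\<in>\<theta>. divergent k \<Gamma>) \<and>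
     transverse_flags n \<theta> (limit_set n \<theta> \<Gamma>)"


section \<open>Properly convex domains and projectively visible groups\<close>

text \<open>Points of projective space are lines through the origin.  The affine chart given by a nonzero
  functional \<open>f\<close> consists of the lines that meet the affine hyperplane \<open>f = 1\<close>.\<close>

abbreviation proj_topology :: "nat \<Rightarrow> real vec set topology" where
  "proj_topology n \<equiv> Gr_topology n 1"

definition properly_convex_domain :: "nat \<Rightarrow> real vec set set \<Rightarrow> bool" where
  "properly_convex_domain n \<Omega> \<longleftrightarrow>
     \<Omega> \<noteq> {} \<and> openin (proj_topology n) \<Omega> \<and> connectedin (proj_topology n) \<Omega> \<and>
     (\<exists>f\<in>carrier_vec n. f \<noteq> 0\<^sub>v n \<and> (\<forall>x\<in>\<Omega>. \<exists>v\<in>x. f \<bullet> v = 1) \<and>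
       (let S = {v \<in> \<Union>\<Omega>. f \<bullet> v = 1} in
         (\<forall>u\<in>S. \<forall>v\<in>S. \<forall>t\<in>{0..1}. (1 - t) \<cdot>\<^sub>v u + t \<cdot>\<^sub>v v \<in> S) \<and>
         (\<exists>B. \<forall>v\<in>S. \<forall>i<n. \<bar>v $ i\<bar> \<le> B)))"

definition Aut :: "nat \<Rightarrow> real vec set set \<Rightarrow> real mat set set" where
  "Aut n \<Omega> = {g \<in> carrier (PGL n). act g ` \<Omega> = \<Omega>}"

definition orbital_limit_set ::
    "nat \<Rightarrow> real vec set set \<Rightarrow> real mat set set \<Rightarrow> real vec set set" where
  "orbital_limit_set n \<Omega> \<Gamma> = {z \<in> proj_topology n frontier_of \<Omega>.
     \<exists>x\<in>\<Omega>. \<exists>\<gamma> :: nat \<Rightarrow> real mat set. range \<gamma> \<subseteq> \<Gamma> \<and>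
       limitin (proj_topology n) (\<lambda>i. act (\<gamma> i) x) z sequentially}"

definition supporting_hyperplane :: "nat \<Rightarrow> real vec set set \<Rightarrow> real vec set \<Rightarrow> bool" where
  "supporting_hyperplane n \<Omega> H \<longleftrightarrow> H \<in> Gr n (n - 1) \<and>
     (\<forall>x\<in>\<Omega>. \<not> x \<subseteq> H) \<and> (\<exists>x\<in>proj_topology n frontier_of \<Omega>. x \<subseteq> H)"

text \<open>Two distinct projective points are joined by two open segments (choose lifts \<open>u\<close>, \<open>v\<close> or
  \<open>u\<close>, \<open>-v\<close>).  If both points are in the closure of a properly convex domain, then exactly one of the
  two segments is contained in that closure.\<close>

definition open_proj_segment :: "nat \<Rightarrow> real vec set \<Rightarrow> real vec set \<Rightarrow> real vec set set \<Rightarrow> bool" where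
  "open_proj_segment n x y S \<longleftrightarrow> (\<exists>u\<in>x - {0\<^sub>v n}. \<exists>v\<in>y - {0\<^sub>v n}.
     S = {{c \<cdot>\<^sub>v (s \<cdot>\<^sub>v u + t \<cdot>\<^sub>v v) | c. True} | s t. s > 0 \<and> t > 0})"

definition projectively_visible ::
    "nat \<Rightarrow> real vec set set \<Rightarrow> real mat set set \<Rightarrow> bool" where
  "projectively_visible n \<Omega> \<Gamma> \<longleftrightarrow>
     subgroup \<Gamma> (PGL n) \<and> \<Gamma> \<subseteq> Aut n \<Omega> \<and>
     subtopology (PGL_topology n) \<Gamma> = discrete_topology \<Gamma> \<and>
     (\<forall>x\<in>orbital_limit_set n \<Omega> \<Gamma>. \<exists>!H. supporting_hyperplane n \<Omega> H \<and> x \<subseteq> H) \<and>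
     (\<forall>x\<in>orbital_limit_set n \<Omega> \<Gamma>. \<forall>y\<in>orbital_limit_set n \<Omega> \<Gamma>. x \<noteq> y \<longrightarrow>
       (\<forall>S. open_proj_segment n x y S \<and> S \<subseteq> proj_topology n closure_of \<Omega> \<longrightarrow> S \<subseteq> \<Omega>))"

end

theory Submission
  imports Defs
begin

text \<open>Choose \<open>k \<in> \<theta>\<close> with \<open>2 k \<le> d\<close>, so that \<open>F\<^sup>k
  \<subseteq> F\<^sup>d\<^sup>-\<^sup>k\<close> for every flag \<open>F\<close>. The functions \<open>X \<mapsto> |det
  (Y\<^sup>* X)|\<^sup>2\<close> on \<open>d \<times> k\<close> matrices span a real vector space of finite dimension
  \<open>N\<close> on which \<open>PGL(d)\<close> acts; the map \<open>u\<close> sends the \<open>k\<close>-plane of a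
  frame \<open>Y\<close> to the line of the function of \<open>Y\<close>, and \<open>wv\<close> sends \<open>Y\<close>
  to the functional that vanishes at \<open>u X\<close> iff the image of \<open>X\<close> meets the orthogonal
  complement of \<open>Y\<close>. For a transverse group, the functional of a limit flag vanishes at the point of a
  limit flag iff the two flags are equal, and it is positive otherwise. The domain \<open>\<Omega>\<close> is the
  projectivization of the open cone on which the functionals of all limit flags, and the \<open>\<Gamma>\<close>-orbit
  of finitely many functionals positive on all points \<open>u Y\<close>, are positive. These functionals are
  projectively compact since \<open>\<Gamma>\<close>-orbits accumulate only at the functionals of limit flags, as the
  Cartan decomposition shows. Hence \<open>\<Omega>\<close> is open and the limit flags give the orbital limit set;
  uniqueness of supporting hyperplanes and visibility of segments follow from the vanishing pattern.\<close>

text \<open>The difficulty is signs: a cone needs vectors and functionals with coherent signs, while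
  a flag only determines lines. The squared modulus of the determinant removes it. A scalar
  \<open>c\<close> and a change of frame \<open>C\<close> act by the positive factors
  \<open>|c|^(2k)\<close> and \<open>|det C|^2\<close>, so everything is determined up to positive
  factors, and the complex case also yields a real representation. The inclusion of the
  \<open>k\<close>-plane of a flag in its plane of dimension \<open>d - k\<close> makes the
  functional of a limit flag vanish at its own point, which puts this point on the boundary. The
  limit functionals alone may fail to cut out a properly convex domain (there are none if \<Gamma>
  is finite); the orbits of the additional functionals repair this, and being strictly positive on
  \<open>u Y\<close> for every frame \<open>Y\<close>, they never vanish at a limit point.
  Faithfulness holds because a matrix that preserves all \<open>k\<close>-planes is scalar. Singular
  values are given by roots of a characteristic polynomial, so the singular value decomposition has
  to be constructed.\<close>

unbundle no vec_syntax
unbundle no inner_syntax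

section \<open>Sequential description of the topology on matrices\<close>

text \<open>Entrywise convergence stands in for \<open>limitin\<close> in
  \<open>mat_topology\<close>. A matrix has finitely many entries in a metric space, so sequences
  detect open sets, and the topological claims below are checked on them.\<close>

definition mlim :: "nat \<Rightarrow> nat \<Rightarrow> (nat \<Rightarrow> 'k::topological_space mat) \<Rightarrow> 'k mat \<Rightarrow> bool" where
  "mlim m n B A \<longleftrightarrow> (\<forall>i<m. \<forall>j<n. (\<lambda>t. B t $$ (i, j)) \<longlonglongrightarrow> A $$ (i, j))"

lemma mlimD: "mlim m n B A \<Longrightarrow> i < m \<Longrightarrow> j < n \<Longrightarrow> (\<lambda>t. B t $$ (i, j)) \<longlonglongrightarrow> A $$ (i, j)"
  by (simp add: mlim_def)

lemma mlim_subseq: "mlim m n B A \<Longrightarrow> strict_mono r \<Longrightarrow> mlim m n (\<lambda>t. B (r t)) A"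
  unfolding mlim_def using LIMSEQ_subseq_LIMSEQ[unfolded o_def] by blast

lemma mlim_const: "mlim m n (\<lambda>_. A) A"
  by (simp add: mlim_def)

text \<open>It suffices that one term of each sequence lies in \<open>U\<close>: the sequence built
  from a failure of openness at \<open>x\<close> has all its terms in \<open>S - U\<close>, the one
  with index \<open>t\<close> within \<open>1/(t+1)\<close> of \<open>x\<close>.\<close>

lemma relatively_openI_seq:
  fixes S :: "'a::metric_space set"
  assumes "U \<subseteq> S"
    and seq: "\<And>x y. x \<in> U \<Longrightarrow> (\<And>t. y t \<in> S) \<Longrightarrow> y \<longlonglongrightarrow> x \<Longrightarrow> \<exists>t::nat. y t \<in> U"
  shows "\<exists>V. open V \<and> U = S \<inter> V"
proof -
  have "\<exists>e>0. S \<inter> ball x e \<subseteq> U" if x: "x \<in> U" for x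
  proof (rule ccontr)
    assume "\<not> ?thesis"
    then have "\<exists>y. y \<in> S \<and> y \<in> ball x (inverse (real (Suc t))) \<and> y \<notin> U" for t
      by (metis IntE inverse_positive_iff_positive of_nat_0_less_iff subsetI zero_less_Suc)
    then obtain y where y: "\<And>t. y t \<in> S" "\<And>t. dist x (y t) < inverse (real (Suc t))" "\<And>t. y t \<notin> U"
      by (metis mem_ball)
    have "(\<lambda>t. dist (y t) x) \<longlonglongrightarrow> 0"
      by (rule Lim_null_comparison[OF _ LIMSEQ_inverse_real_of_nat])
        (use y(2) in \<open>auto simp: dist_commute intro!: always_eventually less_imp_le\<close>)
    then have "y \<longlonglongrightarrow> x" by (simp add: tendsto_dist_iff[of y])
    have "\<exists>t. y t \<in> U" by (rule seq[OF x _ \<open>y \<longlonglongrightarrow> x\<close>]) (rule y(1))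
    with y(3) show False by blast
  qed
  then obtain e where e: "\<And>x. x \<in> U \<Longrightarrow> e x > 0 \<and> S \<inter> ball x (e x) \<subseteq> U" by metis
  show ?thesis
  proof (intro exI[of _ "\<Union>x\<in>U. ball x (e x)"] conjI)
    show "U = S \<inter> (\<Union>x\<in>U. ball x (e x))"
    proof (intro equalityI subsetI)
      fix z assume "z \<in> U"
      then show "z \<in> S \<inter> (\<Union>x\<in>U. ball x (e x))" using e assms(1) centre_in_ball by blast
    next
      fix z assume "z \<in> S \<inter> (\<Union>x\<in>U. ball x (e x))"
      then show "z \<in> U" using e by blast
    qed
  qed auto
qed

text \<open>Extending the entries by zero embeds \<open>S\<close> into the functions on
  \<open>nat \<times> nat\<close>, which form a metric space; there the sequential criterion gives
  an open set \<open>V\<close>. Pulling \<open>V\<close> back along the continuous extension by zero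
  returns to the finite product that defines \<open>mat_topology\<close>.\<close>

lemma openin_mat_topologyI_seq:
  fixes S :: "'k::{metric_space, zero} mat set"
  assumes "U \<subseteq> S" and S: "S \<subseteq> carrier_mat m n"
    and seq: "\<And>A B. A \<in> U \<Longrightarrow> (\<And>t. B t \<in> S) \<Longrightarrow> mlim m n B A \<Longrightarrow> \<exists>t::nat. B t \<in> U"
  shows "openin (subtopology (mat_topology m n) S) U"
proof -
  define I where "I = {..<m} \<times> {..<n}"
  define h where "h A = (\<lambda>p. if p \<in> I then A $$ p else 0)" for A :: "'k mat"
  have hi: "h A (i, j) = A $$ (i, j)" if "i < m" "j < n" for A i j using that by (simp add: h_def I_def)
  have inj: "A = B" if "h A = h B" "A \<in> S" "B \<in> S" for A B
  proof (rule eq_matI)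
    fix i j assume "i < dim_row B" "j < dim_col B"
    then show "A $$ (i, j) = B $$ (i, j)" using hi[of i j A] hi[of i j B] that S by force
  qed (use that S in \<open>auto dest!: subsetD[OF S]\<close>)
  have "\<exists>V. open V \<and> h ` U = h ` S \<inter> V"
  proof (rule relatively_openI_seq)
    show "h ` U \<subseteq> h ` S" using assms(1) by blast
    fix x y assume "x \<in> h ` U" and y: "\<And>t. y t \<in> h ` S" "y \<longlonglongrightarrow> x"
    then obtain A where A: "A \<in> U" "x = h A" by blast
    have "\<forall>t. \<exists>b. b \<in> S \<and> y t = h b" using y(1) by blast
    from choice[OF this] obtain B where "\<forall>t. B t \<in> S \<and> y t = h (B t)" by blast
    then have B: "\<And>t. B t \<in> S" "\<And>t. y t = h (B t)" by auto
    have "mlim m n B A" unfolding mlim_def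
    proof (intro allI impI)
      fix i j assume ij: "i < m" "j < n"
      have "(\<lambda>t. y t (i, j)) \<longlonglongrightarrow> x (i, j)"
        using continuous_on_tendsto_compose[OF continuous_on_product_coordinates y(2)] by simp
      then show "(\<lambda>t. B t $$ (i, j)) \<longlonglongrightarrow> A $$ (i, j)" using hi ij B A by simp
    qed
    have "\<exists>t. B t \<in> U" by (rule seq[OF A(1) _ \<open>mlim m n B A\<close>]) (rule B(1))
    then show "\<exists>t. y t \<in> h ` U" using B(2) by auto
  qed
  then obtain V where V: "open V" "h ` U = h ` S \<inter> V" by blast
  define F where "F A = (\<lambda>p\<in>I. A $$ p)" for A :: "'k mat"
  define e where "e x = (\<lambda>p. if p \<in> I then x p else 0)" for x :: "nat \<times> nat \<Rightarrow> 'k"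
  have "continuous_map (product_topology (\<lambda>_. euclidean) I) (product_topology (\<lambda>_. euclidean) UNIV) e"
    unfolding continuous_map_componentwise_UNIV e_def
    by (auto intro: continuous_map_product_projection[where X = "\<lambda>_. euclidean"])
  then have "continuous_map (product_topology (\<lambda>_. euclidean) I) euclidean e"
    by (simp add: euclidean_product_topology)
  then have op: "openin (product_topology (\<lambda>_. euclidean) I) {x \<in> topspace (product_topology (\<lambda>_. euclidean) I). e x \<in> V}"
    using V(1) by (auto simp: continuous_map_def)
  have eF: "e (F A) = h A" for A by (auto simp: e_def F_def h_def)
  let ?W = "{x \<in> topspace (product_topology (\<lambda>_. euclidean) I). e x \<in> V}"
  have "openin (mat_topology m n) (F -` ?W \<inter> carrier_mat m n)"
    unfolding mat_topology_def openin_pullback_topology using op by (auto simp: F_def I_def)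
  moreover have "U = (F -` ?W \<inter> carrier_mat m n) \<inter> S"
  proof -
    have "A \<in> U \<longleftrightarrow> A \<in> F -` ?W \<inter> carrier_mat m n" if "A \<in> S" for A
    proof -
      have "A \<in> F -` ?W \<inter> carrier_mat m n \<longleftrightarrow> h A \<in> V"
        using that S eF by (auto simp: F_def)
      also have "\<dots> \<longleftrightarrow> h A \<in> h ` U" using V(2) that by blast
      also have "\<dots> \<longleftrightarrow> A \<in> U" using inj that assms(1) by blast
      finally show ?thesis by simp
    qed
    then show ?thesis using assms(1) by blast
  qed
  ultimately show ?thesis unfolding openin_subtopology by blast
qed

lemma openin_mat_topology_seqD:
  assumes U: "openin (subtopology (mat_topology m n) S) U" and A: "A \<in> U"
    and B: "\<And>t. B t \<in> S" "\<And>t. B t \<in> carrier_mat m n" and lim: "mlim m n B A"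
  shows "\<forall>\<^sub>F t in sequentially. B t \<in> U"
proof -
  define I where "I = {..<m} \<times> {..<n}"
  define F where "F A = (\<lambda>p\<in>I. A $$ p)" for A :: "'a mat"
  obtain T where T: "openin (mat_topology m n) T" "U = T \<inter> S" using U unfolding openin_subtopology by blast
  then obtain W where W: "openin (product_topology (\<lambda>_. euclidean) I) W" "T = F -` W \<inter> carrier_mat m n"
    unfolding mat_topology_def openin_pullback_topology F_def I_def by blast
  have "limitin (product_topology (\<lambda>_. euclidean) I) (\<lambda>t. F (B t)) (F A) sequentially"
    unfolding limitin_componentwise
    by (use lim in \<open>auto simp: F_def I_def mlim_def\<close>)
  then have "\<forall>\<^sub>F t in sequentially. F (B t) \<in> W"
    using W A T by (auto simp: limitin_def)
  then show ?thesis by eventually_elim (use W T B in auto)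
qed

lemma bounded_entries_subseq:
  fixes x :: "nat \<Rightarrow> 'i \<Rightarrow> 'k::heine_borel"
  assumes "finite I" and "\<And>i. i \<in> I \<Longrightarrow> bounded (range (\<lambda>t. x t i))"
  shows "\<exists>l r. strict_mono (r::nat\<Rightarrow>nat) \<and> (\<forall>i\<in>I. (\<lambda>t. x (r t) i) \<longlonglongrightarrow> l i)"
  using assms
proof (induction I rule: finite_induct)
  case empty
  then show ?case using strict_mono_id by auto
next
  case (insert a I)
  then obtain l r where r: "strict_mono (r::nat\<Rightarrow>nat)" "\<And>i. i \<in> I \<Longrightarrow> (\<lambda>t. x (r t) i) \<longlonglongrightarrow> l i" by auto
  have "bounded (range (\<lambda>t. x t a))" using insert.prems by simp
  then have "bounded (range (\<lambda>t. x (r t) a))" by (rule bounded_subset) auto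
  then obtain m s where s: "strict_mono (s::nat\<Rightarrow>nat)" "(\<lambda>t. x (r (s t)) a) \<longlonglongrightarrow> m"
    using bounded_imp_convergent_subsequence[of "\<lambda>t. x (r t) a"] by (auto simp: o_def)
  show ?case
  proof (intro exI conjI ballI)
    show "strict_mono (r \<circ> s)" using r s strict_mono_o by blast
    fix i assume i: "i \<in> insert a I"
    show "(\<lambda>t. x ((r \<circ> s) t) i) \<longlonglongrightarrow> (l(a := m)) i"
    proof (cases "i = a")
      case False
      then have "(\<lambda>t. x (r t) i) \<longlonglongrightarrow> l i" using i r by auto
      then show ?thesis using LIMSEQ_subseq_LIMSEQ[OF _ s(1)] False by (fastforce simp: o_def)
    qed (use s in simp)
  qed
qed

lemma bounded_mat_subseq:
  fixes B :: "nat \<Rightarrow> 'k::{real_normed_vector, heine_borel} mat"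
  assumes "\<And>t i j. i < m \<Longrightarrow> j < n \<Longrightarrow> norm (B t $$ (i, j)) \<le> c"
  obtains A r where "A \<in> carrier_mat m n" "strict_mono r" "mlim m n (\<lambda>t. B (r t)) A"
proof -
  have "\<exists>l r. strict_mono (r::nat\<Rightarrow>nat) \<and> (\<forall>p\<in>{..<m}\<times>{..<n}. (\<lambda>t. B (r t) $$ p) \<longlonglongrightarrow> l p)"
    by (rule bounded_entries_subseq) (use assms in \<open>auto simp: bounded_iff\<close>)
  then obtain l r where "strict_mono r" "\<And>p. p \<in> {..<m}\<times>{..<n} \<Longrightarrow> (\<lambda>t. B (r t) $$ p) \<longlonglongrightarrow> l p" by blast
  then show ?thesis by (intro that[of "mat m n l" r]) (auto simp: mlim_def)
qed

section \<open>Real and complex scalars\<close>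

text \<open>One class covers both scalar fields, so each argument is made once. Its law ties
  conjugation to the norm; that conjugation is isometric and fixes real scalars follows from it. The
  Euclidean structure supplies convergent subsequences of bounded matrices and the real basis used
  to expand products.\<close>

class rc_field = real_normed_field + conjugatable_field + euclidean_space +
  assumes mult_conjugate_scaleR: "x * conjugate x = (norm x)\<^sup>2 *\<^sub>R 1"

instance real :: rc_field
  by standard (simp add: power2_eq_square)

instance complex :: rc_field
  by standard (simp only: conjugate_complex_def complex_norm_square[symmetric] scaleR_conv_of_real mult_1_right)

lemma mult_conjugate: "x * conjugate x = of_real ((norm x)\<^sup>2)" for x :: "'k::rc_field"
  by (simp add: mult_conjugate_scaleR of_real_def)

lemma norm_conjugate [simp]: "norm (conjugate x) = norm x" for x :: "'k::rc_field"
proof (cases "x = 0")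
  case False
  have "norm x * norm (conjugate x) = norm x * norm x"
    using arg_cong[OF mult_conjugate[of x], of norm] by (simp add: norm_mult power2_eq_square)
  then show ?thesis using False by simp
qed simp

lemma conjugate_one [simp]: "conjugate (1::'k::conjugatable_field) = 1"
  using conjugate_dist_mul[of 1 "1::'k"] by (metis conjugate_zero_iff mult_cancel_left2 mult.right_neutral zero_neq_one)

lemma conjugate_diff: "conjugate (x - y) = conjugate x - conjugate (y::'k::conjugatable_field)"
  using conjugate_dist_add[of x "- y"] by (simp add: conjugate_neg)

lemma conjugate_of_real [simp]: "conjugate (of_real r :: 'k::rc_field) = of_real r"
proof -
  have pos: "conjugate (of_real r :: 'k) = of_real r" if "r > 0" for r
  proof -
    have "of_real r * conjugate (of_real r :: 'k) = of_real r * of_real r"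
      using mult_conjugate[of "of_real r :: 'k"] that by (simp add: power2_eq_square)
    then show ?thesis using that by simp
  qed
  show ?thesis
    using pos[of r] pos[of "- r"] by (cases r "0::real" rule: linorder_cases) (auto simp: conjugate_neg)
qed

lemma tendsto_conjugate: "(f \<longlongrightarrow> l) F \<Longrightarrow> ((\<lambda>x. conjugate (f x)) \<longlongrightarrow> conjugate (l::'k::rc_field)) F"
  unfolding tendsto_iff dist_norm by (simp add: conjugate_diff[symmetric])

lemma comm_ring_hom_conjugate: "comm_ring_hom (conjugate :: 'k::conjugatable_field \<Rightarrow> 'k)"
  by standard (auto simp: conjugate_dist_add conjugate_dist_mul)

section \<open>Adjoints\<close>

lemma mat_adjoint_carrier [simp]: "A \<in> carrier_mat m n \<Longrightarrow> mat_adjoint A \<in> carrier_mat n m"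
  by (auto simp: mat_adjoint_def)

lemma mat_adjoint_dim [simp]: "dim_row (mat_adjoint A) = dim_col A" "dim_col (mat_adjoint A) = dim_row A"
  by (auto simp: mat_adjoint_def)

lemma mat_adjoint_index [simp]:
  "i < dim_col A \<Longrightarrow> j < dim_row A \<Longrightarrow> mat_adjoint A $$ (i, j) = conjugate (A $$ (j, i))"
  by (simp add: mat_adjoint_def mat_of_rows_def)

lemma mat_adjoint_eq: "mat_adjoint A = map_mat conjugate A\<^sup>T"
  by (rule eq_matI) auto

lemma mat_adjoint_adjoint [simp]: "mat_adjoint (mat_adjoint A) = A"
  by (rule eq_matI) auto

lemma mat_adjoint_one [simp]: "mat_adjoint (1\<^sub>m n) = 1\<^sub>m n"
  by (rule eq_matI) auto

lemma mult_mat_index: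
  "A \<in> carrier_mat m n \<Longrightarrow> B \<in> carrier_mat n p \<Longrightarrow> i < m \<Longrightarrow> j < p \<Longrightarrow>
    (A * B) $$ (i, j) = (\<Sum>r<n. A $$ (i, r) * B $$ (r, j))"
  by (auto simp: scalar_prod_def lessThan_atLeast0 intro!: sum.cong)

lemma mult_vec_index:
  "A \<in> carrier_mat m n \<Longrightarrow> v \<in> carrier_vec n \<Longrightarrow> i < m \<Longrightarrow>
    (A *\<^sub>v v) $ i = (\<Sum>r<n. A $$ (i, r) * v $ r)"
  by (auto simp: scalar_prod_def lessThan_atLeast0 intro!: sum.cong)

lemma mult_unit_vec: "(A :: 'k::field mat) \<in> carrier_mat m n \<Longrightarrow> i < n \<Longrightarrow> A *\<^sub>v unit_vec n i = col A i"
  by (intro eq_vecI) auto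

lemma mat_adjoint_mult:
  assumes "A \<in> carrier_mat m n" "B \<in> carrier_mat n p"
  shows "mat_adjoint (A * B) = mat_adjoint B * mat_adjoint A"
  by (rule eq_matI)
    (use assms in \<open>auto simp: scalar_prod_def sum_conjugate conjugate_dist_mul intro!: sum.cong\<close>)

lemma det_mat_adjoint:
  assumes "A \<in> carrier_mat n n"
  shows "det (mat_adjoint A) = conjugate (det A)"
  using comm_ring_hom.hom_det[OF comm_ring_hom_conjugate, of "A\<^sup>T"] det_transpose[OF assms]
  by (simp add: mat_adjoint_eq)

lemma mat_adjoint_smult: "mat_adjoint (c \<cdot>\<^sub>m A) = conjugate c \<cdot>\<^sub>m mat_adjoint A"
  by (rule eq_matI) (auto simp: conjugate_dist_mul)

lemma cscalar_mult_adjoint: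
  fixes A :: "'k::conjugatable_field mat"
  assumes "A \<in> carrier_mat m n" "x \<in> carrier_vec n" "y \<in> carrier_vec m"
  shows "(A *\<^sub>v x) \<bullet>c y = x \<bullet>c (mat_adjoint A *\<^sub>v y)"
proof -
  have "(A *\<^sub>v x) \<bullet>c y = (\<Sum>i<m. \<Sum>r<n. A $$ (i, r) * x $ r * conjugate (y $ i))"
    using assms by (auto simp: scalar_prod_def lessThan_atLeast0 sum_distrib_right intro!: sum.cong)
  also have "\<dots> = (\<Sum>r<n. \<Sum>i<m. A $$ (i, r) * x $ r * conjugate (y $ i))" by (rule sum.swap)
  also have "\<dots> = x \<bullet>c (mat_adjoint A *\<^sub>v y)"
    using assms by (auto simp: scalar_prod_def lessThan_atLeast0 sum_distrib_left sum_conjugate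
        conjugate_dist_mul mult_ac intro!: sum.cong)
  finally show ?thesis .
qed

lemma cscalar_self:
  "v \<in> carrier_vec n \<Longrightarrow> v \<bullet>c v = of_real (\<Sum>i<n. (norm (v $ i))\<^sup>2)" for v :: "'k::rc_field vec"
  by (auto simp: scalar_prod_def lessThan_atLeast0 mult_conjugate simp del: of_real_power intro!: sum.cong)

lemma cscalar_self_eq_0:
  assumes "v \<in> carrier_vec n"
  shows "v \<bullet>c v = 0 \<longleftrightarrow> v = (0\<^sub>v n :: 'k::rc_field vec)"
proof
  assume "v \<bullet>c v = 0"
  then have "(\<Sum>i<n. (norm (v $ i))\<^sup>2) = 0" using cscalar_self[OF assms] by (simp only: of_real_eq_0_iff)
  then show "v = 0\<^sub>v n" using assms by (intro eq_vecI) (auto simp: sum_nonneg_eq_0_iff)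
qed (use assms in auto)

section \<open>Frames\<close>

text \<open>A Gram determinant expresses full column rank (\<open>frame_iff_rank\<close>) in a form
  that makes \<open>pairing Y Y > 0\<close> immediate.\<close>

definition frame :: "nat \<Rightarrow> nat \<Rightarrow> 'k::rc_field mat \<Rightarrow> bool" where
  "frame d k Y \<longleftrightarrow> Y \<in> carrier_mat d k \<and> det (mat_adjoint Y * Y) \<noteq> 0"

lemma frame_carrier [dest]: "frame d k Y \<Longrightarrow> Y \<in> carrier_mat d k"
  by (simp add: frame_def)

text \<open>\<open>mat_adjoint Y * Y\<close> and \<open>Y\<close> have the same kernel: if the
  former kills \<open>x\<close>, then \<open>Y *\<^sub>v x\<close> is orthogonal to itself.\<close>

lemma frame_iff_inj:
  assumes Y: "Y \<in> carrier_mat d k"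
  shows "frame d k Y \<longleftrightarrow> (\<forall>x\<in>carrier_vec k. Y *\<^sub>v x = 0\<^sub>v d \<longrightarrow> x = 0\<^sub>v k)"
proof -
  have eq: "(mat_adjoint Y * Y) *\<^sub>v x = 0\<^sub>v k \<longleftrightarrow> Y *\<^sub>v x = 0\<^sub>v d" if x: "x \<in> carrier_vec k" for x
  proof
    assume "(mat_adjoint Y * Y) *\<^sub>v x = 0\<^sub>v k"
    then have "(Y *\<^sub>v x) \<bullet>c (Y *\<^sub>v x) = 0"
      using cscalar_mult_adjoint[OF Y x, of "Y *\<^sub>v x"] Y x
        assoc_mult_mat_vec[OF mat_adjoint_carrier[OF Y] Y x] by simp
    then show "Y *\<^sub>v x = 0\<^sub>v d" using cscalar_self_eq_0[of "Y *\<^sub>v x" d] Y x by simp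
  next
    assume "Y *\<^sub>v x = 0\<^sub>v d"
    then show "(mat_adjoint Y * Y) *\<^sub>v x = 0\<^sub>v k" using Y x
      by (subst assoc_mult_mat_vec[of _ k d _ k]) auto
  qed
  have "mat_adjoint Y * Y \<in> carrier_mat k k" by (rule mult_carrier_mat[OF mat_adjoint_carrier[OF Y] Y])
  from det_0_iff_vec_prod_zero_field[OF this] show ?thesis using Y eq by (auto simp: frame_def)
qed

text \<open>\<open>rank\<close> sees only the set of columns, so in both directions the columns must
  first be shown distinct: by a count if the rank is \<open>k\<close>, and by applying
  \<open>Y\<close> to the difference of two unit vectors if \<open>Y\<close> is injective.\<close>

lemma frame_iff_rank:
  fixes Y :: "'k::rc_field mat"
  assumes Y: "Y \<in> carrier_mat d k"
  shows "vec_space.rank d Y = k \<longleftrightarrow> frame d k Y"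
proof -
  interpret vec_space "TYPE('k)" d .
  have dist: "distinct (cols Y)" if "\<forall>x\<in>carrier_vec k. Y *\<^sub>v x = 0\<^sub>v d \<longrightarrow> x = 0\<^sub>v k"
  proof (rule ccontr)
    assume "\<not> distinct (cols Y)"
    then obtain i j where ij: "i < k" "j < k" "i \<noteq> j" "col Y i = col Y j"
      using Y unfolding distinct_conv_nth by auto
    let ?x = "unit_vec k i - unit_vec k j :: 'k vec"
    have "Y *\<^sub>v ?x = 0\<^sub>v d"
      using ij Y by (simp add: mult_minus_distrib_mat_vec[of _ d k] mult_unit_vec[of _ d k])
    then have "?x = 0\<^sub>v k" using that by simp
    then have "?x $ i = 0" using ij by simp
    then show False using ij by simp
  qed
  show ?thesis
  proof
    assume r: "rank Y = k"
    have d: "distinct (cols Y)"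
    proof -
      have sc: "set (cols Y) \<subseteq> carrier_vec d" using Y cols_dim by blast
      obtain S where S: "maximal S (\<lambda>T. T \<subseteq> set (cols Y) \<and> lin_indpt T)"
        using maximal_exists_superset[of "set (cols Y)" "(\<lambda>T. T \<subseteq> set (cols Y) \<and> lin_indpt T)" "{}"]
        by (auto simp: lin_dep_def)
      then have "k = card S" using rank_card_indpt[OF Y S] r by simp
      also have "\<dots> \<le> card (set (cols Y))" using S by (intro card_mono) (auto simp: maximal_def)
      finally show ?thesis using Y card_length[of "cols Y"] by (intro card_distinct) auto
    qed
    show "frame d k Y" unfolding frame_iff_inj[OF Y]
      using lin_depI[OF Y _ _ _ d] full_rank_lin_indpt[OF Y r d] by blast
  next
    assume "frame d k Y"
    then have *: "\<forall>x\<in>carrier_vec k. Y *\<^sub>v x = 0\<^sub>v d \<longrightarrow> x = 0\<^sub>v k" using frame_iff_inj[OF Y] by simp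
    have "lin_indpt (set (cols Y))"
    proof
      assume "lin_dep (set (cols Y))"
      then show False using lin_depE[OF Y _ dist[OF *]] * by blast
    qed
    then show "rank Y = k" by (rule lin_indpt_full_rank[OF Y dist[OF *]])
  qed
qed

section \<open>Column spaces of frames and the topology of Grassmannians\<close>

abbreviation cspace :: "nat \<Rightarrow> 'k::field mat \<Rightarrow> 'k vec set" where
  "cspace n \<equiv> vec_space.col_space n"

lemma cspace_eq: "Y \<in> carrier_mat n k \<Longrightarrow> cspace n Y = {Y *\<^sub>v x | x. x \<in> carrier_vec k}"
  by (subst vec_space.col_space_eq[of _ _ k]) auto

lemma cspace_carrier: "Y \<in> carrier_mat n k \<Longrightarrow> cspace n Y \<subseteq> carrier_vec n"
  by (auto simp: cspace_eq)

lemma frames_eq: "carrier_mat d k \<inter> {A :: 'k::rc_field mat. vec_space.rank d A = k} = {Y. frame d k Y}"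
proof (intro equalityI subsetI)
  fix A :: "'k mat" assume "A \<in> carrier_mat d k \<inter> {A. vec_space.rank d A = k}"
  then show "A \<in> {Y. frame d k Y}" using frame_iff_rank[of A d k] by simp
next
  fix A :: "'k mat" assume "A \<in> {Y. frame d k Y}"
  then show "A \<in> carrier_mat d k \<inter> {A. vec_space.rank d A = k}"
    using frame_iff_rank[of A d k] frame_carrier[of d k A] by simp
qed

lemma Gr_eq_frames: "Gr d k = cspace d ` {Y. frame d k (Y :: 'k::rc_field mat)}"
proof -
  have "Gr d k = topspace (Gr_topology d k :: 'k vec set topology)" by (simp add: topspace_Gr_topology)
  also have "\<dots> = cspace d ` (carrier_mat d k \<inter> {A. vec_space.rank d A = k})"
    unfolding Gr_topology_def
    by (subst quotient_imp_surjective_map[OF quotient_map_quotient_topology, symmetric]) simp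
  also have "carrier_mat d k \<inter> {A :: 'k mat. vec_space.rank d A = k} = {Y. frame d k Y}"
    by (rule frames_eq)
  finally show ?thesis .
qed

lemma openin_Gr:
  "openin (Gr_topology d k) U \<longleftrightarrow> U \<subseteq> Gr d k \<and>
     openin (subtopology (mat_topology d k) {Y. frame d k Y}) {Y. frame d k Y \<and> cspace d Y \<in> (U :: 'k::rc_field vec set set)}"
proof -
  have e: "carrier_mat d k \<inter> {A :: 'k mat. vec_space.rank d A = k} = {Y. frame d k Y}"
    by (rule frames_eq)
  have s: "subtopology (mat_topology d k) {A :: 'k mat. vec_space.rank d A = k} =
      subtopology (mat_topology d k) {Y. frame d k Y}"
    using subtopology_restrict[of "mat_topology d k" "{A :: 'k mat. vec_space.rank d A = k}"] by (simp add: e)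
  have c: "{x. x \<in> carrier_mat d k \<and> frame d k x \<and> cspace d x \<in> U} = {Y. frame d k Y \<and> cspace d Y \<in> U}"
    by (auto dest: frame_carrier)
  have i: "cspace d ` (carrier_mat d k \<inter> {Y. frame d k Y}) = Gr d k"
    unfolding Gr_eq_frames by (rule arg_cong[of _ _ "\<lambda>S. cspace d ` S"]) auto
  show ?thesis
    unfolding Gr_topology_def openin_quotient_topology s topspace_subtopology topspace_mat_topology i
    using c by (simp add: conj_assoc)
qed

lemma openin_GrI:
  assumes "U \<subseteq> Gr d k"
    and "\<And>Y B. frame d k Y \<Longrightarrow> cspace d Y \<in> U \<Longrightarrow> (\<And>t. frame d k (B t)) \<Longrightarrow> mlim d k B Y \<Longrightarrow> \<exists>t::nat. cspace d (B t) \<in> U"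
  shows "openin (Gr_topology d k) (U :: 'k::rc_field vec set set)"
  unfolding openin_Gr
proof (intro conjI assms(1) openin_mat_topologyI_seq)
  fix A B assume "A \<in> {Y. frame d k Y \<and> cspace d Y \<in> U}" "\<And>t::nat. B t \<in> {Y. frame d k Y}" "mlim d k B A"
  then show "\<exists>t. B t \<in> {Y. frame d k Y \<and> cspace d Y \<in> U}" using assms(2)[of A B] by auto
qed auto

lemma limitin_GrI:
  assumes Y: "frame d k Y" and B: "\<forall>\<^sub>F t in sequentially. frame d k (B t)" and lim: "mlim d k B Y"
  shows "limitin (Gr_topology d k) (\<lambda>t. cspace d (B t)) (cspace d (Y :: 'k::rc_field mat)) sequentially"
  unfolding limitin_def topspace_Gr_topology
proof (intro conjI allI impI)
  show "cspace d Y \<in> Gr d k" using Y by (auto simp: Gr_eq_frames)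
  fix U assume U: "openin (Gr_topology d k) U \<and> cspace d Y \<in> U"
  \<comment> \<open>The terms that are not frames, of which there are finitely many, are replaced by
    the limit \<open>Y\<close>, because \<open>openin_mat_topology_seqD\<close> asks for frames at
    all times.\<close>
  define C where "C t = (if frame d k (B t) then B t else Y)" for t
  have "\<forall>\<^sub>F t in sequentially. C t \<in> {Y. frame d k Y \<and> cspace d Y \<in> U}"
  proof (rule openin_mat_topology_seqD)
    show "openin (subtopology (mat_topology d k) {Y. frame d k Y}) {Y. frame d k Y \<and> cspace d Y \<in> U}"
      using U openin_Gr by blast
    show "mlim d k C Y" unfolding mlim_def
    proof (intro allI impI)
      fix i j assume ij: "i < d" "j < k"
      show "(\<lambda>t. C t $$ (i, j)) \<longlonglongrightarrow> Y $$ (i, j)"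
        by (rule Lim_transform_eventually[OF mlimD[OF lim ij]])
          (use B in eventually_elim, simp add: C_def)
    qed
  qed (use U Y in \<open>auto simp: C_def\<close>)
  then show "\<forall>\<^sub>F t in sequentially. cspace d (B t) \<in> U"
    using B by eventually_elim (auto simp: C_def)
qed

section \<open>Continuity of products, adjoints and determinants\<close>

lemma mlim_mult:
  fixes A :: "nat \<Rightarrow> 'k::rc_field mat"
  assumes "mlim m n A A'" "mlim n p B B'" "\<And>t. A t \<in> carrier_mat m n" "A' \<in> carrier_mat m n"
    "\<And>t. B t \<in> carrier_mat n p" "B' \<in> carrier_mat n p"
  shows "mlim m p (\<lambda>t. A t * B t) (A' * B')"
  unfolding mlim_def
proof (intro allI impI)
  fix i j assume ij: "i < m" "j < p"
  have "(\<lambda>t. \<Sum>r<n. A t $$ (i, r) * B t $$ (r, j)) \<longlonglongrightarrow> (\<Sum>r<n. A' $$ (i, r) * B' $$ (r, j))"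
    by (intro tendsto_sum tendsto_mult mlimD[OF assms(1)] mlimD[OF assms(2)] ij) auto
  then show "(\<lambda>t. (A t * B t) $$ (i, j)) \<longlonglongrightarrow> (A' * B') $$ (i, j)"
    using assms(3-6) ij by (simp only: mult_mat_index[of _ m n _ p])
qed

lemma mlim_adjoint:
  fixes A :: "nat \<Rightarrow> 'k::rc_field mat"
  assumes "mlim m n A A'" "\<And>t. A t \<in> carrier_mat m n" "A' \<in> carrier_mat m n"
  shows "mlim n m (\<lambda>t. mat_adjoint (A t)) (mat_adjoint A')"
  unfolding mlim_def
proof (intro allI impI)
  fix i j assume ij: "i < n" "j < m"
  have "(\<lambda>t. conjugate (A t $$ (j, i))) \<longlonglongrightarrow> conjugate (A' $$ (j, i))"
    by (rule tendsto_conjugate[OF mlimD[OF assms(1) ij(2,1)]])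
  moreover have "mat_adjoint (A t) $$ (i, j) = conjugate (A t $$ (j, i))" for t
    using assms(2)[of t] ij by simp
  moreover have "mat_adjoint A' $$ (i, j) = conjugate (A' $$ (j, i))"
    using assms(3) ij by simp
  ultimately show "(\<lambda>t. mat_adjoint (A t) $$ (i, j)) \<longlonglongrightarrow> mat_adjoint A' $$ (i, j)" by simp
qed

lemma tendsto_det:
  fixes A :: "nat \<Rightarrow> 'k::real_normed_field mat"
  assumes "mlim n n A A'" "\<And>t. A t \<in> carrier_mat n n" "A' \<in> carrier_mat n n"
  shows "(\<lambda>t. det (A t)) \<longlonglongrightarrow> det A'"
  unfolding det_def'[OF assms(2)] det_def'[OF assms(3)]
  by (intro tendsto_sum tendsto_mult tendsto_const tendsto_prod mlimD[OF assms(1)])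
    (auto simp: permutes_in_image)

section \<open>The pairing of frames\<close>

text \<open>The determinant is the Hermitian product of the exterior products of the columns of
  \<open>X\<close> and of \<open>Y\<close>. Its squared modulus is real and nonnegative for both
  fields and does not see phases.\<close>

definition pairing :: "'k::rc_field mat \<Rightarrow> 'k mat \<Rightarrow> real" where
  "pairing Y X = (norm (det (mat_adjoint Y * X)))\<^sup>2"

lemma pairing_nonneg [simp]: "pairing Y X \<ge> 0"
  by (simp add: pairing_def)

lemma pairing_eq_0: "pairing Y X = 0 \<longleftrightarrow> det (mat_adjoint Y * X) = 0"
  by (simp add: pairing_def)

lemma tendsto_pairing:
  assumes "mlim d k B Y" "mlim d k C X" "\<And>t. B t \<in> carrier_mat d k" "Y \<in> carrier_mat d k"
    "\<And>t. C t \<in> carrier_mat d k" "X \<in> carrier_mat d k"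
  shows "(\<lambda>t. pairing (B t) (C t)) \<longlonglongrightarrow> pairing Y X"
  unfolding pairing_def
proof (intro tendsto_power tendsto_norm tendsto_det[of k])
  show "mlim k k (\<lambda>t. mat_adjoint (B t) * C t) (mat_adjoint Y * X)"
    by (rule mlim_mult[of k d]) (use assms in \<open>auto intro: mlim_adjoint\<close>)
qed (use assms in \<open>auto intro!: mult_carrier_mat[of _ _ d]\<close>)

lemma pairing_sym:
  assumes "Y \<in> carrier_mat d k" "X \<in> carrier_mat d k"
  shows "pairing Y X = pairing X Y"
proof -
  have "mat_adjoint (mat_adjoint Y * X) = mat_adjoint X * Y"
    using mat_adjoint_mult[of "mat_adjoint Y" k d X k] assms by simp
  moreover have "mat_adjoint Y * X \<in> carrier_mat k k" using assms by (auto intro: mult_carrier_mat[of _ _ d])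
  ultimately show ?thesis unfolding pairing_def using det_mat_adjoint[of "mat_adjoint Y * X" k] by simp
qed

lemma pairing_mult_left:
  assumes "A \<in> carrier_mat d d" "Y \<in> carrier_mat d k" "X \<in> carrier_mat d k"
  shows "pairing (A * Y) X = pairing Y (mat_adjoint A * X)"
  using assms by (simp add: pairing_def mat_adjoint_mult[of _ d d _ k] assoc_mult_mat[of _ k d _ d _ k])

lemma pairing_mult_right:
  assumes "C \<in> carrier_mat k k" "Y \<in> carrier_mat d k" "X \<in> carrier_mat d k"
  shows "pairing (Y * C) X = (norm (det C))\<^sup>2 * pairing Y X"
proof -
  have c: "mat_adjoint Y * X \<in> carrier_mat k k" using assms by (auto intro: mult_carrier_mat[of _ _ d])
  have "mat_adjoint (Y * C) * X = mat_adjoint C * (mat_adjoint Y * X)"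
    using assms by (simp add: mat_adjoint_mult[of _ d k _ k] assoc_mult_mat[of _ k k _ d _ k])
  then show ?thesis unfolding pairing_def
    using assms c by (simp add: det_mult[of _ k] det_mat_adjoint[of _ k] norm_mult power_mult_distrib)
qed

lemma pairing_mult_right':
  assumes "C \<in> carrier_mat k k" "Y \<in> carrier_mat d k" "X \<in> carrier_mat d k"
  shows "pairing Y (X * C) = (norm (det C))\<^sup>2 * pairing Y X"
  using assms pairing_mult_right[of C k X d Y] pairing_sym[of Y d k "X * C"] pairing_sym[of Y d k X] by simp

lemma pairing_smult_left:
  assumes "Y \<in> carrier_mat d k" "X \<in> carrier_mat d k"
  shows "pairing (c \<cdot>\<^sub>m Y) X = (norm c ^ k)\<^sup>2 * pairing Y X"
proof -
  have "mat_adjoint Y * X \<in> carrier_mat k k" using assms by (auto intro: mult_carrier_mat[of _ _ d])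
  moreover have "mat_adjoint (c \<cdot>\<^sub>m Y) * X = conjugate c \<cdot>\<^sub>m (mat_adjoint Y * X)"
    using assms by (simp add: mat_adjoint_smult mult_smult_assoc_mat[of _ k d _ k])
  moreover have "dim_col X = k" using assms by simp
  ultimately show ?thesis by (simp add: pairing_def det_smult norm_mult norm_power power_mult_distrib)
qed

lemma pairing_self: "frame d k Y \<Longrightarrow> pairing Y Y > 0"
  by (simp add: frame_def pairing_def)

lemma frameI_pairing: "Y \<in> carrier_mat d k \<Longrightarrow> X \<in> carrier_mat d k \<Longrightarrow> pairing Y X \<noteq> 0 \<Longrightarrow> frame d k X"
proof -
  assume Y: "Y \<in> carrier_mat d k" and X: "X \<in> carrier_mat d k" and "pairing Y X \<noteq> 0"
  then have nz: "det (mat_adjoint Y * X) \<noteq> 0" by (simp add: pairing_eq_0)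
  have c: "mat_adjoint Y * X \<in> carrier_mat k k" using X Y by (auto intro: mult_carrier_mat[of _ _ d])
  show "frame d k X" unfolding frame_iff_inj[OF X]
  proof (intro ballI impI)
    fix x assume x: "x \<in> carrier_vec k" "X *\<^sub>v x = 0\<^sub>v d"
    then have "(mat_adjoint Y * X) *\<^sub>v x = 0\<^sub>v k"
      using assoc_mult_mat_vec[OF mat_adjoint_carrier[OF Y] X x(1)] Y by auto
    then show "x = 0\<^sub>v k" using det_0_iff_vec_prod_zero_field[OF c] nz x(1) by blast
  qed
qed

section \<open>Column spaces under multiplication from either side\<close>

lemma cspace_mult:
  assumes "A \<in> carrier_mat n d" "Y \<in> carrier_mat d k"
  shows "cspace n (A * Y) = (\<lambda>v. A *\<^sub>v v) ` cspace d Y"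
proof -
  have "A * Y *\<^sub>v x = A *\<^sub>v (Y *\<^sub>v x)" if "x \<in> carrier_vec k" for x
    using assms that by (rule assoc_mult_mat_vec)
  then show ?thesis
    unfolding cspace_eq[OF mult_carrier_mat[OF assms]] cspace_eq[OF assms(2)] by (auto simp: image_iff) metis
qed

lemma col_in_cspace: "Y \<in> carrier_mat n k \<Longrightarrow> j < k \<Longrightarrow> col Y j \<in> cspace n (Y :: 'k::field mat)"
  unfolding cspace_eq by (rule CollectI, rule exI[of _ "unit_vec k j"]) (simp add: mult_unit_vec)

lemma cspace_subset_factor:
  assumes Y: "Y \<in> carrier_mat d k" and Y': "Y' \<in> carrier_mat d m" and sub: "cspace d Y' \<subseteq> cspace d (Y::'k::field mat)"
  obtains C where "C \<in> carrier_mat k m" "Y' = Y * C"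
proof -
  have "\<forall>j. \<exists>x. j < m \<longrightarrow> x \<in> carrier_vec k \<and> col Y' j = Y *\<^sub>v x"
    using col_in_cspace[OF Y'] sub by (auto simp: cspace_eq[OF Y])
  from choice[OF this] obtain x where x: "\<And>j. j < m \<Longrightarrow> x j \<in> carrier_vec k \<and> col Y' j = Y *\<^sub>v x j" by blast
  define C where "C = mat k m (\<lambda>(i, j). x j $ i)"
  have C: "C \<in> carrier_mat k m" by (simp add: C_def)
  have "Y' = Y * C"
  proof (rule eq_matI)
    fix i j assume "i < dim_row (Y * C)" "j < dim_col (Y * C)"
    then have ij: "i < d" "j < m" using Y C by auto
    have "Y' $$ (i, j) = col Y' j $ i" using Y' ij by simp
    also have "\<dots> = (\<Sum>r<k. Y $$ (i, r) * x j $ r)" using x[OF ij(2)] mult_vec_index[OF Y _ ij(1)] by simp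
    also have "\<dots> = (Y * C) $$ (i, j)" using mult_mat_index[OF Y C ij] ij by (simp add: C_def)
    finally show "Y' $$ (i, j) = (Y * C) $$ (i, j)" .
  qed (use Y Y' C in auto)
  with C that show ?thesis by blast
qed

lemma frames_same_cspace:
  assumes Y: "frame d k Y" and Y': "frame d k Y'" and eq: "cspace d Y = cspace d Y'"
  obtains C where "C \<in> carrier_mat k k" "det C \<noteq> 0" "Y' = Y * C"
proof -
  obtain C where C: "C \<in> carrier_mat k k" "Y' = Y * C"
    using cspace_subset_factor[OF frame_carrier[OF Y] frame_carrier[OF Y']] eq by auto
  have "det C \<noteq> 0"
  proof
    assume "det C = 0"
    then obtain v where v: "v \<in> carrier_vec k" "v \<noteq> 0\<^sub>v k" "C *\<^sub>v v = 0\<^sub>v k"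
      using det_0_iff_vec_prod_zero_field[OF C(1)] by blast
    have "Y' *\<^sub>v v = Y *\<^sub>v (C *\<^sub>v v)" unfolding C(2) by (rule assoc_mult_mat_vec[OF frame_carrier[OF Y] C(1) v(1)])
    then have "Y' *\<^sub>v v = 0\<^sub>v d" using v frame_carrier[OF Y] by auto
    then show False using Y' v frame_iff_inj[OF frame_carrier[OF Y']] by blast
  qed
  with C that show ?thesis by blast
qed

lemma cspace_mult_invertible:
  assumes Y: "Y \<in> carrier_mat d k" and C: "C \<in> carrier_mat k k" "det C \<noteq> (0::'k::field)"
  shows "cspace d (Y * C) = cspace d Y"
proof
  show "cspace d (Y * C) \<subseteq> cspace d Y"
    unfolding cspace_eq[OF Y] cspace_eq[OF mult_carrier_mat[OF Y C(1)]]
    using assoc_mult_mat_vec[OF Y C(1)] mult_mat_vec_carrier[OF C(1)] by fastforce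
  show "cspace d Y \<subseteq> cspace d (Y * C)"
  proof
    fix w assume "w \<in> cspace d Y"
    then obtain x where x: "x \<in> carrier_vec k" "w = Y *\<^sub>v x" by (auto simp: cspace_eq[OF Y])
    obtain B where B: "B \<in> carrier_mat k k" "C * B = 1\<^sub>m k"
      using det_non_zero_imp_unit[OF C(1,2), of "()"] by (auto simp: Units_def ring_mat_simps)
    have "(Y * C) *\<^sub>v (B *\<^sub>v x) = Y *\<^sub>v (C *\<^sub>v (B *\<^sub>v x))" using Y C B x by (intro assoc_mult_mat_vec) auto
    also have "C *\<^sub>v (B *\<^sub>v x) = x" using assoc_mult_mat_vec[OF C(1) B(1) x(1)] B x by simp
    finally show "w \<in> cspace d (Y * C)"
      unfolding cspace_eq[OF mult_carrier_mat[OF Y C(1)]] using x B by (auto intro!: exI[of _ "B *\<^sub>v x"])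
  qed
qed

section \<open>Recovering a column space from orthogonality and from the zeros of the
  pairing\<close>

lemma mult_mat_zero_vec: "A \<in> carrier_mat m n \<Longrightarrow> A *\<^sub>v 0\<^sub>v n = (0\<^sub>v m :: 'k::field vec)"
  by (rule eq_vecI) auto

lemma linear_solve:
  assumes "G \<in> carrier_mat k k" "det G \<noteq> (0::'k::field)" "b \<in> carrier_vec k"
  obtains c where "c \<in> carrier_vec k" "G *\<^sub>v c = b"
proof -
  obtain B where B: "B \<in> carrier_mat k k" "G * B = 1\<^sub>m k"
    using det_non_zero_imp_unit[OF assms(1,2), of "()"] by (auto simp: Units_def ring_mat_simps)
  have "G *\<^sub>v (B *\<^sub>v b) = b" using assoc_mult_mat_vec[OF assms(1) B(1) assms(3)] B assms by simp
  then show ?thesis using that[of "B *\<^sub>v b"] B assms by auto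
qed

text \<open>The orthogonal complement of the column space of \<open>Y\<close>.\<close>

definition ann :: "nat \<Rightarrow> 'k::rc_field mat \<Rightarrow> 'k vec set" where
  "ann d Y = {v \<in> carrier_vec d. mat_adjoint Y *\<^sub>v v = 0\<^sub>v (dim_col Y)}"

text \<open>Double orthogonal complement. A vector \<open>w\<close> of the second column space is
  decomposed as \<open>Y z + v\<close> with \<open>v\<close> orthogonal to the columns of
  \<open>Y\<close>. By hypothesis \<open>v\<close> is then orthogonal to \<open>w\<close> as well,
  hence to \<open>v = w - Y z\<close>, so it vanishes.\<close>

lemma cspace_subset_of_ann:
  assumes Y: "frame d k Y" and Y': "frame d k Y'" and sub: "ann d Y \<subseteq> ann d Y'"
  shows "cspace d Y' \<subseteq> cspace d Y"
proof -
  have cY: "Y \<in> carrier_mat d k" and cY': "Y' \<in> carrier_mat d k" using Y Y' by auto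
  have step: "mat_adjoint Y' *\<^sub>v v = 0\<^sub>v k" if "v \<in> carrier_vec d" "mat_adjoint Y *\<^sub>v v = 0\<^sub>v k" for v
    using sub that cY cY' by (auto simp: ann_def)
  show ?thesis
  proof
    fix w assume "w \<in> cspace d Y'"
    then obtain x where x: "x \<in> carrier_vec k" "w = Y' *\<^sub>v x" by (auto simp: cspace_eq[OF cY'])
    have w: "w \<in> carrier_vec d" using x cY' by auto
    have G: "mat_adjoint Y * Y \<in> carrier_mat k k" "det (mat_adjoint Y * Y) \<noteq> 0"
      using Y cY unfolding frame_def by (auto intro: mult_carrier_mat[of _ _ d])
    have "mat_adjoint Y *\<^sub>v w \<in> carrier_vec k" using cY w by (intro mult_mat_vec_carrier[of _ _ d]) auto
    \<comment> \<open>The normal equations: \<open>Y z\<close> is the orthogonal projection of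
      \<open>w\<close> to the column space of \<open>Y\<close>.\<close>
    then obtain z where z: "z \<in> carrier_vec k" "(mat_adjoint Y * Y) *\<^sub>v z = mat_adjoint Y *\<^sub>v w"
      using linear_solve[OF G] by blast
    define v where "v = w - Y *\<^sub>v z"
    have Yz: "Y *\<^sub>v z \<in> carrier_vec d" using cY z by auto
    have v: "v \<in> carrier_vec d" using w Yz by (simp add: v_def)
    have "mat_adjoint Y *\<^sub>v v = mat_adjoint Y *\<^sub>v w - mat_adjoint Y *\<^sub>v (Y *\<^sub>v z)"
      unfolding v_def by (rule mult_minus_distrib_mat_vec[of _ k d]) (use cY w Yz in auto)
    also have "\<dots> = 0\<^sub>v k"
      using z assoc_mult_mat_vec[OF mat_adjoint_carrier[OF cY] cY z(1)] mult_mat_vec_carrier[OF mat_adjoint_carrier[OF cY] w]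
      by auto
    finally have Yv: "mat_adjoint Y *\<^sub>v v = 0\<^sub>v k" .
    have "v \<bullet>c v = w \<bullet>c v - (Y *\<^sub>v z) \<bullet>c v"
      unfolding v_def by (rule minus_scalar_prod_distrib[of _ d]) (use w Yz in auto)
    also have "\<dots> = x \<bullet>c (mat_adjoint Y' *\<^sub>v v) - z \<bullet>c (mat_adjoint Y *\<^sub>v v)"
      using cscalar_mult_adjoint[OF cY' x(1) v] cscalar_mult_adjoint[OF cY z(1) v] x by simp
    also have "\<dots> = 0" using Yv step[OF v Yv] x z by simp
    finally have "v = 0\<^sub>v d" using cscalar_self_eq_0[OF v] by simp
    then have "w = Y *\<^sub>v z" using w Yz by (auto simp: v_def vec_eq_iff)
    then show "w \<in> cspace d Y" using z by (auto simp: cspace_eq[OF cY])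
  qed
qed

text \<open>Cramer's rule shows that \<open>Y\<^sup>* v = 0\<close> implies \<open>Y'\<^sup>* v = 0\<close>: replace a column of \<open>Y'\<close> by \<open>v\<close>.\<close>

lemma cspace_subset_of_pairing_zeros:
  assumes Y: "frame d k Y" and Y': "frame d k Y'"
    and zeros: "\<And>X. X \<in> carrier_mat d k \<Longrightarrow> pairing Y X = 0 \<Longrightarrow> pairing Y' X = 0"
  shows "cspace d Y' \<subseteq> cspace d Y"
proof -
  have cY: "Y \<in> carrier_mat d k" and cY': "Y' \<in> carrier_mat d k" using Y Y' by auto
  have step: "mat_adjoint Y' *\<^sub>v v = 0\<^sub>v k" if v: "v \<in> carrier_vec d" and v0: "mat_adjoint Y *\<^sub>v v = 0\<^sub>v k" for v
  proof -
    define G where "G = mat_adjoint Y' * Y'"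
    have G: "G \<in> carrier_mat k k" "det G \<noteq> 0"
      using Y' cY' unfolding G_def frame_def by (auto intro: mult_carrier_mat[of _ _ d])
    have b: "mat_adjoint Y' *\<^sub>v v \<in> carrier_vec k" using cY' v by (intro mult_mat_vec_carrier[of _ _ d]) auto
    obtain c where c: "c \<in> carrier_vec k" "G *\<^sub>v c = mat_adjoint Y' *\<^sub>v v" using linear_solve[OF G b] by blast
    have "c $ i = 0" if i: "i < k" for i
    proof -
      define X where "X = replace_col Y' v i"
      have X: "X \<in> carrier_mat d k" using cY' by (auto simp: X_def replace_col_def)
      have rc: "mat_adjoint Z * X = replace_col (mat_adjoint Z * Y') (mat_adjoint Z *\<^sub>v v) i"
        if Z: "Z \<in> carrier_mat d k" for Z
      proof (rule eq_matI)
        fix r j assume "r < dim_row (replace_col (mat_adjoint Z * Y') (mat_adjoint Z *\<^sub>v v) i)"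
          "j < dim_col (replace_col (mat_adjoint Z * Y') (mat_adjoint Z *\<^sub>v v) i)"
        then have rj: "r < k" "j < k" using Z cY' by (auto simp: replace_col_def)
        have "col X j = (if j = i then v else col Y' j)"
          using rj cY' v by (intro eq_vecI) (auto simp: X_def replace_col_def)
        then show "(mat_adjoint Z * X) $$ (r, j) = replace_col (mat_adjoint Z * Y') (mat_adjoint Z *\<^sub>v v) i $$ (r, j)"
          using rj Z cY' X by (auto simp: replace_col_def)
      qed (use Z cY' X in \<open>auto simp: replace_col_def\<close>)
      have cc: "mat_adjoint Y * Y' \<in> carrier_mat k k" using cY cY' by (auto intro: mult_carrier_mat[of _ _ d])
      then have "(mat_adjoint Y * Y') *\<^sub>v 0\<^sub>v k = mat_adjoint Y *\<^sub>v v" using v0 mult_mat_zero_vec by simp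
      then have "det (mat_adjoint Y * X) = 0"
        using cramer_lemma_mat[OF cc zero_carrier_vec i] rc[OF cY] i by simp
      then have "pairing Y' X = 0" using zeros[OF X] by (simp add: pairing_eq_0)
      then have "det (replace_col G (G *\<^sub>v c) i) = 0" unfolding c(2) using rc[OF cY'] by (simp add: pairing_eq_0 G_def)
      then show ?thesis using cramer_lemma_mat[OF G(1) c(1) i] G(2) by simp
    qed
    then have "c = 0\<^sub>v k" using c by (intro eq_vecI) auto
    then show ?thesis using c(2) mult_mat_zero_vec[OF G(1)] by simp
  qed
  show ?thesis by (rule cspace_subset_of_ann[OF Y Y']) (use step cY cY' in \<open>auto simp: ann_def\<close>)
qed

lemma cspace_eq_of_ann: "frame d k Y \<Longrightarrow> frame d k Y' \<Longrightarrow> ann d Y = ann d Y' \<Longrightarrow> cspace d Y = cspace d Y'"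
  using cspace_subset_of_ann[of d k Y Y'] cspace_subset_of_ann[of d k Y' Y] by auto

lemma cspace_eq_of_pairing_zeros:
  assumes "frame d k Y" "frame d k Y'"
    and "\<And>X. X \<in> carrier_mat d k \<Longrightarrow> pairing Y X = 0 \<longleftrightarrow> pairing Y' X = 0"
  shows "cspace d Y = cspace d Y'"
  using cspace_subset_of_pairing_zeros[OF assms(1,2)] cspace_subset_of_pairing_zeros[OF assms(2,1)] assms(3) by blast

text \<open>The quotient depends on the column space only, as both of its parts are multiplied by
  \<open>|det C|^4\<close> when \<open>Y\<close> becomes \<open>Y * C\<close>. The resulting
  functions are continuous and separate subspaces, which gives uniqueness of limits in the
  Grassmannian (\<open>limitin_Gr_unique\<close>).\<close>

definition gr_fun :: "nat \<Rightarrow> nat \<Rightarrow> 'k::rc_field mat \<Rightarrow> 'k vec set \<Rightarrow> real" where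
  "gr_fun d k X W = (SOME r. \<exists>Y. frame d k Y \<and> W = cspace d Y \<and> r = (pairing Y X)\<^sup>2 / pairing Y Y)"

lemma gr_fun_cspace:
  assumes Y: "frame d k Y" and X: "X \<in> carrier_mat d k"
  shows "gr_fun d k X (cspace d Y) = (pairing Y X)\<^sup>2 / pairing Y Y"
  unfolding gr_fun_def
proof (rule some_equality)
  fix r assume "\<exists>Y'. frame d k Y' \<and> cspace d Y = cspace d Y' \<and> r = (pairing Y' X)\<^sup>2 / pairing Y' Y'"
  then obtain Y' where Y': "frame d k Y'" "cspace d Y = cspace d Y'" "r = (pairing Y' X)\<^sup>2 / pairing Y' Y'" by blast
  obtain C where C: "C \<in> carrier_mat k k" "det C \<noteq> 0" "Y' = Y * C" using frames_same_cspace[OF Y Y'(1,2)] .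
  have cY: "Y \<in> carrier_mat d k" using Y by auto
  have 1: "pairing Y' X = (norm (det C))\<^sup>2 * pairing Y X" unfolding C(3) by (rule pairing_mult_right[OF C(1) cY X])
  have "pairing Y' Y' = (norm (det C))\<^sup>2 * pairing Y (Y * C)"
    unfolding C(3) by (rule pairing_mult_right[OF C(1) cY]) (use C cY in auto)
  then have 2: "pairing Y' Y' = ((norm (det C))\<^sup>2)\<^sup>2 * pairing Y Y"
    using pairing_mult_right'[OF C(1) cY cY] by (simp add: power2_eq_square)
  show "r = (pairing Y X)\<^sup>2 / pairing Y Y"
    unfolding Y'(3) 1 2 using C(2) by (simp add: power_mult_distrib)
qed (use Y in blast)

lemma tendsto_gr_fun:
  assumes lim: "limitin (Gr_topology d k) W V F" and X: "X \<in> carrier_mat d k"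
  shows "((\<lambda>t. gr_fun d k X (W t)) \<longlongrightarrow> gr_fun d k X V) F"
proof (rule topological_tendstoI)
  fix S :: "real set" assume S: "open S" "gr_fun d k X V \<in> S"
  have "openin (Gr_topology d k) {W \<in> Gr d k. gr_fun d k X W \<in> S}"
  proof (rule openin_GrI)
    fix Y B assume Y: "frame d k Y" "cspace d Y \<in> {W \<in> Gr d k. gr_fun d k X W \<in> S}"
      and B: "\<And>t::nat. frame d k (B t)" "mlim d k B Y"
    have lim: "(\<lambda>t. (pairing (B t) X)\<^sup>2 / pairing (B t) (B t)) \<longlonglongrightarrow> (pairing Y X)\<^sup>2 / pairing Y Y"
      by (intro tendsto_divide tendsto_power tendsto_pairing[of d k] B mlim_const X frame_carrier[OF Y(1)] frame_carrier[OF B(1)])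
        (use pairing_self[OF Y(1)] in auto)
    have "(pairing Y X)\<^sup>2 / pairing Y Y \<in> S" using Y gr_fun_cspace[OF Y(1) X] by simp
    from topological_tendstoD[OF lim S(1) this] obtain t where "(pairing (B t) X)\<^sup>2 / pairing (B t) (B t) \<in> S"
      using eventually_happens sequentially_bot by blast
    then show "\<exists>t. cspace d (B t) \<in> {W \<in> Gr d k. gr_fun d k X W \<in> S}"
      using gr_fun_cspace[OF B(1) X] B(1) by (intro exI[of _ t]) (auto simp: Gr_eq_frames)
  qed auto
  moreover have "V \<in> Gr d k" using lim by (simp add: limitin_def topspace_Gr_topology)
  ultimately have "\<forall>\<^sub>F t in F. W t \<in> {W \<in> Gr d k. gr_fun d k X W \<in> S}"
    using lim S(2) unfolding limitin_def by blast
  then show "\<forall>\<^sub>F t in F. gr_fun d k X (W t) \<in> S" by eventually_elim simp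
qed

lemma limitin_Gr_unique:
  fixes V V' :: "'k::rc_field vec set"
  assumes V: "limitin (Gr_topology d k) W V F" and V': "limitin (Gr_topology d k) W V' F" and F: "F \<noteq> bot"
  shows "V = V'"
proof -
  have "V \<in> Gr d k" "V' \<in> Gr d k" using V V' by (auto simp: limitin_def topspace_Gr_topology)
  then obtain Y Y' where Y: "frame d k Y" "V = cspace d Y" and Y': "frame d k Y'" "V' = cspace d Y'"
    by (auto simp: Gr_eq_frames)
  have "pairing Y X = 0 \<longleftrightarrow> pairing Y' X = 0" if X: "X \<in> carrier_mat d k" for X
  proof -
    have "gr_fun d k X V = gr_fun d k X V'"
      by (rule tendsto_unique[OF F tendsto_gr_fun[OF V X] tendsto_gr_fun[OF V' X]])
    then show ?thesis
      using Y Y' gr_fun_cspace[OF Y(1) X] gr_fun_cspace[OF Y'(1) X] pairing_self[OF Y(1)] pairing_self[OF Y'(1)]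
      by auto
  qed
  then show ?thesis unfolding Y Y' by (rule cspace_eq_of_pairing_zeros[OF Y(1) Y'(1)])
qed

section \<open>Limits of Cartan decompositions\<close>

lemma mat_diag_mult_index: "X \<in> carrier_mat d k \<Longrightarrow> r < d \<Longrightarrow> j < k \<Longrightarrow> (mat_diag d s * X) $$ (r, j) = s r * X $$ (r, j)"
  by (subst mat_diag_mult_left[of _ d k]) auto

text \<open>The Cauchy-Binet expansion in unsorted form: the sum runs over all index functions
  instead of \<open>k\<close>-subsets, so multilinearity suffices and no ordering of minors is
  needed. A noninjective \<open>f\<close> contributes a minor with two equal rows, which is
  zero.\<close>

lemma det_adjoint_diag:
  fixes Y X :: "'k::conjugatable_field mat"
  assumes Y: "Y \<in> carrier_mat d k" and X: "X \<in> carrier_mat d k"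
  shows "det (mat_adjoint Y * (mat_diag d s * X)) =
    (\<Sum>f\<in>{0..<k} \<rightarrow>\<^sub>E {..<d}. (\<Prod>i=0..<k. conjugate (Y $$ (f i, i)) * s (f i)) * det (mat k k (\<lambda>(i, j). X $$ (f i, j))))"
proof -
  define M where "M = mat_adjoint Y * (mat_diag d s * X)"
  have D: "mat_diag d s * X \<in> carrier_mat d k" using X by (intro mult_carrier_mat[of _ d d]) auto
  have M: "M \<in> carrier_mat k k" unfolding M_def using Y D by (intro mult_carrier_mat[of _ k d]) auto
  have M_ij: "M $$ (i, j) = (\<Sum>r<d. conjugate (Y $$ (r, i)) * s r * X $$ (r, j))" if "i < k" "j < k" for i j
  proof -
    have "M $$ (i, j) = (\<Sum>r<d. mat_adjoint Y $$ (i, r) * (mat_diag d s * X) $$ (r, j))"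
      unfolding M_def by (rule mult_mat_index[OF _ D that]) (use Y in simp)
    also have "\<dots> = (\<Sum>r<d. conjugate (Y $$ (r, i)) * s r * X $$ (r, j))"
      by (rule sum.cong) (use Y that mat_diag_mult_index[OF X _ that(2)] in \<open>auto simp: mult.assoc\<close>)
    finally show ?thesis .
  qed
  have "det M = (\<Sum>p | p permutes {0..<k}. of_int (sign p) * (\<Prod>i=0..<k. M $$ (i, p i)))" by (rule det_def'[OF M])
  also have "\<dots> = (\<Sum>p | p permutes {0..<k}. of_int (sign p) *
      (\<Prod>i=0..<k. \<Sum>r<d. conjugate (Y $$ (r, i)) * s r * X $$ (r, p i)))"
    by (intro sum.cong refl arg_cong2[of _ _ _ _ times] prod.cong M_ij) (auto simp: permutes_in_image)
  also have "\<dots> = (\<Sum>p | p permutes {0..<k}. \<Sum>f\<in>{0..<k} \<rightarrow>\<^sub>E {..<d}. of_int (sign p) *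
      (\<Prod>i=0..<k. conjugate (Y $$ (f i, i)) * s (f i) * X $$ (f i, p i)))"
    by (subst prod_sum_PiE) (auto simp: sum_distrib_left)
  also have "\<dots> = (\<Sum>f\<in>{0..<k} \<rightarrow>\<^sub>E {..<d}. \<Sum>p | p permutes {0..<k}. of_int (sign p) *
      (\<Prod>i=0..<k. conjugate (Y $$ (f i, i)) * s (f i) * X $$ (f i, p i)))" by (rule sum.swap)
  also have "\<dots> = (\<Sum>f\<in>{0..<k} \<rightarrow>\<^sub>E {..<d}. (\<Prod>i=0..<k. conjugate (Y $$ (f i, i)) * s (f i)) *
      det (mat k k (\<lambda>(i, j). X $$ (f i, j))))"
  proof (intro sum.cong refl)
    fix f
    have "det (mat k k (\<lambda>(i, j). X $$ (f i, j))) =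
        (\<Sum>p | p permutes {0..<k}. of_int (sign p) * (\<Prod>i=0..<k. X $$ (f i, p i)))"
      by (subst det_def'[of _ k]) (auto intro!: sum.cong prod.cong arg_cong2[of _ _ _ _ times] simp: permutes_in_image)
    then show "(\<Sum>p | p permutes {0..<k}. of_int (sign p) * (\<Prod>i=0..<k. conjugate (Y $$ (f i, i)) * s (f i) * X $$ (f i, p i))) =
      (\<Prod>i=0..<k. conjugate (Y $$ (f i, i)) * s (f i)) * det (mat k k (\<lambda>(i, j). X $$ (f i, j)))"
      by (simp add: prod.distrib sum_distrib_left mult_ac)
  qed
  finally show ?thesis unfolding M_def .
qed

text \<open>Passing from \<open>{..<k}\<close> to \<open>I\<close> trades the indices in
  \<open>b\<close> for equally many in \<open>a\<close>. Each traded factor drops from at least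
  \<open>s (k - 1)\<close> to at most \<open>s k\<close>, and at least one trade occurs. As indices
  start at 0, these two numbers are the \<open>k\<close>-th singular value and the next one.\<close>

lemma prod_ratio_bound:
  fixes s :: "nat \<Rightarrow> real"
  assumes k: "1 \<le> k" "k < d" and pos: "\<And>i. i < d \<Longrightarrow> s i > 0"
    and dec: "\<And>i j. i \<le> j \<Longrightarrow> j < d \<Longrightarrow> s j \<le> s i"
    and I: "I \<subseteq> {..<d}" "card I = k" "I \<noteq> {..<k}"
  shows "(\<Prod>i\<in>I. s i) / (\<Prod>i<k. s i) \<le> s k / s (k - 1)"
proof -
  have fin: "finite I" using I(1) finite_subset by blast
  define a b where "a = I - {..<k}" and "b = {..<k} - I"
  have ca: "card a = card b"
  proof -
    have "card a = k - card (I \<inter> {..<k})" unfolding a_def using fin I(2) by (simp add: card_Diff_subset_Int)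
    moreover have "card b = k - card ({..<k} \<inter> I)" unfolding b_def by (simp add: card_Diff_subset_Int)
    ultimately show ?thesis by (simp add: Int_commute)
  qed
  have "b \<noteq> {}"
  proof
    assume "b = {}"
    then have "{..<k} \<subseteq> I" by (auto simp: b_def)
    then have "{..<k} = I" using fin I(2) by (intro card_subset_eq) auto
    then show False using I(3) by simp
  qed
  then have cb: "card b \<ge> 1" by (simp add: b_def card_gt_0_iff Suc_le_eq)
  have pa: "(\<Prod>i\<in>a. s i) \<le> s k ^ card b"
  proof -
    have "(\<Prod>i\<in>a. s i) \<le> (\<Prod>i\<in>a. s k)"
      by (rule prod_mono) (use I(1) in \<open>auto simp: a_def intro!: dec less_imp_le[OF pos]\<close>)
    then show ?thesis using ca by simp
  qed
  have pb: "s (k - 1) ^ card b \<le> (\<Prod>i\<in>b. s i)"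
  proof -
    have "(\<Prod>i\<in>b. s (k - 1)) \<le> (\<Prod>i\<in>b. s i)"
      by (rule prod_mono) (use pos[of "k - 1"] dec k in \<open>auto simp: b_def less_imp_le\<close>)
    then show ?thesis by simp
  qed
  have p1: "(\<Prod>i\<in>I. s i) = (\<Prod>i\<in>I \<inter> {..<k}. s i) * (\<Prod>i\<in>a. s i)"
    unfolding a_def using fin by (subst prod.union_disjoint[symmetric]) (auto intro!: prod.cong)
  have p2: "(\<Prod>i<k. s i) = (\<Prod>i\<in>I \<inter> {..<k}. s i) * (\<Prod>i\<in>b. s i)"
    unfolding b_def by (subst prod.union_disjoint[symmetric]) (auto intro!: prod.cong)
  have c0: "(\<Prod>i\<in>I \<inter> {..<k}. s i) > 0" by (rule prod_pos) (use I pos in auto)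
  have q: "0 < s (k - 1)" "0 < s k" "s k \<le> s (k - 1)" using k pos dec by auto
  have "(\<Prod>i\<in>I. s i) / (\<Prod>i<k. s i) = (\<Prod>i\<in>a. s i) / (\<Prod>i\<in>b. s i)"
    unfolding p1 p2 using c0 by (intro mult_divide_mult_cancel_left) linarith
  also have "\<dots> \<le> s k ^ card b / s (k - 1) ^ card b"
    by (rule frac_le) (use pa pb q in auto)
  also have "\<dots> = (s k / s (k - 1)) ^ card b" by (simp add: power_divide)
  also have "\<dots> \<le> (s k / s (k - 1)) ^ 1" by (rule power_decreasing) (use cb q in auto)
  finally show ?thesis by simp
qed

definition std_frame :: "nat \<Rightarrow> nat \<Rightarrow> 'k::field mat" where
  "std_frame d k = mat d k (\<lambda>(i, j). if i = j then 1 else 0)"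

lemma std_frame_carrier [simp]: "std_frame d k \<in> carrier_mat d k"
  by (simp add: std_frame_def)

lemma std_frame_diag:
  "k \<le> d \<Longrightarrow> mat_diag d (\<lambda>i. if i < k then 1 else 0) = std_frame d k * mat_adjoint (std_frame d k :: 'k::conjugatable_field mat)"
proof (rule eq_matI)
  fix i j assume "k \<le> d" "i < dim_row (std_frame d k * mat_adjoint (std_frame d k :: 'k mat))"
    "j < dim_col (std_frame d k * mat_adjoint (std_frame d k :: 'k mat))"
  then have ij: "i < d" "j < d" by (auto simp: std_frame_def)
  have "(std_frame d k * mat_adjoint (std_frame d k :: 'k mat)) $$ (i, j) =
      (\<Sum>r<k. std_frame d k $$ (i, r) * mat_adjoint (std_frame d k) $$ (r, j))"
    by (rule mult_mat_index[of _ d k _ d]) (use ij in auto)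
  also have "\<dots> = (\<Sum>r<k. if r = i then (if i = j then 1 else 0) else 0)"
    by (rule sum.cong) (use ij in \<open>auto simp: std_frame_def\<close>)
  also have "\<dots> = mat_diag d (\<lambda>i. if i < k then 1 else 0) $$ (i, j)" using ij by (auto simp: mat_diag_def)
  finally show "mat_diag d (\<lambda>i. if i < k then 1 else 0) $$ (i, j) = (std_frame d k * mat_adjoint (std_frame d k :: 'k mat)) $$ (i, j)"
    by simp
qed (auto simp: std_frame_def mat_diag_def)

text \<open>After division by the product of the \<open>k\<close> largest values,
  \<open>prod_ratio_bound\<close> kills every injective index function whose image is not
  \<open>{..<k}\<close>. What survives is the expansion for the diagonal matrix with entries
  \<open>e\<close>, a projection that equals \<open>std_frame\<close> times its adjoint; so the
  limit splits into two \<open>k \<times> k\<close> determinants.\<close>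

lemma det_cartan_limit:
  fixes Y X :: "nat \<Rightarrow> 'k::rc_field mat"
  assumes k: "1 \<le> k" "k < d" and pos: "\<And>t i. i < d \<Longrightarrow> s t i > 0"
    and dec: "\<And>t i j. i \<le> j \<Longrightarrow> j < d \<Longrightarrow> s t j \<le> s t i"
    and gap: "(\<lambda>t. s t k / s t (k - 1)) \<longlonglongrightarrow> 0"
    and Y: "mlim d k Y Y'" "\<And>t. Y t \<in> carrier_mat d k" "Y' \<in> carrier_mat d k"
    and X: "mlim d k X X'" "\<And>t. X t \<in> carrier_mat d k" "X' \<in> carrier_mat d k"
  shows "(\<lambda>t. det (mat_adjoint (Y t) * (mat_diag d (\<lambda>i. of_real (s t i)) * X t)) / of_real (\<Prod>i<k. s t i)) \<longlonglongrightarrow>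
     det (mat_adjoint Y' * std_frame d k) * det (mat_adjoint (std_frame d k) * X')"
proof -
  define e :: "nat \<Rightarrow> 'k" where "e = (\<lambda>i. if i < k then 1 else 0)"
  define c where "c t = (\<Prod>i<k. s t i)" for t
  have termlim: "(\<lambda>t. (\<Prod>i=0..<k. conjugate (Y t $$ (f i, i)) * of_real (s t (f i))) *
        det (mat k k (\<lambda>(i, j). X t $$ (f i, j))) / of_real (c t)) \<longlonglongrightarrow>
      (\<Prod>i=0..<k. conjugate (Y' $$ (f i, i)) * e (f i)) * det (mat k k (\<lambda>(i, j). X' $$ (f i, j)))"
    if f: "f \<in> {0..<k} \<rightarrow>\<^sub>E {..<d}" for f
  proof (cases "inj_on f {0..<k}")
    case False
    then obtain i j where ij: "i < k" "j < k" "i \<noteq> j" "f i = f j" by (auto simp: inj_on_def)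
    have "det (mat k k (\<lambda>(i, j). Z $$ (f i, j))) = 0" for Z :: "'k mat"
      by (rule det_identical_rows[of _ k i j]) (use ij in auto)
    then show ?thesis by simp
  next
    case True
    have fd: "f i < d" if "i < k" for i using f that by auto
    have l1: "(\<lambda>t. \<Prod>i=0..<k. conjugate (Y t $$ (f i, i))) \<longlonglongrightarrow> (\<Prod>i=0..<k. conjugate (Y' $$ (f i, i)))"
      by (intro tendsto_prod tendsto_conjugate mlimD[OF Y(1)]) (auto intro: fd)
    have l2: "(\<lambda>t. det (mat k k (\<lambda>(i, j). X t $$ (f i, j)))) \<longlonglongrightarrow> det (mat k k (\<lambda>(i, j). X' $$ (f i, j)))"
      by (rule tendsto_det[of k]) (use fd mlimD[OF X(1)] in \<open>auto simp: mlim_def\<close>)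
    have re: "(\<Prod>i=0..<k. s t (f i)) = (\<Prod>i\<in>f ` {0..<k}. s t i)" for t using True by (simp add: prod.reindex)
    have c0: "c t > 0" for t unfolding c_def using k pos by (intro prod_pos) auto
    have l3: "(\<lambda>t. (\<Prod>i=0..<k. s t (f i)) / c t) \<longlonglongrightarrow> (if f ` {0..<k} = {..<k} then 1 else 0)"
    proof (cases "f ` {0..<k} = {..<k}")
      case True
      then have "(\<Prod>i=0..<k. s t (f i)) = c t" for t unfolding re c_def by simp
      then show ?thesis using True c0 by (simp add: less_imp_neq[THEN not_sym])
    next
      case False
      have "card (f ` {0..<k}) = k" using True by (simp add: card_image)
      then have le: "(\<Prod>i=0..<k. s t (f i)) / c t \<le> s t k / s t (k - 1)" for t
        unfolding re c_def using False fd
        by (intro prod_ratio_bound[OF k pos dec]) auto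
      have ge: "0 \<le> (\<Prod>i=0..<k. s t (f i)) / c t" for t
        using c0[of t] pos fd by (intro divide_nonneg_pos prod_nonneg) (auto intro: less_imp_le)
      have "(\<lambda>t. (\<Prod>i=0..<k. s t (f i)) / c t) \<longlonglongrightarrow> 0"
        by (rule tendsto_sandwich[OF _ _ tendsto_const gap]) (use le ge in auto)
      then show ?thesis using False by simp
    qed
    \<comment> \<open>The limit coefficient is the one of the diagonal matrix \<open>e\<close>: an
      injective \<open>f\<close> maps into \<open>{..<k}\<close> iff its image is all of that
      set.\<close>
    have e: "(\<Prod>i=0..<k. e (f i)) = of_real (if f ` {0..<k} = {..<k} then 1 else 0)"
    proof (cases "f ` {0..<k} = {..<k}")
      case True
      then have "f i < k" if "i < k" for i using that by (metis atLeast0LessThan imageI lessThan_iff)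
      then have "(\<Prod>i=0..<k. e (f i)) = 1" by (auto simp: e_def intro!: prod.neutral)
      then show ?thesis using True by simp
    next
      case False
      have "card (f ` {0..<k}) = card {..<k}" using True by (simp add: card_image)
      then have "\<not> f ` {0..<k} \<subseteq> {..<k}" using False card_subset_eq[of "{..<k}" "f ` {0..<k}"] by auto
      then obtain i where "i < k" "\<not> f i < k" by (auto simp: image_subset_iff)
      then have "(\<Prod>i=0..<k. e (f i)) = 0" by (auto simp: e_def prod_zero_iff)
      then show ?thesis using False by simp
    qed
    have "(\<lambda>t. (\<Prod>i=0..<k. conjugate (Y t $$ (f i, i))) * of_real ((\<Prod>i=0..<k. s t (f i)) / c t) *
        det (mat k k (\<lambda>(i, j). X t $$ (f i, j)))) \<longlonglongrightarrow>
      (\<Prod>i=0..<k. conjugate (Y' $$ (f i, i))) * of_real (if f ` {0..<k} = {..<k} then 1 else 0) *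
        det (mat k k (\<lambda>(i, j). X' $$ (f i, j)))"
      by (intro tendsto_mult l1 l2 tendsto_of_real l3)
    then show ?thesis unfolding e[symmetric] by (simp add: prod.distrib mult_ac)
  qed
  have D: "mat_diag d e * X' = std_frame d k * (mat_adjoint (std_frame d k) * X')"
    using X(3) k std_frame_diag[of k d, where 'k='k] assoc_mult_mat[of "std_frame d k" d k "mat_adjoint (std_frame d k)" d X' k]
    by (simp add: e_def)
  have EX: "mat_adjoint (std_frame d k) * X' \<in> carrier_mat k k" using X by (intro mult_carrier_mat[of _ k d]) auto
  have YE: "mat_adjoint Y' * std_frame d k \<in> carrier_mat k k" using Y by (intro mult_carrier_mat[of _ k d]) auto
  have "(\<lambda>t. \<Sum>f\<in>{0..<k} \<rightarrow>\<^sub>E {..<d}. (\<Prod>i=0..<k. conjugate (Y t $$ (f i, i)) * of_real (s t (f i))) *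
        det (mat k k (\<lambda>(i, j). X t $$ (f i, j))) / of_real (c t)) \<longlonglongrightarrow>
     (\<Sum>f\<in>{0..<k} \<rightarrow>\<^sub>E {..<d}. (\<Prod>i=0..<k. conjugate (Y' $$ (f i, i)) * e (f i)) * det (mat k k (\<lambda>(i, j). X' $$ (f i, j))))"
    by (intro tendsto_sum termlim)
  then have "(\<lambda>t. det (mat_adjoint (Y t) * (mat_diag d (\<lambda>i. of_real (s t i)) * X t)) / of_real (c t)) \<longlonglongrightarrow>
     det (mat_adjoint Y' * (mat_diag d e * X'))"
    by (simp only: det_adjoint_diag[OF Y(2) X(2)] det_adjoint_diag[OF Y(3) X(3)] sum_divide_distrib)
  also have "mat_adjoint Y' * (mat_diag d e * X') = (mat_adjoint Y' * std_frame d k) * (mat_adjoint (std_frame d k) * X')"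
    unfolding D using EX Y by (intro assoc_mult_mat[symmetric, of _ k d _ k _ k]) auto
  finally show ?thesis unfolding c_def using det_mult[OF YE EX] by simp
qed

text \<open>The limit has rank one: it is a function of \<open>Y\<close> times a function of
  \<open>X\<close>. The plane of \<open>l' * std_frame d k\<close> attracts all planes
  \<open>Y\<close> whose pairing with \<open>mat_adjoint m' * std_frame d k\<close> is
  nonzero.\<close>

lemma pairing_cartan_limit:
  fixes l m :: "nat \<Rightarrow> 'k::rc_field mat"
  assumes k: "1 \<le> k" "k < d" and pos: "\<And>t i. i < d \<Longrightarrow> s t i > 0"
    and dec: "\<And>t i j. i \<le> j \<Longrightarrow> j < d \<Longrightarrow> s t j \<le> s t i"
    and gap: "(\<lambda>t. s t k / s t (k - 1)) \<longlonglongrightarrow> 0"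
    and l: "mlim d d l l'" "\<And>t. l t \<in> carrier_mat d d" "l' \<in> carrier_mat d d"
    and m: "mlim d d m m'" "\<And>t. m t \<in> carrier_mat d d" "m' \<in> carrier_mat d d"
    and Y: "Y \<in> carrier_mat d k" and X: "X \<in> carrier_mat d k"
  shows "(\<lambda>t. pairing (l t * mat_diag d (\<lambda>i. of_real (s t i)) * m t * Y) X / (\<Prod>i<k. s t i)\<^sup>2) \<longlonglongrightarrow>
     pairing Y (mat_adjoint m' * std_frame d k) * pairing (l' * std_frame d k) X"
proof -
  define D :: "nat \<Rightarrow> 'k mat" where "D t = mat_diag d (\<lambda>i. of_real (s t i))" for t
  have Dc: "D t \<in> carrier_mat d d" for t by (simp add: D_def)
  have adjD: "mat_adjoint (D t) = D t" for t
    by (rule eq_matI) (auto simp: D_def mat_diag_def)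
  have mY: "m t * Y \<in> carrier_mat d k" "m' * Y \<in> carrier_mat d k" for t
    using m Y by (auto intro: mult_carrier_mat)
  have lX: "mat_adjoint (l t) * X \<in> carrier_mat d k" "mat_adjoint l' * X \<in> carrier_mat d k" for t
    using l X by (auto intro: mult_carrier_mat[OF mat_adjoint_carrier])
  have eq: "mat_adjoint (l t * D t * m t * Y) * X = mat_adjoint (m t * Y) * (D t * (mat_adjoint (l t) * X))" for t
  proof -
    have "l t * D t * m t * Y = l t * D t * (m t * Y)"
      by (rule assoc_mult_mat[OF mult_carrier_mat[OF l(2) Dc] m(2) Y])
    then have "mat_adjoint (l t * D t * m t * Y) = mat_adjoint (m t * Y) * (D t * mat_adjoint (l t))"
      using mat_adjoint_mult[of "l t * D t" d d "m t * Y" k] mat_adjoint_mult[OF l(2)[of t] Dc[of t]]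
        mult_carrier_mat[OF l(2)[of t] Dc[of t]] mY adjD by simp
    also have "\<dots> * X = mat_adjoint (m t * Y) * (D t * (mat_adjoint (l t) * X))"
      using l(2)[of t] Dc[of t] mY(1)[of t] X
      by (simp add: assoc_mult_mat[of _ k d _ d _ k] assoc_mult_mat[of _ d d _ d _ k])
    finally show ?thesis .
  qed
  have "(\<lambda>t. det (mat_adjoint (m t * Y) * (D t * (mat_adjoint (l t) * X))) / of_real (\<Prod>i<k. s t i)) \<longlonglongrightarrow>
     det (mat_adjoint (m' * Y) * std_frame d k) * det (mat_adjoint (std_frame d k) * (mat_adjoint l' * X))"
    unfolding D_def
  proof (rule det_cartan_limit[OF k pos dec gap])
    show "mlim d k (\<lambda>t. m t * Y) (m' * Y)" by (rule mlim_mult[OF m(1) mlim_const]) (use m Y in auto)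
    show "mlim d k (\<lambda>t. mat_adjoint (l t) * X) (mat_adjoint l' * X)"
      by (rule mlim_mult[OF mlim_adjoint[OF l] mlim_const]) (use l X in auto)
  qed (use mY lX in auto)
  then have "(\<lambda>t. (norm (det (mat_adjoint (m t * Y) * (D t * (mat_adjoint (l t) * X))) / of_real (\<Prod>i<k. s t i)))\<^sup>2) \<longlonglongrightarrow>
     (norm (det (mat_adjoint (m' * Y) * std_frame d k) * det (mat_adjoint (std_frame d k) * (mat_adjoint l' * X))))\<^sup>2"
    by (intro tendsto_power tendsto_norm)
  moreover have "(norm (det (mat_adjoint (m' * Y) * std_frame d k) * det (mat_adjoint (std_frame d k) * (mat_adjoint l' * X))))\<^sup>2 =
     pairing (m' * Y) (std_frame d k) * pairing (std_frame d k) (mat_adjoint l' * X)"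
    by (simp add: pairing_def norm_mult power_mult_distrib)
  moreover have "\<dots> = pairing Y (mat_adjoint m' * std_frame d k) * pairing (l' * std_frame d k) X"
    using pairing_mult_left[OF m(3) Y std_frame_carrier] pairing_mult_left[OF l(3) std_frame_carrier X] by simp
  moreover have "(norm (det (mat_adjoint (m t * Y) * (D t * (mat_adjoint (l t) * X))) / of_real (\<Prod>i<k. s t i)))\<^sup>2 =
     pairing (l t * D t * m t * Y) X / (\<Prod>i<k. s t i)\<^sup>2" for t
    unfolding pairing_def eq by (simp only: norm_divide norm_of_real power_divide power2_abs)
  ultimately show ?thesis unfolding D_def by simp
qed

section \<open>Unitary matrices\<close>

lemma adjoint_mult_carrier [simp]:
  "A \<in> carrier_mat n m \<Longrightarrow> B \<in> carrier_mat n p \<Longrightarrow> mat_adjoint A * B \<in> carrier_mat m p"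
  by (rule mult_carrier_mat[OF mat_adjoint_carrier])

lemma mat_diag_dim [simp]: "dim_row (mat_diag n f) = n" "dim_col (mat_diag n f) = n"
  by (simp_all add: mat_diag_def)

lemma unitary_carrier: "U \<in> unitary_mats n \<Longrightarrow> U \<in> carrier_mat n n"
  by (simp add: unitary_mats_def)

lemma unitary_adjoint_mult: "U \<in> unitary_mats n \<Longrightarrow> mat_adjoint U * U = 1\<^sub>m n"
  by (simp add: unitary_mats_def)

lemma unitary_mult_adjoint: "U \<in> unitary_mats n \<Longrightarrow> U * mat_adjoint U = 1\<^sub>m n"
  by (rule mat_mult_left_right_inverse[of _ n]) (auto simp: unitary_mats_def)

lemma unitary_adjoint: "U \<in> unitary_mats n \<Longrightarrow> mat_adjoint U \<in> unitary_mats n"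
  using unitary_mult_adjoint[of U n] by (auto simp: unitary_mats_def)

lemma unitary_mult:
  assumes "U \<in> unitary_mats n" "V \<in> unitary_mats n"
  shows "U * V \<in> unitary_mats n"
proof -
  have c: "U \<in> carrier_mat n n" "V \<in> carrier_mat n n" using assms unitary_carrier by auto
  have "mat_adjoint (U * V) * (U * V) = mat_adjoint V * (mat_adjoint U * U * V)"
    using c by (simp add: mat_adjoint_mult[of _ n n _ n] assoc_mult_mat[of _ n n _ n _ n])
  also have "\<dots> = 1\<^sub>m n" using assms c by (simp add: unitary_adjoint_mult)
  finally show ?thesis using c by (simp add: unitary_mats_def)
qed

lemma unitary_one: "1\<^sub>m n \<in> unitary_mats n"
  by (simp add: unitary_mats_def)

lemma one_smult_mat: "(1::'k::field) \<cdot>\<^sub>m A = A"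
  by (rule eq_matI) auto

lemma unitary_smult:
  assumes "U \<in> unitary_mats n" "norm (c::'k::rc_field) = 1"
  shows "c \<cdot>\<^sub>m U \<in> unitary_mats n"
proof -
  have "conjugate c * c = 1" using mult_conjugate[of c] assms(2) by (simp add: mult.commute)
  moreover have "mat_adjoint (c \<cdot>\<^sub>m U) * (c \<cdot>\<^sub>m U) = (conjugate c * c) \<cdot>\<^sub>m (mat_adjoint U * U)"
    using unitary_carrier[OF assms(1)]
    by (simp add: mat_adjoint_smult mult_smult_assoc_mat[of _ n n _ n] mult_smult_distrib[of _ n n _ n])
      (rule eq_matI, auto simp: mult_ac)
  ultimately show ?thesis
    using assms(1) unitary_carrier[OF assms(1)] by (simp add: unitary_mats_def one_smult_mat)
qed

lemma unitary_columns:
  "U \<in> carrier_mat n n \<Longrightarrow> U \<in> unitary_mats n \<longleftrightarrow>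
    (\<forall>i<n. \<forall>j<n. (\<Sum>r<n. conjugate (U $$ (r, i)) * U $$ (r, j)) = (if i = j then 1 else 0))"
proof -
  assume U: "U \<in> carrier_mat n n"
  have "(mat_adjoint U * U) $$ (i, j) = (\<Sum>r<n. conjugate (U $$ (r, i)) * U $$ (r, j))" if "i < n" "j < n" for i j
    using mult_mat_index[of "mat_adjoint U" n n U n i j] U that by simp
  then show ?thesis using U by (auto simp: unitary_mats_def mat_eq_iff)
qed

lemma unitary_entry_le:
  fixes U :: "'k::rc_field mat"
  assumes "U \<in> unitary_mats n" "i < n" "j < n"
  shows "norm (U $$ (i, j)) \<le> 1"
proof -
  have "of_real (\<Sum>r<n. (norm (U $$ (r, j)))\<^sup>2) = (\<Sum>r<n. conjugate (U $$ (r, j)) * U $$ (r, j))"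
    by (simp only: of_real_sum mult_conjugate[symmetric] mult.commute)
  also have "\<dots> = 1" using assms unitary_columns[OF unitary_carrier[OF assms(1)]] by simp
  finally have "(\<Sum>r<n. (norm (U $$ (r, j)))\<^sup>2) = 1" using of_real_eq_1_iff by blast
  moreover have "(norm (U $$ (i, j)))\<^sup>2 \<le> (\<Sum>r<n. (norm (U $$ (r, j)))\<^sup>2)"
    by (rule member_le_sum) (use assms in auto)
  ultimately show ?thesis using abs_square_le_1[of "norm (U $$ (i, j))"] by simp
qed

lemma unitary_limit:
  fixes B :: "nat \<Rightarrow> 'k::rc_field mat"
  assumes "\<And>t. B t \<in> unitary_mats n" "mlim n n B U" "U \<in> carrier_mat n n"
  shows "U \<in> unitary_mats n"
  unfolding unitary_columns[OF assms(3)]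
proof (intro allI impI)
  fix i j assume ij: "i < n" "j < n"
  have "(\<lambda>t. \<Sum>r<n. conjugate (B t $$ (r, i)) * B t $$ (r, j)) \<longlonglongrightarrow> (\<Sum>r<n. conjugate (U $$ (r, i)) * U $$ (r, j))"
    by (intro tendsto_sum tendsto_mult tendsto_conjugate mlimD[OF assms(2)]) (use ij in auto)
  moreover have "(\<Sum>r<n. conjugate (B t $$ (r, i)) * B t $$ (r, j)) = (if i = j then 1 else 0)" for t
    using unitary_columns[OF unitary_carrier[OF assms(1)]] assms(1) ij by blast
  ultimately have "(\<lambda>t::nat. if i = j then 1 else 0) \<longlonglongrightarrow> (\<Sum>r<n. conjugate (U $$ (r, i)) * U $$ (r, j))"
    by (simp only:)
  then have "(if i = j then 1 else 0) = (\<Sum>r<n. conjugate (U $$ (r, i)) * U $$ (r, j))"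
    by (simp only: LIMSEQ_const_iff)
  then show "(\<Sum>r<n. conjugate (U $$ (r, i)) * U $$ (r, j)) = (if i = j then 1 else 0)" by (rule sym)
qed

lemma unitary_subseq:
  fixes B :: "nat \<Rightarrow> 'k::rc_field mat"
  assumes "\<And>t. B t \<in> unitary_mats n"
  obtains U r where "U \<in> unitary_mats n" "strict_mono r" "mlim n n (\<lambda>t. B (r t)) U"
proof -
  obtain U r where *: "U \<in> carrier_mat n n" "strict_mono r" "mlim n n (\<lambda>t. B (r t)) U"
    by (rule bounded_mat_subseq[of n n B 1]) (use unitary_entry_le[OF assms] in auto)
  then show ?thesis using unitary_limit[of "\<lambda>t. B (r t)", OF assms *(3,1)] that by blast
qed

section \<open>Singular value decomposition\<close>

text \<open>The right factor maximises \<open>\<Sum> (n - i) \<parallel>A U e\<^sub>i\<parallel>\<^sup>2\<close>: comparison with plane rotations of \<open>U\<close> forces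
  the columns of \<open>A U\<close> to be orthogonal and of decreasing length.\<close>

definition col_sq :: "nat \<Rightarrow> 'k::rc_field mat \<Rightarrow> nat \<Rightarrow> real" where
  "col_sq n P i = (\<Sum>r<n. (norm (P $$ (r, i)))\<^sup>2)"

text \<open>This multiplies \<open>U\<close> on the right by a unitary that mixes the coordinates
  \<open>i\<close> and \<open>j\<close> with parameter \<open>z\<close>; the square root normalises
  it. Being a right multiplication, it commutes with left multiplication by a matrix
  (\<open>mult_rotate_cols\<close>).\<close>

definition rotate_cols :: "nat \<Rightarrow> nat \<Rightarrow> nat \<Rightarrow> 'k::rc_field \<Rightarrow> 'k mat \<Rightarrow> 'k mat" where
  "rotate_cols n i j z U = mat n n (\<lambda>(r, c).
     if c = i then of_real (1 / sqrt (1 + (norm z)\<^sup>2)) * (U $$ (r, i) + z * U $$ (r, j))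
     else if c = j then of_real (1 / sqrt (1 + (norm z)\<^sup>2)) * (U $$ (r, j) - conjugate z * U $$ (r, i))
     else U $$ (r, c))"

lemma of_real_col_sq: "of_real (col_sq n P i) = (\<Sum>r<n. conjugate (P $$ (r, i)) * P $$ (r, i))"
  unfolding col_sq_def by (simp only: of_real_sum mult_conjugate[symmetric] mult.commute)

lemma sum_conjugate_swap:
  "(\<Sum>r<n. conjugate (P $$ (r, j)) * P $$ (r, i)) = conjugate (\<Sum>r<n. conjugate (P $$ (r, i)) * P $$ (r, j))"
  for P :: "'k::rc_field mat"
  by (simp add: sum_conjugate conjugate_dist_mul mult.commute)

lemma rotate_cols_unitary:
  assumes U: "U \<in> unitary_mats n" and ij: "i < n" "j < n" "i \<noteq> j"
  shows "rotate_cols n i j z U \<in> unitary_mats n"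
proof -
  define a where "a = (of_real (1 / sqrt (1 + (norm z)\<^sup>2)) :: 'a)"
  have ca: "conjugate a = a" unfolding a_def by (rule conjugate_of_real)
  have aa: "a * a * (1 + z * conjugate z) = 1"
  proof -
    have "0 < 1 + (norm z)\<^sup>2" by (simp add: add_pos_nonneg)
    then have "(1 / sqrt (1 + (norm z)\<^sup>2)) * (1 / sqrt (1 + (norm z)\<^sup>2)) * (1 + (norm z)\<^sup>2) = 1" by simp
    from arg_cong[OF this, of "of_real :: real \<Rightarrow> 'a"] show ?thesis
      unfolding mult_conjugate a_def by (simp only: of_real_mult of_real_add of_real_1)
  qed
  define g where "g c c' = (\<Sum>r<n. conjugate (U $$ (r, c)) * U $$ (r, c'))" for c c'
  have g: "g c c' = (if c = c' then 1 else 0)" if "c < n" "c' < n" for c c'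
    using unitary_columns[OF unitary_carrier[OF U]] U that by (simp add: g_def)
  define x where "x c = (if c = i then a else if c = j then - (a * conjugate z) else 0)" for c
  define y where "y c = (if c = i then a * z else if c = j then a else 0)" for c
  define w where "w c = (if c = i \<or> c = j then 0 else (1::'a))" for c
  have V: "rotate_cols n i j z U $$ (r, c) = x c * U $$ (r, i) + y c * U $$ (r, j) + w c * U $$ (r, c)"
    if "r < n" "c < n" for r c
    using that unfolding rotate_cols_def a_def[symmetric] x_def y_def w_def by (simp add: algebra_simps)
  have "rotate_cols n i j z U \<in> carrier_mat n n" by (simp add: rotate_cols_def)
  then show ?thesis
    unfolding unitary_columns[OF \<open>rotate_cols n i j z U \<in> carrier_mat n n\<close>]
  proof (intro allI impI)
    fix c c' assume c: "c < n" "c' < n"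
    have "(\<Sum>r<n. conjugate (rotate_cols n i j z U $$ (r, c)) * rotate_cols n i j z U $$ (r, c')) =
      (\<Sum>r<n. conjugate (x c * U $$ (r, i) + y c * U $$ (r, j) + w c * U $$ (r, c)) *
        (x c' * U $$ (r, i) + y c' * U $$ (r, j) + w c' * U $$ (r, c')))"
      by (intro sum.cong refl) (use V c in simp)
    also have "\<dots> = conjugate (x c) * x c' * g i i + conjugate (x c) * y c' * g i j + conjugate (x c) * w c' * g i c' +
      conjugate (y c) * x c' * g j i + conjugate (y c) * y c' * g j j + conjugate (y c) * w c' * g j c' +
      conjugate (w c) * x c' * g c i + conjugate (w c) * y c' * g c j + conjugate (w c) * w c' * g c c'"
      unfolding g_def sum_distrib_left sum.distrib[symmetric]
      by (intro sum.cong refl) (simp add: conjugate_dist_add conjugate_dist_mul algebra_simps)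
    also have "\<dots> = (if c = c' then 1 else 0)"
    proof -
      have 1: "a * a + a * a * (z * conjugate z) = 1" using aa by (simp add: algebra_simps)
      consider "c = i" "c' = i" | "c = i" "c' = j" | "c = i" "c' \<noteq> i" "c' \<noteq> j" |
        "c = j" "c' = i" | "c = j" "c' = j" | "c = j" "c' \<noteq> i" "c' \<noteq> j" |
        "c \<noteq> i" "c \<noteq> j" "c' = i" | "c \<noteq> i" "c \<noteq> j" "c' = j" | "c \<noteq> i" "c \<noteq> j" "c' \<noteq> i" "c' \<noteq> j" by blast
      then show ?thesis
        by cases (use ij c g 1 in \<open>auto simp: x_def y_def w_def ca conjugate_dist_mul conjugate_neg algebra_simps\<close>)
    qed
    finally show "(\<Sum>r<n. conjugate (rotate_cols n i j z U $$ (r, c)) * rotate_cols n i j z U $$ (r, c')) =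
      (if c = c' then 1 else 0)" .
  qed
qed

lemma mult_rotate_cols:
  assumes "A \<in> carrier_mat n n" "U \<in> carrier_mat n n" "i < n" "j < n"
  shows "A * rotate_cols n i j z U = rotate_cols n i j z (A * U)"
proof (rule eq_matI)
  fix r c assume "r < dim_row (rotate_cols n i j z (A * U))" "c < dim_col (rotate_cols n i j z (A * U))"
  then have rc: "r < n" "c < n" by (auto simp: rotate_cols_def)
  define a where "a = (of_real (1 / sqrt (1 + (norm z)\<^sup>2)) :: 'a)"
  define x where "x = (if c = i then a else if c = j then - (a * conjugate z) else 0)"
  define y where "y = (if c = i then a * z else if c = j then a else 0)"
  define w where "w = (if c = i \<or> c = j then 0 else (1::'a))"
  have V: "rotate_cols n i j z Q $$ (q, c) = x * Q $$ (q, i) + y * Q $$ (q, j) + w * Q $$ (q, c)"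
    if "q < n" for q Q
    using that rc unfolding rotate_cols_def a_def[symmetric] x_def y_def w_def by (simp add: algebra_simps)
  have "(A * rotate_cols n i j z U) $$ (r, c) = (\<Sum>q<n. A $$ (r, q) * rotate_cols n i j z U $$ (q, c))"
    by (rule mult_mat_index[OF assms(1) _ rc]) (simp add: rotate_cols_def)
  also have "\<dots> = (\<Sum>q<n. A $$ (r, q) * (x * U $$ (q, i) + y * U $$ (q, j) + w * U $$ (q, c)))"
    by (intro sum.cong refl) (use V rc in simp)
  also have "\<dots> = x * (\<Sum>q<n. A $$ (r, q) * U $$ (q, i)) + y * (\<Sum>q<n. A $$ (r, q) * U $$ (q, j)) +
      w * (\<Sum>q<n. A $$ (r, q) * U $$ (q, c))"
    unfolding sum_distrib_left sum.distrib[symmetric] by (intro sum.cong refl) (simp add: algebra_simps)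
  also have "\<dots> = rotate_cols n i j z (A * U) $$ (r, c)"
    using V[OF rc(1)] mult_mat_index[OF assms(1,2) rc(1)] rc assms by simp
  finally show "(A * rotate_cols n i j z U) $$ (r, c) = rotate_cols n i j z (A * U) $$ (r, c)" .
qed (use assms in \<open>auto simp: rotate_cols_def\<close>)

text \<open>Requiring \<open>z\<close> times the inner product of the two columns to be a real
  number \<open>x\<close> makes both cross terms equal to \<open>x\<close>. The two choices of
  \<open>z\<close> in \<open>svd_exists\<close> have this property.\<close>

lemma col_sq_rotate:
  fixes P :: "'k::rc_field mat"
  assumes ij: "i < n" "j < n" "i \<noteq> j"
    and x: "z * (\<Sum>r<n. conjugate (P $$ (r, i)) * P $$ (r, j)) = of_real x"
  shows "col_sq n (rotate_cols n i j z P) i = (col_sq n P i + 2 * x + (norm z)\<^sup>2 * col_sq n P j) / (1 + (norm z)\<^sup>2)"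
    and "col_sq n (rotate_cols n i j z P) j = (col_sq n P j - 2 * x + (norm z)\<^sup>2 * col_sq n P i) / (1 + (norm z)\<^sup>2)"
    and "c \<noteq> i \<Longrightarrow> c \<noteq> j \<Longrightarrow> c < n \<Longrightarrow> col_sq n (rotate_cols n i j z P) c = col_sq n P c"
proof -
  let ?w = "\<Sum>r<n. conjugate (P $$ (r, i)) * P $$ (r, j)"
  have x': "conjugate z * conjugate ?w = of_real x"
    using arg_cong[OF x, of conjugate] by (simp only: conjugate_dist_mul conjugate_of_real)
  define a where "a = (of_real (1 / sqrt (1 + (norm z)\<^sup>2)) :: 'k)"
  have q: "(norm (a * y))\<^sup>2 = (norm y)\<^sup>2 / (1 + (norm z)\<^sup>2)" for y :: 'k
  proof -
    have "0 \<le> 1 + (norm z)\<^sup>2" by simp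
    then show ?thesis by (simp add: a_def norm_mult norm_divide power_mult_distrib power_divide)
  qed
  have Ri: "rotate_cols n i j z P $$ (r, i) = a * (P $$ (r, i) + z * P $$ (r, j))"
    and Rj: "rotate_cols n i j z P $$ (r, j) = a * (P $$ (r, j) - conjugate z * P $$ (r, i))" if "r < n" for r
    unfolding rotate_cols_def a_def[symmetric] using that ij by simp_all
  have nz: "of_real ((norm z)\<^sup>2) = z * conjugate z" by (simp only: mult_conjugate)
  have "(of_real (\<Sum>r<n. (norm (P $$ (r, i) + z * P $$ (r, j)))\<^sup>2) :: 'k) =
     (\<Sum>r<n. conjugate (P $$ (r, i)) * P $$ (r, i)) + z * ?w + conjugate z * (\<Sum>r<n. conjugate (P $$ (r, j)) * P $$ (r, i))
     + z * conjugate z * (\<Sum>r<n. conjugate (P $$ (r, j)) * P $$ (r, j))"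
    unfolding sum_distrib_left sum.distrib[symmetric] of_real_sum mult_conjugate[symmetric]
    by (intro sum.cong refl) (simp add: conjugate_dist_add conjugate_dist_mul algebra_simps)
  also have "\<dots> = of_real (col_sq n P i + 2 * x + (norm z)\<^sup>2 * col_sq n P j)"
    unfolding sum_conjugate_swap[of P j i n] x x' of_real_col_sq[symmetric] nz[symmetric]
    by (simp only: of_real_add of_real_mult) (simp add: algebra_simps)
  finally have 1: "(\<Sum>r<n. (norm (P $$ (r, i) + z * P $$ (r, j)))\<^sup>2) = col_sq n P i + 2 * x + (norm z)\<^sup>2 * col_sq n P j"
    using of_real_eq_iff by blast
  show "col_sq n (rotate_cols n i j z P) i = (col_sq n P i + 2 * x + (norm z)\<^sup>2 * col_sq n P j) / (1 + (norm z)\<^sup>2)"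
    unfolding col_sq_def[of n "rotate_cols n i j z P"] 1[symmetric] sum_divide_distrib
    by (intro sum.cong refl) (simp add: Ri q)
  have "(of_real (\<Sum>r<n. (norm (P $$ (r, j) - conjugate z * P $$ (r, i)))\<^sup>2) :: 'k) =
     (\<Sum>r<n. conjugate (P $$ (r, j)) * P $$ (r, j)) - z * ?w - conjugate z * (\<Sum>r<n. conjugate (P $$ (r, j)) * P $$ (r, i))
     + z * conjugate z * (\<Sum>r<n. conjugate (P $$ (r, i)) * P $$ (r, i))"
    unfolding sum_distrib_left sum.distrib[symmetric] sum_subtractf[symmetric] of_real_sum mult_conjugate[symmetric]
    by (intro sum.cong refl) (simp add: conjugate_diff conjugate_dist_mul algebra_simps)
  also have "\<dots> = of_real (col_sq n P j - 2 * x + (norm z)\<^sup>2 * col_sq n P i)"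
    unfolding sum_conjugate_swap[of P j i n] x x' of_real_col_sq[symmetric] nz[symmetric]
    by (simp only: of_real_add of_real_diff of_real_mult) (simp add: algebra_simps)
  finally have 2: "(\<Sum>r<n. (norm (P $$ (r, j) - conjugate z * P $$ (r, i)))\<^sup>2) = col_sq n P j - 2 * x + (norm z)\<^sup>2 * col_sq n P i"
    using of_real_eq_iff by blast
  show "col_sq n (rotate_cols n i j z P) j = (col_sq n P j - 2 * x + (norm z)\<^sup>2 * col_sq n P i) / (1 + (norm z)\<^sup>2)"
    unfolding col_sq_def[of n "rotate_cols n i j z P"] 2[symmetric] sum_divide_distrib
    by (intro sum.cong refl) (simp add: Rj q)
  show "c \<noteq> i \<Longrightarrow> c \<noteq> j \<Longrightarrow> c < n \<Longrightarrow> col_sq n (rotate_cols n i j z P) c = col_sq n P c"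
    by (auto simp: col_sq_def rotate_cols_def intro!: sum.cong)
qed

text \<open>The weights decrease strictly for a reason: with equal weights the sum would not change
  when \<open>P\<close> is multiplied on the right by a unitary matrix, and a maximum would say
  nothing about the columns.\<close>

definition weight_fun :: "nat \<Rightarrow> 'k::rc_field mat \<Rightarrow> real" where
  "weight_fun n P = (\<Sum>i<n. real (n - i) * col_sq n P i)"

text \<open>Compactness of the unitary group enters twice, for boundedness and for attainment of the
  supremum.\<close>

lemma weight_fun_max:
  fixes A :: "'k::rc_field mat"
  assumes A: "A \<in> carrier_mat n n"
  obtains U where "U \<in> unitary_mats n" "\<And>V. V \<in> unitary_mats n \<Longrightarrow> weight_fun n (A * V) \<le> weight_fun n (A * U)"
proof -
  let ?f = "\<lambda>V. weight_fun n (A * V)"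
  have lim: "(\<lambda>t. ?f (B t)) \<longlonglongrightarrow> ?f U"
    if B: "\<And>t. B t \<in> unitary_mats n" "U \<in> unitary_mats n" "mlim n n B U" for B U
  proof -
    have "mlim n n (\<lambda>t. A * B t) (A * U)"
      by (rule mlim_mult[OF mlim_const B(3)]) (use A B unitary_carrier in auto)
    then show ?thesis unfolding weight_fun_def col_sq_def
      by (intro tendsto_sum tendsto_mult tendsto_const tendsto_power tendsto_norm) (auto dest: mlimD)
  qed
  have bdd: "bdd_above (?f ` unitary_mats n)"
  proof (rule ccontr)
    assume "\<not> ?thesis"
    then have "\<forall>t. \<exists>V. V \<in> unitary_mats n \<and> ?f V > real t" by (force simp: bdd_above_def not_le)
    from choice[OF this] obtain B where B: "\<And>t. B t \<in> unitary_mats n" "\<And>t. ?f (B t) > real t" by blast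
    obtain U r where U: "U \<in> unitary_mats n" "strict_mono r" "mlim n n (\<lambda>t. B (r t)) U" by (rule unitary_subseq[OF B(1)])
    have l: "(\<lambda>t. ?f (B (r t))) \<longlonglongrightarrow> ?f U" by (rule lim) (use U B in auto)
    have "filterlim (\<lambda>t. ?f (B (r t))) at_top sequentially"
    proof (rule filterlim_at_top_mono[OF filterlim_real_sequentially], rule always_eventually, rule allI)
      fix t have "real t \<le> real (r t)" using seq_suble[OF U(2)] by simp
      then show "real t \<le> ?f (B (r t))" using B(2)[of "r t"] by linarith
    qed
    then show False using l not_tendsto_and_filterlim_at_infinity[OF _ l filterlim_at_top_imp_at_infinity] by simp
  qed
  define S where "S = Sup (?f ` unitary_mats n)"
  have ne: "?f ` unitary_mats n \<noteq> {}" using unitary_one by auto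
  have "\<exists>V. V \<in> unitary_mats n \<and> ?f V > S - inverse (real (Suc t))" for t
  proof -
    have "S - inverse (real (Suc t)) < Sup (?f ` unitary_mats n)" by (simp add: S_def)
    then show ?thesis unfolding less_cSup_iff[OF ne bdd] by blast
  qed
  then have "\<forall>t. \<exists>V. V \<in> unitary_mats n \<and> ?f V > S - inverse (real (Suc t))" by blast
  from choice[OF this] obtain B where B: "\<And>t. B t \<in> unitary_mats n" "\<And>t. ?f (B t) > S - inverse (real (Suc t))" by blast
  have "?f (B t) \<le> S" for t unfolding S_def by (rule cSup_upper[OF _ bdd]) (use B in auto)
  then have "(\<lambda>t. ?f (B t)) \<longlonglongrightarrow> S"
    using B(2) LIMSEQ_inverse_real_of_nat_add_minus[of S]
    by (intro tendsto_sandwich[OF _ _ LIMSEQ_inverse_real_of_nat_add_minus[of S] tendsto_const])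
      (auto intro!: always_eventually less_imp_le)
  obtain U r where U: "U \<in> unitary_mats n" "strict_mono r" "mlim n n (\<lambda>t. B (r t)) U" by (rule unitary_subseq[OF B(1)])
  have "(\<lambda>t. ?f (B (r t))) \<longlonglongrightarrow> ?f U" by (rule lim) (use U B in auto)
  moreover have "(\<lambda>t. ?f (B (r t))) \<longlonglongrightarrow> S"
    using LIMSEQ_subseq_LIMSEQ[OF \<open>(\<lambda>t. ?f (B t)) \<longlonglongrightarrow> S\<close> U(2)] by (simp add: o_def)
  ultimately have "?f U = S" by (rule LIMSEQ_unique)
  then show ?thesis using that[OF U(1)] cSup_upper[OF _ bdd] unfolding S_def by auto
qed

definition is_svd :: "nat \<Rightarrow> 'k::rc_field mat \<Rightarrow> 'k mat \<Rightarrow> (nat \<Rightarrow> real) \<Rightarrow> 'k mat \<Rightarrow> bool" where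
  "is_svd n A l s m \<longleftrightarrow> l \<in> unitary_mats n \<and> m \<in> unitary_mats n \<and> (\<forall>i<n. 0 < s i) \<and>
     (\<forall>i j. i \<le> j \<longrightarrow> j < n \<longrightarrow> s j \<le> s i) \<and> A = l * mat_diag n (\<lambda>i. of_real (s i)) * m"

lemma svd_exists:
  fixes A :: "'k::rc_field mat"
  assumes A: "A \<in> carrier_mat n n" "det A \<noteq> 0"
  obtains l s m where "is_svd n A l s m"
proof -
  obtain U where U: "U \<in> unitary_mats n" and max: "\<And>V. V \<in> unitary_mats n \<Longrightarrow> weight_fun n (A * V) \<le> weight_fun n (A * U)"
    using weight_fun_max[OF A(1)] by blast
  define P where "P = A * U"
  have Uc: "U \<in> carrier_mat n n" by (rule unitary_carrier[OF U])
  have P: "P \<in> carrier_mat n n" using A Uc by (simp add: P_def)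
  define N where "N = col_sq n P"
  \<comment> \<open>Maximality of \<open>U\<close> against a rotation with parameter
    \<open>z\<close>. After clearing the denominator \<open>1 + (norm z)\<^sup>2\<close>, only the
    difference of the two weights remains as a common factor.\<close>
  have key: "(real (n - i) - real (n - j)) * (2 * x) \<le> (real (n - i) - real (n - j)) * ((norm z)\<^sup>2 * (N i - N j))"
    if ij: "i < j" "j < n" and x: "z * (\<Sum>r<n. conjugate (P $$ (r, i)) * P $$ (r, j)) = of_real x" for i j z x
  proof -
    let ?R = "rotate_cols n i j z P"
    have ij': "i < n" "j < n" "i \<noteq> j" using ij by auto
    have fin: "finite {..<n}" "i \<in> {..<n}" "j \<in> {..<n} - {i}" using ij by auto
    have split: "(\<Sum>c<n. real (n - c) * col_sq n Q c) = real (n - i) * col_sq n Q i + (real (n - j) * col_sq n Q j +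
        (\<Sum>c\<in>{..<n} - {i} - {j}. real (n - c) * col_sq n Q c))" for Q :: "'k mat"
    proof -
      let ?g = "\<lambda>c. real (n - c) * col_sq n Q c"
      have "sum ?g {..<n} = ?g i + sum ?g ({..<n} - {i})" by (rule sum.remove[OF fin(1,2)])
      also have "sum ?g ({..<n} - {i}) = ?g j + sum ?g ({..<n} - {i} - {j})" by (rule sum.remove[OF _ fin(3)]) simp
      finally show ?thesis .
    qed
    have "weight_fun n ?R \<le> weight_fun n P"
      using max[OF rotate_cols_unitary[OF U ij']] mult_rotate_cols[OF A(1) Uc ij'(1,2)] by (simp add: P_def)
    then have "real (n - i) * col_sq n ?R i + real (n - j) * col_sq n ?R j \<le> real (n - i) * N i + real (n - j) * N j"
      unfolding weight_fun_def split N_def using col_sq_rotate(3)[OF ij' x] by simp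
    then have le: "real (n - i) * ((N i + 2 * x + (norm z)\<^sup>2 * N j) / (1 + (norm z)\<^sup>2)) +
        real (n - j) * ((N j - 2 * x + (norm z)\<^sup>2 * N i) / (1 + (norm z)\<^sup>2)) \<le> real (n - i) * N i + real (n - j) * N j"
      using col_sq_rotate(1,2)[OF ij' x] by (simp add: N_def)
    have z: "0 < 1 + (norm z)\<^sup>2" by (simp add: add_pos_nonneg)
    have "(real (n - i) * (N i + 2 * x + (norm z)\<^sup>2 * N j) + real (n - j) * (N j - 2 * x + (norm z)\<^sup>2 * N i)) / (1 + (norm z)\<^sup>2)
       \<le> real (n - i) * N i + real (n - j) * N j"
      using le unfolding times_divide_eq_right add_divide_distrib[symmetric] .
    then have "real (n - i) * (N i + 2 * x + (norm z)\<^sup>2 * N j) + real (n - j) * (N j - 2 * x + (norm z)\<^sup>2 * N i)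
       \<le> (real (n - i) * N i + real (n - j) * N j) * (1 + (norm z)\<^sup>2)"
      using z by (simp add: pos_divide_le_eq)
    then show ?thesis by (simp add: algebra_simps)
  qed
  have wpos: "0 < real (n - i) - real (n - j)" if "i < j" "j < n" for i j using that by auto
  have orth: "(\<Sum>r<n. conjugate (P $$ (r, i)) * P $$ (r, j)) = 0" if ij: "i < j" "j < n" for i j
  proof (rule ccontr)
    define w where "w = (\<Sum>r<n. conjugate (P $$ (r, i)) * P $$ (r, j))"
    assume "(\<Sum>r<n. conjugate (P $$ (r, i)) * P $$ (r, j)) \<noteq> 0"
    then have w: "(norm w)\<^sup>2 > 0" by (simp add: w_def)
    \<comment> \<open>With \<open>z = of_real t * conjugate w\<close> the gain is linear in
      \<open>t\<close> and the loss quadratic. This \<open>t\<close> keeps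
      \<open>t * (N i - N j)\<close> at most 1, whereas maximality would force it to be at least
      2.\<close>
    define t where "t = 1 / (\<bar>N i - N j\<bar> + 1)"
    have t: "t > 0" by (simp add: t_def add_nonneg_pos)
    have "of_real t * conjugate w * w = of_real (t * (norm w)\<^sup>2)"
      using mult_conjugate[of w] by (simp add: mult.assoc mult.commute[of "conjugate w"])
    from mult_left_le_imp_le[OF key[OF ij this[unfolded w_def]] wpos[OF ij]]
    have "2 * (t * (norm w)\<^sup>2) \<le> (norm (of_real t * conjugate w))\<^sup>2 * (N i - N j)"
      unfolding w_def .
    moreover have "(norm (of_real t * conjugate w))\<^sup>2 = t * (t * (norm w)\<^sup>2)"
      by (simp add: norm_mult power_mult_distrib power2_eq_square)
    ultimately have "2 * (t * (norm w)\<^sup>2) \<le> (t * (N i - N j)) * (t * (norm w)\<^sup>2)" by (simp add: algebra_simps)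
    then have "2 \<le> t * (N i - N j)" using t w by (simp add: mult_le_cancel_right)
    also have "\<dots> \<le> t * (\<bar>N i - N j\<bar> + 1)" using t by (intro mult_left_mono) auto
    also have "\<dots> = 1" by (simp add: t_def add_nonneg_pos)
    finally show False by simp
  qed
  have dec': "N j \<le> N i" if ij: "i < j" "j < n" for i j
  proof -
    \<comment> \<open>For orthogonal columns the rotation with \<open>z = 1\<close> averages the two
      squared lengths, which would increase the weighted sum if column \<open>j\<close> were longer
      than column \<open>i\<close>.\<close>
    have "1 * (\<Sum>r<n. conjugate (P $$ (r, i)) * P $$ (r, j)) = of_real 0" using orth[OF ij] by simp
    from mult_left_le_imp_le[OF key[OF ij this] wpos[OF ij]] show ?thesis by simp
  qed
  then have dec: "N j \<le> N i" if "i \<le> j" "j < n" for i j using that by (cases "i = j") auto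
  have orth': "(\<Sum>r<n. conjugate (P $$ (r, i)) * P $$ (r, j)) = 0" if ij: "i \<noteq> j" "i < n" "j < n" for i j
    using orth[of i j] orth[of j i] sum_conjugate_swap[of P i j n] that by (cases "i < j") auto
  have Npos: "N i > 0" if i: "i < n" for i
  proof (rule ccontr)
    assume "\<not> ?thesis"
    then have "N i = 0" using sum_nonneg[of "{..<n}" "\<lambda>r. (norm (P $$ (r, i)))\<^sup>2"] by (simp add: N_def col_sq_def)
    then have z: "P $$ (r, i) = 0" if "r < n" for r
      using that by (auto simp: N_def col_sq_def sum_nonneg_eq_0_iff)
    have "P *\<^sub>v unit_vec n i = 0\<^sub>v n"
      unfolding mult_unit_vec[OF P i] by (rule eq_vecI) (use z P i in auto)
    then have "det P = 0" using det_0_iff_vec_prod_zero_field[OF P] i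
      by (metis unit_vec_carrier index_unit_vec(2) index_zero_vec(1) zero_neq_one)
    moreover have "det U \<noteq> 0"
      using det_mult[OF mat_adjoint_carrier[OF Uc] Uc] unitary_adjoint_mult[OF U] by auto
    ultimately show False using A det_mult[OF A(1) Uc] by (simp add: P_def)
  qed
  define s where "s i = sqrt (N i)" for i
  have spos: "s i > 0" if "i < n" for i using Npos[OF that] by (simp add: s_def)
  \<comment> \<open>The columns of \<open>P = A * U\<close> are orthogonal and nonzero, so
    normalising them writes \<open>P\<close> as a unitary matrix times a diagonal one.\<close>
  define l where "l = mat n n (\<lambda>(r, i). P $$ (r, i) / of_real (s i))"
  have lc: "l \<in> carrier_mat n n" by (simp add: l_def)
  have "l \<in> unitary_mats n" unfolding unitary_columns[OF lc]
  proof (intro allI impI)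
    fix i j assume ij: "i < n" "j < n"
    have cd: "conjugate (x / of_real y) = conjugate x / of_real y" for x :: 'k and y
    proof (cases "y = 0")
      case False
      then have "conjugate (x / of_real y) * of_real y = conjugate (x / of_real y * of_real y)"
        by (simp only: conjugate_dist_mul conjugate_of_real)
      also have "\<dots> = conjugate x" using False by simp
      finally show ?thesis using False by (simp add: field_simps)
    qed simp
    have "(\<Sum>r<n. conjugate (l $$ (r, i)) * l $$ (r, j)) =
      (\<Sum>r<n. conjugate (P $$ (r, i)) * P $$ (r, j)) / (of_real (s i) * of_real (s j))"
      unfolding sum_divide_distrib by (intro sum.cong refl) (use ij in \<open>simp add: l_def cd\<close>)
    also have "\<dots> = (if i = j then 1 else 0)"
    proof (cases "i = j")
      case True
      have e: "of_real (s j) * of_real (s j) = (of_real (N j) :: 'k)"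
        using Npos[OF ij(2)] by (simp add: s_def flip: of_real_mult)
      have "(\<Sum>r<n. conjugate (P $$ (r, j)) * P $$ (r, j)) = of_real (N j)"
        by (simp only: of_real_col_sq N_def)
      then show ?thesis unfolding True e using Npos[OF ij(2)] by simp
    qed (use orth'[OF _ ij] in simp)
    finally show "(\<Sum>r<n. conjugate (l $$ (r, i)) * l $$ (r, j)) = (if i = j then 1 else 0)" .
  qed
  moreover have "A = l * mat_diag n (\<lambda>i. of_real (s i)) * mat_adjoint U"
  proof -
    have "l * mat_diag n (\<lambda>i. of_real (s i)) = P"
    proof (rule eq_matI)
      fix r i assume "r < dim_row P" "i < dim_col P"
      then have ri: "r < n" "i < n" using P by auto
      then show "(l * mat_diag n (\<lambda>i. of_real (s i))) $$ (r, i) = P $$ (r, i)"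
        using spos[OF ri(2)] by (subst mat_diag_mult_right[OF lc]) (simp add: l_def)
    qed (use P lc in auto)
    then have "l * mat_diag n (\<lambda>i. of_real (s i)) * mat_adjoint U = A * (U * mat_adjoint U)"
      unfolding P_def using assoc_mult_mat[OF A(1) Uc mat_adjoint_carrier[OF Uc]] by simp
    then show ?thesis using unitary_mult_adjoint[OF U] A by simp
  qed
  ultimately have "is_svd n A l s (mat_adjoint U)"
    unfolding is_svd_def using unitary_adjoint[OF U] spos dec by (auto simp: s_def)
  then show ?thesis by (rule that)
qed

section \<open>Singular values and Cartan subspaces\<close>

text \<open>The permutation that reverses the basis. Inversion reverses the order of singular
  values, and this matrix restores it; it also exchanges the first \<open>k\<close> and the last
  \<open>k\<close> basis vectors.\<close>

definition rev_mat :: "nat \<Rightarrow> 'k::field mat" where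
  "rev_mat n = mat n n (\<lambda>(i, j). if i + j + 1 = n then 1 else 0)"

lemma rev_mat_carrier [simp]: "rev_mat n \<in> carrier_mat n n"
  by (simp add: rev_mat_def)

lemma rev_mat_adjoint: "mat_adjoint (rev_mat n) = (rev_mat n :: 'k::conjugatable_field mat)"
  by (rule eq_matI) (auto simp: rev_mat_def add.commute)

lemma rev_mat_mult_index:
  assumes "X \<in> carrier_mat n k" "i < n" "j < k"
  shows "(rev_mat n * X) $$ (i, j) = X $$ (n - 1 - i, j)"
proof -
  have "(rev_mat n * X) $$ (i, j) = (\<Sum>r<n. rev_mat n $$ (i, r) * X $$ (r, j))"
    by (rule mult_mat_index[OF _ assms]) simp
  also have "\<dots> = (\<Sum>r<n. if r = n - 1 - i then X $$ (r, j) else 0)"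
    by (rule sum.cong) (use assms in \<open>auto simp: rev_mat_def\<close>)
  finally show ?thesis using assms by simp
qed

lemma rev_mat_square: "rev_mat n * rev_mat n = (1\<^sub>m n :: 'k::field mat)"
proof (rule eq_matI)
  fix i j assume "i < dim_row (1\<^sub>m n :: 'k mat)" "j < dim_col (1\<^sub>m n :: 'k mat)"
  then show "(rev_mat n * rev_mat n) $$ (i, j) = (1\<^sub>m n :: 'k mat) $$ (i, j)"
    by (subst rev_mat_mult_index[of _ n n]) (auto simp: rev_mat_def)
qed (auto simp: rev_mat_def)

lemma rev_mat_unitary: "rev_mat n \<in> unitary_mats n"
  by (simp add: unitary_mats_def rev_mat_adjoint rev_mat_square)

lemma rev_mat_diag: "rev_mat n * mat_diag n f = mat_diag n (\<lambda>i. f (n - 1 - i)) * rev_mat n"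
proof (rule eq_matI)
  fix i j assume "i < dim_row (mat_diag n (\<lambda>i. f (n - 1 - i)) * rev_mat n)" "j < dim_col (mat_diag n (\<lambda>i. f (n - 1 - i)) * rev_mat n)"
  then have ij: "i < n" "j < n" by (auto simp: mat_diag_def rev_mat_def)
  then show "(rev_mat n * mat_diag n f) $$ (i, j) = (mat_diag n (\<lambda>i. f (n - 1 - i)) * rev_mat n) $$ (i, j)"
    by (simp add: rev_mat_mult_index[of _ n n] mat_diag_mult_index[of _ n n])
      (auto simp: mat_diag_def rev_mat_def)
qed (auto simp: mat_diag_def rev_mat_def)

lemma proots_linear_factors: "proots (\<Prod>a\<leftarrow>xs. [:- a, 1:]) = mset (xs :: 'k::field list)"
proof (induction xs)
  case (Cons a xs)
  have "(\<Prod>a\<leftarrow>xs. [:- a, 1:]) \<noteq> 0" by (simp add: prod_list_zero_iff image_iff)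
  then show ?case using Cons by (simp add: proots_mult proots_linear_factor[of "- a", simplified] del: mult_pCons_left)
qed simp

text \<open>\<open>mat_adjoint A * A\<close> is similar to the square of the diagonal factor, so its
  characteristic polynomial splits and the square roots of its roots are the numbers
  \<open>s i\<close>. Sorting them in decreasing order returns \<open>s\<close> itself;
  \<open>singular_value\<close> counts from 1 and \<open>s\<close> from 0.\<close>

lemma singular_value_svd:
  assumes svd: "is_svd n A l s m" and i: "i < n"
  shows "singular_value (Suc i) A = s i"
proof -
  define D :: "'a mat" where "D = mat_diag n (\<lambda>i. of_real (s i))"
  define D2 :: "'a mat" where "D2 = mat_diag n (\<lambda>i. of_real ((s i)\<^sup>2))"
  have D: "D \<in> carrier_mat n n" "mat_adjoint D = D" "D * D = D2"
    unfolding D_def D2_def mat_diag_diag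
    by (simp, rule eq_matI, auto simp: mat_diag_def power2_eq_square)
  have l: "l \<in> carrier_mat n n" "mat_adjoint l * l = 1\<^sub>m n" and m: "m \<in> carrier_mat n n" "mat_adjoint m * m = 1\<^sub>m n"
    and mm: "m * mat_adjoint m = 1\<^sub>m n" and A: "A = l * D * m"
    and pos: "\<And>i. i < n \<Longrightarrow> 0 < s i" and dec: "\<And>i j. i \<le> j \<Longrightarrow> j < n \<Longrightarrow> s j \<le> s i"
    using svd unitary_mult_adjoint[of m n] unfolding is_svd_def D_def unitary_mats_def by auto
  have "mat_adjoint A * A = mat_adjoint m * D2 * m"
  proof -
    have "mat_adjoint A = mat_adjoint m * (D * mat_adjoint l)"
      unfolding A using l m D
      by (simp add: mat_adjoint_mult[of _ n n _ n] assoc_mult_mat[of _ n n _ n _ n])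
    then have "mat_adjoint A * A = mat_adjoint m * (D * ((mat_adjoint l * l) * (D * m)))"
      unfolding A using l(1) m D(1) by (simp add: assoc_mult_mat[of _ n n _ n _ n])
    also have "\<dots> = mat_adjoint m * (D * D) * m"
      using l(2) m(1) D(1) by (simp add: assoc_mult_mat[of _ n n _ n _ n])
    finally show ?thesis using D by simp
  qed
  then have "similar_mat (mat_adjoint A * A) D2"
    unfolding similar_mat_def similar_mat_wit_def Let_def
    using m mm D by (intro exI[of _ "mat_adjoint m"] exI[of _ m]) (auto simp: D2_def)
  then have "char_poly (mat_adjoint A * A) = char_poly D2" by (rule char_poly_similar)
  also have "\<dots> = (\<Prod>a\<leftarrow>diag_mat D2. [:- a, 1:])"
    by (rule char_poly_upper_triangular[of _ n]) (auto simp: D2_def mat_diag_def)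
  also have "diag_mat D2 = map (\<lambda>i. of_real ((s i)\<^sup>2)) [0..<n]"
    by (auto simp: diag_mat_def D2_def mat_diag_def)
  finally have "proots (char_poly (mat_adjoint A * A)) = mset (map (\<lambda>i. of_real ((s i)\<^sup>2)) [0..<n])"
    by (simp only: proots_linear_factors)
  then have "image_mset (\<lambda>x. sqrt (norm x)) (proots (char_poly (mat_adjoint A * A))) =
      mset (map (\<lambda>i. sqrt (norm (of_real ((s i)\<^sup>2) :: 'a))) [0..<n])"
    by (simp only: mset_map[symmetric] map_map o_def)
  also have "map (\<lambda>i. sqrt (norm (of_real ((s i)\<^sup>2) :: 'a))) [0..<n] = map s [0..<n]"
    by (rule map_cong) (use pos in \<open>auto simp: norm_power abs_of_pos\<close>)
  finally have "rev (sorted_list_of_multiset (image_mset (\<lambda>x. sqrt (norm x)) (proots (char_poly (mat_adjoint A * A))))) =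
      rev (sort (map s [0..<n]))" by (simp only: sorted_list_of_multiset_mset)
  also have "sort (map s [0..<n]) = rev (map s [0..<n])"
  proof (rule properties_for_sort)
    show "sorted (rev (map s [0..<n]))"
      unfolding sorted_rev_iff_nth_mono using dec by auto
  qed simp
  finally show ?thesis using i by (simp add: singular_value_def)
qed

section \<open>Classes in PGL, normalised lifts and uniqueness of Cartan subspaces\<close>

definition pcoset :: "'k::field mat \<Rightarrow> 'k mat set" where
  "pcoset A = {c \<cdot>\<^sub>m A | c. c \<noteq> 0}"

lemma rcoset_scalars: "A \<in> carrier_mat n n \<Longrightarrow> scalars n #>\<^bsub>GL n\<^esub> A = pcoset (A :: 'k::field mat)"
proof -
  assume A: "A \<in> carrier_mat n n"
  have "c \<cdot>\<^sub>m 1\<^sub>m n * A = c \<cdot>\<^sub>m A" for c using A by (simp add: mult_smult_assoc_mat[of _ n n _ n])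
  then show ?thesis by (auto simp: r_coset_def scalars_def pcoset_def)
qed

lemma carrier_PGL: "carrier (PGL n) = {pcoset A | A. A \<in> carrier_mat n n \<and> det A \<noteq> (0::'k::field)}"
proof -
  have "carrier (PGL n) = (\<lambda>A. scalars n #>\<^bsub>GL n\<^esub> A) ` carrier (GL n :: 'k mat monoid)"
    by (auto simp: PGL_def FactGroup_def RCOSETS_def)
  then show ?thesis by (auto simp: carrier_GL rcoset_scalars image_iff)
qed

lemma pcoset_self: "A \<in> pcoset A"
  unfolding pcoset_def by (rule CollectI, rule exI[of _ 1]) auto

lemma pcoset_smult: "c \<noteq> 0 \<Longrightarrow> pcoset (c \<cdot>\<^sub>m A) = pcoset (A :: 'k::field mat)"
proof -
  assume c: "c \<noteq> 0"
  have 1: "e \<cdot>\<^sub>m (c \<cdot>\<^sub>m A) = (e * c) \<cdot>\<^sub>m A" for e by (rule eq_matI) (auto simp: mult_ac)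
  have 2: "e \<cdot>\<^sub>m A = (e / c) \<cdot>\<^sub>m (c \<cdot>\<^sub>m A)" for e using c unfolding 1 by simp
  show ?thesis
  proof (intro equalityI subsetI)
    fix x assume "x \<in> pcoset (c \<cdot>\<^sub>m A)"
    then obtain e where "x = e \<cdot>\<^sub>m (c \<cdot>\<^sub>m A)" "e \<noteq> 0" by (auto simp: pcoset_def)
    then have "x = (e * c) \<cdot>\<^sub>m A" "e * c \<noteq> 0" using c unfolding 1 by auto
    then show "x \<in> pcoset A" unfolding pcoset_def by blast
  next
    fix x assume "x \<in> pcoset A"
    then obtain e where "x = e \<cdot>\<^sub>m A" "e \<noteq> 0" by (auto simp: pcoset_def)
    moreover from this(2) have "e / c \<noteq> 0" using c by simp
    ultimately have "x = (e / c) \<cdot>\<^sub>m (c \<cdot>\<^sub>m A)" "e / c \<noteq> 0" by (auto intro: trans[OF _ 2])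
    then show "x \<in> pcoset (c \<cdot>\<^sub>m A)" unfolding pcoset_def by blast
  qed
qed

lemma pcoset_eqI: "B \<in> pcoset A \<Longrightarrow> pcoset B = pcoset A"
proof -
  assume "B \<in> pcoset A"
  then obtain c where "B = c \<cdot>\<^sub>m A" "c \<noteq> 0" by (auto simp: pcoset_def)
  then show ?thesis by (simp add: pcoset_smult)
qed

lemma norm_lift:
  fixes A :: "'k::real_normed_field mat"
  assumes A: "A \<in> carrier_mat n n" "det A \<noteq> 0" and n: "n > 0"
  shows "norm_lift (pcoset A) \<in> pcoset A" "norm (det (norm_lift (pcoset A))) = 1"
proof -
  \<comment> \<open>Scaling by \<open>r\<close> multiplies the determinant by \<open>r ^ n\<close>,
    which brings its modulus to 1.\<close>
  define r where "r = root n (1 / norm (det A))"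
  have r: "r > 0" "r ^ n = 1 / norm (det A)" using n A by (auto simp: r_def)
  have "norm (det (of_real r \<cdot>\<^sub>m A)) = 1" using A r by (simp add: det_smult norm_mult norm_power)
  moreover have "of_real r \<cdot>\<^sub>m A \<in> pcoset A" using r unfolding pcoset_def by (intro CollectI exI[of _ "of_real r"]) auto
  ultimately have "\<exists>B. B \<in> pcoset A \<and> norm (det B) = 1" by blast
  from someI_ex[OF this] show "norm_lift (pcoset A) \<in> pcoset A" "norm (det (norm_lift (pcoset A))) = 1"
    unfolding norm_lift_def by auto
qed

text \<open>The columns of \<open>l\<close> form an orthonormal basis in which
  \<open>mat_adjoint l *\<^sub>v v\<close> lists the coordinates of \<open>v\<close>; the first
  \<open>k\<close> columns span the vectors whose other coordinates vanish.\<close>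

lemma mem_cspace_std:
  fixes l :: "'k::rc_field mat"
  assumes l: "l \<in> unitary_mats d" and k: "k \<le> d"
  shows "v \<in> cspace d (l * std_frame d k) \<longleftrightarrow> v \<in> carrier_vec d \<and> (\<forall>i. k \<le> i \<longrightarrow> i < d \<longrightarrow> (mat_adjoint l *\<^sub>v v) $ i = 0)"
proof -
  have lc: "l \<in> carrier_mat d d" by (rule unitary_carrier[OF l])
  have E: "(std_frame d k *\<^sub>v x) $ i = (if i < k then x $ i else 0)" if "x \<in> carrier_vec k" "i < d" for x :: "'k vec" and i
  proof -
    have "(std_frame d k *\<^sub>v x) $ i = (\<Sum>r<k. std_frame d k $$ (i, r) * x $ r)"
      by (rule mult_vec_index[OF _ that]) simp
    also have "\<dots> = (\<Sum>r<k. if r = i then x $ r else 0)" by (rule sum.cong) (use that k in \<open>auto simp: std_frame_def\<close>)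
    finally show ?thesis by simp
  qed
  have inv1: "mat_adjoint l *\<^sub>v (l *\<^sub>v w) = w" if "w \<in> carrier_vec d" for w
    using assoc_mult_mat_vec[OF mat_adjoint_carrier[OF lc] lc that] unitary_adjoint_mult[OF l] that by simp
  have inv2: "l *\<^sub>v (mat_adjoint l *\<^sub>v w) = w" if "w \<in> carrier_vec d" for w
    using assoc_mult_mat_vec[OF lc mat_adjoint_carrier[OF lc] that] unitary_mult_adjoint[OF l] that by simp
  show ?thesis
  proof
    assume "v \<in> cspace d (l * std_frame d k)"
    then obtain w where w: "w \<in> cspace d (std_frame d k)" "v = l *\<^sub>v w"
      unfolding cspace_mult[OF lc std_frame_carrier] by blast
    then obtain x where x: "x \<in> carrier_vec k" "w = std_frame d k *\<^sub>v x" by (auto simp: cspace_eq[OF std_frame_carrier])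
    have wd: "w \<in> carrier_vec d" using x by (auto intro: mult_mat_vec_carrier[OF std_frame_carrier])
    show "v \<in> carrier_vec d \<and> (\<forall>i. k \<le> i \<longrightarrow> i < d \<longrightarrow> (mat_adjoint l *\<^sub>v v) $ i = 0)"
      using inv1[OF wd] w(2) lc wd E[OF x(1)] x(2) by auto
  next
    assume v: "v \<in> carrier_vec d \<and> (\<forall>i. k \<le> i \<longrightarrow> i < d \<longrightarrow> (mat_adjoint l *\<^sub>v v) $ i = 0)"
    define w where "w = mat_adjoint l *\<^sub>v v"
    have w: "w \<in> carrier_vec d" using v lc by (auto simp: w_def intro: mult_mat_vec_carrier[OF mat_adjoint_carrier])
    have "w = std_frame d k *\<^sub>v vec k (\<lambda>i. w $ i)"
    proof (rule eq_vecI)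
      fix i assume "i < dim_vec (std_frame d k *\<^sub>v vec k (\<lambda>i. w $ i))"
      then have i: "i < d" by (simp add: std_frame_def)
      show "w $ i = (std_frame d k *\<^sub>v vec k (\<lambda>i. w $ i)) $ i"
        unfolding E[OF vec_carrier i] using v i by (auto simp: w_def not_less)
    qed (use w in \<open>auto simp: std_frame_def\<close>)
    then have "w \<in> cspace d (std_frame d k)" by (auto simp: cspace_eq[OF std_frame_carrier])
    moreover have "v = l *\<^sub>v w" using inv2 v by (simp add: w_def)
    ultimately show "v \<in> cspace d (l * std_frame d k)" unfolding cspace_mult[OF lc std_frame_carrier] by blast
  qed
qed

lemma frame_unitary_std:
  fixes l :: "'k::rc_field mat"
  assumes l: "l \<in> unitary_mats d" and k: "k \<le> d"
  shows "frame d k (l * std_frame d k)"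
proof -
  have lc: "l \<in> carrier_mat d d" by (rule unitary_carrier[OF l])
  have EE: "mat_adjoint (std_frame d k) * std_frame d k = (1\<^sub>m k :: 'k mat)"
  proof (rule eq_matI)
    fix i j assume "i < dim_row (1\<^sub>m k :: 'k mat)" "j < dim_col (1\<^sub>m k :: 'k mat)"
    then have ij: "i < k" "j < k" by auto
    have "(mat_adjoint (std_frame d k) * std_frame d k) $$ (i, j) =
        (\<Sum>r<d. mat_adjoint (std_frame d k) $$ (i, r) * (std_frame d k :: 'k mat) $$ (r, j))"
      by (rule mult_mat_index[of _ k d _ k]) (use ij in auto)
    also have "\<dots> = (\<Sum>r<d. if r = i then (if i = j then 1 else 0) else 0)"
      by (rule sum.cong) (use ij k in \<open>auto simp: std_frame_def\<close>)
    finally show "(mat_adjoint (std_frame d k) * std_frame d k) $$ (i, j) = (1\<^sub>m k :: 'k mat) $$ (i, j)"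
      using ij k by simp
  qed (auto simp: std_frame_def)
  have "mat_adjoint (l * std_frame d k) * (l * std_frame d k) =
      mat_adjoint (std_frame d k) * ((mat_adjoint l * l) * std_frame d k)"
    using lc by (simp add: mat_adjoint_mult[OF lc std_frame_carrier] assoc_mult_mat[of _ k d _ d _ k]
        assoc_mult_mat[of _ d d _ d _ k])
  also have "\<dots> = 1\<^sub>m k" using unitary_adjoint_mult[OF l] EE by (simp add: left_mult_one_mat[OF std_frame_carrier])
  finally show ?thesis unfolding frame_def using lc by (simp add: mult_carrier_mat[OF lc std_frame_carrier])
qed

text \<open>The transition \<open>u\<close> from \<open>l\<close> to \<open>l'\<close> commutes with
  the squared diagonal matrix, because both decompositions give the same product of the matrix with
  its adjoint. So the entries of \<open>u\<close> between unequal singular values vanish; by the gap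
  this includes the block with rows from \<open>k\<close> on and columns below
  \<open>k\<close>.\<close>

lemma cartan_unique_subset:
  fixes l l' :: "'k::rc_field mat"
  assumes l: "l \<in> unitary_mats d" and l': "l' \<in> unitary_mats d" and k: "0 < k" "k < d"
    and gap: "s k < s (k - 1)" and pos: "\<And>i. i < d \<Longrightarrow> 0 < s i" and dec: "\<And>i j. i \<le> j \<Longrightarrow> j < d \<Longrightarrow> s j \<le> s i"
    and m: "m \<in> unitary_mats d" and m': "m' \<in> unitary_mats d"
    and eq: "l * mat_diag d (\<lambda>i. of_real (s i)) * m = l' * mat_diag d (\<lambda>i. of_real (s i)) * m'"
  shows "cspace d (l * std_frame d k) \<subseteq> cspace d (l' * std_frame d k)"
proof -
  define D :: "'k mat" where "D = mat_diag d (\<lambda>i. of_real (s i))"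
  define D2 :: "'k mat" where "D2 = mat_diag d (\<lambda>i. of_real ((s i)\<^sup>2))"
  have D: "D \<in> carrier_mat d d" "mat_adjoint D = D" "D * D = D2"
    unfolding D_def D2_def mat_diag_diag
    by (simp, rule eq_matI, auto simp: mat_diag_def power2_eq_square)
  have c: "l \<in> carrier_mat d d" "l' \<in> carrier_mat d d" "m \<in> carrier_mat d d" "m' \<in> carrier_mat d d" "D2 \<in> carrier_mat d d"
    using l l' m m' unitary_carrier by (auto simp: D2_def)
  have sq: "(p * D * q) * mat_adjoint (p * D * q) = p * (D2 * mat_adjoint p)"
    if "p \<in> unitary_mats d" "q \<in> unitary_mats d" for p q
  proof -
    have pq: "p \<in> carrier_mat d d" "q \<in> carrier_mat d d" using that unitary_carrier by auto
    then have adj: "mat_adjoint (p * D * q) = mat_adjoint q * (D * mat_adjoint p)"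
      using D by (simp add: mat_adjoint_mult[of _ d d _ d] assoc_mult_mat[of _ d d _ d _ d])
    have DP: "D * mat_adjoint p \<in> carrier_mat d d" and DQ: "D * q \<in> carrier_mat d d"
      using mult_carrier_mat[OF D(1) mat_adjoint_carrier[OF pq(1)]] mult_carrier_mat[OF D(1) pq(2)] .
    have Z: "mat_adjoint q * (D * mat_adjoint p) \<in> carrier_mat d d"
      by (rule mult_carrier_mat[OF mat_adjoint_carrier[OF pq(2)] DP])
    have "(p * D * q) * mat_adjoint (p * D * q) = p * (D * ((q * mat_adjoint q) * (D * mat_adjoint p)))"
      unfolding adj unfolding assoc_mult_mat[OF pq(1) D(1) pq(2)] assoc_mult_mat[OF pq(1) DQ Z]
        assoc_mult_mat[OF D(1) pq(2) Z] assoc_mult_mat[OF pq(2) mat_adjoint_carrier[OF pq(2)] DP] ..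
    also have "\<dots> = p * ((D * D) * mat_adjoint p)"
      using pq D(1) unitary_mult_adjoint[OF that(2)] by (simp add: assoc_mult_mat[of _ d d _ d _ d])
    finally show ?thesis using D by simp
  qed
  have e2: "l * (D2 * mat_adjoint l) = l' * (D2 * mat_adjoint l')"
    using sq[OF l m] sq[OF l' m'] eq by (simp add: D_def)
  define u where "u = mat_adjoint l' * l"
  have u: "u \<in> carrier_mat d d" using c by (simp add: u_def)
  have "u * D2 = D2 * u"
  proof -
    have "u * D2 = mat_adjoint l' * (l * (D2 * (mat_adjoint l * l)))"
      using c unitary_adjoint_mult[OF l] by (simp add: u_def assoc_mult_mat[of _ d d _ d _ d])
    also have "\<dots> = mat_adjoint l' * ((l * (D2 * mat_adjoint l)) * l)"
      using c by (simp add: assoc_mult_mat[of _ d d _ d _ d])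
    also have "\<dots> = (mat_adjoint l' * l') * (D2 * (mat_adjoint l' * l))"
      unfolding e2 using c by (simp add: assoc_mult_mat[of _ d d _ d _ d])
    finally show ?thesis using unitary_adjoint_mult[OF l'] c by (simp add: u_def)
  qed
  have u0: "u $$ (i, j) = 0" if "k \<le> i" "i < d" "j < k" for i j
  proof -
    have "(u * D2) $$ (i, j) = u $$ (i, j) * of_real ((s j)\<^sup>2)"
      unfolding D2_def using that k by (subst mat_diag_mult_right[OF u]) simp
    moreover have "(D2 * u) $$ (i, j) = of_real ((s i)\<^sup>2) * u $$ (i, j)"
      unfolding D2_def using that k by (subst mat_diag_mult_index[OF u]) simp_all
    ultimately have "u $$ (i, j) * of_real ((s j)\<^sup>2) = of_real ((s i)\<^sup>2) * u $$ (i, j)"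
      using \<open>u * D2 = D2 * u\<close> by (simp only:)
    then have "u $$ (i, j) * (of_real ((s j)\<^sup>2) - of_real ((s i)\<^sup>2)) = 0"
      by (simp only: right_diff_distrib mult.commute diff_self)
    moreover have "(s i)\<^sup>2 < (s j)\<^sup>2"
    proof (rule power_strict_mono)
      have "s i \<le> s k" "s (k - 1) \<le> s j" using dec that k by auto
      then show "s i < s j" using gap by simp
      show "0 \<le> s i" using pos[of i] that by simp
    qed simp
    ultimately show ?thesis by (metis mult_eq_0_iff of_real_eq_iff right_minus_eq less_irrefl)
  qed
  show ?thesis
  proof
    fix v assume "v \<in> cspace d (l * std_frame d k)"
    then have v: "v \<in> carrier_vec d" and vl: "\<And>i. k \<le> i \<Longrightarrow> i < d \<Longrightarrow> (mat_adjoint l *\<^sub>v v) $ i = 0"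
      using mem_cspace_std[OF l] k by auto
    define w where "w = mat_adjoint l *\<^sub>v v"
    have w: "w \<in> carrier_vec d" using v c by (auto simp: w_def intro: mult_mat_vec_carrier[OF mat_adjoint_carrier])
    have vw: "v = l *\<^sub>v w"
      using assoc_mult_mat_vec[OF c(1) mat_adjoint_carrier[OF c(1)] v] unitary_mult_adjoint[OF l] v by (simp add: w_def)
    have "mat_adjoint l' *\<^sub>v v = u *\<^sub>v w"
      unfolding vw u_def by (rule assoc_mult_mat_vec[symmetric, of _ d d]) (use c w in auto)
    moreover have "(u *\<^sub>v w) $ i = 0" if "k \<le> i" "i < d" for i
    proof -
      have "(u *\<^sub>v w) $ i = (\<Sum>r<d. u $$ (i, r) * w $ r)" by (rule mult_vec_index[OF u w that(2)])
      also have "\<dots> = 0" by (rule sum.neutral) (use u0[OF that] vl in \<open>auto simp: w_def not_less\<close>, metis not_less)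
      finally show ?thesis .
    qed
    ultimately show "v \<in> cspace d (l' * std_frame d k)" using v mem_cspace_std[OF l'] k by auto
  qed
qed

lemma cartan_span_eq:
  assumes "l \<in> carrier_mat d d" "k \<le> d"
  shows "(\<lambda>v. l *\<^sub>v v) ` LinearCombinations.module.span class_ring (module_vec TYPE('k::field) d) (unit_vec d ` {..<k}) =
    cspace d (l * std_frame d k)"
proof -
  have "cols (std_frame d k :: 'k mat) = map (unit_vec d) [0..<k]"
    by (rule nth_equalityI) (use assms in \<open>auto simp: std_frame_def unit_vec_def\<close>)
  then have "set (cols (std_frame d k :: 'k mat)) = unit_vec d ` {..<k}" by (simp add: lessThan_atLeast0)
  then have "cspace d (std_frame d k) = LinearCombinations.module.span class_ring (module_vec TYPE('k) d) (unit_vec d ` {..<k})"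
    unfolding vec_space.col_space_def by simp
  then show ?thesis unfolding cspace_mult[OF assms(1) std_frame_carrier] by simp
qed

definition svd_of :: "nat \<Rightarrow> 'k::rc_field mat set \<Rightarrow> 'k mat \<Rightarrow> (nat \<Rightarrow> real) \<Rightarrow> 'k mat \<Rightarrow> bool" where
  "svd_of d g l s m \<longleftrightarrow> (\<exists>A\<in>g. norm (det A) = 1 \<and> is_svd d A l s m)"

lemma svd_of_exists:
  assumes "g \<in> carrier (PGL d)" "d > 0"
  obtains l s m where "svd_of d g l s m"
proof -
  obtain A where A: "A \<in> carrier_mat d d" "det A \<noteq> 0" "g = pcoset A" using assms(1) by (auto simp: carrier_PGL)
  note nl = norm_lift[OF A(1,2) assms(2)]
  have "norm_lift (pcoset A) \<in> carrier_mat d d" using nl(1) A by (auto simp: pcoset_def)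
  then obtain l s m where "is_svd d (norm_lift (pcoset A)) l s m" using svd_exists nl(2) by (metis norm_zero zero_neq_one)
  then show ?thesis using that nl A unfolding svd_of_def by blast
qed

lemma svd_of_norm_lift:
  assumes g: "g \<in> carrier (PGL d)" and d: "d > 0" and svd: "svd_of d g l s m"
  obtains c where "norm c = 1" "is_svd d (norm_lift g) (c \<cdot>\<^sub>m l) s m"
proof -
  obtain A where A: "A \<in> carrier_mat d d" "det A \<noteq> 0" "g = pcoset A" using g by (auto simp: carrier_PGL)
  obtain B where B: "B \<in> g" "norm (det B) = 1" "is_svd d B l s m" using svd by (auto simp: svd_of_def)
  have gB: "g = pcoset B" and Bc: "B \<in> carrier_mat d d" using B(1) A pcoset_eqI[of B A] by (auto simp: pcoset_def)
  note nl = norm_lift[OF Bc _ d]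
  have "det B \<noteq> 0" using B(2) by auto
  then obtain c where c: "norm_lift g = c \<cdot>\<^sub>m B" using nl(1) unfolding gB pcoset_def by blast
  have "norm c ^ d = 1" using nl(2) \<open>det B \<noteq> 0\<close> B(2) Bc c gB by (simp add: det_smult norm_mult norm_power)
  then have nc: "norm c = 1" using power_eq_imp_eq_base[of "norm c" d 1] d by simp
  have l: "l \<in> unitary_mats d" "m \<in> unitary_mats d" using B(3) by (auto simp: is_svd_def)
  have "c \<cdot>\<^sub>m B = c \<cdot>\<^sub>m l * mat_diag d (\<lambda>i. of_real (s i)) * m"
    using B(3) l unitary_carrier[OF l(1)] unitary_carrier[OF l(2)] unfolding is_svd_def
    by (simp add: mult_smult_assoc_mat[of _ d d _ d])
  then have "is_svd d (norm_lift g) (c \<cdot>\<^sub>m l) s m"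
    using B(3) unitary_smult[OF l(1) nc] c unfolding is_svd_def by simp
  with nc that show ?thesis by blast
qed

lemma sing_svd:
  assumes "g \<in> carrier (PGL d)" "svd_of d g l s m" "i < d"
  shows "sing (Suc i) g = s i"
proof -
  obtain c where "is_svd d (norm_lift g) (c \<cdot>\<^sub>m l) s m" using svd_of_norm_lift[OF assms(1) _ assms(2)] assms(3) by auto
  then show ?thesis unfolding sing_def by (rule singular_value_svd[OF _ assms(3)])
qed

lemma root_val_svd:
  assumes "g \<in> carrier (PGL d)" "svd_of d g l s m" "1 \<le> k" "k < d"
  shows "root_val k g = ln (s (k - 1) / s k)"
  using sing_svd[OF assms(1,2), of "k - 1"] sing_svd[OF assms(1,2), of k] assms(3,4) by (simp add: root_val_def)

lemma cspace_smult: "c \<noteq> 0 \<Longrightarrow> Y \<in> carrier_mat d k \<Longrightarrow> cspace d (c \<cdot>\<^sub>m Y) = cspace d (Y :: 'k::field mat)"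
proof -
  assume c: "c \<noteq> 0" and Y: "Y \<in> carrier_mat d k"
  have "c \<cdot>\<^sub>m Y = Y * (c \<cdot>\<^sub>m 1\<^sub>m k)" using Y by (simp add: mult_smult_distrib[of _ d k _ k])
  then show ?thesis using cspace_mult_invertible[OF Y, of "c \<cdot>\<^sub>m 1\<^sub>m k"] c by (simp add: det_smult)
qed

text \<open>Uniqueness in the definite description comes from \<open>cartan_unique_subset\<close>,
  applied in both directions.\<close>

lemma cartan_subspace_svd:
  fixes g :: "'k::rc_field mat set"
  assumes g: "g \<in> carrier (PGL d)" and svd: "svd_of d g l s m" and k: "1 \<le> k" "k < d" and gap: "s k < s (k - 1)"
  shows "cartan_subspace d k g = cspace d (l * std_frame d k)"
proof -
  obtain c where c: "norm c = 1" "is_svd d (norm_lift g) (c \<cdot>\<^sub>m l) s m" using svd_of_norm_lift[OF g _ svd] k by auto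
  have "sing_diag d g = mat_diag d (\<lambda>i. of_real (s i))"
    by (rule eq_matI) (use sing_svd[OF g svd] in \<open>auto simp: sing_diag_def mat_diag_def\<close>)
  then have nl: "norm_lift g = (c \<cdot>\<^sub>m l) * sing_diag d g * m" using c by (simp add: is_svd_def)
  have u: "c \<cdot>\<^sub>m l \<in> unitary_mats d" "m \<in> unitary_mats d" "\<And>i. i < d \<Longrightarrow> 0 < s i" "\<And>i j. i \<le> j \<Longrightarrow> j < d \<Longrightarrow> s j \<le> s i"
    using c by (auto simp: is_svd_def)
  have lc: "l \<in> carrier_mat d d" using svd by (auto simp: svd_of_def is_svd_def unitary_carrier)
  have cl: "cspace d (c \<cdot>\<^sub>m l * std_frame d k) = cspace d (l * std_frame d k)"
    using cspace_smult[of c "l * std_frame d k" d k] c lc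
    by (simp add: mult_smult_assoc_mat[OF lc std_frame_carrier] mult_carrier_mat[OF lc std_frame_carrier]) (metis norm_zero zero_neq_one)
  show ?thesis
    unfolding cartan_subspace_def
  proof (rule the_equality)
    show "\<exists>la\<in>unitary_mats d. \<exists>m\<in>unitary_mats d. norm_lift g = la * sing_diag d g * m \<and>
       cspace d (l * std_frame d k) = (\<lambda>v. la *\<^sub>v v) ` LinearCombinations.module.span class_ring (module_vec TYPE('k) d) (unit_vec d ` {..<k})"
      using u nl cl cartan_span_eq[of "c \<cdot>\<^sub>m l" d k] k unitary_carrier[OF u(1)] by (intro bexI[of _ "c \<cdot>\<^sub>m l"] bexI[of _ m]) auto
    fix W assume "\<exists>la\<in>unitary_mats d. \<exists>m\<in>unitary_mats d. norm_lift g = la * sing_diag d g * m \<and>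
       W = (\<lambda>v. la *\<^sub>v v) ` LinearCombinations.module.span class_ring (module_vec TYPE('k) d) (unit_vec d ` {..<k})"
    then obtain l' m' where *: "l' \<in> unitary_mats d" "m' \<in> unitary_mats d" "norm_lift g = l' * sing_diag d g * m'"
       "W = cspace d (l' * std_frame d k)"
      using cartan_span_eq k unitary_carrier by (metis less_imp_le)
    have e: "(c \<cdot>\<^sub>m l) * mat_diag d (\<lambda>i. of_real (s i)) * m = l' * mat_diag d (\<lambda>i. of_real (s i)) * m'"
      using nl * \<open>sing_diag d g = _\<close> by simp
    have "0 < k" using k by simp
    then show "W = cspace d (l * std_frame d k)"
      using cartan_unique_subset[OF u(1) *(1) _ k(2) gap u(3,4,2) *(2) e]
        cartan_unique_subset[OF *(1) u(1) _ k(2) gap u(3,4) *(2) u(2) e[symmetric]] *(4) cl by auto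
  qed
qed

section \<open>A finite-dimensional representation\<close>

text \<open>Expansion in a real basis separates the variables: the first bracket depends on
  \<open>a\<close> and \<open>c\<close> only, the second on \<open>b\<close> and \<open>e\<close>
  only.\<close>

lemma inner_mult_expand:
  fixes a b c e :: "'k::rc_field"
  shows "inner (a * b) (c * e) = (\<Sum>\<beta>\<in>Basis. \<Sum>\<gamma>\<in>Basis. \<Sum>\<beta>'\<in>Basis. \<Sum>\<gamma>'\<in>Basis.
    (inner a \<beta> * inner c \<beta>') * (inner b \<gamma> * inner e \<gamma>' * inner (\<beta> * \<gamma>) (\<beta>' * \<gamma>')))"
proof -
  have m: "x * y = (\<Sum>\<beta>\<in>Basis. \<Sum>\<gamma>\<in>Basis. (inner x \<beta> * inner y \<gamma>) *\<^sub>R (\<beta> * \<gamma>))" for x y :: 'k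
  proof -
    have "x * y = (\<Sum>\<beta>\<in>Basis. inner x \<beta> *\<^sub>R \<beta>) * (\<Sum>\<gamma>\<in>Basis. inner y \<gamma> *\<^sub>R \<gamma>)"
      by (simp only: euclidean_representation)
    also have "\<dots> = (\<Sum>\<beta>\<in>Basis. \<Sum>\<gamma>\<in>Basis. (inner x \<beta> * inner y \<gamma>) *\<^sub>R (\<beta> * \<gamma>))"
      by (simp add: sum_product mult.commute[of "inner y _"])
    finally show ?thesis .
  qed
  have "inner (a * b) (c * e) =
      (\<Sum>\<beta>\<in>Basis. \<Sum>\<gamma>\<in>Basis. inner ((inner a \<beta> * inner b \<gamma>) *\<^sub>R (\<beta> * \<gamma>)) (c * e))"
    unfolding m[of a b] inner_sum_left ..
  also have "\<dots> = (\<Sum>\<beta>\<in>Basis. \<Sum>\<gamma>\<in>Basis. \<Sum>\<beta>'\<in>Basis. \<Sum>\<gamma>'\<in>Basis.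
      (inner a \<beta> * inner c \<beta>') * (inner b \<gamma> * inner e \<gamma>' * inner (\<beta> * \<gamma>) (\<beta>' * \<gamma>')))"
    unfolding m[of c e] inner_sum_right
    by (intro sum.cong refl) (simp add: mult_ac)
  finally show ?thesis .
qed

text \<open>By the Cauchy-Binet expansion the determinant is a finite sum of products of a function
  of \<open>Y\<close> and a function of \<open>X\<close>. Its squared modulus is again such a sum,
  with real factors, and this bounds the dimension of the span of the functions
  \<open>\<lambda>Y. pairing Y X\<close>.\<close>

lemma pairing_finite_rank:
  "\<exists>(n::nat) u w. \<forall>Y\<in>carrier_mat d k. \<forall>X\<in>carrier_mat d k.
     pairing Y (X :: 'k::rc_field mat) = (\<Sum>i<n. u i Y * w i X)"
proof -
  define P where "P = ({0..<k} \<rightarrow>\<^sub>E {..<d})"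
  define p :: "(nat \<Rightarrow> nat) \<Rightarrow> 'k mat \<Rightarrow> 'k" where "p f Y = (\<Prod>i=0..<k. conjugate (Y $$ (f i, i)))" for f Y
  define q :: "(nat \<Rightarrow> nat) \<Rightarrow> 'k mat \<Rightarrow> 'k" where "q f X = det (mat k k (\<lambda>(i, j). X $$ (f i, j)))" for f X
  define T where "T = P \<times> P \<times> (Basis::'k set) \<times> (Basis::'k set) \<times> (Basis::'k set) \<times> (Basis::'k set)"
  have fin: "finite P" unfolding P_def by (rule finite_PiE) auto
  then have finT: "finite T" by (simp add: T_def)
  define U where "U t Y = (case t of (f, h, \<beta>, \<gamma>, \<beta>', \<gamma>') \<Rightarrow> inner (p f Y) \<beta> * inner (p h Y) \<beta>')"
    for t :: "(nat \<Rightarrow> nat) \<times> (nat \<Rightarrow> nat) \<times> 'k \<times> 'k \<times> 'k \<times> 'k" and Y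
  define W where "W t X = (case t of (f, h, \<beta>, \<gamma>, \<beta>', \<gamma>') \<Rightarrow>
     inner (q f X) \<gamma> * inner (q h X) \<gamma>' * inner (\<beta> * \<gamma>) (\<beta>' * \<gamma>'))"
    for t :: "(nat \<Rightarrow> nat) \<times> (nat \<Rightarrow> nat) \<times> 'k \<times> 'k \<times> 'k \<times> 'k" and X
  have main: "pairing Y X = (\<Sum>t\<in>T. U t Y * W t X)" if Y: "Y \<in> carrier_mat d k" and X: "X \<in> carrier_mat d k" for Y X
  proof -
    have one: "mat_diag d (\<lambda>_. 1) * X = X"
      by (rule eq_matI) (use X mat_diag_mult_index[OF X] in \<open>auto simp del: index_mult_mat(1)\<close>)
    have "det (mat_adjoint Y * X) = (\<Sum>f\<in>P. p f Y * q f X)"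
      using det_adjoint_diag[OF Y X, of "\<lambda>_. 1"] unfolding one by (simp add: P_def p_def q_def)
    then have "pairing Y X = inner (\<Sum>f\<in>P. p f Y * q f X) (\<Sum>h\<in>P. p h Y * q h X)"
      unfolding pairing_def by (simp only: power2_norm_eq_inner)
    also have "\<dots> = (\<Sum>f\<in>P. \<Sum>h\<in>P. inner (p f Y * q f X) (p h Y * q h X))"
      by (simp only: inner_sum_left inner_sum_right) (rule sum.swap)
    also have "\<dots> = (\<Sum>f\<in>P. \<Sum>h\<in>P. \<Sum>\<beta>\<in>Basis. \<Sum>\<gamma>\<in>Basis. \<Sum>\<beta>'\<in>Basis. \<Sum>\<gamma>'\<in>Basis.
        U (f, h, \<beta>, \<gamma>, \<beta>', \<gamma>') Y * W (f, h, \<beta>, \<gamma>, \<beta>', \<gamma>') X)"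
      by (intro sum.cong refl, subst inner_mult_expand) (simp only: U_def W_def prod.case)
    also have "\<dots> = (\<Sum>t\<in>T. U t Y * W t X)"
    proof -
      have e: "(case t of (f, h, \<beta>, \<gamma>, \<beta>', \<gamma>') \<Rightarrow> U (f, h, \<beta>, \<gamma>, \<beta>', \<gamma>') Y * W (f, h, \<beta>, \<gamma>, \<beta>', \<gamma>') X) = U t Y * W t X" for t
        by (cases t rule: prod_cases6) (simp only: prod.case)
      show ?thesis unfolding T_def sum.cartesian_product by (intro sum.cong refl e)
    qed
    finally show ?thesis .
  qed
  obtain h where h: "bij_betw h {0..<card T} T" using ex_bij_betw_nat_finite[OF finT] by blast
  have "(\<Sum>t\<in>T. U t Y * W t X) = (\<Sum>i<card T. U (h i) Y * W (h i) X)" for Y X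
    using sum.reindex_bij_betw[OF h, of "\<lambda>t. U t Y * W t X"] by (simp add: lessThan_atLeast0)
  then show ?thesis using main
    by (intro exI[of _ "card T"] exI[of _ "\<lambda>i. U (h i)"] exI[of _ "\<lambda>i. W (h i)"]) auto
qed

text \<open>The functions \<open>\<lambda>Y. pairing Y (X j)\<close> form a basis of the real span
  of all functions \<open>\<lambda>Y. pairing Y Z\<close>, and \<open>w Z\<close> lists the
  coordinates of the function of \<open>Z\<close>.\<close>

locale pairing_basis =
  fixes d k N :: nat and X :: "nat \<Rightarrow> 'k::rc_field mat" and w :: "'k mat \<Rightarrow> nat \<Rightarrow> real"
  assumes X: "\<And>j. j < N \<Longrightarrow> X j \<in> carrier_mat d k"
    and indep: "\<And>c j. (\<And>Y. Y \<in> carrier_mat d k \<Longrightarrow> (\<Sum>j<N. c j * pairing Y (X j)) = 0) \<Longrightarrow> j < N \<Longrightarrow> c j = 0"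
    and expand: "\<And>Y Z. Y \<in> carrier_mat d k \<Longrightarrow> Z \<in> carrier_mat d k \<Longrightarrow>
      pairing Y Z = (\<Sum>j<N. pairing Y (X j) * w Z j)"

lemma pairing_basis_exists: "\<exists>N X w. pairing_basis d k N (X :: nat \<Rightarrow> 'k::rc_field mat) w"
proof -
  let ?C = "carrier_mat d k :: 'k mat set"
  obtain n u w where fr: "\<And>Y X. Y \<in> ?C \<Longrightarrow> X \<in> ?C \<Longrightarrow> pairing Y X = (\<Sum>i<(n::nat). u i Y * w i X)"
    using pairing_finite_rank[of d k] by blast
  define good where "good m X \<longleftrightarrow> (\<forall>j<m. X j \<in> ?C) \<and>
     (\<forall>c. (\<forall>Y\<in>?C. (\<Sum>j<m. c j * pairing Y (X j)) = 0) \<longrightarrow> (\<forall>j<m. c j = 0))" for m :: nat and X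
  define ind where "ind m \<longleftrightarrow> (\<exists>X. good m X)" for m
  have bound: "m \<le> n" if im: "ind m" for m
  proof (rule ccontr)
    assume "\<not> m \<le> n"
    then have mn: "n < m" by simp
    obtain X where g: "good m X" using im by (auto simp: ind_def)
    have X: "\<And>j. j < m \<Longrightarrow> X j \<in> ?C" using g by (simp add: good_def)
    have i: "(\<forall>Y\<in>?C. (\<Sum>j<m. c j * pairing Y (X j)) = 0) \<Longrightarrow> (\<forall>j<m. c j = 0)" for c
      using g unfolding good_def by (elim conjE allE[of _ c] impE)
    \<comment> \<open>A square matrix obtained by padding with zero rows, of which there is at least
      one since \<open>n < m\<close>. So \<open>M\<close> is singular, and a kernel vector is a
      linear relation among the functions of the \<open>X j\<close>.\<close>
    define M where "M = mat m m (\<lambda>(i, j). if i < n then w i (X j) else 0)"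
    have M: "M \<in> carrier_mat m m" by (simp add: M_def)
    have "(mat_adjoint M) *\<^sub>v unit_vec m n = 0\<^sub>v m"
      by (subst mult_unit_vec[of _ m m]) (use M mn in \<open>auto intro!: eq_vecI simp: M_def\<close>)
    moreover have "unit_vec m n \<noteq> (0\<^sub>v m :: real vec)" using mn by (metis index_unit_vec(2) index_zero_vec(1) zero_neq_one)
    ultimately have "det (mat_adjoint M) = 0"
      using det_0_iff_vec_prod_zero_field[OF mat_adjoint_carrier[OF M]] unit_vec_carrier by blast
    then have "det M = 0" using det_mat_adjoint[OF M] by simp
    then obtain c where c: "c \<in> carrier_vec m" "c \<noteq> 0\<^sub>v m" "M *\<^sub>v c = 0\<^sub>v m"
      using det_0_iff_vec_prod_zero_field[OF M] by blast
    have z: "(\<Sum>j<m. w i (X j) * c $ j) = 0" if "i < n" for i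
    proof -
      have "(M *\<^sub>v c) $ i = (\<Sum>j<m. M $$ (i, j) * c $ j)" by (rule mult_vec_index[OF M c(1)]) (use that mn in simp)
      also have "\<dots> = (\<Sum>j<m. w i (X j) * c $ j)" by (rule sum.cong) (use that mn in \<open>auto simp: M_def\<close>)
      finally show ?thesis using c(3) that mn by simp
    qed
    have "\<forall>j<m. c $ j = 0"
    proof (rule i, rule ballI)
      fix Y assume Y: "Y \<in> ?C"
      have "(\<Sum>j<m. c $ j * pairing Y (X j)) = (\<Sum>j<m. \<Sum>i<n. u i Y * (w i (X j) * c $ j))"
        by (intro sum.cong refl) (use fr[OF Y X] in \<open>auto simp: sum_distrib_left mult_ac\<close>)
      also have "\<dots> = (\<Sum>i<n. u i Y * (\<Sum>j<m. w i (X j) * c $ j))"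
        by (subst sum.swap) (simp add: sum_distrib_left)
      also have "\<dots> = 0" by (rule sum.neutral) (use z in simp)
      finally show "(\<Sum>j<m. c $ j * pairing Y (X j)) = 0" .
    qed
    then have "c = 0\<^sub>v m" using c(1) by (intro eq_vecI) auto
    then show False using c(2) by simp
  qed
  have "ind 0" by (simp add: ind_def good_def)
  define N where "N = (GREATEST m. ind m)"
  have "ind N" unfolding N_def by (rule GreatestI_nat[of ind 0 n]) (use \<open>ind 0\<close> bound in auto)
  have "\<not> ind (Suc N)"
    using Greatest_le_nat[of ind "Suc N" n] bound unfolding N_def[symmetric] by auto
  obtain X where g: "good N X" using \<open>ind N\<close> by (auto simp: ind_def)
  have X: "\<And>j. j < N \<Longrightarrow> X j \<in> ?C" using g by (simp add: good_def)
  have i: "(\<forall>Y\<in>?C. (\<Sum>j<N. c j * pairing Y (X j)) = 0) \<Longrightarrow> (\<forall>j<N. c j = 0)" for c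
    using g unfolding good_def by (elim conjE allE[of _ c] impE)
  \<comment> \<open>An independent family of maximal size is a basis: adjoining \<open>Z\<close>
    creates a relation, and the coefficient of \<open>Z\<close> in it is nonzero because the family
    itself is independent.\<close>
  have "\<exists>v. \<forall>Y\<in>?C. pairing Y Z = (\<Sum>j<N. pairing Y (X j) * v j)" if Z: "Z \<in> ?C" for Z
  proof -
    define X' where "X' = X(N := Z)"
    have X': "\<forall>j<Suc N. X' j \<in> ?C" using X Z by (auto simp: X'_def less_Suc_eq)
    have ng: "\<not> good (Suc N) X'" using \<open>\<not> ind (Suc N)\<close> by (auto simp: ind_def)
    have "\<exists>c. (\<forall>Y\<in>?C. (\<Sum>j<Suc N. c j * pairing Y (X' j)) = 0) \<and> \<not> (\<forall>j<Suc N. c j = 0)"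
    proof (rule ccontr)
      assume n: "\<nexists>c. (\<forall>Y\<in>?C. (\<Sum>j<Suc N. c j * pairing Y (X' j)) = 0) \<and> \<not> (\<forall>j<Suc N. c j = 0)"
      have "(\<forall>Y\<in>?C. (\<Sum>j<Suc N. c j * pairing Y (X' j)) = 0) \<longrightarrow> (\<forall>j<Suc N. c j = 0)" for c
        using n[unfolded not_ex de_Morgan_conj not_not imp_conv_disj[symmetric]] by (rule spec)
      then have "good (Suc N) X'" unfolding good_def by (intro conjI X' allI)
      then show False using ng by contradiction
    qed
    then obtain c where c: "\<forall>Y\<in>?C. (\<Sum>j<Suc N. c j * pairing Y (X' j)) = 0" and nz: "\<not> (\<forall>j<Suc N. c j = 0)"
      by (elim exE conjE)
    have c': "(\<Sum>j<N. c j * pairing Y (X j)) + c N * pairing Y Z = 0" if "Y \<in> ?C" for Y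
      using bspec[OF c that] by (simp add: X'_def)
    have "c N \<noteq> 0"
    proof
      assume "c N = 0"
      then have "\<forall>j<N. c j = 0" using i[of c] c' by auto
      then show False using nz \<open>c N = 0\<close> by (auto simp: less_Suc_eq)
    qed
    have "pairing Y Z = (\<Sum>j<N. pairing Y (X j) * (- c j / c N))" if "Y \<in> ?C" for Y
    proof -
      have "c N * pairing Y Z = - (\<Sum>j<N. c j * pairing Y (X j))" using c'[OF that] by linarith
      then have "pairing Y Z = - (\<Sum>j<N. c j * pairing Y (X j)) / c N" using \<open>c N \<noteq> 0\<close> by (simp add: field_simps)
      also have "\<dots> = (\<Sum>j<N. pairing Y (X j) * (- c j / c N))"
        by (simp add: sum_divide_distrib sum_negf[symmetric] mult_ac)
      finally show ?thesis .
    qed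
    then show ?thesis by (intro exI[of _ "\<lambda>j. - c j / c N"] ballI)
  qed
  then have "\<forall>Z. \<exists>v. Z \<in> ?C \<longrightarrow> (\<forall>Y\<in>?C. pairing Y Z = (\<Sum>j<N. pairing Y (X j) * v j))"
    by (simp only: ex_simps(6)) simp
  from choice[OF this] obtain v where v: "\<forall>Z. Z \<in> ?C \<longrightarrow> (\<forall>Y\<in>?C. pairing Y Z = (\<Sum>j<N. pairing Y (X j) * v Z j))"
    by (elim exE)
  have "pairing_basis d k N X v"
  proof
    fix c j assume "\<And>Y. Y \<in> ?C \<Longrightarrow> (\<Sum>j<N. c j * pairing Y (X j)) = 0" "j < N"
    then show "c j = 0" using i[of c] by simp
  next
    fix Y Z assume "Y \<in> ?C" "Z \<in> ?C"
    then show "pairing Y Z = (\<Sum>j<N. pairing Y (X j) * v Z j)" using v[THEN spec, of Z] by (elim impE bspec)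
  qed (rule X)
  then show ?thesis by (intro exI)
qed

section \<open>Coordinate vectors, functionals and the representation\<close>

lemma scalar_prod_sum: "v \<in> carrier_vec n \<Longrightarrow> (u :: 'a::comm_semiring_0 vec) \<bullet> v = (\<Sum>i<n. u $ i * v $ i)"
  by (simp add: scalar_prod_def lessThan_atLeast0)

lemma transpose_scalar_prod:
  fixes M :: "'a::comm_semiring_1 mat"
  assumes "M \<in> carrier_mat m n" "f \<in> carrier_vec m" "v \<in> carrier_vec n"
  shows "(M\<^sup>T *\<^sub>v f) \<bullet> v = f \<bullet> (M *\<^sub>v v)"
proof -
  have "(M\<^sup>T *\<^sub>v f) \<bullet> v = (\<Sum>i<n. \<Sum>r<m. M $$ (r, i) * f $ r * v $ i)"
    using assms by (auto simp: scalar_prod_def lessThan_atLeast0 sum_distrib_right intro!: sum.cong)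
  also have "\<dots> = (\<Sum>r<m. \<Sum>i<n. M $$ (r, i) * f $ r * v $ i)" by (rule sum.swap)
  also have "\<dots> = f \<bullet> (M *\<^sub>v v)"
    using assms by (auto simp: scalar_prod_def lessThan_atLeast0 sum_distrib_left mult_ac intro!: sum.cong)
  finally show ?thesis .
qed

lemma frame_mult_invertible:
  assumes A: "A \<in> carrier_mat d d" "det A \<noteq> 0" and Y: "frame d k Y"
  shows "frame d k (A * Y)"
proof -
  have cY: "Y \<in> carrier_mat d k" using Y by auto
  have AY: "A * Y \<in> carrier_mat d k" by (rule mult_carrier_mat[OF A(1) cY])
  show ?thesis unfolding frame_iff_inj[OF AY]
  proof (intro ballI impI)
    fix x assume x: "x \<in> carrier_vec k" "A * Y *\<^sub>v x = 0\<^sub>v d"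
    then have "A *\<^sub>v (Y *\<^sub>v x) = 0\<^sub>v d" using assoc_mult_mat_vec[OF A(1) cY x(1)] by simp
    then have "Y *\<^sub>v x = 0\<^sub>v d" using det_0_iff_vec_prod_zero_field[OF A(1)] A(2) mult_mat_vec_carrier[OF cY x(1)] by blast
    then show "x = 0\<^sub>v k" using Y x(1) frame_iff_inj[OF cY] by blast
  qed
qed

context pairing_basis
begin

text \<open>Evaluation at \<open>Y\<close> in the coordinates dual to the basis. As the pairing is
  symmetric, this is also the function of \<open>Y\<close> in another coordinate system; the Gram
  matrix \<open>M\<close> in \<open>gram_inverse\<close> takes \<open>wv Y\<close> to
  \<open>u Y\<close>.\<close>

definition u :: "'k mat \<Rightarrow> real vec" where "u Y = vec N (\<lambda>j. pairing Y (X j))"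

definition wv :: "'k mat \<Rightarrow> real vec" where "wv Z = vec N (w Z)"

text \<open>Row \<open>j\<close> holds the coordinates of
  \<open>\<lambda>Y. pairing (A * Y) (X j)\<close>, which belongs to the same function space because
  the adjoint moves \<open>A\<close> to the other side.\<close>

definition R :: "'k mat \<Rightarrow> real mat" where "R A = mat N N (\<lambda>(j, l). w (mat_adjoint A * X j) l)"

lemma u_carrier [simp]: "u Y \<in> carrier_vec N" by (simp add: u_def)

lemma wv_carrier [simp]: "wv Y \<in> carrier_vec N" by (simp add: wv_def)

lemma R_carrier [simp]: "R A \<in> carrier_mat N N" by (simp add: R_def)

lemma wv_u: "Y \<in> carrier_mat d k \<Longrightarrow> Z \<in> carrier_mat d k \<Longrightarrow> wv Z \<bullet> u Y = pairing Y Z"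
  by (simp add: scalar_prod_sum[of _ N] expand[of Y Z]) (simp add: u_def wv_def mult.commute)

text \<open>Independence of the basis functions says that the vectors \<open>u Y\<close> span.
  Identities between functionals or between matrices therefore need checking on these vectors
  only.\<close>

lemma u_span:
  assumes f: "f \<in> carrier_vec N" and "\<And>Y. Y \<in> carrier_mat d k \<Longrightarrow> f \<bullet> u Y = 0"
  shows "f = 0\<^sub>v N"
proof (rule eq_vecI)
  fix i assume "i < dim_vec (0\<^sub>v N :: real vec)"
  then have i: "i < N" by simp
  have "f $ i = 0"
  proof (rule indep[OF _ i])
    fix Y :: "'k mat" assume "Y \<in> carrier_mat d k"
    from assms(2)[OF this] show "(\<Sum>j<N. f $ j * pairing Y (X j)) = 0"
      by (simp add: scalar_prod_sum[of _ N]) (simp add: u_def)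
  qed
  then show "f $ i = 0\<^sub>v N $ i" using i by simp
qed (use f in simp)

lemma R_u: "A \<in> carrier_mat d d \<Longrightarrow> Y \<in> carrier_mat d k \<Longrightarrow> R A *\<^sub>v u Y = u (A * Y)"
proof (rule eq_vecI)
  fix j assume A: "A \<in> carrier_mat d d" and Y: "Y \<in> carrier_mat d k" and "j < dim_vec (u (A * Y))"
  then have j: "j < N" by (simp add: u_def)
  have AX: "mat_adjoint A * X j \<in> carrier_mat d k" using A X[OF j] by simp
  have "(R A *\<^sub>v u Y) $ j = wv (mat_adjoint A * X j) \<bullet> u Y"
    unfolding mult_vec_index[OF R_carrier u_carrier j] scalar_prod_sum[OF u_carrier]
    by (intro sum.cong refl) (use j in \<open>auto simp: R_def wv_def\<close>)
  also have "\<dots> = pairing (A * Y) (X j)" unfolding wv_u[OF Y AX] pairing_mult_left[OF A Y X[OF j]] ..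
  finally show "(R A *\<^sub>v u Y) $ j = u (A * Y) $ j" using j by (simp add: u_def)
qed (simp add: u_def R_def)

lemma R_wv:
  assumes A: "A \<in> carrier_mat d d" and Z: "Z \<in> carrier_mat d k"
  shows "(R A)\<^sup>T *\<^sub>v wv Z = wv (mat_adjoint A * Z)"
proof -
  have c: "(R A)\<^sup>T *\<^sub>v wv Z \<in> carrier_vec N" by (intro mult_mat_vec_carrier[of _ N N]) auto
  have AZ: "mat_adjoint A * Z \<in> carrier_mat d k" using A Z by simp
  have "(R A)\<^sup>T *\<^sub>v wv Z - wv (mat_adjoint A * Z) = 0\<^sub>v N"
  proof (rule u_span)
    fix Y :: "'k mat" assume Y: "Y \<in> carrier_mat d k"
    have "((R A)\<^sup>T *\<^sub>v wv Z - wv (mat_adjoint A * Z)) \<bullet> u Y = ((R A)\<^sup>T *\<^sub>v wv Z) \<bullet> u Y - wv (mat_adjoint A * Z) \<bullet> u Y"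
      by (rule minus_scalar_prod_distrib[of _ N]) (use c in auto)
    also have "((R A)\<^sup>T *\<^sub>v wv Z) \<bullet> u Y = pairing (A * Y) Z"
      unfolding transpose_scalar_prod[OF R_carrier wv_carrier u_carrier] R_u[OF A Y]
      by (rule wv_u[OF mult_carrier_mat[OF A Y] Z])
    also have "pairing (A * Y) Z - wv (mat_adjoint A * Z) \<bullet> u Y = 0"
      unfolding wv_u[OF Y AZ] pairing_mult_left[OF A Y Z] by simp
    finally show "((R A)\<^sup>T *\<^sub>v wv Z - wv (mat_adjoint A * Z)) \<bullet> u Y = 0" .
  qed (use c in simp)
  then have e: "((R A)\<^sup>T *\<^sub>v wv Z - wv (mat_adjoint A * Z)) $ j = 0" if "j < N" for j using that by simp
  show ?thesis
  proof (rule eq_vecI)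
    fix j assume "j < dim_vec (wv (mat_adjoint A * Z))"
    then have j: "j < N" by (simp add: wv_def)
    show "((R A)\<^sup>T *\<^sub>v wv Z) $ j = wv (mat_adjoint A * Z) $ j"
      using e[OF j] j index_minus_vec(1)[of j "wv (mat_adjoint A * Z)" "(R A)\<^sup>T *\<^sub>v wv Z"] by (simp add: wv_def del: index_mult_mat_vec)
  qed (simp add: wv_def R_def)
qed

lemma mat_eq_on_u:
  assumes M: "M \<in> carrier_mat N N" and M': "M' \<in> carrier_mat N N"
    and eq: "\<And>Y. Y \<in> carrier_mat d k \<Longrightarrow> M *\<^sub>v u Y = M' *\<^sub>v u Y"
  shows "M = M'"
proof (rule eq_matI)
  fix i j assume "i < dim_row M'" "j < dim_col M'"
  then have ij: "i < N" "j < N" using M' by auto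
  have r: "row M i \<in> carrier_vec N" "row M' i \<in> carrier_vec N"
    using row_carrier[of M i] row_carrier[of M' i] M M' by simp_all
  have "row M i - row M' i = 0\<^sub>v N"
  proof (rule u_span)
    fix Y :: "'k mat" assume Y: "Y \<in> carrier_mat d k"
    have "(row M i - row M' i) \<bullet> u Y = row M i \<bullet> u Y - row M' i \<bullet> u Y"
      by (rule minus_scalar_prod_distrib[of _ N]) (use r in auto)
    also have "\<dots> = 0" using arg_cong[OF eq[OF Y], of "\<lambda>v. v $ i"] M M' ij by simp
    finally show "(row M i - row M' i) \<bullet> u Y = 0" .
  qed (use r in auto)
  then have "(row M i - row M' i) $ j = 0" using ij by simp
  then show "M $$ (i, j) = M' $$ (i, j)" using M M' ij by simp
qed (use M M' in auto)

lemma R_mult: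
  assumes "A \<in> carrier_mat d d" "B \<in> carrier_mat d d"
  shows "R (A * B) = R A * R B"
proof (rule mat_eq_on_u)
  fix Y :: "'k mat" assume Y: "Y \<in> carrier_mat d k"
  have BY: "B * Y \<in> carrier_mat d k" by (rule mult_carrier_mat[OF assms(2) Y])
  have "R (A * B) *\<^sub>v u Y = u (A * (B * Y))"
    unfolding R_u[OF mult_carrier_mat[OF assms] Y] assoc_mult_mat[OF assms Y] ..
  also have "\<dots> = R A *\<^sub>v (R B *\<^sub>v u Y)" unfolding R_u[OF assms(2) Y] R_u[OF assms(1) BY] ..
  also have "\<dots> = R A * R B *\<^sub>v u Y" by (rule assoc_mult_mat_vec[symmetric, of _ N N _ N]) auto
  finally show "R (A * B) *\<^sub>v u Y = R A * R B *\<^sub>v u Y" .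
qed (simp_all add: mult_carrier_mat[OF R_carrier R_carrier])

lemma R_one: "R (1\<^sub>m d) = 1\<^sub>m N"
  by (rule mat_eq_on_u) (auto simp: R_u left_mult_one_mat[of _ d k] one_mult_mat_vec[OF u_carrier])

text \<open>For nonzero \<open>c\<close> the factor is positive, so the class of \<open>A\<close> in
  PGL determines the action on rays, not merely on lines.\<close>

lemma R_smult:
  assumes "A \<in> carrier_mat d d"
  shows "R (c \<cdot>\<^sub>m A) = (norm c ^ k)\<^sup>2 \<cdot>\<^sub>m R A"
proof (rule mat_eq_on_u)
  fix Y :: "'k mat" assume Y: "Y \<in> carrier_mat d k"
  have AY: "A * Y \<in> carrier_mat d k" by (rule mult_carrier_mat[OF assms Y])
  have "R (c \<cdot>\<^sub>m A) *\<^sub>v u Y = u (c \<cdot>\<^sub>m (A * Y))"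
    using R_u[of "c \<cdot>\<^sub>m A" Y] assms Y mult_smult_assoc_mat[OF assms Y] by simp
  also have "\<dots> = (norm c ^ k)\<^sup>2 \<cdot>\<^sub>v u (A * Y)"
    by (rule eq_vecI) (auto simp: u_def pairing_smult_left[OF AY X])
  also have "\<dots> = (norm c ^ k)\<^sup>2 \<cdot>\<^sub>v (R A *\<^sub>v u Y)" by (simp only: R_u[OF assms Y])
  also have "\<dots> = ((norm c ^ k)\<^sup>2 \<cdot>\<^sub>m R A) *\<^sub>v u Y"
    by (rule eq_vecI) (auto simp: R_def)
  finally show "R (c \<cdot>\<^sub>m A) *\<^sub>v u Y = ((norm c ^ k)\<^sup>2 \<cdot>\<^sub>m R A) *\<^sub>v u Y" .
qed auto

lemma det_R:
  assumes A: "A \<in> carrier_mat d d" "det A \<noteq> 0"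
  shows "det (R A) \<noteq> 0"
proof -
  obtain B where B: "B \<in> carrier_mat d d" "A * B = 1\<^sub>m d"
    using det_non_zero_imp_unit[OF A, of "()"] by (auto simp: Units_def ring_mat_simps)
  have "R A * R B = 1\<^sub>m N" using R_mult[OF A(1) B(1)] B(2) R_one by simp
  then have "det (R A) * det (R B) = 1" using det_mult[OF R_carrier R_carrier, of A B] by simp
  then show ?thesis by auto
qed

text \<open>Both \<open>u\<close> and \<open>wv\<close> are multiplied by \<open>|det C|^2\<close>
  under a change of frame, so up to a positive factor they depend on the column space only.\<close>

lemma u_smult_frame:
  assumes Y: "frame d k Y" and Y': "frame d k Y'" and eq: "cspace d Y = cspace d Y'"
  obtains c where "c > 0" "u Y' = c \<cdot>\<^sub>v u Y" "wv Y' = c \<cdot>\<^sub>v wv Y"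
proof -
  have cY: "Y \<in> carrier_mat d k" "Y' \<in> carrier_mat d k" using Y Y' by auto
  obtain C where C: "C \<in> carrier_mat k k" "det C \<noteq> 0" "Y' = Y * C" using frames_same_cspace[OF Y Y' eq] .
  define c where "c = (norm (det C))\<^sup>2"
  have "c > 0" using C(2) by (simp add: c_def)
  have u: "u Y' = c \<cdot>\<^sub>v u Y"
    by (rule eq_vecI) (auto simp: u_def C(3) c_def pairing_mult_right[OF C(1) cY(1) X])
  have "wv Y' - c \<cdot>\<^sub>v wv Y = 0\<^sub>v N"
  proof (rule u_span)
    fix Z :: "'k mat" assume Z: "Z \<in> carrier_mat d k"
    have "(wv Y' - c \<cdot>\<^sub>v wv Y) \<bullet> u Z = wv Y' \<bullet> u Z - (c \<cdot>\<^sub>v wv Y) \<bullet> u Z"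
      by (rule minus_scalar_prod_distrib[of _ N]) auto
    also have "\<dots> = pairing Z Y' - c * pairing Z Y" using wv_u[OF Z cY(1)] wv_u[OF Z cY(2)]
      by (simp add: smult_scalar_prod_distrib[of _ N])
    also have "\<dots> = 0" unfolding C(3) pairing_mult_right'[OF C(1) Z cY(1)] c_def by simp
    finally show "(wv Y' - c \<cdot>\<^sub>v wv Y) \<bullet> u Z = 0" .
  qed auto
  then have "(wv Y' - c \<cdot>\<^sub>v wv Y) $ j = 0" if "j < N" for j using that by simp
  then have "wv Y' = c \<cdot>\<^sub>v wv Y" by (intro eq_vecI) (auto simp: wv_def)
  with \<open>c > 0\<close> u that show ?thesis by blast
qed

text \<open>The locale knows \<open>w\<close> only through the expansion and says nothing about
  continuity. Inverting the Gram matrix of the \<open>X j\<close> writes each coordinate as a fixed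
  linear combination of pairings, which are continuous.\<close>

lemma gram_inverse: "\<exists>G. \<forall>Z\<in>carrier_mat d k. \<forall>l<N. w Z l = (\<Sum>i<N. G l i * pairing Z (X i))"
proof -
  define M where "M = mat N N (\<lambda>(i, j). pairing (X i) (X j))"
  have M: "M \<in> carrier_mat N N" by (simp add: M_def)
  have uM: "u Z = M *\<^sub>v wv Z" if Z: "Z \<in> carrier_mat d k" for Z
  proof (rule eq_vecI)
    fix i assume "i < dim_vec (M *\<^sub>v wv Z)"
    then have i: "i < N" by (simp add: M_def)
    have "u Z $ i = pairing (X i) Z" using i pairing_sym[OF Z X[OF i]] by (simp add: u_def)
    also have "\<dots> = (\<Sum>j<N. M $$ (i, j) * wv Z $ j)" unfolding expand[OF X[OF i] Z]
      by (intro sum.cong refl) (use i in \<open>auto simp: M_def wv_def\<close>)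
    finally show "u Z $ i = (M *\<^sub>v wv Z) $ i" using mult_vec_index[OF M wv_carrier i] by simp
  qed (simp add: u_def M_def)
  have "det M \<noteq> 0"
  proof
    assume "det M = 0"
    then obtain c where c: "c \<in> carrier_vec N" "c \<noteq> 0\<^sub>v N" "M *\<^sub>v c = 0\<^sub>v N"
      using det_0_iff_vec_prod_zero_field[OF M] by blast
    \<comment> \<open>By symmetry of \<open>M\<close> a kernel vector annihilates every
      \<open>u Y = M *\<^sub>v wv Y\<close>, and \<open>u_span\<close> applies.\<close>
    have MT: "M\<^sup>T = M" by (rule eq_matI) (auto simp: M_def pairing_sym[OF X X])
    have "c = 0\<^sub>v N"
    proof (rule u_span[OF c(1)])
      fix Y :: "'k mat" assume Y: "Y \<in> carrier_mat d k"
      have "c \<bullet> u Y = (M *\<^sub>v c) \<bullet> wv Y"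
        using transpose_scalar_prod[OF M c(1) wv_carrier, of Y] unfolding MT uM[OF Y] by simp
      then show "c \<bullet> u Y = 0" using c(3) by simp
    qed
    then show False using c(2) by simp
  qed
  then obtain B where B: "B \<in> carrier_mat N N" "B * M = 1\<^sub>m N"
    using det_non_zero_imp_unit[OF M, of "()"] by (auto simp: Units_def ring_mat_simps)
  have "w Z l = (\<Sum>i<N. B $$ (l, i) * pairing Z (X i))" if Z: "Z \<in> carrier_mat d k" and l: "l < N" for Z l
  proof -
    have "wv Z = B *\<^sub>v u Z"
      unfolding uM[OF Z] using assoc_mult_mat_vec[OF B(1) M wv_carrier, of Z] B(2) by simp
    then have "wv Z $ l = (\<Sum>i<N. B $$ (l, i) * u Z $ i)" using mult_vec_index[OF B(1) u_carrier l] by simp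
    then show ?thesis using l by (simp add: wv_def u_def)
  qed
  then show ?thesis by (intro exI[of _ "\<lambda>l i. B $$ (l, i)"]) blast
qed

lemma tendsto_u:
  assumes "mlim d k B Y" "\<And>t. B t \<in> carrier_mat d k" "Y \<in> carrier_mat d k" "j < N"
  shows "(\<lambda>t. u (B t) $ j) \<longlonglongrightarrow> u Y $ j"
  using tendsto_pairing[OF assms(1) mlim_const assms(2,3) X[OF assms(4)] X[OF assms(4)]] assms(4) by (simp add: u_def)

lemma tendsto_wv:
  assumes "mlim d k B Y" "\<And>t. B t \<in> carrier_mat d k" "Y \<in> carrier_mat d k" "j < N"
  shows "(\<lambda>t. wv (B t) $ j) \<longlonglongrightarrow> wv Y $ j"
proof -
  obtain G where G: "\<And>Z l. Z \<in> carrier_mat d k \<Longrightarrow> l < N \<Longrightarrow> w Z l = (\<Sum>i<N. G l i * pairing Z (X i))"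
    using gram_inverse by blast
  have "(\<lambda>t. \<Sum>i<N. G j i * pairing (B t) (X i)) \<longlonglongrightarrow> (\<Sum>i<N. G j i * pairing Y (X i))"
    by (intro tendsto_sum tendsto_mult tendsto_const tendsto_pairing[OF assms(1) mlim_const assms(2,3)] X) auto
  then show ?thesis using G[OF assms(2,4)] G[OF assms(3,4)] assms(4) by (simp add: wv_def)
qed

text \<open>The entries of \<open>R (A t)\<close> are fixed linear combinations of pairings of
  \<open>A t * X i\<close> with \<open>X j\<close>. A rank-one limit of the pairing thus becomes the
  rank-one matrix with column \<open>u L\<close> and row \<open>wv M\<close>.\<close>

lemma tendsto_R:
  assumes A: "\<And>t. A t \<in> carrier_mat d d" and M: "M \<in> carrier_mat d k" and L: "L \<in> carrier_mat d k"
    and lim: "\<And>Y Z. Y \<in> carrier_mat d k \<Longrightarrow> Z \<in> carrier_mat d k \<Longrightarrow>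
      (\<lambda>t. c t * pairing (A t * Y) Z) \<longlonglongrightarrow> pairing Y M * pairing L Z"
    and jl: "j < N" "l < N"
  shows "(\<lambda>t. c t * R (A t) $$ (j, l)) \<longlonglongrightarrow> u L $ j * wv M $ l"
proof -
  obtain G where G: "\<And>Z l. Z \<in> carrier_mat d k \<Longrightarrow> l < N \<Longrightarrow> w Z l = (\<Sum>i<N. G l i * pairing Z (X i))"
    using gram_inverse by blast
  have "(\<lambda>t. \<Sum>i<N. G l i * (c t * pairing (A t * X i) (X j))) \<longlonglongrightarrow> (\<Sum>i<N. G l i * (pairing (X i) M * pairing L (X j)))"
    by (intro tendsto_sum tendsto_mult tendsto_const lim X jl) auto
  moreover have "(\<Sum>i<N. G l i * (c t * pairing (A t * X i) (X j))) = c t * R (A t) $$ (j, l)" for t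
  proof -
    have AX: "mat_adjoint (A t) * X j \<in> carrier_mat d k" using A[of t] X[OF jl(1)] by simp
    have "R (A t) $$ (j, l) = (\<Sum>i<N. G l i * pairing (mat_adjoint (A t) * X j) (X i))"
      using G[OF AX jl(2)] jl by (simp add: R_def)
    also have "\<dots> = (\<Sum>i<N. G l i * pairing (A t * X i) (X j))"
      by (intro sum.cong refl) (use pairing_sym[OF AX X] pairing_mult_left[OF A X X[OF jl(1)]] in simp)
    finally show ?thesis by (simp add: sum_distrib_left mult_ac)
  qed
  moreover have "(\<Sum>i<N. G l i * (pairing (X i) M * pairing L (X j))) = u L $ j * wv M $ l"
  proof -
    have "wv M $ l = (\<Sum>i<N. G l i * pairing (X i) M)" using G[OF M jl(2)] jl pairing_sym[OF M X] by (simp add: wv_def)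
    then show ?thesis using jl by (simp add: u_def sum_distrib_left mult_ac)
  qed
  ultimately show ?thesis by simp
qed

text \<open>A scalar \<open>R A\<close> makes the functions of \<open>A * Y\<close> and of
  \<open>Y\<close> proportional; their zero sets agree, and these determine the column
  spaces.\<close>

lemma cspace_of_R_scalar:
  assumes A: "A \<in> carrier_mat d d" "det A \<noteq> 0" and R: "R A = t \<cdot>\<^sub>m 1\<^sub>m N" and Y: "frame d k Y"
  shows "cspace d (A * Y) = cspace d Y"
proof -
  have cY: "Y \<in> carrier_mat d k" using Y by auto
  have AY: "frame d k (A * Y)" by (rule frame_mult_invertible[OF A Y])
  have p: "pairing (A * Y) Z = t * pairing Y Z" if Z: "Z \<in> carrier_mat d k" for Z
  proof -
    have "u (A * Y) = t \<cdot>\<^sub>v u Y" unfolding R_u[OF A(1) cY, symmetric] R by (rule eq_vecI) (auto simp: u_def)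
    then show ?thesis using wv_u[OF frame_carrier[OF AY] Z] wv_u[OF cY Z] by (simp add: scalar_prod_smult_distrib[of _ N])
  qed
  have "t \<noteq> 0" using p[OF frame_carrier[OF AY]] pairing_self[OF AY] by auto
  then show ?thesis using p by (intro cspace_eq_of_pairing_zeros[OF AY Y]) simp
qed

end

section \<open>Sequences in real projective space\<close>

definition vlim :: "nat \<Rightarrow> (nat \<Rightarrow> real vec) \<Rightarrow> real vec \<Rightarrow> bool" where
  "vlim n v x \<longleftrightarrow> (\<forall>i<n. (\<lambda>t. v t $ i) \<longlonglongrightarrow> x $ i)"

definition line :: "real vec \<Rightarrow> real vec set" where
  "line v = {c \<cdot>\<^sub>v v | c. True}"

definition colm :: "nat \<Rightarrow> real vec \<Rightarrow> real mat" where
  "colm n v = mat n 1 (\<lambda>(i, j). v $ i)"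

lemma vlim_subseq: "vlim n v x \<Longrightarrow> strict_mono r \<Longrightarrow> vlim n (\<lambda>t. v (r t)) x"
  unfolding vlim_def using LIMSEQ_subseq_LIMSEQ[unfolded o_def] by blast

lemma vlim_scalar_prod:
  assumes "vlim n v x" "vlim n f g" "\<And>t. v t \<in> carrier_vec n" "x \<in> carrier_vec n"
  shows "(\<lambda>t. f t \<bullet> v t) \<longlonglongrightarrow> g \<bullet> x"
  unfolding scalar_prod_sum[OF assms(3)] scalar_prod_sum[OF assms(4)]
  by (intro tendsto_sum tendsto_mult) (use assms(1,2) in \<open>auto simp: vlim_def\<close>)

lemma vlim_const: "vlim n (\<lambda>_. x) x"
  by (simp add: vlim_def)

lemma colm_carrier [simp]: "colm n v \<in> carrier_mat n 1"
  by (simp add: colm_def)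

lemma colm_mult: "v \<in> carrier_vec n \<Longrightarrow> x \<in> carrier_vec 1 \<Longrightarrow> colm n v *\<^sub>v x = x $ 0 \<cdot>\<^sub>v v"
proof (rule eq_vecI)
  fix i assume v: "v \<in> carrier_vec n" and x: "x \<in> carrier_vec 1" and "i < dim_vec (x $ 0 \<cdot>\<^sub>v v)"
  then have "i < n" by simp
  then show "(colm n v *\<^sub>v x) $ i = (x $ 0 \<cdot>\<^sub>v v) $ i"
    using mult_vec_index[OF colm_carrier x] v by (simp add: colm_def)
qed (simp add: colm_def)

lemma frame_colm: "v \<in> carrier_vec n \<Longrightarrow> frame n 1 (colm n v) \<longleftrightarrow> v \<noteq> 0\<^sub>v n"
proof -
  assume v: "v \<in> carrier_vec n"
  have nz: "x = 0\<^sub>v 1 \<longleftrightarrow> x $ 0 = 0" if "x \<in> carrier_vec 1" for x :: "real vec" using that by auto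
  have "(x $ 0 \<cdot>\<^sub>v v = 0\<^sub>v n \<longrightarrow> x = 0\<^sub>v 1)" if x1: "x \<in> carrier_vec 1" and v0: "v \<noteq> 0\<^sub>v n" for x
  proof
    assume e: "x $ 0 \<cdot>\<^sub>v v = 0\<^sub>v n"
    obtain i where "i < n" "v $ i \<noteq> 0" using v0 v by (metis eq_vecI carrier_vecD index_zero_vec)
    then show "x = 0\<^sub>v 1" unfolding nz[OF x1] using arg_cong[OF e, of "\<lambda>w. w $ i"] v by simp
  qed
  moreover have "\<not> (x $ 0 \<cdot>\<^sub>v v = 0\<^sub>v n \<longrightarrow> x = 0\<^sub>v 1)" if "x = unit_vec 1 0" "v = 0\<^sub>v n" for x
    using that nz[of x] by simp
  ultimately show ?thesis
    unfolding frame_iff_inj[OF colm_carrier] using colm_mult[OF v] unit_vec_carrier by (metis)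
qed

lemma cspace_colm: "v \<in> carrier_vec n \<Longrightarrow> cspace n (colm n v) = line v"
proof -
  assume v: "v \<in> carrier_vec n"
  have "{colm n v *\<^sub>v x | x. x \<in> carrier_vec 1} = line v"
  proof (intro equalityI subsetI)
    fix y assume "y \<in> {colm n v *\<^sub>v x | x. x \<in> carrier_vec 1}"
    then show "y \<in> line v" using colm_mult[OF v] by (auto simp: line_def)
  next
    fix y assume "y \<in> line v"
    then obtain c where "y = c \<cdot>\<^sub>v v" by (auto simp: line_def)
    then have "y = colm n v *\<^sub>v vec 1 (\<lambda>_. c)" using colm_mult[OF v, of "vec 1 (\<lambda>_. c)"] by simp
    then show "y \<in> {colm n v *\<^sub>v x | x. x \<in> carrier_vec 1}" by (intro CollectI exI[of _ "vec 1 (\<lambda>_. c)"]) simp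
  qed
  then show ?thesis by (simp add: cspace_eq[OF colm_carrier])
qed

lemma frame_1_colm: "frame n 1 Y \<Longrightarrow> Y = colm n (col Y 0)"
  by (rule eq_matI) (auto simp: colm_def dest!: frame_carrier)

lemma Gr_lines: "Gr n 1 = {line v | v. v \<in> carrier_vec n \<and> v \<noteq> 0\<^sub>v n}"
proof (intro equalityI subsetI)
  fix L :: "real vec set" assume "L \<in> Gr n 1"
  then obtain Y where Y: "frame n 1 Y" "L = cspace n Y" by (auto simp: Gr_eq_frames)
  have c: "col Y 0 \<in> carrier_vec n" using frame_carrier[OF Y(1)] by auto
  then show "L \<in> {line v | v. v \<in> carrier_vec n \<and> v \<noteq> 0\<^sub>v n}"
    using Y frame_1_colm[OF Y(1)] cspace_colm[OF c] frame_colm[OF c] by (metis (mono_tags, lifting) mem_Collect_eq)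
next
  fix L :: "real vec set" assume "L \<in> {line v | v. v \<in> carrier_vec n \<and> v \<noteq> 0\<^sub>v n}"
  then obtain v where v: "v \<in> carrier_vec n" "v \<noteq> 0\<^sub>v n" "L = line v" by blast
  then have "frame n 1 (colm n v)" "L = cspace n (colm n v)" using frame_colm cspace_colm by auto
  then show "L \<in> Gr n 1" by (auto simp: Gr_eq_frames)
qed

lemma openin_projI:
  assumes "\<And>L. L \<in> U \<Longrightarrow> \<exists>v\<in>carrier_vec n. v \<noteq> 0\<^sub>v n \<and> L = line v"
    and seq: "\<And>v x. x \<in> carrier_vec n \<Longrightarrow> x \<noteq> 0\<^sub>v n \<Longrightarrow> line x \<in> U \<Longrightarrow> (\<And>t. v t \<in> carrier_vec n) \<Longrightarrow> (\<And>t. v t \<noteq> 0\<^sub>v n) \<Longrightarrow>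
       vlim n v x \<Longrightarrow> \<exists>t::nat. line (v t) \<in> U"
  shows "openin (proj_topology n) U"
proof (rule openin_GrI)
  show "U \<subseteq> Gr n 1" unfolding Gr_lines using assms(1) by blast
  fix Y :: "real mat" and B assume Y: "frame n 1 Y" "cspace n Y \<in> U" and B: "\<And>t::nat. frame n 1 (B t)" "mlim n 1 B Y"
  have cc: "col M 0 \<in> carrier_vec n" if "frame n 1 M" for M :: "real mat"
    using frame_carrier[OF that] by auto
  have c: "col Y 0 \<in> carrier_vec n" "\<And>t. col (B t) 0 \<in> carrier_vec n"
    by (rule cc[OF Y(1)], rule cc[OF B(1)])
  have eY: "cspace n Y = line (col Y 0)" "col Y 0 \<noteq> 0\<^sub>v n"
    using cspace_colm[OF c(1)] frame_1_colm[OF Y(1)] frame_colm[OF c(1)] Y(1) by simp_all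
  have eB: "cspace n (B t) = line (col (B t) 0)" "col (B t) 0 \<noteq> 0\<^sub>v n" for t
    using cspace_colm[OF c(2)] frame_1_colm[OF B(1)] frame_colm[OF c(2)] B(1)[of t] by simp_all
  have "vlim n (\<lambda>t. col (B t) 0) (col Y 0)"
  proof -
    have "col M 0 $ i = M $$ (i, 0)" if "frame n 1 M" "i < n" for M :: "real mat" and i
      using frame_carrier[OF that(1)] that(2) by simp
    then show ?thesis using B(2) Y(1) B(1) by (simp add: vlim_def mlim_def)
  qed
  then have "\<exists>t. line (col (B t) 0) \<in> U" by (intro seq[OF c(1) eY(2)]) (use Y eY eB c in simp_all)
  then show "\<exists>t. cspace n (B t) \<in> U" unfolding eB .
qed

lemma limitin_projI:
  assumes x: "x \<in> carrier_vec n" "x \<noteq> 0\<^sub>v n" and v: "\<And>t. v t \<in> carrier_vec n" and lim: "vlim n v x"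
  shows "limitin (proj_topology n) (\<lambda>t. line (v t)) (line x) sequentially"
proof -
  obtain i where i: "i < n" "x $ i \<noteq> 0" using x by (metis eq_vecI carrier_vecD index_zero_vec)
  have "\<forall>\<^sub>F t in sequentially. v t $ i \<noteq> 0"
    using lim i by (intro tendsto_imp_eventually_ne[of _ "x $ i"]) (auto simp: vlim_def)
  then have "\<forall>\<^sub>F t in sequentially. frame n 1 (colm n (v t))"
  proof (rule eventually_mono)
    fix t assume "v t $ i \<noteq> 0"
    then have "v t \<noteq> 0\<^sub>v n" using i by auto
    then show "frame n 1 (colm n (v t))" using frame_colm[OF v[of t]] by simp
  qed
  moreover have "frame n 1 (colm n x)" using frame_colm[OF x(1)] x by simp
  moreover have "mlim n 1 (\<lambda>t. colm n (v t)) (colm n x)" using lim by (simp add: mlim_def vlim_def colm_def)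
  ultimately have "limitin (proj_topology n) (\<lambda>t. cspace n (colm n (v t))) (cspace n (colm n x)) sequentially"
    by (intro limitin_GrI)
  then show ?thesis using cspace_colm[OF v] cspace_colm[OF x(1)] by simp
qed

lemma line_smult: "c \<noteq> 0 \<Longrightarrow> line (c \<cdot>\<^sub>v v) = line v"
proof (intro equalityI subsetI)
  fix y assume "c \<noteq> 0" "y \<in> line (c \<cdot>\<^sub>v v)"
  then obtain e where "y = e \<cdot>\<^sub>v (c \<cdot>\<^sub>v v)" by (auto simp: line_def)
  then have "y = (e * c) \<cdot>\<^sub>v v" by (simp add: smult_smult_assoc)
  then show "y \<in> line v" unfolding line_def by blast
next
  fix y assume c: "c \<noteq> 0" and "y \<in> line v"
  then obtain e where "y = e \<cdot>\<^sub>v v" by (auto simp: line_def)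
  then have "y = (e / c) \<cdot>\<^sub>v (c \<cdot>\<^sub>v v)" using c by (simp add: smult_smult_assoc)
  then show "y \<in> line (c \<cdot>\<^sub>v v)" unfolding line_def by blast
qed

lemma line_self: "v \<in> line v"
  unfolding line_def by (rule CollectI, rule exI[of _ 1]) (auto intro: eq_vecI)

lemma line_eqD:
  assumes "line v = line x" "v \<in> carrier_vec n" "v \<noteq> 0\<^sub>v n"
  obtains c where "c \<noteq> 0" "v = c \<cdot>\<^sub>v x"
proof -
  have "v \<in> line x" using line_self assms(1) by blast
  then obtain c where c: "v = c \<cdot>\<^sub>v x" by (auto simp: line_def)
  have "c \<noteq> 0"
  proof
    assume "c = 0"
    then have "v = 0\<^sub>v n" using c assms(2) by (intro eq_vecI) auto
    then show False using assms(3) by simp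
  qed
  with c that show ?thesis by blast
qed

text \<open>The coordinate \<open>i0\<close> determines the scale: \<open>s\<close> converges to the
  quotient of the two limits there. This identifies limits that are known up to scaling
  only.\<close>

lemma proportional_limit:
  fixes a b :: "nat \<Rightarrow> 'i \<Rightarrow> real"
  assumes a: "\<And>i. i \<in> I \<Longrightarrow> (\<lambda>t. a t i) \<longlonglongrightarrow> x i" and b: "\<And>i. i \<in> I \<Longrightarrow> (\<lambda>t. b t i) \<longlonglongrightarrow> y i"
    and ab: "\<And>t i. i \<in> I \<Longrightarrow> a t i = s t * b t i" and nz: "i0 \<in> I" "y i0 \<noteq> 0"
  obtains c where "\<And>i. i \<in> I \<Longrightarrow> x i = c * y i" "s \<longlonglongrightarrow> c"
proof -
  have ev: "\<forall>\<^sub>F t in sequentially. b t i0 \<noteq> 0" by (rule tendsto_imp_eventually_ne[OF b[OF nz(1)] nz(2)])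
  have "(\<lambda>t. a t i0 / b t i0) \<longlonglongrightarrow> x i0 / y i0" by (intro tendsto_divide a b nz)
  then have s: "s \<longlonglongrightarrow> x i0 / y i0"
    by (rule Lim_transform_eventually) (use ev in eventually_elim, simp add: ab[OF nz(1)])
  have "x i = x i0 / y i0 * y i" if "i \<in> I" for i
    by (rule LIMSEQ_unique[OF a[OF that]]) (use tendsto_mult[OF s b[OF that]] ab[OF that] in simp)
  with s that show ?thesis by blast
qed

section \<open>Hyperplanes as kernels of functionals\<close>

lemma kernel_frame:
  fixes f :: "real vec"
  assumes f: "f \<in> carrier_vec n" "f \<noteq> 0\<^sub>v n"
  obtains Y where "frame n (n - 1) Y" "cspace n Y = {v \<in> carrier_vec n. f \<bullet> v = 0}"
proof -
  obtain i where i: "i < n" "f $ i \<noteq> 0" using f by (metis eq_vecI carrier_vecD index_zero_vec)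
  \<comment> \<open>\<open>\<sigma>\<close> enumerates the coordinates other than the pivot
    \<open>i\<close>. They are the free parameters, and the equation
    \<open>f \<bullet> v = 0\<close> is solved for coordinate \<open>i\<close>.\<close>
  define \<sigma> where "\<sigma> c = (if c < i then c else Suc c)" for c
  have bij: "bij_betw \<sigma> {..<n - 1} ({..<n} - {i})"
  proof (rule bij_betw_byWitness[where f' = "\<lambda>c. if c < i then c else c - 1"])
  qed (use i in \<open>auto simp: \<sigma>_def\<close>)
  have \<sigma>: "\<sigma> c \<noteq> i" for c by (simp add: \<sigma>_def)
  have \<sigma>_less: "\<sigma> c < n" if "c < n - 1" for c using that by (auto simp: \<sigma>_def)
  have inj: "\<sigma> c = \<sigma> c' \<longleftrightarrow> c = c'" for c c' by (auto simp: \<sigma>_def split: if_splits)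
  have split: "(\<Sum>r<n. g r) = g i + (\<Sum>c<n - 1. g (\<sigma> c))" for g :: "nat \<Rightarrow> real"
    using sum.remove[of "{..<n}" i g] i sum.reindex_bij_betw[OF bij, of g] by simp
  define Y where "Y = mat n (n - 1) (\<lambda>(r, c). if r = \<sigma> c then 1 else if r = i then - f $ (\<sigma> c) / f $ i else 0)"
  have Y: "Y \<in> carrier_mat n (n - 1)" by (simp add: Y_def)
  have Y\<sigma>: "(Y *\<^sub>v x) $ (\<sigma> c) = x $ c" if "x \<in> carrier_vec (n - 1)" "c < n - 1" for x c
  proof -
    have "(Y *\<^sub>v x) $ (\<sigma> c) = (\<Sum>r<n - 1. Y $$ (\<sigma> c, r) * x $ r)" by (rule mult_vec_index[OF Y that(1) \<sigma>_less[OF that(2)]])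
    also have "\<dots> = (\<Sum>r<n - 1. if r = c then x $ r else 0)"
      by (rule sum.cong) (use that \<sigma> \<sigma>_less inj in \<open>auto simp: Y_def\<close>)
    finally show ?thesis using that by simp
  qed
  have Yi: "(Y *\<^sub>v x) $ i = - (\<Sum>c<n - 1. f $ (\<sigma> c) * x $ c) / f $ i" if "x \<in> carrier_vec (n - 1)" for x
  proof -
    have "(Y *\<^sub>v x) $ i = (\<Sum>r<n - 1. Y $$ (i, r) * x $ r)" by (rule mult_vec_index[OF Y that i(1)])
    also have "\<dots> = (\<Sum>r<n - 1. - (f $ (\<sigma> r) * x $ r) / f $ i)"
      by (rule sum.cong) (use that \<sigma>[THEN not_sym] i in \<open>auto simp: Y_def\<close>)
    finally show ?thesis by (simp add: sum_divide_distrib sum_negf)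
  qed
  have fr: "frame n (n - 1) Y" unfolding frame_iff_inj[OF Y]
  proof (intro ballI impI)
    fix x :: "real vec" assume x: "x \<in> carrier_vec (n - 1)" "Y *\<^sub>v x = 0\<^sub>v n"
    show "x = 0\<^sub>v (n - 1)"
    proof (rule eq_vecI)
      fix c assume "c < dim_vec (0\<^sub>v (n - 1) :: real vec)"
      then show "x $ c = 0\<^sub>v (n - 1) $ c" using Y\<sigma>[OF x(1), of c] x(2) \<sigma>_less[of c] by simp
    qed (use x in simp)
  qed
  have "cspace n Y = {v \<in> carrier_vec n. f \<bullet> v = 0}"
  proof (intro equalityI subsetI)
    fix v assume "v \<in> cspace n Y"
    then obtain x where x: "x \<in> carrier_vec (n - 1)" "v = Y *\<^sub>v x" by (auto simp: cspace_eq[OF Y])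
    have v: "v \<in> carrier_vec n" using x mult_mat_vec_carrier[OF Y] by simp
    have "f \<bullet> v = f $ i * v $ i + (\<Sum>c<n - 1. f $ (\<sigma> c) * v $ (\<sigma> c))"
      unfolding scalar_prod_sum[OF v] by (rule split)
    also have "(\<Sum>c<n - 1. f $ (\<sigma> c) * v $ (\<sigma> c)) = (\<Sum>c<n - 1. f $ (\<sigma> c) * x $ c)"
      by (rule sum.cong) (use Y\<sigma>[OF x(1)] x(2) in auto)
    finally show "v \<in> {v \<in> carrier_vec n. f \<bullet> v = 0}" using v Yi[OF x(1)] x(2) i by simp
  next
    fix v assume "v \<in> {v \<in> carrier_vec n. f \<bullet> v = 0}"
    then have v: "v \<in> carrier_vec n" "f \<bullet> v = 0" by auto
    define x where "x = vec (n - 1) (\<lambda>c. v $ (\<sigma> c))"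
    have x: "x \<in> carrier_vec (n - 1)" by (simp add: x_def)
    have "f $ i * v $ i + (\<Sum>c<n - 1. f $ (\<sigma> c) * v $ (\<sigma> c)) = 0"
      using v(2) unfolding scalar_prod_sum[OF v(1)] split .
    then have vi: "v $ i = - (\<Sum>c<n - 1. f $ (\<sigma> c) * v $ (\<sigma> c)) / f $ i" using i(2) by (simp add: field_simps)
    have "v = Y *\<^sub>v x"
    proof (rule eq_vecI)
      fix r assume "r < dim_vec (Y *\<^sub>v x)"
      then have r: "r < n" using Y by simp
      show "v $ r = (Y *\<^sub>v x) $ r"
      proof (cases "r = i")
        case True
        then show ?thesis using vi Yi[OF x] by (simp add: x_def)
      next
        case False
        then have "r \<in> \<sigma> ` {..<n - 1}" using bij_betw_imp_surj_on[OF bij] r by auto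
        then obtain c where c: "c < n - 1" "r = \<sigma> c" by auto
        then show ?thesis using Y\<sigma>[OF x c(1)] by (simp add: x_def)
      qed
    qed (use v Y in simp)
    then show "v \<in> cspace n Y" using x by (auto simp: cspace_eq[OF Y])
  qed
  with fr that show ?thesis by blast
qed

text \<open>Both spaces have frames with \<open>n - 1\<close> columns. The inclusion gives a square
  factor \<open>C\<close>, which is injective because \<open>Y\<close> is, hence invertible.\<close>

lemma hyperplane_eq:
  fixes f :: "real vec"
  assumes f: "f \<in> carrier_vec n" "f \<noteq> 0\<^sub>v n" and H: "H \<in> Gr n (n - 1)" and sub: "\<And>v. v \<in> H \<Longrightarrow> f \<bullet> v = 0"
  shows "H = {v \<in> carrier_vec n. f \<bullet> v = 0}"
proof -
  obtain Y0 where Y0: "frame n (n - 1) Y0" "cspace n Y0 = {v \<in> carrier_vec n. f \<bullet> v = 0}"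
    using kernel_frame[OF f] .
  obtain Y where Y: "frame n (n - 1) Y" "H = cspace n Y" using H by (auto simp: Gr_eq_frames)
  have c: "Y \<in> carrier_mat n (n - 1)" "Y0 \<in> carrier_mat n (n - 1)" using Y Y0 by auto
  have "cspace n Y \<subseteq> cspace n Y0" using cspace_carrier[OF c(1)] sub Y unfolding Y0 by blast
  then obtain C where C: "C \<in> carrier_mat (n - 1) (n - 1)" "Y = Y0 * C" using cspace_subset_factor[OF c(2,1)] by blast
  have "det C \<noteq> 0"
  proof
    assume "det C = 0"
    then obtain v where v: "v \<in> carrier_vec (n - 1)" "v \<noteq> 0\<^sub>v (n - 1)" "C *\<^sub>v v = 0\<^sub>v (n - 1)"
      using det_0_iff_vec_prod_zero_field[OF C(1)] by blast
    have "Y *\<^sub>v v = 0\<^sub>v n" unfolding C(2) assoc_mult_mat_vec[OF c(2) C(1) v(1)] v(3) by (rule mult_mat_zero_vec[OF c(2)])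
    then show False using Y(1) v frame_iff_inj[OF c(1)] by blast
  qed
  then show ?thesis using cspace_mult_invertible[OF c(2) C(1)] C(2) Y Y0 by simp
qed

section \<open>Convex domains cut out by a projectively compact set of functionals\<close>

definition ones :: "nat \<Rightarrow> real vec" where "ones n = vec n (\<lambda>_. 1)"

definition ones_plus :: "nat \<Rightarrow> nat \<Rightarrow> real vec" where "ones_plus n j = vec n (\<lambda>i. if i = j then 2 else 1)"

text \<open>In the affine chart \<open>ones = 1\<close>, positivity of \<open>ones_plus j\<close> bounds the coordinate \<open>j\<close> below by
  \<open>-1\<close>, so these functionals make the domain properly convex.\<close>

locale dual_cone =
  fixes n :: nat and Z :: "real vec set" and p0 :: "real vec"
  assumes Z: "Z \<subseteq> carrier_vec n"
    and compact: "\<And>f. (\<And>t::nat. f t \<in> Z) \<Longrightarrow>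
      \<exists>r c g. strict_mono (r::nat \<Rightarrow> nat) \<and> (\<forall>t. c t > 0) \<and> g \<in> Z \<and> vlim n (\<lambda>t. c t \<cdot>\<^sub>v f (r t)) g"
    and ones: "ones n \<in> Z" "\<And>j. j < n \<Longrightarrow> ones_plus n j \<in> Z"
    and p0: "p0 \<in> carrier_vec n" "\<And>f. f \<in> Z \<Longrightarrow> f \<bullet> p0 > 0"
begin

definition Cone :: "real vec set" where "Cone = {v \<in> carrier_vec n. \<forall>f\<in>Z. f \<bullet> v > 0}"

definition Omega :: "real vec set set" where "Omega = line ` Cone"

lemma fZ: "f \<in> Z \<Longrightarrow> f \<in> carrier_vec n" using Z by blast

lemma p0_Cone: "p0 \<in> Cone" using p0 by (simp add: Cone_def)

lemma Z_nonzero: "f \<in> Z \<Longrightarrow> f \<noteq> 0\<^sub>v n" using p0(2)[of f] p0(1) by auto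

lemma Cone_nonzero: "v \<in> Cone \<Longrightarrow> v \<noteq> 0\<^sub>v n"
  using ones(1) fZ[OF ones(1)] by (auto simp: Cone_def)

lemma Cone_combine:
  assumes u: "u \<in> carrier_vec n" "\<And>f. f \<in> Z \<Longrightarrow> f \<bullet> u \<ge> 0" and v: "v \<in> carrier_vec n" "\<And>f. f \<in> Z \<Longrightarrow> f \<bullet> v \<ge> 0"
    and pos: "\<And>f. f \<in> Z \<Longrightarrow> f \<bullet> u > 0 \<or> f \<bullet> v > 0" and st: "s > 0" "t > 0"
  shows "s \<cdot>\<^sub>v u + t \<cdot>\<^sub>v v \<in> Cone"
  unfolding Cone_def
proof (intro CollectI conjI ballI)
  fix f assume f: "f \<in> Z"
  have "f \<bullet> (s \<cdot>\<^sub>v u + t \<cdot>\<^sub>v v) = s * (f \<bullet> u) + t * (f \<bullet> v)"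
    using fZ[OF f] u v by (simp add: scalar_prod_add_distrib[of _ n] scalar_prod_smult_distrib[of _ n])
  moreover have "s * (f \<bullet> u) \<ge> 0" "t * (f \<bullet> v) \<ge> 0" using u(2)[OF f] v(2)[OF f] st by auto
  moreover have "s * (f \<bullet> u) > 0 \<or> t * (f \<bullet> v) > 0" using pos[OF f] st by auto
  ultimately show "f \<bullet> (s \<cdot>\<^sub>v u + t \<cdot>\<^sub>v v) > 0" by linarith
qed (use u v in auto)

lemma Cone_smult: "v \<in> Cone \<Longrightarrow> c > 0 \<Longrightarrow> c \<cdot>\<^sub>v v \<in> Cone"
  using fZ by (auto simp: Cone_def scalar_prod_smult_distrib[of _ n])

text \<open>Functionals that fail at \<open>v t\<close> accumulate, after positive rescaling, at an
  element of \<open>Z\<close> that is not positive at \<open>x\<close>. Here projective compactness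
  of \<open>Z\<close> does the work of finiteness.\<close>

lemma Cone_open:
  assumes x: "x \<in> Cone" and v: "\<And>t::nat. v t \<in> carrier_vec n" "vlim n v x"
  shows "\<exists>t. v t \<in> Cone"
proof (rule ccontr)
  assume "\<not> ?thesis"
  then have "\<forall>t. \<exists>f. f \<in> Z \<and> f \<bullet> v t \<le> 0" using v(1) by (force simp: Cone_def not_less)
  from choice[OF this] obtain f where f: "\<forall>t. f t \<in> Z \<and> f t \<bullet> v t \<le> 0" by (elim exE)
  then have fZt: "f t \<in> Z" for t by simp
  obtain r c g where r: "strict_mono r" "\<forall>t. c t > 0" "g \<in> Z" "vlim n (\<lambda>t. c t \<cdot>\<^sub>v f (r t)) g"
    using compact[of f, OF fZt] by (elim exE conjE)
  have xc: "x \<in> carrier_vec n" using x by (simp add: Cone_def)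
  have "(\<lambda>t. (c t \<cdot>\<^sub>v f (r t)) \<bullet> v (r t)) \<longlonglongrightarrow> g \<bullet> x"
    by (rule vlim_scalar_prod[OF vlim_subseq[OF v(2) r(1)] r(4) v(1) xc])
  moreover have "(c t \<cdot>\<^sub>v f (r t)) \<bullet> v (r t) \<le> 0" for t
    using f r(2) fZ[OF fZt] v(1) by (simp add: smult_scalar_prod_distrib[of _ n] mult_nonneg_nonpos less_imp_le)
  ultimately have "g \<bullet> x \<le> 0" by (intro LIMSEQ_le_const2) auto
  then show False using x r(3) by (force simp: Cone_def)
qed

lemma line_in_Omega:
  assumes "v \<in> carrier_vec n" "v \<noteq> 0\<^sub>v n" "line v \<in> Omega"
  shows "v \<in> Cone \<or> - 1 \<cdot>\<^sub>v v \<in> Cone"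
proof -
  obtain x where x: "x \<in> Cone" "line v = line x" using assms(3) by (auto simp: Omega_def)
  obtain c where c: "c \<noteq> 0" "v = c \<cdot>\<^sub>v x" using line_eqD[OF x(2) assms(1,2)] .
  show ?thesis
  proof (cases "c > 0")
    case True
    then show ?thesis using Cone_smult[OF x(1)] c by simp
  next
    case False
    then have "- c > 0" using c by simp
    from Cone_smult[OF x(1) this] show ?thesis using c by (simp add: smult_smult_assoc)
  qed
qed

text \<open>A single functional has no sign on a line, but a product of two functionals has; in this
  form positivity makes sense in projective space.\<close>

lemma Omega_sign:
  assumes L: "line v \<in> Omega" "v \<in> carrier_vec n" "v \<noteq> 0\<^sub>v n" and f: "f \<in> Z" "g \<in> Z"
  shows "(f \<bullet> v) * (g \<bullet> v) > 0"
  using line_in_Omega[OF L(2,3,1)]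
proof
  assume "v \<in> Cone"
  then show ?thesis using f by (simp add: Cone_def)
next
  assume "- 1 \<cdot>\<^sub>v v \<in> Cone"
  then have "f \<bullet> (- 1 \<cdot>\<^sub>v v) > 0" "g \<bullet> (- 1 \<cdot>\<^sub>v v) > 0" using f by (auto simp: Cone_def)
  then have "f \<bullet> v < 0" "g \<bullet> v < 0" using fZ[OF f(1)] fZ[OF f(2)] L(2) scalar_prod_smult_distrib[of _ n v "-1"] by simp_all
  then show ?thesis by (rule mult_neg_neg)
qed

lemma openin_Omega: "openin (proj_topology n) Omega"
proof (rule openin_projI)
  fix L assume "L \<in> Omega"
  then show "\<exists>v\<in>carrier_vec n. v \<noteq> 0\<^sub>v n \<and> L = line v" using Cone_nonzero by (auto simp: Omega_def Cone_def)
next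
  fix v :: "nat \<Rightarrow> real vec" and x assume x: "x \<in> carrier_vec n" "x \<noteq> 0\<^sub>v n" "line x \<in> Omega"
    and v: "\<And>t. v t \<in> carrier_vec n" "\<And>t. v t \<noteq> 0\<^sub>v n" "vlim n v x"
  from line_in_Omega[OF x] show "\<exists>t. line (v t) \<in> Omega"
  proof
    assume "x \<in> Cone"
    then have "\<exists>t. v t \<in> Cone" by (rule Cone_open[OF _ v(1,3)])
    then show ?thesis by (auto simp: Omega_def)
  next
    assume m: "- 1 \<cdot>\<^sub>v x \<in> Cone"
    have "vlim n (\<lambda>t. - 1 \<cdot>\<^sub>v v t) (- 1 \<cdot>\<^sub>v x)"
      unfolding vlim_def
    proof (intro allI impI)
      fix i assume i: "i < n"
      have "(\<lambda>t. - 1 * v t $ i) \<longlonglongrightarrow> - 1 * x $ i"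
        by (intro tendsto_mult tendsto_const) (use v(3) i in \<open>simp add: vlim_def\<close>)
      then show "(\<lambda>t. (- 1 \<cdot>\<^sub>v v t) $ i) \<longlonglongrightarrow> (- 1 \<cdot>\<^sub>v x) $ i"
        using carrier_vecD[OF v(1)] carrier_vecD[OF x(1)] i by simp
    qed
    then have "\<exists>t. - 1 \<cdot>\<^sub>v v t \<in> Cone" by (intro Cone_open[OF m]) (use v in auto)
    then obtain t where "- 1 \<cdot>\<^sub>v v t \<in> Cone" ..
    moreover have "line (- 1 \<cdot>\<^sub>v v t) = line (v t)" by (rule line_smult) simp
    ultimately show ?thesis unfolding Omega_def by (metis imageI)
  qed
qed

text \<open>The lines on which the product is negative form an open set, which
  \<open>Omega_sign\<close> keeps disjoint from \<open>Omega\<close>.\<close>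

lemma closure_sign:
  assumes L: "line v \<in> proj_topology n closure_of Omega" and v: "v \<in> carrier_vec n" "v \<noteq> 0\<^sub>v n" and f: "f \<in> Z" "g \<in> Z"
  shows "(f \<bullet> v) * (g \<bullet> v) \<ge> 0"
proof (rule ccontr)
  assume "\<not> ?thesis"
  then have neg: "(f \<bullet> v) * (g \<bullet> v) < 0" by simp
  define T where "T = {line x | x. x \<in> carrier_vec n \<and> (f \<bullet> x) * (g \<bullet> x) < 0}"
  have nz: "x \<noteq> 0\<^sub>v n" if "x \<in> carrier_vec n" "(f \<bullet> x) * (g \<bullet> x) < 0" for x
    using that fZ[OF f(1)] by auto
  have Tneg: "(f \<bullet> x) * (g \<bullet> x) < 0" if "line x \<in> T" "x \<in> carrier_vec n" "x \<noteq> 0\<^sub>v n" for x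
  proof -
    obtain y where y: "y \<in> carrier_vec n" "(f \<bullet> y) * (g \<bullet> y) < 0" "line x = line y" using \<open>line x \<in> T\<close> by (auto simp: T_def)
    obtain c where c: "c \<noteq> 0" "x = c \<cdot>\<^sub>v y" using line_eqD[OF y(3) \<open>x \<in> carrier_vec n\<close> \<open>x \<noteq> 0\<^sub>v n\<close>] .
    have "(f \<bullet> x) * (g \<bullet> x) = (c * c) * ((f \<bullet> y) * (g \<bullet> y))"
      unfolding c(2) using fZ[OF f(1)] fZ[OF f(2)] y(1) by (simp add: scalar_prod_smult_distrib[of _ n])
    moreover have "c * c > 0" using c(1) by (auto simp: zero_less_mult_iff linorder_neq_iff)
    ultimately show ?thesis using y(2) by (simp add: mult_pos_neg)
  qed
  have "openin (proj_topology n) T"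
  proof (rule openin_projI)
    fix L assume "L \<in> T"
    then show "\<exists>v\<in>carrier_vec n. v \<noteq> 0\<^sub>v n \<and> L = line v" using nz unfolding T_def by blast
  next
    fix y :: "nat \<Rightarrow> real vec" and x assume x: "x \<in> carrier_vec n" "x \<noteq> 0\<^sub>v n" "line x \<in> T"
      and y: "\<And>t. y t \<in> carrier_vec n" "\<And>t. y t \<noteq> 0\<^sub>v n" "vlim n y x"
    have "(\<lambda>t. (f \<bullet> y t) * (g \<bullet> y t)) \<longlonglongrightarrow> (f \<bullet> x) * (g \<bullet> x)"
      by (intro tendsto_mult vlim_scalar_prod[OF y(3) vlim_const y(1) x(1)])
    then have "\<forall>\<^sub>F t in sequentially. (f \<bullet> y t) * (g \<bullet> y t) < 0"
      by (rule order_tendstoD(2)) (rule Tneg[OF x(3,1,2)])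
    then obtain t where "(f \<bullet> y t) * (g \<bullet> y t) < 0" using eventually_happens sequentially_bot by blast
    then show "\<exists>t. line (y t) \<in> T" using y(1) unfolding T_def by blast
  qed
  moreover have "line v \<in> T" using v neg unfolding T_def by blast
  ultimately obtain L where L: "L \<in> Omega" "L \<in> T" using L unfolding in_closure_of by blast
  then obtain x where x: "x \<in> Cone" "L = line x" by (auto simp: Omega_def)
  then have "x \<in> carrier_vec n" "x \<noteq> 0\<^sub>v n" using Cone_nonzero by (auto simp: Cone_def)
  then show False using Tneg[of x] Omega_sign[of x f g] L x f by auto
qed

lemma frontierI:
  assumes v: "v \<in> carrier_vec n" "v \<noteq> 0\<^sub>v n" and lim: "vlim n y v" "\<And>t. line (y t) \<in> Omega" "\<And>t. y t \<in> carrier_vec n"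
    and f: "f \<in> Z" "f \<bullet> v = 0"
  shows "line v \<in> proj_topology n frontier_of Omega"
proof -
  have "line v \<notin> Omega" using Omega_sign[OF _ v f(1) f(1)] f(2) by auto
  moreover have "line v \<in> proj_topology n closure_of Omega"
    unfolding in_closure_of
  proof (intro conjI allI impI)
    have l: "limitin (proj_topology n) (\<lambda>t. line (y t)) (line v) sequentially" by (rule limitin_projI[OF v lim(3,1)])
    then show "line v \<in> topspace (proj_topology n)" by (simp add: limitin_def)
    fix T assume "line v \<in> T \<and> openin (proj_topology n) T"
    then have "\<forall>\<^sub>F t in sequentially. line (y t) \<in> T" using l by (auto simp: limitin_def)
    then obtain t where "line (y t) \<in> T" using eventually_happens sequentially_bot by blast
    then show "\<exists>L. L \<in> Omega \<and> L \<in> T" using lim(2) by blast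
  qed
  ultimately show ?thesis using openin_Omega by (simp add: frontier_of_def interior_of_openin)
qed

lemma properly_convex: "properly_convex_domain n Omega"
  unfolding properly_convex_domain_def
proof (intro conjI)
  show "Omega \<noteq> {}" using p0_Cone by (auto simp: Omega_def)
  show "openin (proj_topology n) Omega" by (rule openin_Omega)
  \<comment> \<open>The segment from \<open>p0\<close> to \<open>v\<close>. The domain is a union of
    such paths, all of which pass through the line of \<open>p0\<close>, and is therefore
    connected.\<close>
  define g where "g v t = (1 - t) \<cdot>\<^sub>v p0 + t \<cdot>\<^sub>v v" for v and t :: real
  have gC: "g v t \<in> Cone" if "v \<in> Cone" "t \<in> {0..1}" for v t
  proof -
    have v: "v \<in> carrier_vec n" "\<And>f. f \<in> Z \<Longrightarrow> f \<bullet> v > 0" using that by (auto simp: Cone_def)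
    show ?thesis unfolding Cone_def
    proof (intro CollectI conjI ballI)
      fix f assume f: "f \<in> Z"
      have "f \<bullet> g v t = (1 - t) * (f \<bullet> p0) + t * (f \<bullet> v)"
        using fZ[OF f] p0 v unfolding g_def by (simp add: scalar_prod_add_distrib[of _ n] scalar_prod_smult_distrib[of _ n])
      moreover have "(1 - t) * (f \<bullet> p0) \<ge> 0" "t * (f \<bullet> v) \<ge> 0" using that p0(2)[OF f] v(2)[OF f] by auto
      moreover have "(1 - t) * (f \<bullet> p0) > 0 \<or> t * (f \<bullet> v) > 0" using that p0(2)[OF f] v(2)[OF f] by (cases "t = 0") auto
      ultimately show "f \<bullet> g v t > 0" by linarith
    qed (use p0 v in \<open>auto simp: g_def\<close>)
  qed
  show "connectedin (proj_topology n) Omega"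
  proof -
    let ?P = "\<lambda>v. (\<lambda>t. line (g v t)) ` {0..1}"
    have con: "connectedin (proj_topology n) (?P v)" if v: "v \<in> Cone" for v
    proof -
      have cm: "continuous_map (top_of_set {0..1}) (proj_topology n) (\<lambda>t. line (g v t))"
        unfolding continuous_map_def
      proof (intro conjI allI impI)
        show "(\<lambda>t. line (g v t)) \<in> topspace (top_of_set {0..1}) \<rightarrow> topspace (proj_topology n)"
          unfolding topspace_Gr_topology Gr_lines using gC[OF v] Cone_nonzero by (force simp: Cone_def)
        fix U assume U: "openin (proj_topology n) U"
        have "\<exists>V. open V \<and> {t \<in> {0..1}. line (g v t) \<in> U} = {0..1} \<inter> V"
        proof (rule relatively_openI_seq)
          fix x y assume x: "x \<in> {t \<in> {0..1}. line (g v t) \<in> U}" and y: "\<And>t::nat. y t \<in> {0..1::real}" "y \<longlonglongrightarrow> x"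
          have vc: "v \<in> carrier_vec n" using v by (simp add: Cone_def)
          have gx: "g v x \<in> carrier_vec n" "g v x \<noteq> 0\<^sub>v n" using gC[OF v, of x] x Cone_nonzero by (auto simp: Cone_def)
          have "vlim n (\<lambda>t. g v (y t)) (g v x)" unfolding vlim_def g_def
            using vc p0 by (auto intro!: tendsto_intros y(2))
          then have "limitin (proj_topology n) (\<lambda>t. line (g v (y t))) (line (g v x)) sequentially"
            by (intro limitin_projI gx) (use vc p0 in \<open>auto simp: g_def\<close>)
          then have "\<forall>\<^sub>F t in sequentially. line (g v (y t)) \<in> U" using x U by (auto simp: limitin_def)
          then obtain t where "line (g v (y t)) \<in> U" using eventually_happens sequentially_bot by blast
          then show "\<exists>t. y t \<in> {t \<in> {0..1}. line (g v t) \<in> U}" using y(1) by blast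
        qed auto
        then show "openin (top_of_set {0..1}) {x \<in> topspace (top_of_set {0..1}). line (g v x) \<in> U}"
          unfolding openin_open by simp
      qed
      have "connectedin (top_of_set {0..1::real}) {0..1}" by (simp add: connectedin_subtopology)
      from connectedin_continuous_map_image[OF cm this] show ?thesis .
    qed
    have P0: "line p0 \<in> ?P v" if "v \<in> Cone" for v
    proof -
      have "g v 0 = p0" using p0 that by (auto simp: g_def Cone_def intro!: eq_vecI)
      then show ?thesis by (intro image_eqI[of _ _ 0]) auto
    qed
    have P1: "line v \<in> ?P v" if "v \<in> Cone" for v
    proof -
      have "g v 1 = v" using p0 that by (auto simp: g_def Cone_def intro!: eq_vecI)
      then show ?thesis by (intro image_eqI[of _ _ 1]) auto
    qed
    have "connectedin (proj_topology n) (\<Union>(?P ` Cone))"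
    proof (rule connectedin_Union)
      have "line p0 \<in> \<Inter>(?P ` Cone)" using P0 by blast
      then show "\<Inter>(?P ` Cone) \<noteq> {}" by blast
    qed (use con in blast)
    moreover have "\<Union>(?P ` Cone) = Omega" using P1 gC by (auto simp: Omega_def)
    ultimately show ?thesis by simp
  qed
  define S where "S = {v \<in> \<Union>Omega. ones n \<bullet> v = 1}"
  have o: "ones n \<in> carrier_vec n" by (simp add: ones_def)
  have S: "S = {v \<in> Cone. ones n \<bullet> v = 1}"
  proof (intro equalityI subsetI)
    fix v assume "v \<in> S"
    then obtain x c where x: "x \<in> Cone" "v = c \<cdot>\<^sub>v x" "ones n \<bullet> v = 1" by (auto simp: S_def Omega_def line_def)
    have "1 = c * (ones n \<bullet> x)" using x o by (simp add: scalar_prod_smult_distrib[of _ n] Cone_def)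
    moreover have "ones n \<bullet> x > 0" using x(1) ones(1) by (simp add: Cone_def)
    ultimately have "c > 0" using zero_less_mult_pos2[of c "ones n \<bullet> x"] by linarith
    then show "v \<in> {v \<in> Cone. ones n \<bullet> v = 1}" using Cone_smult x by simp
  next
    fix v assume "v \<in> {v \<in> Cone. ones n \<bullet> v = 1}"
    then show "v \<in> S" using line_self by (auto simp: S_def Omega_def)
  qed
  have bound: "\<bar>v $ i\<bar> \<le> real n + 1" if v: "v \<in> S" and i: "i < n" for v i
  proof -
    have vc: "v \<in> carrier_vec n" and s1: "(\<Sum>j<n. v $ j) = 1"
      using v unfolding S by (auto simp: Cone_def scalar_prod_sum ones_def)
    have low: "v $ j > -1" if j: "j < n" for j
    proof -
      have "0 < ones_plus n j \<bullet> v" using v ones(2)[OF j] unfolding S by (simp add: Cone_def)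
      also have "ones_plus n j \<bullet> v = (\<Sum>r<n. v $ r + (if r = j then v $ r else 0))"
        unfolding scalar_prod_sum[OF vc] by (rule sum.cong) (auto simp: ones_plus_def)
      also have "\<dots> = 1 + v $ j" using j s1 by (simp add: sum.distrib)
      finally show ?thesis by simp
    qed
    \<comment> \<open>In this chart the coordinates add up to 1 and each exceeds -1, so none of them
      is larger than \<open>n\<close>.\<close>
    have "v $ i = 1 - (\<Sum>j\<in>{..<n} - {i}. v $ j)" using s1 sum.remove[of "{..<n}" i "\<lambda>j. v $ j"] i by simp
    moreover have "(\<Sum>j\<in>{..<n} - {i}. v $ j) \<ge> (\<Sum>j\<in>{..<n} - {i}. -1)"
      by (rule sum_mono) (use low in \<open>auto intro: less_imp_le\<close>)
    moreover have "(\<Sum>j\<in>{..<n} - {i}. -1::real) \<ge> - real n" using i by simp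
    ultimately show ?thesis using low[OF i] by simp
  qed
  have meets: "\<exists>v\<in>x. ones n \<bullet> v = 1" if xO: "x \<in> Omega" for x
  proof -
    obtain y where y: "y \<in> Cone" "x = line y" using xO by (auto simp: Omega_def)
    then have pos: "ones n \<bullet> y > 0" and yc: "y \<in> carrier_vec n" using ones(1) by (auto simp: Cone_def)
    have "ones n \<bullet> ((1 / (ones n \<bullet> y)) \<cdot>\<^sub>v y) = 1" using pos scalar_prod_smult_distrib[OF o yc] by simp
    moreover have "(1 / (ones n \<bullet> y)) \<cdot>\<^sub>v y \<in> x" unfolding y(2) line_def by blast
    ultimately show ?thesis by blast
  qed
  have conv: "(1 - t) \<cdot>\<^sub>v u + t \<cdot>\<^sub>v v \<in> S" if uv: "u \<in> S" "v \<in> S" and t: "t \<in> {0..1}" for u v and t :: real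
  proof -
    have c: "u \<in> Cone" "v \<in> Cone" "u \<in> carrier_vec n" "v \<in> carrier_vec n" "ones n \<bullet> u = 1" "ones n \<bullet> v = 1"
      using uv by (auto simp: S Cone_def)
    have l: "f \<bullet> ((1 - t) \<cdot>\<^sub>v u + t \<cdot>\<^sub>v v) = (1 - t) * (f \<bullet> u) + t * (f \<bullet> v)" if "f \<in> carrier_vec n" for f
      using that c by (simp add: scalar_prod_add_distrib[of _ n] scalar_prod_smult_distrib[of _ n])
    have "f \<bullet> ((1 - t) \<cdot>\<^sub>v u + t \<cdot>\<^sub>v v) > 0" if f: "f \<in> Z" for f
    proof -
      have p: "f \<bullet> u > 0" "f \<bullet> v > 0" using c f by (auto simp: Cone_def)
      then have "(1 - t) * (f \<bullet> u) \<ge> 0" "t * (f \<bullet> v) \<ge> 0" using t by auto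
      moreover have "(1 - t) * (f \<bullet> u) > 0 \<or> t * (f \<bullet> v) > 0" using t p by (cases "t = 0") auto
      ultimately show ?thesis unfolding l[OF fZ[OF f]] by linarith
    qed
    then show ?thesis using c l[OF o] by (simp add: S Cone_def)
  qed
  have "ones n \<noteq> 0\<^sub>v n \<and> (\<forall>x\<in>Omega. \<exists>v\<in>x. ones n \<bullet> v = 1) \<and>
       (let S = {v \<in> \<Union>Omega. ones n \<bullet> v = 1} in
         (\<forall>u\<in>S. \<forall>v\<in>S. \<forall>t\<in>{0..1}. (1 - t) \<cdot>\<^sub>v u + t \<cdot>\<^sub>v v \<in> S) \<and>
         (\<exists>B. \<forall>v\<in>S. \<forall>i<n. \<bar>v $ i\<bar> \<le> B))"
    unfolding Let_def S_def[symmetric]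
    by (intro conjI ballI exI[of _ "real n + 1"] allI impI Z_nonzero[OF ones(1)] meets conv bound)
  then show "\<exists>f\<in>carrier_vec n. f \<noteq> 0\<^sub>v n \<and> (\<forall>x\<in>Omega. \<exists>v\<in>x. f \<bullet> v = 1) \<and>
       (let S = {v \<in> \<Union>Omega. f \<bullet> v = 1} in
         (\<forall>u\<in>S. \<forall>v\<in>S. \<forall>t\<in>{0..1}. (1 - t) \<cdot>\<^sub>v u + t \<cdot>\<^sub>v v \<in> S) \<and>
         (\<exists>B. \<forall>v\<in>S. \<forall>i<n. \<bar>v $ i\<bar> \<le> B))"
    using o by (rule bexI)
qed

text \<open>The cone contains \<open>x + \<epsilon> v\<close> for all \<open>v\<close> with \<open>h \<bullet> v > 0\<close> and small \<open>\<epsilon>\<close>, because \<open>h\<close> is the only element of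
  the compact family that vanishes at \<open>x\<close>; so a hyperplane through \<open>x\<close> missing the cone lies in the kernel of \<open>h\<close>.\<close>

lemma unique_supporting_hyperplane:
  assumes x: "x \<in> carrier_vec n" "x \<noteq> 0\<^sub>v n" and nonneg: "\<And>f. f \<in> Z \<Longrightarrow> f \<bullet> x \<ge> 0"
    and h: "h \<in> Z" "h \<bullet> x = 0" and uniq: "\<And>f. f \<in> Z \<Longrightarrow> f \<bullet> x = 0 \<Longrightarrow> \<exists>c. f = c \<cdot>\<^sub>v h"
    and fr: "line x \<in> proj_topology n frontier_of Omega"
  shows "\<exists>!H. supporting_hyperplane n Omega H \<and> line x \<subseteq> H"
proof -
  have hc: "h \<in> carrier_vec n" "h \<noteq> 0\<^sub>v n" using fZ[OF h(1)] Z_nonzero[OF h(1)] by auto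
  define K where "K = {v \<in> carrier_vec n. h \<bullet> v = 0}"
  have tangent: "\<exists>e>0. x + e \<cdot>\<^sub>v v \<in> Cone" if v: "v \<in> carrier_vec n" "h \<bullet> v > 0" for v
  proof (rule ccontr)
    assume no: "\<not> ?thesis"
    have "\<exists>f. f \<in> Z \<and> f \<bullet> (x + inverse (real (Suc t)) \<cdot>\<^sub>v v) \<le> 0" for t
    proof -
      have "x + inverse (real (Suc t)) \<cdot>\<^sub>v v \<notin> Cone"
        using no inverse_positive_iff_positive[of "real (Suc t)"] by (metis of_nat_0_less_iff zero_less_Suc)
      then show ?thesis using x v by (auto simp: Cone_def not_less)
    qed
    then have "\<forall>t. \<exists>f. f \<in> Z \<and> f \<bullet> (x + inverse (real (Suc t)) \<cdot>\<^sub>v v) \<le> 0" by blast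
    from choice[OF this] obtain f where f: "\<forall>t. f t \<in> Z \<and> f t \<bullet> (x + inverse (real (Suc t)) \<cdot>\<^sub>v v) \<le> 0" by (elim exE)
    then have fZt: "f t \<in> Z" for t by simp
    have fx: "f t \<bullet> x + inverse (real (Suc t)) * (f t \<bullet> v) \<le> 0" for t
      using f[THEN spec, of t] fZ[OF fZt] x v by (simp add: scalar_prod_add_distrib[of _ n] scalar_prod_smult_distrib[of _ n])
    obtain r c g where r: "strict_mono r" "\<forall>t. c t > 0" "g \<in> Z" "vlim n (\<lambda>t. c t \<cdot>\<^sub>v f (r t)) g"
      using compact[of f, OF fZt] by (elim exE conjE)
    have lx: "(\<lambda>t. c t * (f (r t) \<bullet> x)) \<longlonglongrightarrow> g \<bullet> x"
      using vlim_scalar_prod[OF vlim_const r(4) x(1) x(1)] fZ[OF fZt] x by (simp add: smult_scalar_prod_distrib[of _ n])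
    have lv: "(\<lambda>t. c t * (f (r t) \<bullet> v)) \<longlonglongrightarrow> g \<bullet> v"
      using vlim_scalar_prod[OF vlim_const r(4) v(1) v(1)] fZ[OF fZt] v by (simp add: smult_scalar_prod_distrib[of _ n])
    have neg: "f t \<bullet> v \<le> 0" for t
    proof -
      have "inverse (real (Suc t)) * (f t \<bullet> v) \<le> 0" using fx[of t] nonneg[OF fZt, of t] by linarith
      then show ?thesis by (simp add: mult_le_0_iff)
    qed
    have "c t * (f (r t) \<bullet> v) \<le> 0" for t using neg r(2) by (simp add: mult_nonneg_nonpos less_imp_le)
    then have gv: "g \<bullet> v \<le> 0" using lv by (intro LIMSEQ_le_const2) auto
    have le: "c t * (f (r t) \<bullet> x) + inverse (real (Suc (r t))) * (c t * (f (r t) \<bullet> v)) \<le> 0" for t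
    proof -
      have "c t * (f (r t) \<bullet> x + inverse (real (Suc (r t))) * (f (r t) \<bullet> v)) \<le> 0"
        using fx[of "r t"] r(2) by (intro mult_nonneg_nonpos) (auto intro: less_imp_le)
      then show ?thesis by (simp add: algebra_simps)
    qed
    have "(\<lambda>t. inverse (real (Suc (r t)))) \<longlonglongrightarrow> 0"
      using LIMSEQ_subseq_LIMSEQ[OF LIMSEQ_inverse_real_of_nat r(1)] by (simp add: o_def)
    then have "(\<lambda>t. c t * (f (r t) \<bullet> x) + inverse (real (Suc (r t))) * (c t * (f (r t) \<bullet> v))) \<longlonglongrightarrow> g \<bullet> x + 0 * (g \<bullet> v)"
      by (intro tendsto_add tendsto_mult lx lv)
    then have "g \<bullet> x \<le> 0" using le LIMSEQ_le_const2[of _ "g \<bullet> x" 0] by simp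
    then have "g \<bullet> x = 0" using nonneg[OF r(3)] by simp
    then obtain e where e: "g = e \<cdot>\<^sub>v h" using uniq[OF r(3)] by blast
    \<comment> \<open>Both \<open>g\<close> and \<open>h\<close> are positive at \<open>p0\<close>,
      which makes the factor between them positive.\<close>
    have "e * (h \<bullet> p0) > 0" using p0(2)[OF r(3)] p0(1) hc unfolding e by (simp add: smult_scalar_prod_distrib[of _ n])
    then have "e > 0" using p0(2)[OF h(1)] by (simp add: zero_less_mult_iff)
    then have "g \<bullet> v > 0" unfolding e using v hc by (simp add: smult_scalar_prod_distrib[of _ n])
    then show False using gv by simp
  qed
  have lineK: "line x \<subseteq> K" unfolding line_def K_def using x h(2) hc by (auto simp: scalar_prod_smult_distrib[of _ n])
  show ?thesis
  proof (rule ex1I[of _ K])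
    obtain Y where Y: "frame n (n - 1) Y" "cspace n Y = K" using kernel_frame[OF hc] unfolding K_def by blast
    have "K \<in> Gr n (n - 1)" unfolding Gr_eq_frames using Y by blast
    moreover have "\<not> L \<subseteq> K" if LO: "L \<in> Omega" for L
    proof -
      obtain y where y: "y \<in> Cone" "L = line y" using LO by (auto simp: Omega_def)
      then have "h \<bullet> y > 0" using h by (simp add: Cone_def)
      then show ?thesis using line_self[of y] y(2) by (auto simp: K_def)
    qed
    ultimately show "supporting_hyperplane n Omega K \<and> line x \<subseteq> K"
      using lineK fr unfolding supporting_hyperplane_def by blast
    fix H assume H: "supporting_hyperplane n Omega H \<and> line x \<subseteq> H"
    then have HG: "H \<in> Gr n (n - 1)" and miss: "\<And>L. L \<in> Omega \<Longrightarrow> \<not> L \<subseteq> H" by (auto simp: supporting_hyperplane_def)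
    obtain Y' where Y': "frame n (n - 1) Y'" "H = cspace n Y'" using HG by (auto simp: Gr_eq_frames)
    note cY' = frame_carrier[OF Y'(1)]
    have Hc: "H \<subseteq> carrier_vec n" using cspace_carrier[OF cY'] Y' by simp
    have Hadd: "a + b \<in> H" if aH: "a \<in> H" and bH: "b \<in> H" for a b
    proof -
      obtain p q where "p \<in> carrier_vec (n - 1)" "a = Y' *\<^sub>v p" "q \<in> carrier_vec (n - 1)" "b = Y' *\<^sub>v q"
        using aH bH unfolding Y'(2) cspace_eq[OF cY'] by blast
      then have "a + b = Y' *\<^sub>v (p + q)" "p + q \<in> carrier_vec (n - 1)" using mult_add_distrib_mat_vec[OF cY'] by auto
      then show ?thesis unfolding Y'(2) cspace_eq[OF cY'] by blast
    qed
    have Hsm: "c \<cdot>\<^sub>v a \<in> H" if aH: "a \<in> H" for c a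
    proof -
      obtain p where "p \<in> carrier_vec (n - 1)" "a = Y' *\<^sub>v p" using aH unfolding Y'(2) cspace_eq[OF cY'] by blast
      then have "c \<cdot>\<^sub>v a = Y' *\<^sub>v (c \<cdot>\<^sub>v p)" "c \<cdot>\<^sub>v p \<in> carrier_vec (n - 1)" using mult_mat_vec[OF cY'] by auto
      then show ?thesis unfolding Y'(2) cspace_eq[OF cY'] by blast
    qed
    have xH: "x \<in> H" using H line_self by blast
    have noC: "y \<notin> Cone" if "y \<in> H" for y
    proof
      assume "y \<in> Cone"
      then have "line y \<in> Omega" by (simp add: Omega_def)
      moreover have "line y \<subseteq> H" using Hsm[OF that] by (auto simp: line_def)
      ultimately show False using miss by blast
    qed
    have np: "\<not> h \<bullet> v > 0" if vH: "v \<in> H" for v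
    proof
      assume "h \<bullet> v > 0"
      then obtain e where "x + e \<cdot>\<^sub>v v \<in> Cone" using tangent[of v] vH Hc by blast
      then show False using noC Hadd[OF xH Hsm[OF vH]] by blast
    qed
    have "h \<bullet> v = 0" if vH: "v \<in> H" for v
    proof -
      have "h \<bullet> (- 1 \<cdot>\<^sub>v v) = - (h \<bullet> v)" using hc subsetD[OF Hc vH] by (simp add: scalar_prod_smult_distrib[of _ n])
      then show ?thesis using np[OF vH] np[OF Hsm[OF vH, of "-1"]] by simp
    qed
    then show "H = K" unfolding K_def by (rule hyperplane_eq[OF hc HG])
  qed
qed

text \<open>If the lifts \<open>u\<close> and \<open>v\<close> are multiples of \<open>x\<close> and
  \<open>y\<close> by factors of the same sign, every point of the segment is, up to sign, a
  positive combination of \<open>x\<close> and \<open>y\<close>, and each functional in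
  \<open>Z\<close> is positive at one of the ends. With opposite signs the segment is the
  complementary one: \<open>h\<close> and \<open>k\<close> take opposite signs at one of its points,
  which \<open>closure_sign\<close> forbids in the closure.\<close>

lemma segment_in_Omega:
  assumes x: "x \<in> carrier_vec n" "\<And>f. f \<in> Z \<Longrightarrow> f \<bullet> x \<ge> 0" and y: "y \<in> carrier_vec n" "\<And>f. f \<in> Z \<Longrightarrow> f \<bullet> y \<ge> 0"
    and pos: "\<And>f. f \<in> Z \<Longrightarrow> f \<bullet> x > 0 \<or> f \<bullet> y > 0"
    and h: "h \<in> Z" "h \<bullet> x = 0" and k: "k \<in> Z" "k \<bullet> y = 0"
    and S: "open_proj_segment n (line x) (line y) S" and cl: "S \<subseteq> proj_topology n closure_of Omega"
  shows "S \<subseteq> Omega"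
proof -
  obtain u v where uv: "u \<in> line x - {0\<^sub>v n}" "v \<in> line y - {0\<^sub>v n}"
    and S: "S = {{c \<cdot>\<^sub>v (s \<cdot>\<^sub>v u + t \<cdot>\<^sub>v v) | c. True} | s t. s > 0 \<and> t > 0}"
    using S unfolding open_proj_segment_def by blast
  obtain a b where ab: "u = a \<cdot>\<^sub>v x" "v = b \<cdot>\<^sub>v y" using uv by (auto simp: line_def)
  have nz: "a \<noteq> 0" "b \<noteq> 0" using uv ab x y by (auto intro: eq_vecI)
  have S': "S = {line ((s * a) \<cdot>\<^sub>v x + (t * b) \<cdot>\<^sub>v y) | s t. s > 0 \<and> t > 0}"
    unfolding S ab line_def smult_smult_assoc ..
  have hy: "h \<bullet> y > 0" and kx: "k \<bullet> x > 0" using pos[OF h(1)] pos[OF k(1)] h k by auto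
  show ?thesis
  proof (cases "a * b > 0")
    case True
    show ?thesis
    proof
      fix L assume "L \<in> S"
      then obtain s t where st: "s > 0" "t > 0" "L = line ((s * a) \<cdot>\<^sub>v x + (t * b) \<cdot>\<^sub>v y)" unfolding S' by blast
      show "L \<in> Omega"
      proof (cases "a > 0")
        case True
        then have "b > 0" using \<open>a * b > 0\<close> by (simp add: zero_less_mult_iff)
        then have "(s * a) \<cdot>\<^sub>v x + (t * b) \<cdot>\<^sub>v y \<in> Cone" using True st by (intro Cone_combine[OF x y pos]) auto
        then show ?thesis using st by (simp add: Omega_def)
      next
        case False
        then have ab0: "a < 0" "b < 0" using \<open>a * b > 0\<close> nz by (auto simp: zero_less_mult_iff)
        then have "(s * (- a)) \<cdot>\<^sub>v x + (t * (- b)) \<cdot>\<^sub>v y \<in> Cone" using st by (intro Cone_combine[OF x y pos] mult_pos_pos) auto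
        moreover have "(s * (- a)) \<cdot>\<^sub>v x + (t * (- b)) \<cdot>\<^sub>v y = - 1 \<cdot>\<^sub>v ((s * a) \<cdot>\<^sub>v x + (t * b) \<cdot>\<^sub>v y)"
          by (rule eq_vecI) (use x y in \<open>auto simp: algebra_simps\<close>)
        ultimately show ?thesis unfolding Omega_def st(3) using line_smult[of "- 1" "(s * a) \<cdot>\<^sub>v x + (t * b) \<cdot>\<^sub>v y"]
          by (metis imageI zero_neq_neg_one)
      qed
    qed
  next
    case False
    then have neg: "a * b < 0" using nz by (simp add: not_less order_less_le)
    define z where "z = (1 * a) \<cdot>\<^sub>v x + (1 * b) \<cdot>\<^sub>v y"
    have z: "z \<in> carrier_vec n" using x y by (simp add: z_def)
    have hz: "h \<bullet> z = b * (h \<bullet> y)" "k \<bullet> z = a * (k \<bullet> x)"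
      using x y h k fZ[OF h(1)] fZ[OF k(1)] unfolding z_def
      by (simp_all add: scalar_prod_add_distrib[of _ n] scalar_prod_smult_distrib[of _ n])
    then have "z \<noteq> 0\<^sub>v n" using nz hy fZ[OF h(1)] by auto
    moreover have "line z \<in> S" unfolding S' z_def by (intro CollectI exI[of _ "1::real"]) simp
    ultimately have "(h \<bullet> z) * (k \<bullet> z) \<ge> 0" using closure_sign[OF subsetD[OF cl] z _ h(1) k(1)] by blast
    moreover have "(h \<bullet> z) * (k \<bullet> z) = (a * b) * ((h \<bullet> y) * (k \<bullet> x))" unfolding hz by simp
    moreover have "(h \<bullet> y) * (k \<bullet> x) > 0" using hy kx by simp
    ultimately show ?thesis using neg by (metis mult_neg_pos not_le)
  qed
qed

end

section \<open>The projective linear group\<close>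

lemma GL_inverse:
  assumes "A \<in> carrier_mat n n" "det A \<noteq> (0::'k::field)"
  obtains B where "B \<in> carrier_mat n n" "A * B = 1\<^sub>m n" "B * A = 1\<^sub>m n" "det B \<noteq> 0"
proof -
  obtain B where B: "B \<in> carrier_mat n n" "A * B = 1\<^sub>m n" "B * A = 1\<^sub>m n"
    using det_non_zero_imp_unit[OF assms, of "()"] by (auto simp: Units_def ring_mat_simps)
  moreover have "det A * det B = 1" using det_mult[OF assms(1) B(1)] B(2) by simp
  ultimately show ?thesis using that by force
qed

lemma PGL_mult:
  assumes "A \<in> carrier_mat n n" "det A \<noteq> 0" "B \<in> carrier_mat n n" "det B \<noteq> (0::'k::field)"
  shows "pcoset A \<otimes>\<^bsub>PGL n\<^esub> pcoset B = pcoset (A * B)"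
proof -
  have c: "A \<in> carrier (GL n)" "B \<in> carrier (GL n)" using assms by (auto simp: carrier_GL)
  have "pcoset A \<otimes>\<^bsub>PGL n\<^esub> pcoset B = (scalars n #>\<^bsub>GL n\<^esub> A) <#>\<^bsub>GL n\<^esub> (scalars n #>\<^bsub>GL n\<^esub> B)"
    using assms by (simp add: PGL_def FactGroup_def rcoset_scalars)
  also have "\<dots> = scalars n #>\<^bsub>GL n\<^esub> (A * B)"
    using normal.rcos_sum[OF scalars_normal c] by simp
  finally show ?thesis using assms by (simp add: rcoset_scalars[of _ n])
qed

lemma PGL_one: "\<one>\<^bsub>PGL n\<^esub> = pcoset (1\<^sub>m n :: 'k::field mat)"
  by (simp add: PGL_def FactGroup_def scalars_def pcoset_def)

lemma pcoset_in_PGL: "A \<in> carrier_mat n n \<Longrightarrow> det A \<noteq> (0::'k::field) \<Longrightarrow> pcoset A \<in> carrier (PGL n)"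
  by (auto simp: carrier_PGL)

lemma PGL_inv:
  assumes "A \<in> carrier_mat n n" "det A \<noteq> 0" "B \<in> carrier_mat n n" "det B \<noteq> (0::'k::field)" "B * A = 1\<^sub>m n"
  shows "inv\<^bsub>PGL n\<^esub> (pcoset A) = pcoset B"
  by (rule group.inv_equality[OF group_PGL]) (use assms in \<open>auto simp: PGL_mult PGL_one pcoset_in_PGL\<close>)

lemma pcoset_eqD:
  assumes "pcoset A = pcoset B"
  obtains c where "c \<noteq> 0" "A = c \<cdot>\<^sub>m B"
  using pcoset_self[of A] assms by (auto simp: pcoset_def)

lemma svd_of_mat:
  fixes l :: "'k::rc_field mat"
  assumes g: "g \<in> carrier (PGL d)" and svd: "svd_of d g l s m"
  defines "A \<equiv> l * mat_diag d (\<lambda>i. of_real (s i)) * m"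
  shows "A \<in> carrier_mat d d" "det A \<noteq> 0" "g = pcoset A" "norm (det A) = 1"
proof -
  obtain B where B: "B \<in> g" "norm (det B) = 1" "is_svd d B l s m" using svd by (auto simp: svd_of_def)
  then have BA: "B = A" by (simp add: is_svd_def A_def)
  obtain A0 where "A0 \<in> carrier_mat d d" "g = pcoset A0" using g by (auto simp: carrier_PGL)
  then show "A \<in> carrier_mat d d" "g = pcoset A" using B(1) pcoset_eqI[of B A0] unfolding BA by (auto simp: pcoset_def)
  show "norm (det A) = 1" using B(2) BA by simp
  then show "det A \<noteq> 0" by auto
qed

lemma svd_ofD:
  assumes "svd_of d g l s m"
  shows "l \<in> unitary_mats d" "m \<in> unitary_mats d" "\<And>i. i < d \<Longrightarrow> 0 < s i" "\<And>i j. i \<le> j \<Longrightarrow> j < d \<Longrightarrow> s j \<le> s i"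
  using assms by (auto simp: svd_of_def is_svd_def)

text \<open>Inverting the decomposition inverts the diagonal factor, whose entries then increase;
  conjugation by \<open>rev_mat\<close> puts them in decreasing order. The left factor of the
  inverse is read off from \<open>m\<close>, so the repelling data of an element are the attracting
  data of its inverse.\<close>

lemma svd_of_inv:
  fixes l :: "'k::rc_field mat"
  assumes g: "g \<in> carrier (PGL d)" and svd: "svd_of d g l s m"
  shows "svd_of d (inv\<^bsub>PGL d\<^esub> g) (mat_adjoint m * rev_mat d) (\<lambda>i. 1 / s (d - 1 - i)) (rev_mat d * mat_adjoint l)"
proof -
  define D :: "'k mat" where "D = mat_diag d (\<lambda>i. of_real (s i))"
  define D' :: "'k mat" where "D' = mat_diag d (\<lambda>i. of_real (1 / s i))"
  define F :: "'k mat" where "F = mat_diag d (\<lambda>i. of_real (1 / s (d - 1 - i)))"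
  let ?J = "rev_mat d :: 'k mat"
  note sv = svd_ofD[OF svd]
  note A = svd_of_mat[OF g svd, folded D_def]
  have c: "l \<in> carrier_mat d d" "m \<in> carrier_mat d d" "D \<in> carrier_mat d d" "D' \<in> carrier_mat d d" "F \<in> carrier_mat d d"
    using sv unitary_carrier by (auto simp: D_def D'_def F_def)
  note ca = mat_adjoint_carrier[OF c(1)] mat_adjoint_carrier[OF c(2)]
  have DD: "D' * D = 1\<^sub>m d"
    unfolding D_def D'_def mat_diag_diag by (rule eq_matI) (use sv(3) in \<open>auto simp: mat_diag_def less_imp_neq[THEN not_sym]\<close>)
  have JF: "?J * F = D' * ?J"
  proof -
    have "mat_diag d (\<lambda>i. of_real (1 / s (d - 1 - (d - 1 - i)))) = D'"
      unfolding D'_def by (rule eq_matI) (auto simp: mat_diag_def)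
    then show ?thesis unfolding F_def rev_mat_diag by simp
  qed
  define B where "B = mat_adjoint m * (D' * mat_adjoint l)"
  have D'l: "D' * mat_adjoint l \<in> carrier_mat d d" by (rule mult_carrier_mat[OF c(4) ca(1)])
  have B: "B \<in> carrier_mat d d" unfolding B_def by (rule mult_carrier_mat[OF ca(2) D'l])
  have Beq: "B = (mat_adjoint m * ?J) * F * (?J * mat_adjoint l)"
  proof -
    have J: "?J \<in> carrier_mat d d" by simp
    have Jl: "?J * mat_adjoint l \<in> carrier_mat d d" by (rule mult_carrier_mat[OF J ca(1)])
    have "(mat_adjoint m * ?J) * F * (?J * mat_adjoint l) = mat_adjoint m * (?J * F) * (?J * mat_adjoint l)"
      unfolding assoc_mult_mat[OF ca(2) J c(5)] ..
    also have "\<dots> = mat_adjoint m * (D' * (?J * (?J * mat_adjoint l)))"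
      unfolding JF using assoc_mult_mat[OF ca(2) mult_carrier_mat[OF c(4) J] Jl] assoc_mult_mat[OF c(4) J Jl] by simp
    also have "?J * (?J * mat_adjoint l) = mat_adjoint l"
      using assoc_mult_mat[OF J J ca(1)] left_mult_one_mat[OF ca(1)] by (simp add: rev_mat_square)
    finally show ?thesis by (simp add: B_def)
  qed
  have BA: "B * (l * D * m) = 1\<^sub>m d"
  proof -
    have "B * (l * D * m) = mat_adjoint m * (D' * ((mat_adjoint l * l) * (D * m)))"
      unfolding B_def using c ca by (simp add: assoc_mult_mat[of _ d d _ d _ d])
    also have "\<dots> = mat_adjoint m * ((D' * D) * m)"
      using c unitary_adjoint_mult[OF sv(1)] by (simp add: assoc_mult_mat[of _ d d _ d _ d])
    also have "\<dots> = 1\<^sub>m d" using c unitary_adjoint_mult[OF sv(2)] by (simp add: DD)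
    finally show ?thesis .
  qed
  have dB: "det B * det (l * D * m) = 1" using det_mult[OF B A(1)] BA by simp
  have "norm (det B) * norm (det (l * D * m)) = 1" using arg_cong[OF dB, of norm] by (simp only: norm_mult norm_one)
  then have "norm (det B) = 1" unfolding A(4) by simp
  moreover have "inv\<^bsub>PGL d\<^esub> g = pcoset B" unfolding A(3) by (rule PGL_inv[OF A(1,2) B _ BA]) (use dB in auto)
  moreover have "is_svd d B (mat_adjoint m * ?J) (\<lambda>i. 1 / s (d - 1 - i)) (?J * mat_adjoint l)"
    unfolding is_svd_def
  proof (intro conjI allI impI)
    show "mat_adjoint m * ?J \<in> unitary_mats d"
      by (rule unitary_mult[OF unitary_adjoint[OF sv(2)] rev_mat_unitary])
    show "?J * mat_adjoint l \<in> unitary_mats d"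
      by (rule unitary_mult[OF rev_mat_unitary unitary_adjoint[OF sv(1)]])
    show "B = mat_adjoint m * ?J * mat_diag d (\<lambda>i. of_real (1 / s (d - 1 - i))) * (?J * mat_adjoint l)"
      unfolding Beq F_def ..
    fix i assume "i < d"
    then show "0 < 1 / s (d - 1 - i)" using sv(3) by simp
  next
    fix i j assume ij: "i \<le> j" "j < d"
    have "s (d - 1 - i) \<le> s (d - 1 - j)" by (rule sv(4)) (use ij in auto)
    moreover have "0 < s (d - 1 - i)" using ij by (intro sv(3)) auto
    ultimately show "1 / s (d - 1 - j) \<le> 1 / s (d - 1 - i)" by (simp add: frac_le)
  qed
  ultimately show ?thesis unfolding svd_of_def using pcoset_self by blast
qed

section \<open>Limits of Cartan subspaces of a transverse group\<close>

text \<open>The recursion carries the finite set of elements already used; each \<open>S t\<close>,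
  being infinite, offers a new one.\<close>

lemma inj_choice:
  fixes S :: "nat \<Rightarrow> 'a set"
  assumes "\<And>t. infinite (S t)"
  obtains \<gamma> where "inj \<gamma>" "\<And>t. \<gamma> t \<in> S t"
proof -
  have "\<exists>f :: nat \<Rightarrow> 'a \<times> 'a set. \<forall>t. (fst (f t) \<in> S t \<and> finite (snd (f t))) \<and>
     (snd (f (Suc t)) = insert (fst (f t)) (snd (f t)) \<and> fst (f (Suc t)) \<notin> insert (fst (f t)) (snd (f t)))"
  proof (rule dependent_nat_choice[where P = "\<lambda>t (p :: 'a \<times> 'a set). fst p \<in> S t \<and> finite (snd p)"
      and Q = "\<lambda>t (p :: 'a \<times> 'a set) q. snd q = insert (fst p) (snd p) \<and> fst q \<notin> insert (fst p) (snd p)"])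
    have "S 0 \<noteq> {}" using assms[of 0] by auto
    then obtain x where "x \<in> S 0" by blast
    then show "\<exists>p :: 'a \<times> 'a set. fst p \<in> S 0 \<and> finite (snd p)" by (intro exI[of _ "(x, {})"]) simp
  next
    fix p :: "'a \<times> 'a set" and t assume "fst p \<in> S t \<and> finite (snd p)"
    then have "infinite (S (Suc t) - insert (fst p) (snd p))" using assms by (intro Diff_infinite_finite) auto
    then obtain x where "x \<in> S (Suc t) - insert (fst p) (snd p)" by (metis ex_in_conv finite.emptyI)
    then show "\<exists>q. (fst q \<in> S (Suc t) \<and> finite (snd q)) \<and> snd q = insert (fst p) (snd p) \<and> fst q \<notin> insert (fst p) (snd p)"
      using \<open>fst p \<in> S t \<and> finite (snd p)\<close> by (intro exI[of _ "(x, insert (fst p) (snd p))"]) simp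
  qed
  then obtain f where f: "\<And>t. fst (f t) \<in> S t" "\<And>t. snd (f (Suc t)) = insert (fst (f t)) (snd (f t))"
    "\<And>t. fst (f (Suc t)) \<notin> insert (fst (f t)) (snd (f t))" by blast
  have mem: "fst (f m) \<in> snd (f n)" if "m < n" for m n
    using that by (induction n) (auto simp: f(2) less_Suc_eq)
  have "fst (f m) \<noteq> fst (f n)" if "m < n" for m n
  proof (cases n)
    case (Suc n')
    then show ?thesis using mem[OF that] f(3)[of n'] f(2)[of n'] by metis
  qed (use that in simp)
  then have "inj (\<lambda>t. fst (f t))" by (metis injI linorder_neqE_nat)
  with f(1) that show ?thesis by blast
qed

definition mat_close :: "nat \<Rightarrow> real \<Rightarrow> 'k::real_normed_vector mat \<Rightarrow> 'k mat \<Rightarrow> bool" where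
  "mat_close d e A B \<longleftrightarrow> (\<forall>i\<in>{..<d}. \<forall>j\<in>{..<d}. norm (A $$ (i, j) - B $$ (i, j)) < e)"

lemma mlim_eventually_close:
  assumes "mlim d d B A" "e > 0"
  shows "\<forall>\<^sub>F t in sequentially. mat_close d e (B t) A"
  unfolding mat_close_def
  by (intro eventually_ball_finite ballI finite_lessThan)
    (use assms in \<open>auto simp: mlim_def tendsto_iff dist_norm\<close>)

lemma mlim_of_close:
  assumes "\<And>t. mat_close d (inverse (real (Suc t))) (B t) A"
  shows "mlim d d B A"
  unfolding mlim_def
proof (intro allI impI)
  fix i j assume "i < d" "j < d"
  then have le: "norm (B t $$ (i, j) - A $$ (i, j)) \<le> inverse (real (Suc t))" for t
    using assms[of t] by (auto simp: mat_close_def intro: less_imp_le)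
  have "(\<lambda>t. norm (B t $$ (i, j) - A $$ (i, j))) \<longlonglongrightarrow> 0"
    by (rule Lim_null_comparison[OF _ LIMSEQ_inverse_real_of_nat]) (use le in simp)
  then show "(\<lambda>t. B t $$ (i, j)) \<longlonglongrightarrow> A $$ (i, j)"
    by (rule LIM_zero_cancel[OF tendsto_norm_zero_cancel])
qed

lemma mat_close_triangle:
  assumes "mat_close d (e / 2) A B" "mat_close d (e / 2) B C"
  shows "mat_close d e A C"
  unfolding mat_close_def
proof (intro ballI)
  fix i j assume "i \<in> {..<d}" "j \<in> {..<d}"
  then have "norm (A $$ (i, j) - B $$ (i, j)) < e / 2" "norm (B $$ (i, j) - C $$ (i, j)) < e / 2"
    using assms by (auto simp: mat_close_def)
  then show "norm (A $$ (i, j) - C $$ (i, j)) < e" by norm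
qed

text \<open>The ratio \<open>b t / a t\<close> converges because it can be computed at
  \<open>z0\<close>, where the limit \<open>\<phi>\<close> is nonzero; it then relates the two
  limits at every \<open>z\<close>.\<close>

lemma two_scales:
  fixes P :: "nat \<Rightarrow> 'z \<Rightarrow> real"
  assumes a: "\<And>t. a t \<noteq> 0" and \<phi>: "\<And>z. z \<in> S \<Longrightarrow> (\<lambda>t. a t * P t z) \<longlonglongrightarrow> \<phi> z"
    and \<psi>: "\<And>z. z \<in> S \<Longrightarrow> (\<lambda>t. b t * P t z) \<longlonglongrightarrow> \<psi> z" and z0: "z0 \<in> S" "\<phi> z0 \<noteq> 0" and z: "z \<in> S"
  shows "\<psi> z = \<psi> z0 / \<phi> z0 * \<phi> z"
proof -
  have ev: "\<forall>\<^sub>F t in sequentially. a t * P t z0 \<noteq> 0" by (rule tendsto_imp_eventually_ne[OF \<phi>[OF z0(1)] z0(2)])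
  have "(\<lambda>t. (b t * P t z0) / (a t * P t z0)) \<longlonglongrightarrow> \<psi> z0 / \<phi> z0" by (intro tendsto_divide \<phi> \<psi> z0)
  then have "(\<lambda>t. b t / a t) \<longlonglongrightarrow> \<psi> z0 / \<phi> z0"
    by (rule Lim_transform_eventually) (use ev in eventually_elim, simp)
  then have "(\<lambda>t. b t / a t * (a t * P t z)) \<longlonglongrightarrow> \<psi> z0 / \<phi> z0 * \<phi> z" by (intro tendsto_mult \<phi> z)
  then have "(\<lambda>t. b t * P t z) \<longlonglongrightarrow> \<psi> z0 / \<phi> z0 * \<phi> z" using a by simp
  then show ?thesis using LIMSEQ_unique[OF \<psi>[OF z]] by blast
qed

text \<open>If no value is taken infinitely often, some later term always avoids all values seen so
  far. The dichotomy makes arbitrary sequences in \<Gamma> accessible, since divergence speaks only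
  of sequences without repetition.\<close>

lemma const_or_inj_subseq:
  fixes \<gamma> :: "nat \<Rightarrow> 'a"
  shows "\<exists>r. strict_mono (r::nat \<Rightarrow> nat) \<and> ((\<forall>t. \<gamma> (r t) = \<gamma> (r 0)) \<or> inj (\<lambda>t. \<gamma> (r t)))"
proof (cases "\<exists>a. infinite {t. \<gamma> t = a}")
  case True
  then obtain a where a: "infinite {t. \<gamma> t = a}" by blast
  show ?thesis
    by (rule exI[of _ "enumerate {t. \<gamma> t = a}"])
      (use strict_mono_enumerate[OF a] enumerate_in_set[OF a] in auto)
next
  case False
  have step: "\<exists>t'>t. \<gamma> t' \<notin> \<gamma> ` {..t}" for t
  proof -
    have "{t'. \<gamma> t' \<in> \<gamma> ` {..t}} = (\<Union>s\<le>t. {t'. \<gamma> t' = \<gamma> s})" by auto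
    then have "finite ({t'. \<gamma> t' \<in> \<gamma> ` {..t}} \<union> {..t})" using False by auto
    then obtain t' where "t' \<notin> {t'. \<gamma> t' \<in> \<gamma> ` {..t}} \<union> {..t}" using ex_new_if_finite[OF infinite_UNIV_nat] by blast
    then show ?thesis by (intro exI[of _ t']) auto
  qed
  have "\<forall>t. \<exists>t'. t < t' \<and> \<gamma> t' \<notin> \<gamma> ` {..t}" by (rule allI) (use step in blast)
  from choice[OF this] obtain h where h: "\<forall>t. h t > t \<and> \<gamma> (h t) \<notin> \<gamma> ` {..t}" by (elim exE)
  define r where "r = rec_nat 0 (\<lambda>_. h)"
  have rS: "r (Suc t) = h (r t)" for t by (simp add: r_def)
  have r: "strict_mono r" unfolding strict_mono_Suc_iff rS using h by blast
  have "\<gamma> (r s) \<noteq> \<gamma> (r t)" if "s < t" for s t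
  proof (cases t)
    case (Suc t')
    then have "r s \<le> r t'" using that r strict_mono_less_eq[of r s t'] by simp
    then have "\<gamma> (r s) \<in> \<gamma> ` {..r t'}" by simp
    then show ?thesis using h[THEN spec, of "r t'"] Suc rS by auto
  qed (use that in simp)
  then have "inj (\<lambda>t. \<gamma> (r t))" by (metis injI linorder_neqE_nat)
  with r show ?thesis by blast
qed

lemma inj_subseq: "inj \<gamma> \<Longrightarrow> strict_mono (r :: nat \<Rightarrow> nat) \<Longrightarrow> inj (\<lambda>t. \<gamma> (r t))"
  using inj_compose[OF _ strict_mono_imp_inj_on[of r]] by (simp add: o_def)

locale transverse =
  fixes d :: nat and \<theta> :: "nat set" and \<Gamma> :: "'k::rc_field mat set set"
  assumes sym: "symmetric_subset d \<theta>" and nonempty: "\<theta> \<noteq> {}" and transverse: "transverse_group d \<theta> \<Gamma>"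
begin

lemma theta: "k \<in> \<theta> \<Longrightarrow> 1 \<le> k" "k \<in> \<theta> \<Longrightarrow> k < d" "k \<in> \<theta> \<Longrightarrow> d - k \<in> \<theta>"
  using sym by (force simp: symmetric_subset_def)+

lemma d_pos: "0 < d" using nonempty theta by fastforce

lemma Gamma_subgroup: "subgroup \<Gamma> (PGL d)"
  using transverse by (simp add: transverse_group_def)

lemma Gamma_PGL: "g \<in> \<Gamma> \<Longrightarrow> g \<in> carrier (PGL d)"
  using subgroup.mem_carrier[OF Gamma_subgroup] .

lemma Gamma_mat:
  assumes "g \<in> \<Gamma>"
  obtains A where "A \<in> carrier_mat d d" "det A \<noteq> 0" "g = pcoset A"
  using Gamma_PGL[OF assms] that by (auto simp: carrier_PGL)

lemma Gamma_mult:
  assumes "pcoset A \<in> \<Gamma>" "pcoset B \<in> \<Gamma>" "A \<in> carrier_mat d d" "det A \<noteq> 0" "B \<in> carrier_mat d d" "det B \<noteq> 0"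
  shows "pcoset (A * B) \<in> \<Gamma>"
  using subgroup.m_closed[OF Gamma_subgroup assms(1,2)] PGL_mult[OF assms(3-6)] by simp

lemma Gamma_inv:
  assumes "pcoset A \<in> \<Gamma>" "A \<in> carrier_mat d d" "det A \<noteq> 0" "B \<in> carrier_mat d d" "det B \<noteq> 0" "B * A = 1\<^sub>m d"
  shows "pcoset B \<in> \<Gamma>"
  using subgroup.m_inv_closed[OF Gamma_subgroup assms(1)] PGL_inv[OF assms(2-6)] by simp

text \<open>Limits of left unitary factors along infinitely many elements. Unitary matrices are used
  instead of flags because they form a compact set and carry the planes of all dimensions in
  \<theta> at once. Asking for infinitely many elements in every neighbourhood makes closedness easy
  and agrees with limits along injective sequences (\<open>lims_of_seq\<close>,
  \<open>seq_of_lims\<close>).\<close>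

definition lims :: "'k mat set" where
  "lims = {l \<in> unitary_mats d. \<forall>e>0. infinite {g \<in> \<Gamma>. \<exists>l' s m. svd_of d g l' s m \<and> mat_close d e l' l}}"

lemma lims_unitary: "l \<in> lims \<Longrightarrow> l \<in> unitary_mats d" by (simp add: lims_def)

lemma lims_carrier: "l \<in> lims \<Longrightarrow> l \<in> carrier_mat d d" using lims_unitary unitary_carrier by blast

lemma lims_of_seq:
  assumes \<gamma>: "inj \<gamma>" "\<And>t::nat. \<gamma> t \<in> \<Gamma>" and svd: "\<And>t. svd_of d (\<gamma> t) (l t) (s t) (m t)"
    and lim: "mlim d d l l0" "l0 \<in> unitary_mats d"
  shows "l0 \<in> lims"
  unfolding lims_def
proof (intro CollectI conjI allI impI lim(2))
  fix e :: real assume e: "e > 0"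
  obtain T where T: "\<And>t. t \<ge> T \<Longrightarrow> mat_close d e (l t) l0"
    using mlim_eventually_close[OF lim(1) e] by (auto simp: eventually_sequentially)
  have "\<gamma> ` {T..} \<subseteq> {g \<in> \<Gamma>. \<exists>l' s m. svd_of d g l' s m \<and> mat_close d e l' l0}"
  proof
    fix g assume "g \<in> \<gamma> ` {T..}"
    then obtain t where t: "t \<ge> T" "g = \<gamma> t" by auto
    have "svd_of d g (l t) (s t) (m t) \<and> mat_close d e (l t) l0" using svd[of t] T[OF t(1)] t(2) by simp
    then show "g \<in> {g \<in> \<Gamma>. \<exists>l' s m. svd_of d g l' s m \<and> mat_close d e l' l0}" using \<gamma>(2)[of t] t(2) by blast
  qed
  moreover have "infinite (\<gamma> ` {T..})" using \<gamma>(1) infinite_Ici by (metis finite_imageD inj_on_subset subset_UNIV)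
  ultimately show "infinite {g \<in> \<Gamma>. \<exists>l' s m. svd_of d g l' s m \<and> mat_close d e l' l0}" using infinite_super by blast
qed

lemma seq_of_lims:
  assumes "l0 \<in> lims"
  obtains \<gamma> l s m where "inj \<gamma>" "\<And>t::nat. \<gamma> t \<in> \<Gamma>" "\<And>t. svd_of d (\<gamma> t) (l t) (s t) (m t)" "mlim d d l l0"
proof -
  define S where "S t = {g \<in> \<Gamma>. \<exists>l' s m. svd_of d g l' s m \<and> mat_close d (inverse (real (Suc t))) l' l0}" for t
  have inf: "infinite (S t)" for t using assms by (simp add: lims_def S_def)
  obtain \<gamma> where \<gamma>: "inj \<gamma>" "\<And>t. \<gamma> t \<in> S t" using inj_choice[of S, OF inf] by blast
  have "\<exists>z. svd_of d (\<gamma> t) (fst z) (fst (snd z)) (snd (snd z)) \<and> mat_close d (inverse (real (Suc t))) (fst z) l0" for t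
  proof -
    obtain l' s m where "svd_of d (\<gamma> t) l' s m \<and> mat_close d (inverse (real (Suc t))) l' l0" using \<gamma>(2)[of t] unfolding S_def by blast
    then show ?thesis by (intro exI[of _ "(l', s, m)"]) simp
  qed
  then have "\<forall>t. \<exists>z. svd_of d (\<gamma> t) (fst z) (fst (snd z)) (snd (snd z)) \<and>
      mat_close d (inverse (real (Suc t))) (fst z) l0" by (rule allI)
  from choice[OF this] obtain z where
    z: "\<forall>t. svd_of d (\<gamma> t) (fst (z t)) (fst (snd (z t))) (snd (snd (z t))) \<and>
      mat_close d (inverse (real (Suc t))) (fst (z t)) l0" by (elim exE)
  show ?thesis
  proof (rule that[of \<gamma> "\<lambda>t. fst (z t)" "\<lambda>t. fst (snd (z t))" "\<lambda>t. snd (snd (z t))"])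
    show "inj \<gamma>" by (rule \<gamma>(1))
    show "\<gamma> t \<in> \<Gamma>" for t using \<gamma>(2)[of t] by (simp add: S_def)
    show "svd_of d (\<gamma> t) (fst (z t)) (fst (snd (z t))) (snd (snd (z t)))" for t using z by blast
    show "mlim d d (\<lambda>t. fst (z t)) l0" by (rule mlim_of_close) (use z in blast)
  qed
qed

lemma lims_closed:
  assumes l: "\<And>t::nat. l t \<in> lims" and lim: "mlim d d l l0" "l0 \<in> carrier_mat d d"
  shows "l0 \<in> lims"
  unfolding lims_def
proof (intro CollectI conjI allI impI)
  show "l0 \<in> unitary_mats d" by (rule unitary_limit[OF lims_unitary[OF l] lim])
  fix e :: real assume e: "e > 0"
  then have "\<forall>\<^sub>F t in sequentially. mat_close d (e / 2) (l t) l0" by (intro mlim_eventually_close lim) simp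
  then obtain t where t: "mat_close d (e / 2) (l t) l0" using eventually_happens sequentially_bot by blast
  have "infinite {g \<in> \<Gamma>. \<exists>l' s m. svd_of d g l' s m \<and> mat_close d (e / 2) l' (l t)}"
    using l[of t] e by (simp add: lims_def)
  moreover have "{g \<in> \<Gamma>. \<exists>l' s m. svd_of d g l' s m \<and> mat_close d (e / 2) l' (l t)} \<subseteq>
     {g \<in> \<Gamma>. \<exists>l' s m. svd_of d g l' s m \<and> mat_close d e l' l0}"
    using mat_close_triangle[OF _ t] by blast
  ultimately show "infinite {g \<in> \<Gamma>. \<exists>l' s m. svd_of d g l' s m \<and> mat_close d e l' l0}" using infinite_super by blast
qed

text \<open>The ratio is the exponential of minus the root value; it involves \<open>k\<close> and
  \<open>k - 1\<close> because \<open>s\<close> counts from 0.\<close>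

lemma gap_tendsto:
  assumes \<gamma>: "inj \<gamma>" "\<And>t::nat. \<gamma> t \<in> \<Gamma>" and svd: "\<And>t. svd_of d (\<gamma> t) (l t) (s t) (m t)" and k: "k \<in> \<theta>"
  shows "(\<lambda>t. s t k / s t (k - 1)) \<longlonglongrightarrow> 0"
proof -
  have "divergent k \<Gamma>" using transverse k by (simp add: transverse_group_def)
  then have "filterlim (\<lambda>t. root_val k (\<gamma> t)) at_top sequentially" using \<gamma> by (auto simp: divergent_def)
  then have "filterlim (\<lambda>t. - root_val k (\<gamma> t)) at_bot sequentially"
    by (subst filterlim_uminus_at_top[symmetric]) (simp add: filterlim_uminus_at_bot)
  then have "(\<lambda>t. exp (- root_val k (\<gamma> t))) \<longlonglongrightarrow> 0" by (rule filterlim_compose[OF exp_at_bot])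
  moreover have "exp (- root_val k (\<gamma> t)) = s t k / s t (k - 1)" for t
  proof -
    have "0 < s t k" "0 < s t (k - 1)" using svd_ofD(3)[OF svd] theta[OF k] by auto
    then show ?thesis using root_val_svd[OF Gamma_PGL[OF \<gamma>(2)] svd theta(1,2)[OF k]]
      by (simp add: exp_minus)
  qed
  ultimately show ?thesis by simp
qed

lemma eventually_gap:
  assumes \<gamma>: "inj \<gamma>" "\<And>t::nat. \<gamma> t \<in> \<Gamma>" and svd: "\<And>t. svd_of d (\<gamma> t) (l t) (s t) (m t)" and k: "k \<in> \<theta>"
  shows "\<forall>\<^sub>F t in sequentially. cartan_subspace d k (\<gamma> t) = cspace d (l t * std_frame d k)"
proof -
  have "\<forall>\<^sub>F t in sequentially. s t k / s t (k - 1) < 1"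
    by (rule order_tendstoD(2)[OF gap_tendsto[OF \<gamma> svd k]]) simp
  then show ?thesis
  proof (rule eventually_mono)
    fix t assume lt: "s t k / s t (k - 1) < 1"
    have "0 < s t (k - 1)" using svd_ofD(3)[OF svd] theta[OF k] by auto
    then have "s t k < s t (k - 1)" using lt by simp
    then show "cartan_subspace d k (\<gamma> t) = cspace d (l t * std_frame d k)"
      by (rule cartan_subspace_svd[OF Gamma_PGL[OF \<gamma>(2)] svd theta(1,2)[OF k]])
  qed
qed

section \<open>Flags of unitary matrices and the limit set\<close>

definition flag :: "'k mat \<Rightarrow> nat \<Rightarrow> 'k vec set" where
  "flag l = (\<lambda>j\<in>\<theta>. cspace d (l * std_frame d j))"

lemma flag_in_flags:
  assumes l: "l \<in> unitary_mats d"
  shows "flag l \<in> flags d \<theta>"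
  unfolding flags_def
proof (intro CollectI conjI ballI impI)
  show "flag l \<in> (\<Pi>\<^sub>E k\<in>\<theta>. Gr d k)"
    using frame_unitary_std[OF l] theta by (auto simp: flag_def Gr_eq_frames less_imp_le)
  fix j k assume jk: "j \<in> \<theta>" "k \<in> \<theta>" "j \<le> k"
  then show "flag l j \<subseteq> flag l k"
    using mem_cspace_std[OF l, of j] mem_cspace_std[OF l, of k] theta(2)[OF jk(1)] theta(2)[OF jk(2)]
    by (auto simp: flag_def less_imp_le)
qed

lemma limitin_flag:
  fixes l :: "nat \<Rightarrow> 'k mat"
  assumes l: "\<And>t::nat. l t \<in> unitary_mats d" "mlim d d l l0" "l0 \<in> unitary_mats d" and k: "k \<in> \<theta>"
  shows "limitin (Gr_topology d k) (\<lambda>t. cspace d (l t * std_frame d k)) (cspace d (l0 * std_frame d k)) sequentially"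
proof (rule limitin_GrI)
  have kd: "k \<le> d" using theta(2)[OF k] by simp
  show "frame d k (l0 * std_frame d k)" by (rule frame_unitary_std[OF l(3) kd])
  show "\<forall>\<^sub>F t in sequentially. frame d k (l t * std_frame d k)" using frame_unitary_std[OF l(1) kd] by simp
  show "mlim d k (\<lambda>t. l t * std_frame d k) (l0 * std_frame d k)"
    by (rule mlim_mult[OF l(2) mlim_const]) (use unitary_carrier[OF l(1)] unitary_carrier[OF l(3)] in auto)
qed

lemma limitin_flag_topology:
  assumes l: "\<And>t::nat. l t \<in> unitary_mats d" "mlim d d l l0" "l0 \<in> unitary_mats d"
  shows "limitin (flag_topology d \<theta>) (\<lambda>t. flag (l t)) (flag l0) sequentially"
  unfolding flag_topology_def limitin_subtopology limitin_componentwise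
proof (intro conjI ballI)
  show "flag l0 \<in> flags d \<theta>" by (rule flag_in_flags[OF l(3)])
  show "\<forall>\<^sub>F t in sequentially. flag (l t) \<in> flags d \<theta>" using flag_in_flags[OF l(1)] by simp
  show "flag l0 \<in> extensional \<theta>" by (simp add: flag_def)
  have "flag (l t) \<in> topspace (product_topology (\<lambda>k. Gr_topology d k) \<theta>)" for t
    using flag_in_flags[OF l(1)] by (simp add: topspace_Gr_topology flags_def)
  then show "\<forall>\<^sub>F t in sequentially. flag (l t) \<in> topspace (product_topology (\<lambda>k. Gr_topology d k) \<theta>)" by simp
  fix k assume k: "k \<in> \<theta>"
  show "limitin (Gr_topology d k) (\<lambda>t. flag (l t) k) (flag l0 k) sequentially"
    using limitin_flag[OF l k] k by (simp add: flag_def)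
qed

lemma finite_theta: "finite \<theta>"
  by (rule finite_subset[of _ "{..<d}"]) (use theta in auto)

lemma eventually_flag:
  assumes \<gamma>: "inj \<gamma>" "\<And>t::nat. \<gamma> t \<in> \<Gamma>" and svd: "\<And>t. svd_of d (\<gamma> t) (l t) (s t) (m t)"
  shows "\<forall>\<^sub>F t in sequentially. (\<lambda>k\<in>\<theta>. cartan_subspace d k (\<gamma> t)) = flag (l t)"
proof -
  have "\<forall>\<^sub>F t in sequentially. \<forall>k\<in>\<theta>. cartan_subspace d k (\<gamma> t) = cspace d (l t * std_frame d k)"
    by (intro eventually_ball_finite[OF finite_theta] ballI eventually_gap[OF \<gamma> svd])
  then show ?thesis by eventually_elim (auto simp: flag_def intro!: restrict_ext)
qed

lemma svd_seq:
  assumes "\<And>t::nat. \<gamma> t \<in> \<Gamma>"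
  obtains l s m where "\<And>t. svd_of d (\<gamma> t) (l t) (s t) (m t)"
proof -
  have "\<exists>z. svd_of d (\<gamma> t) (fst z) (fst (snd z)) (snd (snd z))" for t
  proof -
    obtain l' s m where "svd_of d (\<gamma> t) l' s m" using svd_of_exists[OF Gamma_PGL[OF assms] d_pos] by blast
    then show ?thesis by (intro exI[of _ "(l', s, m)"]) simp
  qed
  then have "\<forall>t. \<exists>z. svd_of d (\<gamma> t) (fst z) (fst (snd z)) (snd (snd z))" by (rule allI)
  from choice[OF this] obtain z where
    "\<forall>t. svd_of d (\<gamma> t) (fst (z t)) (fst (snd (z t))) (snd (snd (z t)))" by (elim exE)
  then show ?thesis by (intro that[of "\<lambda>t. fst (z t)" "\<lambda>t. fst (snd (z t))" "\<lambda>t. snd (snd (z t))"]) simp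
qed

text \<open>Left unitary factors converge along a subsequence, and the Cartan subspaces are spanned
  by their first columns as soon as the gap is positive, hence eventually. Uniqueness of limits in
  each Grassmannian identifies a given limit with the flag of a matrix in
  \<open>lims\<close>.\<close>

lemma limit_set_eq: "limit_set d \<theta> \<Gamma> = flag ` lims"
proof (intro equalityI subsetI)
  fix F assume "F \<in> limit_set d \<theta> \<Gamma>"
  then obtain \<gamma> :: "nat \<Rightarrow> 'k mat set" where \<gamma>: "inj \<gamma>" "range \<gamma> \<subseteq> \<Gamma>"
    and lim: "limitin (flag_topology d \<theta>) (\<lambda>i. \<lambda>k\<in>\<theta>. cartan_subspace d k (\<gamma> i)) F sequentially"
    by (auto simp: limit_set_def)
  have \<gamma>': "\<gamma> t \<in> \<Gamma>" for t using \<gamma>(2) by auto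
  obtain l s m where svd: "\<And>t. svd_of d (\<gamma> t) (l t) (s t) (m t)"
    by (rule svd_seq[of \<gamma>, OF \<gamma>']) (rule that)
  obtain l0 r where r: "l0 \<in> unitary_mats d" "strict_mono r" "mlim d d (\<lambda>t. l (r t)) l0"
    using unitary_subseq[of l, OF svd_ofD(1)[OF svd]] .
  have "inj (\<lambda>t. \<gamma> (r t))" by (rule inj_subseq[OF \<gamma>(1) r(2)])
  then have l0: "l0 \<in> lims" by (rule lims_of_seq[OF _ \<gamma>' svd r(3,1)])
  have "F k = flag l0 k" if k: "k \<in> \<theta>" for k
  proof -
    have "limitin (Gr_topology d k) (\<lambda>t. cartan_subspace d k (\<gamma> t)) (F k) sequentially"
      using lim k by (auto simp: flag_topology_def limitin_subtopology limitin_componentwise)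
    then have 1: "limitin (Gr_topology d k) (\<lambda>t. cartan_subspace d k (\<gamma> (r t))) (F k) sequentially"
      using limitin_subsequence[OF r(2)] by (simp add: o_def)
    have ev: "\<forall>\<^sub>F t in sequentially. cspace d (l (r t) * std_frame d k) = cartan_subspace d k (\<gamma> (r t))"
      using eventually_subseq[OF r(2) eventually_gap[OF \<gamma>(1) \<gamma>' svd k]] by (simp add: eq_commute)
    have 2: "limitin (Gr_topology d k) (\<lambda>t. cartan_subspace d k (\<gamma> (r t))) (cspace d (l0 * std_frame d k)) sequentially"
      by (rule limitin_transform_eventually[OF ev limitin_flag[OF svd_ofD(1)[OF svd] r(3,1) k]])
    show ?thesis using limitin_Gr_unique[OF 1 2] k by (simp add: flag_def)
  qed
  moreover have "F \<in> extensional \<theta>"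
    using lim by (auto simp: flag_topology_def limitin_subtopology limitin_componentwise)
  ultimately have "F = flag l0" by (intro extensionalityI[of _ \<theta>]) (auto simp: flag_def)
  then show "F \<in> flag ` lims" using l0 by blast
next
  fix F assume "F \<in> flag ` lims"
  then obtain l0 where l0: "l0 \<in> lims" "F = flag l0" by blast
  obtain \<gamma> l s m where \<gamma>: "inj \<gamma>" "\<And>t::nat. \<gamma> t \<in> \<Gamma>" and svd: "\<And>t. svd_of d (\<gamma> t) (l t) (s t) (m t)" and lim: "mlim d d l l0"
    by (rule seq_of_lims[OF l0(1)]) (rule that)
  have ev: "\<forall>\<^sub>F t in sequentially. flag (l t) = (\<lambda>k\<in>\<theta>. cartan_subspace d k (\<gamma> t))"
    using eventually_flag[OF \<gamma> svd] by (simp add: eq_commute)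
  have "limitin (flag_topology d \<theta>) (\<lambda>i. \<lambda>k\<in>\<theta>. cartan_subspace d k (\<gamma> i)) F sequentially"
    unfolding l0(2)
    by (rule limitin_transform_eventually[OF ev limitin_flag_topology[OF svd_ofD(1)[OF svd] lim lims_unitary[OF l0(1)]]])
  then show "F \<in> limit_set d \<theta> \<Gamma>" unfolding limit_set_def using \<gamma> by (intro CollectI exI[of _ \<gamma>]) auto
qed

text \<open>Inversion exchanges the roles of the two unitary factors (\<open>svd_of_inv\<close>), so
  the limit of the right factors also yields a member of \<open>lims\<close>: it describes where the
  inverses attract.\<close>

lemma dynamics:
  assumes \<gamma>: "inj \<gamma>" "\<And>t::nat. \<gamma> t \<in> \<Gamma>" and svd: "\<And>t. svd_of d (\<gamma> t) (l t) (s t) (m t)"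
    and l: "mlim d d l l0" "l0 \<in> unitary_mats d" and m: "mlim d d m m0" "m0 \<in> unitary_mats d"
  shows "l0 \<in> lims" "mat_adjoint m0 * rev_mat d \<in> lims"
    and "j \<in> \<theta> \<Longrightarrow> Y \<in> carrier_mat d j \<Longrightarrow> X \<in> carrier_mat d j \<Longrightarrow>
      (\<lambda>t. pairing (l t * mat_diag d (\<lambda>i. of_real (s t i)) * m t * Y) X / (\<Prod>i<j. s t i)\<^sup>2) \<longlonglongrightarrow>
       pairing Y (mat_adjoint m0 * std_frame d j) * pairing (l0 * std_frame d j) X"
proof -
  show "l0 \<in> lims" by (rule lims_of_seq[OF \<gamma> svd l])
  have mc: "m t \<in> carrier_mat d d" "l t \<in> carrier_mat d d" for t
    using svd_ofD(1,2)[OF svd[of t]] unitary_carrier by auto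
  show "mat_adjoint m0 * rev_mat d \<in> lims"
  proof (rule lims_of_seq[where \<gamma> = "\<lambda>t. inv\<^bsub>PGL d\<^esub> (\<gamma> t)"])
    have "\<gamma> t = \<gamma> t'" if "inv\<^bsub>PGL d\<^esub> (\<gamma> t) = inv\<^bsub>PGL d\<^esub> (\<gamma> t')" for t t'
      using that group.inv_inv[OF group_PGL Gamma_PGL[OF \<gamma>(2)]] by metis
    then show "inj (\<lambda>t. inv\<^bsub>PGL d\<^esub> (\<gamma> t))" using \<gamma>(1) by (meson injI injD)
    show "inv\<^bsub>PGL d\<^esub> (\<gamma> t) \<in> \<Gamma>" for t by (rule subgroup.m_inv_closed[OF Gamma_subgroup \<gamma>(2)])
    show "svd_of d (inv\<^bsub>PGL d\<^esub> (\<gamma> t)) (mat_adjoint (m t) * rev_mat d) (\<lambda>i. 1 / s t (d - 1 - i)) (rev_mat d * mat_adjoint (l t))" for t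
      by (rule svd_of_inv[OF Gamma_PGL[OF \<gamma>(2)] svd])
    show "mlim d d (\<lambda>t. mat_adjoint (m t) * rev_mat d) (mat_adjoint m0 * rev_mat d)"
      by (rule mlim_mult[OF mlim_adjoint[OF m(1)] mlim_const])
        (use mc unitary_carrier[OF m(2)] in auto)
    show "mat_adjoint m0 * rev_mat d \<in> unitary_mats d"
      by (rule unitary_mult[OF unitary_adjoint[OF m(2)] rev_mat_unitary])
  qed
  assume j: "j \<in> \<theta>" and Y: "Y \<in> carrier_mat d j" and X: "X \<in> carrier_mat d j"
  show "(\<lambda>t. pairing (l t * mat_diag d (\<lambda>i. of_real (s t i)) * m t * Y) X / (\<Prod>i<j. s t i)\<^sup>2) \<longlonglongrightarrow>
       pairing Y (mat_adjoint m0 * std_frame d j) * pairing (l0 * std_frame d j) X"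
    by (rule pairing_cartan_limit[OF theta(1,2)[OF j] svd_ofD(3)[OF svd] svd_ofD(4)[OF svd] gap_tendsto[OF \<gamma> svd j]
        l(1) mc(2) unitary_carrier[OF l(2)] m(1) mc(1) unitary_carrier[OF m(2)] Y X])
qed

text \<open>The matrices \<open>B A\<^sub>t\<close> and the representatives of \<open>B A\<^sub>t\<close> with unit determinant differ by scalars, so
  the two rank-one limits of the pairing are proportional, and they determine the column spaces.\<close>

lemma lims_invariant:
  assumes l0: "l0 \<in> lims" and B: "B \<in> carrier_mat d d" "det B \<noteq> 0" "pcoset B \<in> \<Gamma>"
  obtains l1 where "l1 \<in> lims" "\<And>j. j \<in> \<theta> \<Longrightarrow> cspace d (B * (l0 * std_frame d j)) = cspace d (l1 * std_frame d j)"
proof -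
  obtain \<gamma> l s m where \<gamma>: "inj \<gamma>" "\<And>t::nat. \<gamma> t \<in> \<Gamma>" and svd: "\<And>t. svd_of d (\<gamma> t) (l t) (s t) (m t)" and lim: "mlim d d l l0"
    by (rule seq_of_lims[OF l0]) (rule that)
  define \<delta> where "\<delta> t = pcoset B \<otimes>\<^bsub>PGL d\<^esub> \<gamma> t" for t
  have \<delta>G: "\<delta> t \<in> \<Gamma>" for t unfolding \<delta>_def by (rule subgroup.m_closed[OF Gamma_subgroup B(3) \<gamma>(2)])
  have \<delta>inj: "inj \<delta>"
  proof (rule injI)
    interpret PGL: group "PGL d :: 'k mat set monoid" by (rule group_PGL)
    fix t t' assume "\<delta> t = \<delta> t'"
    then have "\<gamma> t = \<gamma> t'" unfolding \<delta>_def
      using PGL.Units_l_cancel[of "pcoset B" "\<gamma> t" "\<gamma> t'"] PGL.Units_eq Gamma_PGL[OF B(3)]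
        Gamma_PGL[OF \<gamma>(2), of t] Gamma_PGL[OF \<gamma>(2), of t'] by simp
    then show "t = t'" using \<gamma>(1) by (simp add: injD)
  qed
  obtain l' s' m' where svd': "\<And>t. svd_of d (\<delta> t) (l' t) (s' t) (m' t)"
    by (rule svd_seq[of \<delta>, OF \<delta>G]) (rule that)
  obtain m0 r1 where r1: "m0 \<in> unitary_mats d" "strict_mono r1" "mlim d d (\<lambda>t. m (r1 t)) m0"
    using unitary_subseq[of m, OF svd_ofD(2)[OF svd]] .
  obtain l1 r2 where r2: "l1 \<in> unitary_mats d" "strict_mono r2" "mlim d d (\<lambda>t. l' (r1 (r2 t))) l1"
    using unitary_subseq[of "\<lambda>t. l' (r1 t)", OF svd_ofD(1)[OF svd']] .
  obtain m1 r3 where r3: "m1 \<in> unitary_mats d" "strict_mono r3" "mlim d d (\<lambda>t. m' (r1 (r2 (r3 t)))) m1"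
    using unitary_subseq[of "\<lambda>t. m' (r1 (r2 t))", OF svd_ofD(2)[OF svd']] .
  define r where "r t = r1 (r2 (r3 t))" for t
  have r23: "strict_mono (\<lambda>t. r2 (r3 t))" using strict_mono_o[OF r2(2) r3(2)] by (simp add: o_def)
  have rm: "strict_mono r" using strict_mono_o[OF r1(2) r23] by (simp add: o_def r_def[abs_def])
  have rinj: "inj (\<lambda>t. \<gamma> (r t))" "inj (\<lambda>t. \<delta> (r t))"
    by (rule inj_subseq[OF \<gamma>(1) rm], rule inj_subseq[OF \<delta>inj rm])
  note dyn = dynamics[of "\<lambda>t. \<gamma> (r t)" "\<lambda>t. l (r t)" "\<lambda>t. s (r t)" "\<lambda>t. m (r t)" l0 m0,
      OF rinj(1) \<gamma>(2) svd mlim_subseq[OF lim rm] lims_unitary[OF l0]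
      mlim_subseq[OF r1(3) r23, folded r_def] r1(1)]
  note dyn' = dynamics[of "\<lambda>t. \<delta> (r t)" "\<lambda>t. l' (r t)" "\<lambda>t. s' (r t)" "\<lambda>t. m' (r t)" l1 m1,
      OF rinj(2) \<delta>G svd' mlim_subseq[OF r2(3) r3(2), folded r_def] r2(1) r3(3)[folded r_def] r3(1)]
  define A where "A t = l t * mat_diag d (\<lambda>i. of_real (s t i)) * m t" for t
  define A' where "A' t = l' t * mat_diag d (\<lambda>i. of_real (s' t i)) * m' t" for t
  have A: "A t \<in> carrier_mat d d" "det (A t) \<noteq> 0" "\<gamma> t = pcoset (A t)" for t
    unfolding A_def using svd_of_mat[OF Gamma_PGL[OF \<gamma>(2)] svd] by auto
  have A': "A' t \<in> carrier_mat d d" "\<delta> t = pcoset (A' t)" for t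
    unfolding A'_def using svd_of_mat[OF Gamma_PGL[OF \<delta>G] svd'] by auto
  have "\<exists>e. e \<noteq> 0 \<and> A' t = e \<cdot>\<^sub>m (B * A t)" for t
  proof -
    have "pcoset (A' t) = pcoset (B * A t)"
      using A'(2)[of t] PGL_mult[OF B(1,2) A(1,2)[of t]] A(3)[of t] by (simp add: \<delta>_def)
    then show ?thesis by (metis pcoset_eqD)
  qed
  then have "\<forall>t. \<exists>e. e \<noteq> 0 \<and> A' t = e \<cdot>\<^sub>m (B * A t)" by (rule allI)
  from choice[OF this] obtain e where e: "\<forall>t. e t \<noteq> 0 \<and> A' t = e t \<cdot>\<^sub>m (B * A t)" by (elim exE)
  have "cspace d (B * (l0 * std_frame d j)) = cspace d (l1 * std_frame d j)" if j: "j \<in> \<theta>" for j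
  proof -
    let ?M = "mat_adjoint m0 * std_frame d j" and ?M' = "mat_adjoint m1 * std_frame d j"
    let ?L = "B * (l0 * std_frame d j)" and ?L' = "l1 * std_frame d j"
    have jd: "j \<le> d" using theta(2)[OF j] by simp
    have fM: "frame d j ?M" "frame d j ?M'" "frame d j ?L'"
      using frame_unitary_std[OF unitary_adjoint[OF r1(1)] jd] frame_unitary_std[OF unitary_adjoint[OF r3(1)] jd]
        frame_unitary_std[OF r2(1) jd] by auto
    have fL0: "frame d j (l0 * std_frame d j)" by (rule frame_unitary_std[OF lims_unitary[OF l0] jd])
    have fL: "frame d j ?L" by (rule frame_mult_invertible[OF B(1,2) fL0])
    note cM = fM[THEN frame_carrier] and cL = frame_carrier[OF fL] and cL0 = frame_carrier[OF fL0]
    let ?S = "carrier_mat d j \<times> carrier_mat d j"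
    define P where "P t z = pairing (B * A (r t) * fst z) (snd z)" for t and z :: "'k mat \<times> 'k mat"
    define \<phi> where "\<phi> z = pairing (fst z) ?M * pairing ?L (snd z)" for z
    define \<psi> where "\<psi> z = pairing (fst z) ?M' * pairing ?L' (snd z)" for z
    define a where "a t = 1 / (\<Prod>i<j. s (r t) i)\<^sup>2" for t
    define b where "b t = (norm (e (r t)) ^ j)\<^sup>2 / (\<Prod>i<j. s' (r t) i)\<^sup>2" for t
    have pos: "(\<Prod>i<j. s (r t) i) > 0" "(\<Prod>i<j. s' (r t) i) > 0" for t
      using svd_ofD(3)[OF svd, of _ "r t"] svd_ofD(3)[OF svd', of _ "r t"] jd by (auto intro!: prod_pos)
    have \<phi>: "(\<lambda>t. a t * P t z) \<longlonglongrightarrow> \<phi> z" if z: "z \<in> ?S" for z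
    proof -
      have zc: "fst z \<in> carrier_mat d j" "snd z \<in> carrier_mat d j" using z by auto
      have BX: "mat_adjoint B * snd z \<in> carrier_mat d j" using B(1) zc by simp
      have "P t z = pairing (A (r t) * fst z) (mat_adjoint B * snd z)" for t
      proof -
        have AY: "A (r t) * fst z \<in> carrier_mat d j" by (rule mult_carrier_mat[OF A(1) zc(1)])
        show ?thesis unfolding P_def assoc_mult_mat[OF B(1) A(1) zc(1)] by (rule pairing_mult_left[OF B(1) AY zc(2)])
      qed
      moreover have "\<phi> z = pairing (fst z) ?M * pairing (l0 * std_frame d j) (mat_adjoint B * snd z)"
        unfolding \<phi>_def using pairing_mult_left[OF B(1) cL0 zc(2)] by simp
      ultimately show ?thesis using dyn(3)[OF j zc(1) BX] by (simp add: a_def A_def)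
    qed
    have \<psi>: "(\<lambda>t. b t * P t z) \<longlonglongrightarrow> \<psi> z" if z: "z \<in> ?S" for z
    proof -
      have zc: "fst z \<in> carrier_mat d j" "snd z \<in> carrier_mat d j" using z by auto
      have "pairing (A' (r t) * fst z) (snd z) = (norm (e (r t)) ^ j)\<^sup>2 * P t z" for t
      proof -
        have BA: "B * A (r t) \<in> carrier_mat d d" by (rule mult_carrier_mat[OF B(1) A(1)])
        have "A' (r t) * fst z = e (r t) \<cdot>\<^sub>m (B * A (r t) * fst z)"
          using e mult_smult_assoc_mat[OF BA zc(1)] by simp
        then show ?thesis unfolding P_def using pairing_smult_left[OF mult_carrier_mat[OF BA zc(1)] zc(2)] by simp
      qed
      then show ?thesis using dyn'(3)[OF j zc] by (simp add: b_def A'_def \<psi>_def)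
    qed
    have "a t > 0" for t unfolding a_def by (intro divide_pos_pos zero_less_power pos) simp
    then have a0: "a t \<noteq> 0" for t by (metis less_irrefl)
    \<comment> \<open>At this argument both factors of \<open>\<phi>\<close> are pairings of a frame
      with itself, hence nonzero.\<close>
    let ?z0 = "(?M, ?L)"
    have z0: "?z0 \<in> ?S" "\<phi> ?z0 \<noteq> 0" using cM cL pairing_self[OF fM(1)] pairing_self[OF fL] by (auto simp: \<phi>_def)
    define \<rho> where "\<rho> = \<psi> ?z0 / \<phi> ?z0"
    have eq: "\<psi> z = \<rho> * \<phi> z" if z: "z \<in> ?S" for z
      unfolding \<rho>_def by (rule two_scales[of a ?S P \<phi> b \<psi> ?z0 z, OF a0 \<phi> \<psi> z0 z])
    have \<psi>1: "\<psi> (?M', ?L') \<noteq> 0" using pairing_self[OF fM(2)] pairing_self[OF fM(3)] by (simp add: \<psi>_def)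
    have \<rho>: "\<rho> \<noteq> 0" using eq[of "(?M', ?L')"] \<psi>1 cM by auto
    show ?thesis
    proof (rule cspace_eq_of_pairing_zeros[OF fL fM(3)])
      fix X :: "'k mat" assume X: "X \<in> carrier_mat d j"
      \<comment> \<open>Testing with \<open>?M\<close> and with \<open>?M'\<close>, whose pairings
        with themselves are positive, transfers the zeros of \<open>?L'\<close> to \<open>?L\<close>
        and those of \<open>?L\<close> to \<open>?L'\<close>.\<close>
      have 1: "pairing ?M ?M' * pairing ?L' X = \<rho> * (pairing ?M ?M * pairing ?L X)"
        using eq[of "(?M, X)"] cM X by (simp add: \<psi>_def \<phi>_def)
      have 2: "pairing ?M' ?M' * pairing ?L' X = \<rho> * (pairing ?M' ?M * pairing ?L X)"
        using eq[of "(?M', X)"] cM X by (simp add: \<psi>_def \<phi>_def)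
      show "pairing ?L X = 0 \<longleftrightarrow> pairing ?L' X = 0"
        using 1 2 \<rho> pairing_self[OF fM(1)] pairing_self[OF fM(2)] by auto
    qed
  qed
  with dyn'(1) that show ?thesis by blast
qed

end

section \<open>Faithfulness on frames\<close>

lemma nonzero_entry:
  assumes "v \<in> carrier_vec n" "v \<noteq> 0\<^sub>v n"
  obtains i where "i < n" "v $ i \<noteq> 0"
proof (rule ccontr)
  assume "\<not> thesis"
  then have "v $ i = 0" if "i < n" for i using that \<open>\<And>i. i < n \<Longrightarrow> v $ i \<noteq> 0 \<Longrightarrow> thesis\<close> by blast
  then have "v = 0\<^sub>v n" using assms(1) by (intro eq_vecI) auto
  then show False using assms(2) by simp
qed

text \<open>A vector \<open>v\<close> supported on two coordinates is completed to a
  \<open>k\<close>-frame by basis vectors away from these coordinates, which is possible as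
  \<open>k < d\<close>. Its image under \<open>A\<close> stays in the plane of the frame, so the two
  coordinates of the image are proportional to those of \<open>v\<close>. Unit vectors show that
  \<open>A\<close> is diagonal, and sums of two unit vectors that its diagonal is constant.\<close>

lemma scalar_of_preserving_spaces:
  fixes A :: "'k::rc_field mat"
  assumes A: "A \<in> carrier_mat d d" and k: "1 \<le> k" "k < d"
    and pres: "\<And>Y. frame d k Y \<Longrightarrow> cspace d (A * Y) = cspace d Y"
  shows "\<exists>c. A = c \<cdot>\<^sub>m 1\<^sub>m d"
proof -
  have key: "\<exists>x0. (A *\<^sub>v v) $ i = x0 * v $ i \<and> (A *\<^sub>v v) $ j = x0 * v $ j"
    if ij: "i < d" "j < d" "i \<noteq> j" and v: "v \<in> carrier_vec d" "v $ i \<noteq> 0"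
      and v0: "\<And>r. r < d \<Longrightarrow> r \<noteq> i \<Longrightarrow> r \<noteq> j \<Longrightarrow> v $ r = 0" for i j v
  proof -
    \<comment> \<open>The \<open>k - 1\<close> further columns have to fit into the
      \<open>d - 2\<close> remaining coordinates.\<close>
    have "card {1..<k} \<le> card ({..<d} - {i, j})" using ij k by (simp add: card_Diff_subset)
    then obtain h where h: "h ` {1..<k} \<subseteq> {..<d} - {i, j}" "inj_on h {1..<k}"
      using card_le_inj[of "{1..<k}" "{..<d} - {i, j}"] by auto
    define Y where "Y = mat d k (\<lambda>(r, c). if c = 0 then v $ r else if r = h c then 1 else 0)"
    have Y: "Y \<in> carrier_mat d k" by (simp add: Y_def)
    have Yr: "(Y *\<^sub>v x) $ r = x $ 0 * v $ r + (\<Sum>c\<in>{1..<k}. if r = h c then x $ c else 0)"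
      if "x \<in> carrier_vec k" "r < d" for x r
    proof -
      have "(Y *\<^sub>v x) $ r = (\<Sum>c<k. Y $$ (r, c) * x $ c)" by (rule mult_vec_index[OF Y that])
      also have "{..<k} = insert 0 {1..<k}" using k by auto
      also have "(\<Sum>c\<in>insert 0 {1..<k}. Y $$ (r, c) * x $ c) = Y $$ (r, 0) * x $ 0 + (\<Sum>c\<in>{1..<k}. Y $$ (r, c) * x $ c)"
        by simp
      also have "(\<Sum>c\<in>{1..<k}. Y $$ (r, c) * x $ c) = (\<Sum>c\<in>{1..<k}. if r = h c then x $ c else 0)"
        by (rule sum.cong) (use that in \<open>auto simp: Y_def\<close>)
      finally show ?thesis using that k by (simp add: Y_def mult.commute)
    qed
    have Yij: "(Y *\<^sub>v x) $ r = x $ 0 * v $ r" if "x \<in> carrier_vec k" "r = i \<or> r = j" for x r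
    proof -
      have "r \<noteq> h c" if c: "c \<in> {1..<k}" for c
      proof -
        have "h c \<in> {..<d} - {i, j}" using h(1) c by blast
        then show ?thesis using \<open>r = i \<or> r = j\<close> by auto
      qed
      then have "(\<Sum>c\<in>{1..<k}. if r = h c then x $ c else 0) = 0" by (intro sum.neutral) auto
      then show ?thesis using Yr[of x r] that ij by auto
    qed
    have Yh: "(Y *\<^sub>v x) $ (h c) = x $ c" if "x \<in> carrier_vec k" "c \<in> {1..<k}" for x c
    proof -
      have "h c \<in> {..<d} - {i, j}" using h(1) that(2) by blast
      then have hc: "h c < d" "h c \<noteq> i" "h c \<noteq> j" by auto
      have "(\<Sum>c'\<in>{1..<k}. if h c = h c' then x $ c' else 0) = (\<Sum>c'\<in>{1..<k}. if c' = c then x $ c' else 0)"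
        by (rule sum.cong) (use h(2) that(2) in \<open>auto simp: inj_on_def\<close>)
      then show ?thesis using Yr[OF that(1) hc(1)] v0[OF hc] that(2) by simp
    qed
    have fY: "frame d k Y" unfolding frame_iff_inj[OF Y]
    proof (intro ballI impI)
      fix x :: "'k vec" assume x: "x \<in> carrier_vec k" "Y *\<^sub>v x = 0\<^sub>v d"
      have x0: "x $ 0 = 0" using Yij[OF x(1), of i] x(2) ij v(2) by simp
      show "x = 0\<^sub>v k"
      proof (rule eq_vecI)
        fix c assume "c < dim_vec (0\<^sub>v k :: 'k vec)"
        then have c: "c < k" by simp
        show "x $ c = 0\<^sub>v k $ c"
        proof (cases "c = 0")
          case False
          then have "c \<in> {1..<k}" using c by auto
          then have "x $ c = 0\<^sub>v d $ h c" using Yh[OF x(1)] x(2) by simp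
          moreover have "h c \<in> {..<d} - {i, j}" using h(1) \<open>c \<in> {1..<k}\<close> by blast
          ultimately show ?thesis using c by simp
        qed (use x0 c in simp)
      qed (use x in simp)
    qed
    have vY: "v = col Y 0" using v k by (intro eq_vecI) (auto simp: Y_def)
    have "A *\<^sub>v v = col (A * Y) 0" unfolding vY using A Y k by (intro eq_vecI) auto
    also have "\<dots> \<in> cspace d (A * Y)" by (rule col_in_cspace[OF mult_carrier_mat[OF A Y]]) (use k in simp)
    finally have "A *\<^sub>v v \<in> cspace d Y" using pres[OF fY] by simp
    then obtain x where x: "x \<in> carrier_vec k" "A *\<^sub>v v = Y *\<^sub>v x" by (auto simp: cspace_eq[OF Y])
    show ?thesis using Yij[OF x(1), of i] Yij[OF x(1), of j] x(2) by (intro exI[of _ "x $ 0"]) simp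
  qed
  have off: "A $$ (j, i) = 0" if ij: "i < d" "j < d" "i \<noteq> j" for i j
  proof -
    obtain x0 where "(A *\<^sub>v unit_vec d i) $ j = x0 * unit_vec d i $ j"
      using key[OF ij, of "unit_vec d i"] ij by auto
    then show ?thesis using A that by (simp add: mult_unit_vec[OF A])
  qed
  have diag: "A $$ (i, i) = A $$ (j, j)" if ij: "i < d" "j < d" "i \<noteq> j" for i j
  proof -
    let ?v = "unit_vec d i + unit_vec d j :: 'k vec"
    obtain x0 where x0: "(A *\<^sub>v ?v) $ i = x0 * ?v $ i" "(A *\<^sub>v ?v) $ j = x0 * ?v $ j"
      using key[OF ij, of ?v] ij by auto
    have "A *\<^sub>v ?v = col A i + col A j"
      using that A by (simp add: mult_add_distrib_mat_vec[OF A] mult_unit_vec[OF A])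
    then have "A $$ (i, i) + A $$ (i, j) = x0" "A $$ (j, i) + A $$ (j, j) = x0" using x0 that A by auto
    then show ?thesis using off[of i j] off[of j i] that by simp
  qed
  have "A = A $$ (0, 0) \<cdot>\<^sub>m 1\<^sub>m d"
  proof (rule eq_matI)
    fix i j assume "i < dim_row (A $$ (0, 0) \<cdot>\<^sub>m 1\<^sub>m d)" "j < dim_col (A $$ (0, 0) \<cdot>\<^sub>m 1\<^sub>m d)"
    then have ij: "i < d" "j < d" by auto
    show "A $$ (i, j) = (A $$ (0, 0) \<cdot>\<^sub>m 1\<^sub>m d) $$ (i, j)"
    proof (cases "i = j")
      case True
      then have "A $$ (i, j) = A $$ (0, 0)" using diag[of i 0] ij k by (cases "i = 0") auto
      then show ?thesis using True ij by simp
    next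
      case False
      then show ?thesis using off[of j i] ij by simp
    qed
  qed (use A in auto)
  then show ?thesis by blast
qed

lemma nonzero_mat_entry:
  assumes "M \<in> carrier_mat m n" "M \<noteq> 0\<^sub>m m n"
  obtains i where "i \<in> {..<m} \<times> {..<n}" "M $$ i \<noteq> 0"
proof (rule ccontr)
  assume neg: "\<not> thesis"
  have "M $$ (i, j) = 0" if "i < m" "j < n" for i j
  proof (rule ccontr)
    assume "M $$ (i, j) \<noteq> 0"
    then have thesis using \<open>\<And>i. i \<in> {..<m} \<times> {..<n} \<Longrightarrow> M $$ i \<noteq> 0 \<Longrightarrow> thesis\<close>[of "(i, j)"] that by simp
    then show False using neg by contradiction
  qed
  then have "M = 0\<^sub>m m n" using assms(1) by (intro eq_matI) auto
  then show False using assms(2) by contradiction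
qed

lemma split_subseq:
  assumes "\<And>t::nat. P t \<or> Q t"
  shows "\<exists>r. strict_mono (r::nat \<Rightarrow> nat) \<and> ((\<forall>t. P (r t)) \<or> (\<forall>t. Q (r t)))"
proof -
  have "{t. P t} \<union> {t. Q t} = UNIV" using assms by auto
  then have "infinite {t. P t} \<or> infinite {t. Q t}" using infinite_UNIV_nat by (metis finite_UnI)
  then show ?thesis
  proof
    assume a: "infinite {t. P t}"
    show ?thesis using strict_mono_enumerate[OF a] enumerate_in_set[OF a] by blast
  next
    assume a: "infinite {t. Q t}"
    show ?thesis using strict_mono_enumerate[OF a] enumerate_in_set[OF a] by blast
  qed
qed

lemma act_pcoset_line:
  assumes M: "M \<in> carrier_mat n n" and v: "v \<in> carrier_vec n"
  shows "act (pcoset M) (line v) = line (M *\<^sub>v v)"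
proof (intro equalityI subsetI)
  fix y assume "y \<in> act (pcoset M) (line v)"
  then obtain c e where "y = (c \<cdot>\<^sub>m M) *\<^sub>v (e \<cdot>\<^sub>v v)" by (auto simp: act_def pcoset_def line_def)
  then have "y = (c * e) \<cdot>\<^sub>v (M *\<^sub>v v)"
    using M v mult_mat_vec[OF M v, of e] by (intro eq_vecI) (auto simp: mult_ac)
  then show "y \<in> line (M *\<^sub>v v)" unfolding line_def by blast
next
  fix y assume "y \<in> line (M *\<^sub>v v)"
  then obtain e where "y = e \<cdot>\<^sub>v (M *\<^sub>v v)" by (auto simp: line_def)
  then have "y = M *\<^sub>v (e \<cdot>\<^sub>v v)" using mult_mat_vec[OF M v] by simp
  then show "y \<in> act (pcoset M) (line v)" unfolding act_def line_def using pcoset_self by blast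
qed

lemma act_pcoset_image:
  fixes A :: "'k::field mat"
  assumes A: "A \<in> carrier_mat n n" and Y: "Y \<in> carrier_mat n k"
  shows "act (pcoset A) (cspace n Y) = cspace n (A * Y)"
proof -
  have "act (pcoset A) (cspace n Y) = (\<lambda>v. A *\<^sub>v v) ` cspace n Y"
  proof (intro equalityI subsetI)
    fix y assume "y \<in> act (pcoset A) (cspace n Y)"
    then obtain c x where x: "x \<in> carrier_vec k" "y = (c \<cdot>\<^sub>m A) *\<^sub>v (Y *\<^sub>v x)"
      by (auto simp: act_def pcoset_def cspace_eq[OF Y])
    have Yx: "Y *\<^sub>v x \<in> carrier_vec n" using mult_mat_vec_carrier[OF Y x(1)] .
    have "y = c \<cdot>\<^sub>v (A *\<^sub>v (Y *\<^sub>v x))" unfolding x(2)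
    proof (rule eq_vecI)
      fix i assume "i < dim_vec (c \<cdot>\<^sub>v (A *\<^sub>v (Y *\<^sub>v x)))"
      then have i: "i < n" using A by simp
      have "((c \<cdot>\<^sub>m A) *\<^sub>v (Y *\<^sub>v x)) $ i = (\<Sum>r<n. c * (A $$ (i, r) * (Y *\<^sub>v x) $ r))"
        unfolding mult_vec_index[OF smult_carrier_mat[OF A] Yx i]
        by (rule sum.cong) (use A i in \<open>auto simp del: index_mult_mat_vec\<close>)
      also have "\<dots> = c * (A *\<^sub>v (Y *\<^sub>v x)) $ i"
        unfolding mult_vec_index[OF A Yx i] by (rule sum_distrib_left[symmetric])
      finally show "((c \<cdot>\<^sub>m A) *\<^sub>v (Y *\<^sub>v x)) $ i = (c \<cdot>\<^sub>v (A *\<^sub>v (Y *\<^sub>v x))) $ i" using A i by simp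
    qed (use A in simp)
    also have "\<dots> = A *\<^sub>v (c \<cdot>\<^sub>v (Y *\<^sub>v x))" using mult_mat_vec[OF A Yx] by simp
    also have "c \<cdot>\<^sub>v (Y *\<^sub>v x) = Y *\<^sub>v (c \<cdot>\<^sub>v x)" using mult_mat_vec[OF Y x(1)] by simp
    finally have y: "y = A *\<^sub>v (Y *\<^sub>v (c \<cdot>\<^sub>v x))" .
    have "Y *\<^sub>v (c \<cdot>\<^sub>v x) \<in> cspace n Y"
      unfolding cspace_eq[OF Y] by (intro CollectI exI[of _ "c \<cdot>\<^sub>v x"]) (use x in simp)
    then show "y \<in> (\<lambda>v. A *\<^sub>v v) ` cspace n Y" unfolding y by (rule imageI)
  next
    fix y assume "y \<in> (\<lambda>v. A *\<^sub>v v) ` cspace n Y"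
    then show "y \<in> act (pcoset A) (cspace n Y)" unfolding act_def using pcoset_self by blast
  qed
  then show ?thesis using cspace_mult[OF A Y] by simp
qed

section \<open>The visible domain of a transverse group\<close>

locale transverse_rep = transverse d \<theta> \<Gamma> + pairing_basis d k N X w
  for d k N :: nat and \<theta> :: "nat set" and \<Gamma> :: "'k::rc_field mat set set" and X :: "nat \<Rightarrow> 'k mat"
    and w :: "'k mat \<Rightarrow> nat \<Rightarrow> real" +
  assumes k: "k \<in> \<theta>" "2 * k \<le> d"
begin

section \<open>Points and functionals attached to limit flags\<close>

abbreviation "E \<equiv> std_frame d k :: 'k mat"
abbreviation "J \<equiv> rev_mat d :: 'k mat"

definition pt :: "'k mat \<Rightarrow> real vec" where "pt l = u (l * E)"
text \<open>\<open>J * E\<close> consists of the last \<open>k\<close> basis vectors in reverse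
  order, so \<open>l * (J * E)\<close> spans the orthogonal complement of the plane of dimension
  \<open>d - k\<close> in the flag of \<open>l\<close> (\<open>ann_lJE\<close>). The functional thus
  vanishes exactly at the points \<open>u Y\<close> of those \<open>k\<close>-planes that meet this
  plane nontrivially.\<close>

definition dual :: "'k mat \<Rightarrow> real vec" where "dual l = wv (l * (J * E))"

lemma kd: "1 \<le> k" "k < d" "d - k \<in> \<theta>" "k \<le> d - k" "d - k \<le> d" "k \<le> d"
  using theta[OF k(1)] k(2) by auto

lemma JE_carrier [simp]: "J * E \<in> carrier_mat d k" by (rule mult_carrier_mat[of _ _ d]) auto

lemma lE_carrier: "l \<in> lims \<Longrightarrow> l * E \<in> carrier_mat d k"
  using mult_carrier_mat[OF lims_carrier std_frame_carrier] .

lemma lE_frame: "l \<in> lims \<Longrightarrow> frame d k (l * E)"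
  by (rule frame_unitary_std[OF lims_unitary kd(6)])

lemma lJE_carrier: "l \<in> lims \<Longrightarrow> l * (J * E) \<in> carrier_mat d k"
  using mult_carrier_mat[OF lims_carrier JE_carrier] .

lemma lJE_frame: "l \<in> lims \<Longrightarrow> frame d k (l * (J * E))"
proof -
  assume l: "l \<in> lims"
  have "frame d k (l * J * E)" by (rule frame_unitary_std[OF unitary_mult[OF lims_unitary[OF l] rev_mat_unitary] kd(6)])
  then show ?thesis using assoc_mult_mat[OF lims_carrier[OF l] rev_mat_carrier std_frame_carrier] by simp
qed

lemma ann_lJE:
  assumes l: "l \<in> lims"
  shows "ann d (l * (J * E)) = cspace d (l * std_frame d (d - k))"
proof (rule Set.set_eqI)
  fix v :: "'k vec"
  have lc: "l \<in> carrier_mat d d" by (rule lims_carrier[OF l])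
  have eq: "mat_adjoint (l * (J * E)) *\<^sub>v v = 0\<^sub>v k \<longleftrightarrow> (\<forall>i. d - k \<le> i \<longrightarrow> i < d \<longrightarrow> (mat_adjoint l *\<^sub>v v) $ i = 0)"
    if v: "v \<in> carrier_vec d"
  proof -
    define x where "x = mat_adjoint l *\<^sub>v v"
    have x: "x \<in> carrier_vec d" unfolding x_def by (rule mult_mat_vec_carrier[OF mat_adjoint_carrier[OF lc] v])
    have "mat_adjoint (l * (J * E)) *\<^sub>v v = mat_adjoint (J * E) *\<^sub>v x"
      unfolding x_def mat_adjoint_mult[OF lc JE_carrier]
      by (rule assoc_mult_mat_vec[OF mat_adjoint_carrier[OF JE_carrier] mat_adjoint_carrier[OF lc] v])
    moreover have "(mat_adjoint (J * E) *\<^sub>v x) $ r = x $ (d - 1 - r)" if r: "r < k" for r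
    proof -
      have "(mat_adjoint (J * E) *\<^sub>v x) $ r = (\<Sum>i<d. mat_adjoint (J * E) $$ (r, i) * x $ i)"
        by (rule mult_vec_index[OF mat_adjoint_carrier[OF JE_carrier] x r])
      also have "\<dots> = (\<Sum>i<d. if i = d - 1 - r then x $ i else 0)"
      proof (rule sum.cong[OF refl])
        fix i assume "i \<in> {..<d}"
        then have i: "i < d" by simp
        have "mat_adjoint (J * E) $$ (r, i) = conjugate ((J * E) $$ (i, r))"
          by (rule mat_adjoint_index) (use i r in \<open>auto simp: std_frame_def rev_mat_def\<close>)
        also have "(J * E) $$ (i, r) = E $$ (d - 1 - i, r)" by (rule rev_mat_mult_index[OF std_frame_carrier i r])
        also have "\<dots> = (if i = d - 1 - r then 1 else 0)" using i r kd by (auto simp: std_frame_def)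
        finally show "mat_adjoint (J * E) $$ (r, i) * x $ i = (if i = d - 1 - r then x $ i else 0)" by auto
      qed
      finally show ?thesis using r kd by simp
    qed
    moreover have "dim_vec (mat_adjoint (J * E) *\<^sub>v x) = k" by (simp add: std_frame_def)
    ultimately have "mat_adjoint (l * (J * E)) *\<^sub>v v = 0\<^sub>v k \<longleftrightarrow> (\<forall>r<k. x $ (d - 1 - r) = 0)"
      by (auto simp: vec_eq_iff simp del: index_mult_mat_vec)
    also have "\<dots> \<longleftrightarrow> (\<forall>i. d - k \<le> i \<longrightarrow> i < d \<longrightarrow> x $ i = 0)"
    proof (intro iffI allI impI)
      fix i assume a: "\<forall>r<k. x $ (d - 1 - r) = 0" "d - k \<le> i" "i < d"
      then have "d - 1 - i < k" "d - 1 - (d - 1 - i) = i" by auto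
      then show "x $ i = 0" using a(1) by metis
    next
      fix r assume "\<forall>i. d - k \<le> i \<longrightarrow> i < d \<longrightarrow> x $ i = 0" "r < k"
      then show "x $ (d - 1 - r) = 0" using kd by auto
    qed
    finally show ?thesis unfolding x_def .
  qed
  have "dim_col (l * (J * E)) = k" by (rule carrier_matD(2)[OF lJE_carrier[OF l]])
  then show "v \<in> ann d (l * (J * E)) \<longleftrightarrow> v \<in> cspace d (l * std_frame d (d - k))"
    unfolding mem_cspace_std[OF lims_unitary[OF l] kd(5)] ann_def using eq by auto
qed

section \<open>Positive functionals and incidence of limit flags\<close>

lemma pt_carrier [simp]: "pt l \<in> carrier_vec N" by (simp add: pt_def)
lemma dual_carrier [simp]: "dual l \<in> carrier_vec N" by (simp add: dual_def)

lemma u_nonneg: "i < N \<Longrightarrow> u Y $ i \<ge> 0" by (simp add: u_def)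

lemma u_nonzero: "frame d k Y \<Longrightarrow> u Y \<noteq> 0\<^sub>v N"
proof
  assume Y: "frame d k Y" and "u Y = 0\<^sub>v N"
  then have "wv Y \<bullet> u Y = 0" by simp
  then show False using wv_u[OF frame_carrier[OF Y] frame_carrier[OF Y]] pairing_self[OF Y] by simp
qed

lemma pt_nonzero: "l \<in> lims \<Longrightarrow> pt l \<noteq> 0\<^sub>v N"
  unfolding pt_def by (rule u_nonzero[OF lE_frame])

text \<open>All entries of these functionals are at least 1, while \<open>u Y\<close> has
  nonnegative entries, not all zero if \<open>Y\<close> is a frame; so they are strictly positive
  there. They are the functionals that \<open>dual_cone\<close> demands for a bounded chart.\<close>

definition K0 :: "real vec set" where "K0 = insert (ones N) (ones_plus N ` {..<N})"

lemma K0_carrier: "\<kappa> \<in> K0 \<Longrightarrow> \<kappa> \<in> carrier_vec N"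
  by (auto simp: K0_def ones_def ones_plus_def)

lemma K0_ge: "\<kappa> \<in> K0 \<Longrightarrow> i < N \<Longrightarrow> \<kappa> $ i \<ge> 1"
  by (auto simp: K0_def ones_def ones_plus_def)

lemma K0_u_nonneg: "\<kappa> \<in> K0 \<Longrightarrow> \<kappa> \<bullet> u Y \<ge> 0"
  unfolding scalar_prod_sum[OF u_carrier]
  by (intro sum_nonneg mult_nonneg_nonneg u_nonneg) (use K0_ge in \<open>force intro: order_trans[of 0 1]\<close>)+

lemma K0_u_pos:
  assumes \<kappa>: "\<kappa> \<in> K0" and Y: "frame d k Y"
  shows "\<kappa> \<bullet> u Y > 0"
proof -
  obtain i where i: "i < N" "u Y $ i \<noteq> 0" by (rule nonzero_entry[OF u_carrier u_nonzero[OF Y]])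
  have "u Y $ i > 0" using u_nonneg[OF i(1)] i(2) by (simp add: order_less_le)
  moreover have "u Y $ i \<le> \<kappa> $ i * u Y $ i"
    using K0_ge[OF \<kappa> i(1)] u_nonneg[OF i(1), of Y] by (simp add: mult_le_cancel_right1)
  moreover have "\<kappa> $ i * u Y $ i \<le> (\<Sum>r<N. \<kappa> $ r * u Y $ r)"
  proof (rule member_le_sum)
    fix r assume "r \<in> {..<N} - {i}"
    then have "\<kappa> $ r \<ge> 1" "u Y $ r \<ge> 0" using K0_ge[OF \<kappa>] u_nonneg by auto
    then show "0 \<le> \<kappa> $ r * u Y $ r" by simp
  qed (use i in auto)
  ultimately show ?thesis unfolding scalar_prod_sum[OF u_carrier] by linarith
qed

text \<open>Any frame of the orthogonal complement is allowed, not only the one in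
  \<open>dual\<close>: the action moves frames to frames but does not preserve unitary matrices, so
  this form is the one that is invariant.\<close>

definition Z1 :: "real vec set" where
  "Z1 = {wv Y | Y. frame d k Y \<and> (\<exists>l\<in>lims. ann d Y = cspace d (l * std_frame d (d - k)))}"

text \<open>All lifts \<open>A\<close> of elements of \<Gamma> occur, which makes the set invariant
  without a choice of representatives.\<close>

definition Z2 :: "real vec set" where
  "Z2 = {(R A)\<^sup>T *\<^sub>v \<kappa> | A \<kappa>. A \<in> carrier_mat d d \<and> det A \<noteq> 0 \<and> pcoset A \<in> \<Gamma> \<and> \<kappa> \<in> K0}"

definition ZZ :: "real vec set" where "ZZ = Z1 \<union> Z2"

lemma dual_Z1: "l \<in> lims \<Longrightarrow> dual l \<in> Z1"
  unfolding Z1_def dual_def using lJE_frame ann_lJE by blast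

lemma flag_theta: "j \<in> \<theta> \<Longrightarrow> flag l j = cspace d (l * std_frame d j)"
  by (simp add: flag_def)

text \<open>The pairing is zero iff the \<open>k\<close>-plane of \<open>l'\<close> meets
  \<open>ann d Y\<close>, the plane of dimension \<open>d - k\<close> of \<open>l\<close>. For
  distinct flags transversality excludes this; for equal ones the \<open>k\<close>-plane lies inside
  because \<open>k \<le> d - k\<close>.\<close>

lemma incidence:
  assumes Y: "frame d k Y" and l: "l \<in> lims" and ann: "ann d Y = cspace d (l * std_frame d (d - k))" and l': "l' \<in> lims"
  shows "wv Y \<bullet> pt l' = 0 \<longleftrightarrow> flag l = flag l'"
proof -
  have cY: "Y \<in> carrier_mat d k" using Y by auto
  have c': "l' * E \<in> carrier_mat d k" by (rule lE_carrier[OF l'])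
  have M: "mat_adjoint Y * (l' * E) \<in> carrier_mat k k" using cY c' by simp
  have "wv Y \<bullet> pt l' = pairing Y (l' * E)"
    unfolding pt_def wv_u[OF c' cY] by (rule pairing_sym[OF c' cY])
  then have "wv Y \<bullet> pt l' = 0 \<longleftrightarrow> (\<exists>x. x \<in> carrier_vec k \<and> x \<noteq> 0\<^sub>v k \<and> mat_adjoint Y * (l' * E) *\<^sub>v x = 0\<^sub>v k)"
    unfolding pairing_eq_0 det_0_iff_vec_prod_zero_field[OF M, symmetric] by (simp add: pairing_eq_0)
  also have "\<dots> \<longleftrightarrow> (\<exists>x. x \<in> carrier_vec k \<and> x \<noteq> 0\<^sub>v k \<and> (l' * E) *\<^sub>v x \<in> ann d Y)"
  proof -
    have "mat_adjoint Y * (l' * E) *\<^sub>v x = 0\<^sub>v k \<longleftrightarrow> (l' * E) *\<^sub>v x \<in> ann d Y" if x: "x \<in> carrier_vec k" for x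
      unfolding ann_def assoc_mult_mat_vec[OF mat_adjoint_carrier[OF cY] c' x]
      using mult_mat_vec_carrier[OF c' x] cY by simp
    then show ?thesis by blast
  qed
  also have "\<dots> \<longleftrightarrow> flag l = flag l'"
  proof
    assume "\<exists>x. x \<in> carrier_vec k \<and> x \<noteq> 0\<^sub>v k \<and> (l' * E) *\<^sub>v x \<in> ann d Y"
    then obtain x where x: "x \<in> carrier_vec k" "x \<noteq> 0\<^sub>v k" "(l' * E) *\<^sub>v x \<in> ann d Y" by blast
    show "flag l = flag l'"
    proof (rule ccontr)
      assume ne: "flag l \<noteq> flag l'"
      have "transverse_flags d \<theta> (limit_set d \<theta> \<Gamma>)" using transverse by (simp add: transverse_group_def)
      note this[unfolded transverse_flags_def limit_set_eq, rule_format, OF imageI[OF l'] imageI[OF l] ne[symmetric] k(1)]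
      moreover have "(l' * E) *\<^sub>v x \<in> flag l' k" using x(1) by (auto simp: flag_theta[OF k(1)] cspace_eq[OF c'])
      moreover have "(l' * E) *\<^sub>v x \<in> flag l (d - k)" using x(3) ann by (simp add: flag_theta[OF kd(3)])
      ultimately have "(l' * E) *\<^sub>v x \<in> {0\<^sub>v d}" by (metis IntI)
      then have "(l' * E) *\<^sub>v x = 0\<^sub>v d" by simp
      then show False using x(1,2) lE_frame[OF l', unfolded frame_iff_inj[OF c']] by auto
    qed
  next
    assume eq: "flag l = flag l'"
    have "flag l k \<subseteq> flag l (d - k)"
      using flag_in_flags[OF lims_unitary[OF l]] k(1) kd(3,4) by (auto simp: flags_def)
    then have sub: "cspace d (l' * E) \<subseteq> ann d Y" using eq flag_theta[OF k(1), of l'] flag_theta[OF kd(3), of l] ann by simp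
    have "(l' * E) *\<^sub>v unit_vec k 0 \<in> cspace d (l' * E)" by (auto simp: cspace_eq[OF c'])
    then have mem: "(l' * E) *\<^sub>v unit_vec k 0 \<in> ann d Y" using sub by (rule subsetD[rotated])
    have nz: "unit_vec k 0 \<noteq> (0\<^sub>v k :: 'k vec)"
    proof
      assume "unit_vec k 0 = (0\<^sub>v k :: 'k vec)"
      then have "unit_vec k 0 $ 0 = (0\<^sub>v k :: 'k vec) $ 0" by simp
      then show False using kd(1) by simp
    qed
    show "\<exists>x. x \<in> carrier_vec k \<and> x \<noteq> 0\<^sub>v k \<and> (l' * E) *\<^sub>v x \<in> ann d Y"
      by (intro exI[of _ "unit_vec k 0"] conjI nz mem unit_vec_carrier)
  qed
  finally show ?thesis .
qed

lemma dual_pt: "l \<in> lims \<Longrightarrow> l' \<in> lims \<Longrightarrow> dual l \<bullet> pt l' = 0 \<longleftrightarrow> flag l = flag l'"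
  unfolding dual_def by (rule incidence[OF lJE_frame _ ann_lJE])

lemma ZZ_carrier: "f \<in> ZZ \<Longrightarrow> f \<in> carrier_vec N"
  unfolding ZZ_def Z1_def Z2_def using K0_carrier by (auto intro!: mult_mat_vec_carrier[of _ N N])

lemma Z2_u:
  assumes A: "A \<in> carrier_mat d d" "\<kappa> \<in> K0" and Y: "Y \<in> carrier_mat d k"
  shows "((R A)\<^sup>T *\<^sub>v \<kappa>) \<bullet> u Y = \<kappa> \<bullet> u (A * Y)"
  using transpose_scalar_prod[OF R_carrier K0_carrier[OF A(2)] u_carrier] R_u[OF A(1) Y] by simp

lemma ZZ_u_nonneg: "f \<in> ZZ \<Longrightarrow> Y \<in> carrier_mat d k \<Longrightarrow> f \<bullet> u Y \<ge> 0"
  unfolding ZZ_def Z1_def Z2_def using wv_u Z2_u K0_u_nonneg by (auto dest!: frame_carrier)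

lemma Z2_u_pos:
  assumes "f \<in> Z2" and Y: "frame d k Y"
  shows "f \<bullet> u Y > 0"
proof -
  obtain A \<kappa> where A: "A \<in> carrier_mat d d" "det A \<noteq> 0" "\<kappa> \<in> K0" "f = (R A)\<^sup>T *\<^sub>v \<kappa>"
    using assms(1) unfolding Z2_def by blast
  show ?thesis unfolding A(4) Z2_u[OF A(1,3) frame_carrier[OF Y]]
    by (rule K0_u_pos[OF A(3) frame_mult_invertible[OF A(1,2) Y]])
qed

text \<open>A point of the cone found without knowledge of the limit set: the value of
  \<open>wv Y\<close> at \<open>u (X j)\<close> is the coordinate \<open>u Y $ j\<close>, so for
  every frame \<open>Y\<close> some summand is positive.\<close>

definition base_pt :: "real vec" where "base_pt = vec N (\<lambda>i. \<Sum>j<N. u (X j) $ i)"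

lemma base_pt_carrier [simp]: "base_pt \<in> carrier_vec N" by (simp add: base_pt_def)

lemma scalar_base_pt: "f \<bullet> base_pt = (\<Sum>j<N. f \<bullet> u (X j))"
proof -
  have "f \<bullet> base_pt = (\<Sum>i<N. \<Sum>j<N. f $ i * u (X j) $ i)"
    unfolding scalar_prod_sum[OF base_pt_carrier] by (simp add: base_pt_def sum_distrib_left)
  also have "\<dots> = (\<Sum>j<N. \<Sum>i<N. f $ i * u (X j) $ i)" by (rule sum.swap)
  finally show ?thesis by (simp add: scalar_prod_sum[OF u_carrier])
qed

lemma X_frame: "j < N \<Longrightarrow> frame d k (X j)"
proof -
  assume j: "j < N"
  have "\<exists>Y\<in>carrier_mat d k. pairing Y (X j) \<noteq> 0"
  proof (rule ccontr)
    assume "\<not> ?thesis"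
    then have z: "\<And>Y. Y \<in> carrier_mat d k \<Longrightarrow> pairing Y (X j) = 0" by blast
    have "(\<lambda>i. if i = j then 1 else 0 :: real) j = 0"
    proof (rule indep[of "\<lambda>i. if i = j then 1 else 0" j, OF _ j])
      fix Y :: "'k mat" assume "Y \<in> carrier_mat d k"
      then show "(\<Sum>i<N. (if i = j then 1 else 0) * pairing Y (X i)) = 0"
        using z by (intro sum.neutral) auto
    qed
    then show False by simp
  qed
  then show ?thesis using frameI_pairing[OF _ X[OF j]] by blast
qed

lemma N_pos: "0 < N"
proof (rule ccontr)
  assume "\<not> 0 < N"
  then have "i \<ge> N" for i by simp
  then have "u (1\<^sub>m d * E) = 0\<^sub>v N" using nonzero_entry[OF u_carrier] by (metis leD)
  then show False using u_nonzero[OF frame_unitary_std[OF unitary_one kd(6)]] by contradiction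
qed

lemma base_pt_pos: "f \<in> ZZ \<Longrightarrow> f \<bullet> base_pt > 0"
proof -
  assume f: "f \<in> ZZ"
  have nn: "f \<bullet> u (X j) \<ge> 0" if "j < N" for j by (rule ZZ_u_nonneg[OF f X[OF that]])
  have "\<exists>j<N. f \<bullet> u (X j) > 0"
  proof (cases "f \<in> Z2")
    case True
    then show ?thesis using Z2_u_pos[OF True X_frame[OF N_pos]] N_pos by blast
  next
    case False
    then obtain Y where Y: "frame d k Y" "f = wv Y" using f by (auto simp: ZZ_def Z1_def)
    obtain j where j: "j < N" "u Y $ j \<noteq> 0" by (rule nonzero_entry[OF u_carrier u_nonzero[OF Y(1)]])
    have "f \<bullet> u (X j) = u Y $ j"
      unfolding Y(2) wv_u[OF X[OF j(1)] frame_carrier[OF Y(1)]] using j pairing_sym[OF X[OF j(1)] frame_carrier[OF Y(1)]]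
      by (simp add: u_def)
    then show ?thesis using j nn[OF j(1)] by (intro exI[of _ j]) simp
  qed
  then obtain j where j: "j < N" "f \<bullet> u (X j) > 0" by blast
  have "f \<bullet> u (X j) \<le> (\<Sum>j<N. f \<bullet> u (X j))" by (rule member_le_sum) (use j nn in auto)
  then show ?thesis unfolding scalar_base_pt using j by linarith
qed

section \<open>Limits of normalised group elements and projective compactness\<close>

lemma R_limit:
  assumes \<gamma>: "inj \<gamma>" "\<And>t::nat. \<gamma> t \<in> \<Gamma>" and svd: "\<And>t. svd_of d (\<gamma> t) (l t) (s t) (m t)"
    and l: "mlim d d l l0" "l0 \<in> unitary_mats d" and m: "mlim d d m m0" "m0 \<in> unitary_mats d"
  obtains B c m1 where "\<forall>t::nat. B t \<in> carrier_mat d d \<and> det (B t) \<noteq> 0 \<and> \<gamma> t = pcoset (B t) \<and> c t > 0"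
    "l0 \<in> lims" "m1 \<in> lims" "\<forall>i<N. \<forall>j<N. (\<lambda>t. c t * R (B t) $$ (i, j)) \<longlonglongrightarrow> pt l0 $ i * dual m1 $ j"
proof -
  note dyn = dynamics[OF \<gamma> svd l m]
  define B where "B t = l t * mat_diag d (\<lambda>i. of_real (s t i)) * m t" for t
  define c where "c t = 1 / (\<Prod>i<k. s t i)\<^sup>2" for t
  have B: "B t \<in> carrier_mat d d" "det (B t) \<noteq> 0" "\<gamma> t = pcoset (B t)" for t
    unfolding B_def using svd_of_mat[OF Gamma_PGL[OF \<gamma>(2)] svd] by auto
  have c: "c t > 0" for t
  proof -
    have "(\<Prod>i<k. s t i) > 0" by (rule prod_pos) (use svd_ofD(3)[OF svd, of _ t] kd in auto)
    then show ?thesis unfolding c_def by (intro divide_pos_pos zero_less_power) auto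
  qed
  \<comment> \<open>This matrix lies in \<open>lims\<close> by \<open>dynamics\<close>. Its factor
    \<open>J\<close> cancels against the one in \<open>dual\<close>, so \<open>dual m1\<close> is
    the functional of \<open>mat_adjoint m0 * E\<close>.\<close>
  define m1 where "m1 = mat_adjoint m0 * J"
  have m1: "m1 \<in> lims" using dyn(2) by (simp add: m1_def)
  have m0c: "mat_adjoint m0 \<in> carrier_mat d d" using unitary_carrier[OF m(2)] by simp
  have "m1 * (J * E) = mat_adjoint m0 * (J * (J * E))"
    unfolding m1_def by (rule assoc_mult_mat[OF m0c rev_mat_carrier JE_carrier])
  also have "J * (J * E) = E"
    unfolding assoc_mult_mat[OF rev_mat_carrier rev_mat_carrier std_frame_carrier, symmetric] rev_mat_square
    by (rule left_mult_one_mat[OF std_frame_carrier])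
  finally have mE: "m1 * (J * E) = mat_adjoint m0 * E" .
  have lim: "(\<lambda>t. c t * R (B t) $$ (i, j)) \<longlonglongrightarrow> pt l0 $ i * dual m1 $ j" if ij: "i < N" "j < N" for i j
    unfolding pt_def dual_def mE
  proof (rule tendsto_R[OF B(1) _ _ _ ij])
    show "mat_adjoint m0 * E \<in> carrier_mat d k" by (rule mult_carrier_mat[OF m0c std_frame_carrier])
    show "l0 * E \<in> carrier_mat d k" by (rule lE_carrier[OF dyn(1)])
    fix Y Z :: "'k mat" assume "Y \<in> carrier_mat d k" "Z \<in> carrier_mat d k"
    from dyn(3)[OF k(1) this] show "(\<lambda>t. c t * pairing (B t * Y) Z) \<longlonglongrightarrow> pairing Y (mat_adjoint m0 * E) * pairing (l0 * E) Z"
      by (simp add: B_def c_def)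
  qed
  show ?thesis by (rule that[of B c m1]) (use B c m1 dyn(1) lim in auto)
qed

lemma R_limit_subseq:
  assumes \<gamma>: "inj \<gamma>" "\<And>t::nat. \<gamma> t \<in> \<Gamma>"
  obtains r B c l0 m1 where "strict_mono r" "\<forall>t::nat. B t \<in> carrier_mat d d \<and> det (B t) \<noteq> 0 \<and> \<gamma> (r t) = pcoset (B t) \<and> c t > 0"
    "l0 \<in> lims" "m1 \<in> lims" "\<forall>i<N. \<forall>j<N. (\<lambda>t. c t * R (B t) $$ (i, j)) \<longlonglongrightarrow> pt l0 $ i * dual m1 $ j"
proof -
  obtain l s m where svd: "\<And>t. svd_of d (\<gamma> t) (l t) (s t) (m t)"
    by (rule svd_seq[of \<gamma>, OF \<gamma>(2)]) (rule that)
  obtain l0 r1 where r1: "l0 \<in> unitary_mats d" "strict_mono r1" "mlim d d (\<lambda>t. l (r1 t)) l0"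
    using unitary_subseq[of l, OF svd_ofD(1)[OF svd]] .
  obtain m0 r2 where r2: "m0 \<in> unitary_mats d" "strict_mono r2" "mlim d d (\<lambda>t. m (r1 (r2 t))) m0"
    using unitary_subseq[of "\<lambda>t. m (r1 t)", OF svd_ofD(2)[OF svd]] .
  define r where "r t = r1 (r2 t)" for t
  have r: "strict_mono r" using strict_mono_o[OF r1(2) r2(2)] by (simp add: o_def r_def[abs_def])
  obtain B c m1 where "\<forall>t::nat. B t \<in> carrier_mat d d \<and> det (B t) \<noteq> 0 \<and> \<gamma> (r t) = pcoset (B t) \<and> c t > 0"
    "l0 \<in> lims" "m1 \<in> lims" "\<forall>i<N. \<forall>j<N. (\<lambda>t. c t * R (B t) $$ (i, j)) \<longlonglongrightarrow> pt l0 $ i * dual m1 $ j"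
    using R_limit[of "\<lambda>t. \<gamma> (r t)" "\<lambda>t. l (r t)" "\<lambda>t. s (r t)" "\<lambda>t. m (r t)" l0 m0,
      OF inj_subseq[OF \<gamma>(1) r] \<gamma>(2) svd mlim_subseq[OF r1(3) r2(2), folded r_def] r1(1) r2(3)[folded r_def] r2(1)] .
  with r that show ?thesis by blast
qed

lemma Z_compact:
  assumes f: "\<And>t::nat. f t \<in> ZZ"
  shows "\<exists>r c g. strict_mono (r::nat \<Rightarrow> nat) \<and> (\<forall>t. c t > 0) \<and> g \<in> ZZ \<and> vlim N (\<lambda>t. c t \<cdot>\<^sub>v f (r t)) g"
proof -
  obtain r where r: "strict_mono (r::nat\<Rightarrow>nat)" "(\<forall>t. f (r t) \<in> Z1) \<or> (\<forall>t. f (r t) \<in> Z2)"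
    using split_subseq[of "\<lambda>t. f t \<in> Z1" "\<lambda>t. f t \<in> Z2"] f by (auto simp: ZZ_def)
  from r(2) show ?thesis
  proof
    assume "\<forall>t. f (r t) \<in> Z1"
    then have "\<forall>t. \<exists>z. frame d k (fst z) \<and> snd z \<in> lims \<and> ann d (fst z) = cspace d (snd z * std_frame d (d - k)) \<and> f (r t) = wv (fst z)"
      by (fastforce simp: Z1_def)
    from choice[OF this] obtain z where z: "\<forall>t. frame d k (fst (z t)) \<and> snd (z t) \<in> lims \<and>
        ann d (fst (z t)) = cspace d (snd (z t) * std_frame d (d - k)) \<and> f (r t) = wv (fst (z t))" by (elim exE)
    define l where "l t = snd (z t)" for t
    have l: "l t \<in> lims" for t using z by (simp add: l_def)
    \<comment> \<open>Frames with the same orthogonal complement have proportional functionals, so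
      each \<open>f (r t)\<close> is a positive multiple of the functional of a unitary matrix,
      where compactness applies.\<close>
    have "\<exists>c. c > 0 \<and> f (r t) = c \<cdot>\<^sub>v dual (l t)" for t
    proof -
      have "cspace d (l t * (J * E)) = cspace d (fst (z t))"
        by (rule cspace_eq_of_ann[OF lJE_frame[OF l]]) (use z ann_lJE[OF l] in \<open>auto simp: l_def\<close>)
      then show ?thesis using u_smult_frame[OF lJE_frame[OF l], of "fst (z t)" t] z unfolding dual_def by metis
    qed
    then have "\<forall>t. \<exists>c. c > 0 \<and> f (r t) = c \<cdot>\<^sub>v dual (l t)" by (rule allI)
    from choice[OF this] obtain c where c: "\<forall>t. c t > 0 \<and> f (r t) = c t \<cdot>\<^sub>v dual (l t)" by (elim exE)
    obtain l0 q where q: "l0 \<in> unitary_mats d" "strict_mono q" "mlim d d (\<lambda>t. l (q t)) l0"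
      using unitary_subseq[of l, OF lims_unitary[OF l]] .
    have l0: "l0 \<in> lims" by (rule lims_closed[OF l q(3) unitary_carrier[OF q(1)]])
    have lim: "vlim N (\<lambda>t. dual (l (q t))) (dual l0)"
      unfolding vlim_def dual_def
    proof (intro allI impI)
      fix i assume i: "i < N"
      have ml: "mlim d k (\<lambda>t. l (q t) * (J * E)) (l0 * (J * E))"
        by (rule mlim_mult[OF q(3) mlim_const]) (use lims_carrier[OF l] lims_carrier[OF l0] in auto)
      show "(\<lambda>t. wv (l (q t) * (J * E)) $ i) \<longlonglongrightarrow> wv (l0 * (J * E)) $ i"
        by (rule tendsto_wv[OF ml lJE_carrier[OF l] lJE_carrier[OF l0] i])
    qed
    show ?thesis
    proof (intro exI conjI allI)
      show "strict_mono (\<lambda>t. r (q t))" using strict_mono_o[OF r(1) q(2)] by (simp add: o_def)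
      show "dual l0 \<in> ZZ" using dual_Z1[OF l0] by (simp add: ZZ_def)
      show "0 < 1 / c (q t)" for t using c by simp
      have "(1 / c (q t)) \<cdot>\<^sub>v f (r (q t)) = dual (l (q t))" for t
      proof -
        have "c (q t) > 0" "f (r (q t)) = c (q t) \<cdot>\<^sub>v dual (l (q t))" using c by auto
        then show ?thesis by (simp add: smult_smult_assoc)
      qed
      then show "vlim N (\<lambda>t. (1 / c (q t)) \<cdot>\<^sub>v f (r (q t))) (dual l0)" using lim by simp
    qed
  next
    assume "\<forall>t. f (r t) \<in> Z2"
    then have "\<forall>t. \<exists>z. fst z \<in> carrier_mat d d \<and> det (fst z) \<noteq> 0 \<and> pcoset (fst z) \<in> \<Gamma> \<and> snd z \<in> K0 \<and> f (r t) = (R (fst z))\<^sup>T *\<^sub>v snd z"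
      by (fastforce simp: Z2_def)
    from choice[OF this] obtain z where z: "\<forall>t. fst (z t) \<in> carrier_mat d d \<and> det (fst (z t)) \<noteq> 0 \<and>
       pcoset (fst (z t)) \<in> \<Gamma> \<and> snd (z t) \<in> K0 \<and> f (r t) = (R (fst (z t)))\<^sup>T *\<^sub>v snd (z t)" by (elim exE)
    define A where "A t = fst (z t)" for t
    define \<kappa>' where "\<kappa>' t = snd (z t)" for t
    have A: "A t \<in> carrier_mat d d" "det (A t) \<noteq> 0" "pcoset (A t) \<in> \<Gamma>" and \<kappa>': "\<kappa>' t \<in> K0"
      and fA: "f (r t) = (R (A t))\<^sup>T *\<^sub>v \<kappa>' t" for t using z by (auto simp: A_def \<kappa>'_def)
    have finK: "finite K0" by (simp add: K0_def)
    obtain r1 where r1: "strict_mono (r1::nat\<Rightarrow>nat)" "(\<forall>t. \<kappa>' (r1 t) = \<kappa>' (r1 0)) \<or> inj (\<lambda>t. \<kappa>' (r1 t))"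
      using const_or_inj_subseq[of \<kappa>'] by blast
    \<comment> \<open>\<open>K0\<close> is finite, so a subsequence uses one and the same
      \<open>\<kappa>\<close>.\<close>
    have "\<not> inj (\<lambda>t. \<kappa>' (r1 t))"
    proof
      assume "inj (\<lambda>t. \<kappa>' (r1 t))"
      then have "infinite (range (\<lambda>t. \<kappa>' (r1 t)))" by (rule range_inj_infinite)
      moreover have "range (\<lambda>t. \<kappa>' (r1 t)) \<subseteq> K0" using \<kappa>' by auto
      ultimately show False using finK finite_subset by blast
    qed
    define \<kappa> where "\<kappa> = \<kappa>' (r1 0)"
    have \<kappa>: "\<kappa>' (r1 t) = \<kappa>" for t using r1(2) \<open>\<not> inj (\<lambda>t. \<kappa>' (r1 t))\<close> by (auto simp: \<kappa>_def)
    have \<kappa>K: "\<kappa> \<in> K0" using \<kappa>' by (simp add: \<kappa>_def)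
    note \<kappa>c = K0_carrier[OF \<kappa>K]
    obtain r2 where r2: "strict_mono (r2::nat\<Rightarrow>nat)"
      "(\<forall>t. pcoset (A (r1 (r2 t))) = pcoset (A (r1 (r2 0)))) \<or> inj (\<lambda>t. pcoset (A (r1 (r2 t))))"
      using const_or_inj_subseq[of "\<lambda>t. pcoset (A (r1 t))"] by blast
    have scal: "(R (e \<cdot>\<^sub>m B))\<^sup>T *\<^sub>v \<kappa> = (norm e ^ k)\<^sup>2 \<cdot>\<^sub>v ((R B)\<^sup>T *\<^sub>v \<kappa>)" if "B \<in> carrier_mat d d" for e B
      unfolding R_smult[OF that] by (rule eq_vecI) (use \<kappa>c in \<open>auto simp: R_def\<close>)
    have sm: "strict_mono (\<lambda>t. r (r1 (r2 t)))"
      using strict_mono_o[OF r(1) strict_mono_o[OF r1(1) r2(1)]] by (simp add: o_def)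
    from r2(2) show ?thesis
    proof
      assume const: "\<forall>t. pcoset (A (r1 (r2 t))) = pcoset (A (r1 (r2 0)))"
      define A0 where "A0 = A (r1 (r2 0))"
      have "\<exists>e. e \<noteq> 0 \<and> A (r1 (r2 t)) = e \<cdot>\<^sub>m A0" for t using const unfolding A0_def by (metis pcoset_eqD)
      then have "\<forall>t. \<exists>e. e \<noteq> 0 \<and> A (r1 (r2 t)) = e \<cdot>\<^sub>m A0" by (rule allI)
      from choice[OF this] obtain e where e: "\<forall>t. e t \<noteq> 0 \<and> A (r1 (r2 t)) = e t \<cdot>\<^sub>m A0" by (elim exE)
      show ?thesis
      proof (intro exI conjI allI)
        show "strict_mono (\<lambda>t. r (r1 (r2 t)))" by (rule sm)
        show "(R A0)\<^sup>T *\<^sub>v \<kappa> \<in> ZZ" unfolding ZZ_def Z2_def A0_def using A \<kappa>K by blast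
        show "0 < 1 / (norm (e t) ^ k)\<^sup>2" for t using e by simp
        have "(1 / (norm (e t) ^ k)\<^sup>2) \<cdot>\<^sub>v f (r (r1 (r2 t))) = (R A0)\<^sup>T *\<^sub>v \<kappa>" for t
        proof -
          have e0: "e t \<noteq> 0" and eA: "A (r1 (r2 t)) = e t \<cdot>\<^sub>m A0" using e by auto
          have "f (r (r1 (r2 t))) = (norm (e t) ^ k)\<^sup>2 \<cdot>\<^sub>v ((R A0)\<^sup>T *\<^sub>v \<kappa>)"
            unfolding fA \<kappa> eA by (rule scal) (simp add: A0_def A)
          then show ?thesis using e0 by (simp add: smult_smult_assoc)
        qed
        then show "vlim N (\<lambda>t. (1 / (norm (e t) ^ k)\<^sup>2) \<cdot>\<^sub>v f (r (r1 (r2 t)))) ((R A0)\<^sup>T *\<^sub>v \<kappa>)" by (simp add: vlim_const)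
      qed
    next
      assume inj: "inj (\<lambda>t. pcoset (A (r1 (r2 t))))"
      obtain r3 B c l0 m1 where r3: "strict_mono r3"
        and B: "\<forall>t::nat. B t \<in> carrier_mat d d \<and> det (B t) \<noteq> 0 \<and> pcoset (A (r1 (r2 (r3 t)))) = pcoset (B t) \<and> c t > 0"
        and lm: "l0 \<in> lims" "m1 \<in> lims"
        and lim: "\<forall>i<N. \<forall>j<N. (\<lambda>t. c t * R (B t) $$ (i, j)) \<longlonglongrightarrow> pt l0 $ i * dual m1 $ j"
        using R_limit_subseq[of "\<lambda>t. pcoset (A (r1 (r2 t)))", OF inj A(3)] .
      have "\<exists>e. e \<noteq> 0 \<and> A (r1 (r2 (r3 t))) = e \<cdot>\<^sub>m B t" for t using B by (metis pcoset_eqD)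
      then have "\<forall>t. \<exists>e. e \<noteq> 0 \<and> A (r1 (r2 (r3 t))) = e \<cdot>\<^sub>m B t" by (rule allI)
      from choice[OF this] obtain e where e: "\<forall>t. e t \<noteq> 0 \<and> A (r1 (r2 (r3 t))) = e t \<cdot>\<^sub>m B t" by (elim exE)
      \<comment> \<open>Strict positivity of \<open>\<kappa>\<close> at \<open>pt l0\<close> keeps
        the limit of the rescaled functionals away from zero: it is a positive multiple of
        \<open>dual m1\<close>. So along distinct elements the orbits accumulate in
        \<open>Z1\<close>.\<close>
      have \<alpha>: "\<kappa> \<bullet> pt l0 > 0" unfolding pt_def by (rule K0_u_pos[OF \<kappa>K lE_frame[OF lm(1)]])
      define \<alpha> where "\<alpha> = \<kappa> \<bullet> pt l0"
      have \<alpha>0: "\<alpha> > 0" using \<alpha> by (simp add: \<alpha>_def)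
      have v: "vlim N (\<lambda>t. (c t / \<alpha>) \<cdot>\<^sub>v ((R (B t))\<^sup>T *\<^sub>v \<kappa>)) (dual m1)"
        unfolding vlim_def
      proof (intro allI impI)
        fix j assume j: "j < N"
        have "((c t / \<alpha>) \<cdot>\<^sub>v ((R (B t))\<^sup>T *\<^sub>v \<kappa>)) $ j = (\<Sum>i<N. c t * R (B t) $$ (i, j) * \<kappa> $ i) / \<alpha>" for t
        proof -
          have "((R (B t))\<^sup>T *\<^sub>v \<kappa>) $ j = (\<Sum>i<N. (R (B t))\<^sup>T $$ (j, i) * \<kappa> $ i)"
            by (rule mult_vec_index[OF _ \<kappa>c j]) simp
          also have "\<dots> = (\<Sum>i<N. R (B t) $$ (i, j) * \<kappa> $ i)"
            by (rule sum.cong) (use j in \<open>auto simp: R_def\<close>)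
          finally have "((c t / \<alpha>) \<cdot>\<^sub>v ((R (B t))\<^sup>T *\<^sub>v \<kappa>)) $ j = c t / \<alpha> * (\<Sum>i<N. R (B t) $$ (i, j) * \<kappa> $ i)"
            using j by (simp add: R_def del: index_mult_mat_vec)
          also have "\<dots> = (\<Sum>i<N. c t * R (B t) $$ (i, j) * \<kappa> $ i) / \<alpha>"
            by (simp add: sum_distrib_left sum_divide_distrib mult.assoc)
          finally show ?thesis .
        qed
        moreover have "(\<lambda>t. (\<Sum>i<N. c t * R (B t) $$ (i, j) * \<kappa> $ i) / \<alpha>) \<longlonglongrightarrow> (\<Sum>i<N. pt l0 $ i * dual m1 $ j * \<kappa> $ i) / \<alpha>"
        proof (intro tendsto_divide tendsto_sum tendsto_const)
          fix i assume "i \<in> {..<N}"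
          then have "(\<lambda>t. c t * R (B t) $$ (i, j)) \<longlonglongrightarrow> pt l0 $ i * dual m1 $ j" using lim j by simp
          then show "(\<lambda>t. c t * R (B t) $$ (i, j) * \<kappa> $ i) \<longlonglongrightarrow> pt l0 $ i * dual m1 $ j * \<kappa> $ i"
            by (rule tendsto_mult_right)
        qed (use \<alpha>0 in simp)
        moreover have "(\<Sum>i<N. pt l0 $ i * dual m1 $ j * \<kappa> $ i) / \<alpha> = dual m1 $ j"
        proof -
          have "(\<Sum>i<N. pt l0 $ i * dual m1 $ j * \<kappa> $ i) = dual m1 $ j * \<alpha>"
            unfolding \<alpha>_def scalar_prod_sum[OF pt_carrier] sum_distrib_left by (intro sum.cong refl) (simp add: mult_ac)
          then show ?thesis using \<alpha>0 by simp
        qed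
        ultimately show "(\<lambda>t. ((c t / \<alpha>) \<cdot>\<^sub>v ((R (B t))\<^sup>T *\<^sub>v \<kappa>)) $ j) \<longlonglongrightarrow> dual m1 $ j" by simp
      qed
      show ?thesis
      proof (intro exI conjI allI)
        show "strict_mono (\<lambda>t. r (r1 (r2 (r3 t))))" using strict_mono_o[OF sm r3] by (simp add: o_def)
        show "dual m1 \<in> ZZ" using dual_Z1[OF lm(2)] by (simp add: ZZ_def)
        show "0 < c t / \<alpha> / (norm (e t) ^ k)\<^sup>2" for t using B e \<alpha>0 by simp
        have "(c t / \<alpha> / (norm (e t) ^ k)\<^sup>2) \<cdot>\<^sub>v f (r (r1 (r2 (r3 t)))) = (c t / \<alpha>) \<cdot>\<^sub>v ((R (B t))\<^sup>T *\<^sub>v \<kappa>)" for t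
        proof -
          have e0: "e t \<noteq> 0" and eA: "A (r1 (r2 (r3 t))) = e t \<cdot>\<^sub>m B t" using e by auto
          have "f (r (r1 (r2 (r3 t)))) = (norm (e t) ^ k)\<^sup>2 \<cdot>\<^sub>v ((R (B t))\<^sup>T *\<^sub>v \<kappa>)"
            unfolding fA \<kappa> eA by (rule scal) (use B in blast)
          then show ?thesis using e0 by (simp add: smult_smult_assoc)
        qed
        then show "vlim N (\<lambda>t. (c t / \<alpha> / (norm (e t) ^ k)\<^sup>2) \<cdot>\<^sub>v f (r (r1 (r2 (r3 t))))) (dual m1)" using v by simp
      qed
    qed
  qed
qed

section \<open>The invariant cone\<close>

lemma K0_ZZ: "\<kappa> \<in> K0 \<Longrightarrow> \<kappa> \<in> ZZ"
proof -
  assume \<kappa>: "\<kappa> \<in> K0"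
  have "pcoset (1\<^sub>m d :: 'k mat) \<in> \<Gamma>" using subgroup.one_closed[OF Gamma_subgroup] by (simp add: PGL_one)
  moreover have "(R (1\<^sub>m d))\<^sup>T *\<^sub>v \<kappa> = \<kappa>" using K0_carrier[OF \<kappa>] by (simp add: R_one)
  ultimately have "\<kappa> \<in> Z2" unfolding Z2_def using \<kappa> by (intro CollectI exI[of _ "1\<^sub>m d"] exI[of _ \<kappa>]) simp
  then show ?thesis by (simp add: ZZ_def)
qed

sublocale dual_cone N ZZ base_pt
proof
  show "ZZ \<subseteq> carrier_vec N" using ZZ_carrier by blast
  show "\<exists>r c g. strict_mono (r::nat \<Rightarrow> nat) \<and> (\<forall>t. c t > 0) \<and> g \<in> ZZ \<and> vlim N (\<lambda>t. c t \<cdot>\<^sub>v f (r t)) g"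
    if "\<And>t::nat. f t \<in> ZZ" for f by (rule Z_compact[OF that])
  show "ones N \<in> ZZ" by (rule K0_ZZ) (simp add: K0_def)
  show "ones_plus N j \<in> ZZ" if "j < N" for j by (rule K0_ZZ) (use that in \<open>simp add: K0_def\<close>)
qed (auto intro: base_pt_pos)

text \<open>The transpose of \<open>R A\<close> turns \<open>wv Y\<close> into the functional of
  \<open>mat_adjoint A * Y\<close>, whose orthogonal complement is the preimage under
  \<open>A\<close> of that of \<open>Y\<close>. This is the image under the inverse
  \<open>B\<close>, whose class is in \<Gamma>, so \<open>lims_invariant\<close> applies to
  \<open>B\<close>.\<close>

lemma Z1_invariant:
  assumes A: "A \<in> carrier_mat d d" "det A \<noteq> 0" "pcoset A \<in> \<Gamma>" and f: "f \<in> Z1"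
  shows "(R A)\<^sup>T *\<^sub>v f \<in> Z1"
proof -
  obtain Y l where Y: "frame d k Y" "f = wv Y" and l: "l \<in> lims" and ann: "ann d Y = cspace d (l * std_frame d (d - k))"
    using f unfolding Z1_def by blast
  define M where "M = l * std_frame d (d - k)"
  have Mc: "M \<in> carrier_mat d (d - k)" unfolding M_def by (rule mult_carrier_mat[OF lims_carrier[OF l] std_frame_carrier])
  have cY: "Y \<in> carrier_mat d k" by (rule frame_carrier[OF Y(1)])
  obtain B where B: "B \<in> carrier_mat d d" "A * B = 1\<^sub>m d" "B * A = 1\<^sub>m d" "det B \<noteq> 0"
    by (rule GL_inverse[OF A(1,2)])
  obtain l1 where l1: "l1 \<in> lims" "\<And>j. j \<in> \<theta> \<Longrightarrow> cspace d (B * (l * std_frame d j)) = cspace d (l1 * std_frame d j)"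
    by (rule lims_invariant[OF l B(1,4) Gamma_inv[OF A(3,1,2) B(1,4,3)]]) (rule that)
  have AY: "mat_adjoint A * Y \<in> carrier_mat d k" by (rule mult_carrier_mat[OF mat_adjoint_carrier[OF A(1)] cY])
  have adj: "mat_adjoint (mat_adjoint A * Y) *\<^sub>v v = mat_adjoint Y *\<^sub>v (A *\<^sub>v v)" if v: "v \<in> carrier_vec d" for v
    unfolding mat_adjoint_mult[OF mat_adjoint_carrier[OF A(1)] cY] mat_adjoint_adjoint
    by (rule assoc_mult_mat_vec[OF mat_adjoint_carrier[OF cY] A(1) v])
  have mem: "v \<in> ann d (mat_adjoint A * Y) \<longleftrightarrow> A *\<^sub>v v \<in> cspace d M" if v: "v \<in> carrier_vec d" for v
    unfolding M_def ann[symmetric] ann_def mem_Collect_eq adj[OF v] carrier_matD(2)[OF AY] carrier_matD(2)[OF cY]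
    using v mult_mat_vec_carrier[OF A(1) v] by simp
  have "ann d (mat_adjoint A * Y) = cspace d (B * M)"
  proof (intro equalityI subsetI)
    fix v assume v: "v \<in> ann d (mat_adjoint A * Y)"
    then have vc: "v \<in> carrier_vec d" by (simp add: ann_def)
    obtain x where x: "x \<in> carrier_vec (d - k)" "A *\<^sub>v v = M *\<^sub>v x"
      using v unfolding mem[OF vc] cspace_eq[OF Mc] by blast
    have "v = B * A *\<^sub>v v" using B(3) vc by simp
    also have "\<dots> = B *\<^sub>v (M *\<^sub>v x)" unfolding assoc_mult_mat_vec[OF B(1) A(1) vc] x(2) ..
    also have "\<dots> = B * M *\<^sub>v x" by (rule assoc_mult_mat_vec[OF B(1) Mc x(1), symmetric])
    finally show "v \<in> cspace d (B * M)" unfolding cspace_eq[OF mult_carrier_mat[OF B(1) Mc]] using x(1) by blast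
  next
    fix v assume "v \<in> cspace d (B * M)"
    then obtain x where x: "x \<in> carrier_vec (d - k)" "v = B * M *\<^sub>v x"
      unfolding cspace_eq[OF mult_carrier_mat[OF B(1) Mc]] by blast
    have Mx: "M *\<^sub>v x \<in> carrier_vec d" by (rule mult_mat_vec_carrier[OF Mc x(1)])
    have v: "v = B *\<^sub>v (M *\<^sub>v x)" unfolding x(2) by (rule assoc_mult_mat_vec[OF B(1) Mc x(1)])
    have vc: "v \<in> carrier_vec d" unfolding v by (rule mult_mat_vec_carrier[OF B(1) Mx])
    have "A *\<^sub>v v = A * B *\<^sub>v (M *\<^sub>v x)" unfolding v by (rule assoc_mult_mat_vec[OF A(1) B(1) Mx, symmetric])
    then have "A *\<^sub>v v = M *\<^sub>v x" using B(2) Mx by simp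
    then show "v \<in> ann d (mat_adjoint A * Y)" unfolding mem[OF vc] cspace_eq[OF Mc] using x(1) by blast
  qed
  also have "\<dots> = cspace d (l1 * std_frame d (d - k))" unfolding M_def by (rule l1(2)[OF kd(3)])
  finally have ann': "ann d (mat_adjoint A * Y) = cspace d (l1 * std_frame d (d - k))" .
  have "det (mat_adjoint A) \<noteq> 0" using A(2) unfolding det_mat_adjoint[OF A(1)] by simp
  then have "frame d k (mat_adjoint A * Y)" by (rule frame_mult_invertible[OF mat_adjoint_carrier[OF A(1)] _ Y(1)])
  then show ?thesis unfolding Y(2) R_wv[OF A(1) cY] Z1_def using l1(1) ann' by blast
qed

lemma Z_invariant:
  assumes A: "A \<in> carrier_mat d d" "det A \<noteq> 0" "pcoset A \<in> \<Gamma>" and f: "f \<in> ZZ"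
  shows "(R A)\<^sup>T *\<^sub>v f \<in> ZZ"
proof (cases "f \<in> Z1")
  case True
  then show ?thesis using Z1_invariant[OF A] by (simp add: ZZ_def)
next
  case False
  then have "f \<in> Z2" using f by (simp add: ZZ_def)
  then obtain C \<kappa> where C: "C \<in> carrier_mat d d" "det C \<noteq> 0" "pcoset C \<in> \<Gamma>" "\<kappa> \<in> K0" "f = (R C)\<^sup>T *\<^sub>v \<kappa>"
    unfolding Z2_def by blast
  have t: "(R B)\<^sup>T \<in> carrier_mat N N" for B by simp
  have "(R A)\<^sup>T *\<^sub>v f = ((R A)\<^sup>T * (R C)\<^sup>T) *\<^sub>v \<kappa>"
    unfolding C(5) by (rule assoc_mult_mat_vec[OF t t K0_carrier[OF C(4)], symmetric])
  also have "(R A)\<^sup>T * (R C)\<^sup>T = (R (C * A))\<^sup>T"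
    unfolding R_mult[OF C(1) A(1)] by (rule transpose_mult[OF R_carrier R_carrier, symmetric])
  finally have eq: "(R A)\<^sup>T *\<^sub>v f = (R (C * A))\<^sup>T *\<^sub>v \<kappa>" .
  have "C * A \<in> carrier_mat d d" "det (C * A) \<noteq> 0" "pcoset (C * A) \<in> \<Gamma>"
    using mult_carrier_mat[OF C(1) A(1)] det_mult[OF C(1) A(1)] C(2) A(2) Gamma_mult[OF C(3) A(3) C(1,2) A(1,2)] by auto
  then show ?thesis unfolding eq ZZ_def Z2_def using C(4) by blast
qed

lemma Cone_invariant:
  assumes A: "A \<in> carrier_mat d d" "det A \<noteq> 0" "pcoset A \<in> \<Gamma>" and v: "v \<in> Cone"
  shows "R A *\<^sub>v v \<in> Cone"
proof -
  have vc: "v \<in> carrier_vec N" "\<And>f. f \<in> ZZ \<Longrightarrow> f \<bullet> v > 0" using v by (auto simp: Cone_def)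
  have "f \<bullet> (R A *\<^sub>v v) > 0" if f: "f \<in> ZZ" for f
    unfolding transpose_scalar_prod[OF R_carrier ZZ_carrier[OF f] vc(1), symmetric]
    by (rule vc(2)[OF Z_invariant[OF A f]])
  then show ?thesis unfolding Cone_def using mult_mat_vec_carrier[OF R_carrier vc(1)] by blast
qed

section \<open>The representation on the domain and its faithfulness\<close>

definition rho0 :: "'k mat set \<Rightarrow> real mat set" where
  "rho0 g = pcoset (R (SOME A. A \<in> g))"

lemma rho0_pcoset:
  assumes A: "A \<in> carrier_mat d d"
  shows "rho0 (pcoset A) = pcoset (R A)"
proof -
  have "(SOME B. B \<in> pcoset A) \<in> pcoset A" using pcoset_self by (rule someI)
  then obtain c where c: "c \<noteq> 0" "(SOME B. B \<in> pcoset A) = c \<cdot>\<^sub>m A" by (auto simp: pcoset_def)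
  show ?thesis unfolding rho0_def c(2) R_smult[OF A] by (rule pcoset_smult) (use c(1) in simp)
qed

lemma rho0_hom: "rho0 \<in> hom (PGL d) (PGL N)"
proof (rule homI)
  fix x :: "'k mat set" assume "x \<in> carrier (PGL d)"
  then obtain A where A: "A \<in> carrier_mat d d" "det A \<noteq> 0" "x = pcoset A" by (auto simp: carrier_PGL)
  show "rho0 x \<in> carrier (PGL N)" unfolding A(3) rho0_pcoset[OF A(1)] by (rule pcoset_in_PGL[OF R_carrier det_R[OF A(1,2)]])
  fix y :: "'k mat set" assume "y \<in> carrier (PGL d)"
  then obtain B where B: "B \<in> carrier_mat d d" "det B \<noteq> 0" "y = pcoset B" by (auto simp: carrier_PGL)
  show "rho0 (x \<otimes>\<^bsub>PGL d\<^esub> y) = rho0 x \<otimes>\<^bsub>PGL N\<^esub> rho0 y"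
    unfolding A(3) B(3) PGL_mult[OF A(1,2) B(1,2)] rho0_pcoset[OF A(1)] rho0_pcoset[OF B(1)]
      rho0_pcoset[OF mult_carrier_mat[OF A(1) B(1)]] R_mult[OF A(1) B(1)]
    by (rule PGL_mult[OF R_carrier det_R[OF A(1,2)] R_carrier det_R[OF B(1,2)], symmetric])
qed

text \<open>If the images agree, then \<open>C * A\<close>, with \<open>C\<close> inverse to
  \<open>B\<close>, is represented by a scalar matrix. It therefore preserves every
  \<open>k\<close>-plane and is itself scalar.\<close>

lemma rho0_inj: "inj_on rho0 (carrier (PGL d))"
proof (rule inj_onI)
  fix x y :: "'k mat set" assume x: "x \<in> carrier (PGL d)" and y: "y \<in> carrier (PGL d)" and eq: "rho0 x = rho0 y"
  obtain A where A: "A \<in> carrier_mat d d" "det A \<noteq> 0" "x = pcoset A" using x by (auto simp: carrier_PGL)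
  obtain B where B: "B \<in> carrier_mat d d" "det B \<noteq> 0" "y = pcoset B" using y by (auto simp: carrier_PGL)
  have "pcoset (R A) = pcoset (R B)" using eq by (simp add: A B rho0_pcoset)
  then obtain t where t: "t \<noteq> 0" "R A = t \<cdot>\<^sub>m R B" by (rule pcoset_eqD)
  obtain C where C: "C \<in> carrier_mat d d" "B * C = 1\<^sub>m d" "C * B = 1\<^sub>m d" "det C \<noteq> 0" by (rule GL_inverse[OF B(1,2)])
  have CA: "C * A \<in> carrier_mat d d" "det (C * A) \<noteq> 0"
    using mult_carrier_mat[OF C(1) A(1)] det_mult[OF C(1) A(1)] A(2) C(4) by auto
  have "R (C * A) = t \<cdot>\<^sub>m (R C * R B)" unfolding R_mult[OF C(1) A(1)] t(2)
    by (rule mult_smult_distrib[OF R_carrier R_carrier])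
  also have "R C * R B = 1\<^sub>m N" unfolding R_mult[OF C(1) B(1), symmetric] C(3) R_one ..
  finally have R: "R (C * A) = t \<cdot>\<^sub>m 1\<^sub>m N" .
  obtain c where c: "C * A = c \<cdot>\<^sub>m 1\<^sub>m d"
    using scalar_of_preserving_spaces[OF CA(1) kd(1,2) cspace_of_R_scalar[OF CA R]] by blast
  have "A = B * C * A" using A(1) C(2) by simp
  also have "\<dots> = B * (C * A)" by (rule assoc_mult_mat[OF B(1) C(1) A(1)])
  also have "\<dots> = c \<cdot>\<^sub>m B" unfolding c using mult_smult_distrib[OF B(1) one_carrier_mat] B(1) by simp
  finally have AB: "A = c \<cdot>\<^sub>m B" .
  have "c \<noteq> 0" using A(2) AB d_pos B(1) by (auto simp: det_smult)
  then show "x = y" unfolding A(3) B(3) AB by (rule pcoset_smult)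
qed

lemma Gamma_inj: "inj_on rho0 \<Gamma>"
  by (rule inj_on_subset[OF rho0_inj]) (use Gamma_PGL in blast)

lemma subgroup_image: "subgroup (rho0 ` \<Gamma>) (PGL N)"
proof -
  interpret group_hom "PGL d" "PGL N" rho0
    by (intro group_hom.intro group_hom_axioms.intro group_PGL rho0_hom)
  show ?thesis by (rule subgroup_img_is_subgroup[OF Gamma_subgroup])
qed

lemma image_mat:
  assumes "g \<in> rho0 ` \<Gamma>"
  obtains A where "A \<in> carrier_mat d d" "det A \<noteq> 0" "pcoset A \<in> \<Gamma>" "g = pcoset (R A)"
proof -
  obtain h where h: "h \<in> \<Gamma>" "g = rho0 h" using assms by blast
  obtain A where A: "A \<in> carrier_mat d d" "det A \<noteq> 0" "h = pcoset A" by (rule Gamma_mat[OF h(1)])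
  show ?thesis by (rule that[of A]) (use A h rho0_pcoset in auto)
qed

lemma act_Omega:
  assumes A: "A \<in> carrier_mat d d" "det A \<noteq> 0" "pcoset A \<in> \<Gamma>"
  shows "act (pcoset (R A)) ` Omega = Omega"
proof (intro equalityI subsetI)
  have C: "Cone \<subseteq> carrier_vec N" by (auto simp: Cone_def)
  {
    fix L assume "L \<in> act (pcoset (R A)) ` Omega"
    then obtain v where v: "v \<in> Cone" "L = act (pcoset (R A)) (line v)" by (auto simp: Omega_def)
    have "L = line (R A *\<^sub>v v)" unfolding v(2) by (rule act_pcoset_line[OF R_carrier subsetD[OF C v(1)]])
    then show "L \<in> Omega" unfolding Omega_def using Cone_invariant[OF A v(1)] by blast
  next
    fix L assume "L \<in> Omega"
    then obtain v where v: "v \<in> Cone" "L = line v" by (auto simp: Omega_def)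
    note vc = subsetD[OF C v(1)]
    obtain B where B: "B \<in> carrier_mat d d" "A * B = 1\<^sub>m d" "B * A = 1\<^sub>m d" "det B \<noteq> 0"
      by (rule GL_inverse[OF A(1,2)])
    have Bv: "R B *\<^sub>v v \<in> Cone" by (rule Cone_invariant[OF B(1,4) Gamma_inv[OF A(3,1,2) B(1,4,3)] v(1)])
    have "act (pcoset (R A)) (line (R B *\<^sub>v v)) = line (R A *\<^sub>v (R B *\<^sub>v v))"
      by (rule act_pcoset_line[OF R_carrier subsetD[OF C Bv]])
    also have "R A *\<^sub>v (R B *\<^sub>v v) = R (A * B) *\<^sub>v v"
      unfolding R_mult[OF A(1) B(1)] by (rule assoc_mult_mat_vec[OF R_carrier R_carrier vc, symmetric])
    also have "\<dots> = v" unfolding B(2) R_one by (rule one_mult_mat_vec[OF vc])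
    finally show "L \<in> act (pcoset (R A)) ` Omega" unfolding v(2) Omega_def using Bv by (intro image_eqI[of _ _ "line (R B *\<^sub>v v)"]) auto
  }
qed

lemma image_Aut: "rho0 ` \<Gamma> \<subseteq> Aut N Omega"
proof
  fix g assume g: "g \<in> rho0 ` \<Gamma>"
  obtain A where A: "A \<in> carrier_mat d d" "det A \<noteq> 0" "pcoset A \<in> \<Gamma>" "g = pcoset (R A)" by (rule image_mat[OF g])
  show "g \<in> Aut N Omega" unfolding Aut_def mem_Collect_eq A(4)
    by (rule conjI[OF pcoset_in_PGL[OF R_carrier det_R[OF A(1,2)]] act_Omega[OF A(1-3)]])
qed

section \<open>Discreteness of the image group\<close>

lemma dual_base_pt: "l \<in> lims \<Longrightarrow> dual l \<bullet> base_pt > 0"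
  by (rule base_pt_pos) (simp add: ZZ_def dual_Z1)

lemma dual_nonzero: "l \<in> lims \<Longrightarrow> dual l \<noteq> 0\<^sub>v N"
  using dual_base_pt[of l] by (intro notI) simp

text \<open>A limit along distinct elements is a multiple of the rank-one matrix with column
  \<open>pt l0\<close> and row \<open>dual m1\<close>. It kills the nonzero vector
  \<open>pt m1\<close>, since the functional of a flag vanishes at its own point, so it is not
  invertible.\<close>

lemma no_limit_in_PGL:
  assumes \<gamma>: "inj \<gamma>" "\<And>t::nat. \<gamma> t \<in> \<Gamma>" and B: "\<And>t. pcoset (B t) = rho0 (\<gamma> t)"
    and lim: "mlim N N B A" and A: "A \<in> carrier_mat N N" "det A \<noteq> 0"
  shows False
proof -
  obtain r C c l0 m1 where r: "strict_mono (r :: nat \<Rightarrow> nat)"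
    and C: "\<forall>t::nat. C t \<in> carrier_mat d d \<and> det (C t) \<noteq> 0 \<and> \<gamma> (r t) = pcoset (C t) \<and> c t > 0"
    and lm: "l0 \<in> lims" "m1 \<in> lims" and cl: "\<forall>i<N. \<forall>j<N. (\<lambda>t. c t * R (C t) $$ (i, j)) \<longlonglongrightarrow> pt l0 $ i * dual m1 $ j"
    by (rule R_limit_subseq[OF \<gamma>]) (rule that)
  have "\<exists>e. B (r t) = e \<cdot>\<^sub>m R (C t)" for t
  proof -
    have "pcoset (B (r t)) = pcoset (R (C t))" using B[of "r t"] C rho0_pcoset[of "C t"] by simp
    then show ?thesis by (rule pcoset_eqD) blast
  qed
  then have "\<forall>t. \<exists>e. B (r t) = e \<cdot>\<^sub>m R (C t)" by (rule allI)
  from choice[OF this] obtain e where e: "\<forall>t. B (r t) = e t \<cdot>\<^sub>m R (C t)" by (elim exE)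
  obtain i0 where i0: "i0 < N" "pt l0 $ i0 \<noteq> 0" by (rule nonzero_entry[OF pt_carrier pt_nonzero[OF lm(1)]])
  obtain j0 where j0: "j0 < N" "dual m1 $ j0 \<noteq> 0" by (rule nonzero_entry[OF dual_carrier dual_nonzero[OF lm(2)]])
  obtain x where x: "\<And>i. i \<in> {..<N} \<times> {..<N} \<Longrightarrow> A $$ i = x * (pt l0 $ fst i * dual m1 $ snd i)"
  proof (rule proportional_limit[where a = "\<lambda>t i. B (r t) $$ i" and b = "\<lambda>t i. c t * R (C t) $$ i" and I = "{..<N} \<times> {..<N}"
        and x = "\<lambda>i. A $$ i" and y = "\<lambda>i. pt l0 $ fst i * dual m1 $ snd i" and s = "\<lambda>t. e t / c t" and ?i0.0 = "(i0, j0)"])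
    fix i assume "i \<in> {..<N} \<times> {..<N}"
    then obtain a b where i: "i = (a, b)" "a < N" "b < N" by auto
    show "(\<lambda>t. B (r t) $$ i) \<longlonglongrightarrow> A $$ i" unfolding i(1) by (rule mlimD[OF mlim_subseq[OF lim r] i(2,3)])
    show "(\<lambda>t. c t * R (C t) $$ i) \<longlonglongrightarrow> pt l0 $ fst i * dual m1 $ snd i" using cl i by simp
    fix t
    have "c t > 0" "B (r t) = e t \<cdot>\<^sub>m R (C t)" using C e by auto
    then show "B (r t) $$ i = e t / c t * (c t * R (C t) $$ i)" using i by (simp add: R_def)
  qed (use i0 j0 in auto)
  have "A *\<^sub>v pt m1 = 0\<^sub>v N"
  proof (rule eq_vecI)
    fix i assume "i < dim_vec (0\<^sub>v N :: real vec)"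
    then have i: "i < N" by simp
    have "(A *\<^sub>v pt m1) $ i = (\<Sum>j<N. A $$ (i, j) * pt m1 $ j)" by (rule mult_vec_index[OF A(1) pt_carrier i])
    also have "\<dots> = (\<Sum>j<N. x * pt l0 $ i * (dual m1 $ j * pt m1 $ j))"
      by (intro sum.cong refl) (use i x in auto)
    also have "\<dots> = x * pt l0 $ i * (dual m1 \<bullet> pt m1)" unfolding scalar_prod_sum[OF pt_carrier] by (rule sum_distrib_left[symmetric])
    also have "dual m1 \<bullet> pt m1 = 0" using dual_pt[OF lm(2,2)] by simp
    finally show "(A *\<^sub>v pt m1) $ i = 0\<^sub>v N $ i" using i by simp
  qed (use A in simp)
  then have "det A = 0" unfolding det_0_iff_vec_prod_zero_field[OF A(1)] using pt_nonzero[OF lm(2)] pt_carrier by blast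
  then show False using A(2) by contradiction
qed

lemma discrete: "subtopology (PGL_topology N) (rho0 ` \<Gamma>) = discrete_topology (rho0 ` \<Gamma>)"
proof (rule HOL.sym, unfold discrete_topology_unique, intro conjI ballI)
  let ?G = "rho0 ` \<Gamma>"
  have sub: "?G \<subseteq> carrier (PGL N)" using subgroup.subset[OF subgroup_image] .
  have top: "openin (PGL_topology N) T \<longleftrightarrow> T \<subseteq> carrier (PGL N) \<and>
     openin (subtopology (mat_topology N N) (carrier (GL N))) {A \<in> carrier_mat N N. det A \<noteq> 0 \<and> pcoset A \<in> T}" for T :: "real mat set set"
  proof -
    have ts: "topspace (subtopology (mat_topology N N) (carrier (GL N))) = {A \<in> carrier_mat N N. det A \<noteq> (0::real)}"
      by (auto simp: carrier_GL)
    have "(\<lambda>A. scalars N #>\<^bsub>GL N\<^esub> A) ` {A \<in> carrier_mat N N. det A \<noteq> (0::real)} = carrier (PGL N)"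
      unfolding carrier_PGL by (force simp: rcoset_scalars)
    moreover have "{A \<in> {A \<in> carrier_mat N N. det A \<noteq> (0::real)}. scalars N #>\<^bsub>GL N\<^esub> A \<in> T} = {A \<in> carrier_mat N N. det A \<noteq> 0 \<and> pcoset A \<in> T}"
      by (auto simp: rcoset_scalars)
    ultimately show ?thesis unfolding PGL_topology_def openin_quotient_topology ts by simp
  qed
  \<comment> \<open>Removing all other elements of the image from the whole group leaves an open
    set, and its trace on the image is \<open>{g}\<close>.\<close>
  have op: "openin (PGL_topology N) (carrier (PGL N) - (?G - {g}))" if g: "g \<in> ?G" for g
    unfolding top
  proof (intro conjI openin_mat_topologyI_seq)
    fix A :: "real mat" and B :: "nat \<Rightarrow> real mat"
    assume A: "A \<in> {A \<in> carrier_mat N N. det A \<noteq> 0 \<and> pcoset A \<in> carrier (PGL N) - (?G - {g})}"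
      and B: "\<And>t. B t \<in> carrier (GL N)" and lim: "mlim N N B A"
    have Ac: "A \<in> carrier_mat N N" "det A \<noteq> 0" "pcoset A \<notin> ?G - {g}" using A by auto
    have Bc: "B t \<in> carrier_mat N N" "det (B t) \<noteq> 0" for t using B[of t] by (auto simp: carrier_GL)
    show "\<exists>t. B t \<in> {A \<in> carrier_mat N N. det A \<noteq> 0 \<and> pcoset A \<in> carrier (PGL N) - (?G - {g})}"
    proof (rule ccontr)
      assume neg: "\<not> ?thesis"
      have Bg: "pcoset (B t) \<in> ?G - {g}" for t
      proof (rule ccontr)
        assume "pcoset (B t) \<notin> ?G - {g}"
        then have "B t \<in> {A \<in> carrier_mat N N. det A \<noteq> 0 \<and> pcoset A \<in> carrier (PGL N) - (?G - {g})}"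
          using Bc[of t] pcoset_in_PGL[of "B t" N] by simp
        then show False using neg by (metis exI)
      qed
      then have "\<forall>t. \<exists>h. h \<in> \<Gamma> \<and> pcoset (B t) = rho0 h" by (metis DiffE imageE)
      from choice[OF this] obtain h where h: "\<forall>t. h t \<in> \<Gamma> \<and> pcoset (B t) = rho0 (h t)" by (elim exE)
      obtain r where r: "strict_mono (r::nat\<Rightarrow>nat)" "(\<forall>t. h (r t) = h (r 0)) \<or> inj (\<lambda>t. h (r t))"
        using const_or_inj_subseq[of h] by (elim exE conjE)
      from r(2) show False
      proof
        assume "inj (\<lambda>t. h (r t))"
        then show False
          by (rule no_limit_in_PGL[where B = "\<lambda>t. B (r t)" and A = A]) (use h mlim_subseq[OF lim r(1)] Ac in auto)
      next
        \<comment> \<open>The class does not change along the subsequence, so the limit lies in it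
          as well and would be one of the removed elements.\<close>
        assume const: "\<forall>t. h (r t) = h (r 0)"
        have "\<exists>e. B (r t) = e \<cdot>\<^sub>m B (r 0)" for t
        proof -
          have "pcoset (B (r t)) = pcoset (B (r 0))" using h spec[OF const, of t] by simp
          then show ?thesis by (rule pcoset_eqD) blast
        qed
        then have "\<forall>t. \<exists>e. B (r t) = e \<cdot>\<^sub>m B (r 0)" by (rule allI)
        from choice[OF this] obtain e where e: "\<forall>t. B (r t) = e t \<cdot>\<^sub>m B (r 0)" by (elim exE)
        define M where "M = B (r 0)"
        have M: "M \<in> carrier_mat N N" "det M \<noteq> 0" using Bc by (auto simp: M_def)
        have "M \<noteq> 0\<^sub>m N N" using M(2) det_zero[OF N_pos] by auto
        then obtain i0 where i0: "i0 \<in> {..<N} \<times> {..<N}" "M $$ i0 \<noteq> 0"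
          by (rule nonzero_mat_entry[OF M(1)])
        obtain x where x: "\<And>i. i \<in> {..<N} \<times> {..<N} \<Longrightarrow> A $$ i = x * M $$ i"
        proof (rule proportional_limit[where a = "\<lambda>t i. B (r t) $$ i" and b = "\<lambda>t i. M $$ i" and I = "{..<N} \<times> {..<N}"
              and x = "\<lambda>i. A $$ i" and y = "\<lambda>i. M $$ i" and s = e and ?i0.0 = i0])
          fix i assume "i \<in> {..<N} \<times> {..<N}"
          then obtain a b where i: "i = (a, b)" "a < N" "b < N" by auto
          show "(\<lambda>t. B (r t) $$ i) \<longlonglongrightarrow> A $$ i" unfolding i(1) by (rule mlimD[OF mlim_subseq[OF lim r(1)] i(2,3)])
          fix t
          have "B (r t) = e t \<cdot>\<^sub>m M" unfolding M_def by (rule spec[OF e])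
          then show "B (r t) $$ i = e t * M $$ i" using i M(1) by simp
        qed (use i0 in auto)
        have AM: "A = x \<cdot>\<^sub>m M" by (rule eq_matI) (use x Ac(1) M(1) in auto)
        have "x \<noteq> 0" using Ac(2) AM N_pos M(1) by (auto simp: det_smult)
        then have "pcoset A = pcoset (B (r 0))" unfolding AM M_def by (rule pcoset_smult)
        then show False using Bg[of "r 0"] Ac(3) by simp
      qed
    qed
  qed (auto simp: carrier_GL)
  have "topspace (PGL_topology N) = carrier (PGL N :: real mat set monoid)"
  proof (intro equalityI subsetI)
    fix g assume "g \<in> topspace (PGL_topology N :: real mat set topology)"
    then show "g \<in> carrier (PGL N)" using top[of "topspace (PGL_topology N)"] openin_topspace by blast
  next
    fix g assume g: "g \<in> carrier (PGL N :: real mat set monoid)"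
    have "{A \<in> carrier_mat N N. det A \<noteq> 0 \<and> pcoset A \<in> carrier (PGL N)} = carrier (GL N :: real mat monoid)"
      using pcoset_in_PGL by (auto simp: carrier_GL)
    moreover have "openin (subtopology (mat_topology N N) (carrier (GL N))) (carrier (GL N :: real mat monoid))"
    proof -
      have "topspace (subtopology (mat_topology N N) (carrier (GL N))) = carrier (GL N :: real mat monoid)"
        by (auto simp: carrier_GL)
      then show ?thesis using openin_topspace[of "subtopology (mat_topology N N) (carrier (GL N :: real mat monoid))"] by simp
    qed
    ultimately have "openin (PGL_topology N) (carrier (PGL N :: real mat set monoid))" unfolding top by simp
    then show "g \<in> topspace (PGL_topology N)" using g openin_subset by blast
  qed
  then show "topspace (subtopology (PGL_topology N) ?G) = ?G" using sub by auto
  fix g assume g: "g \<in> ?G"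
  show "openin (subtopology (PGL_topology N) ?G) {g}" unfolding openin_subtopology
    by (rule exI[of _ "carrier (PGL N) - (?G - {g})"]) (use op[OF g] g sub in auto)
qed

section \<open>Limits of orbits and the orbital limit set\<close>

lemma orbit_limit:
  assumes lim: "\<forall>i<N. \<forall>j<N. (\<lambda>t. c t * R (B t) $$ (i, j)) \<longlonglongrightarrow> pt l0 $ i * dual m1 $ j" and v: "v \<in> carrier_vec N"
  shows "vlim N (\<lambda>t. c t \<cdot>\<^sub>v (R (B t) *\<^sub>v v)) ((dual m1 \<bullet> v) \<cdot>\<^sub>v pt l0)"
  unfolding vlim_def
proof (intro allI impI)
  fix i assume i: "i < N"
  have "(\<lambda>t. \<Sum>j<N. c t * R (B t) $$ (i, j) * v $ j) \<longlonglongrightarrow> (\<Sum>j<N. pt l0 $ i * dual m1 $ j * v $ j)"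
  proof (rule tendsto_sum)
    fix j assume "j \<in> {..<N}"
    then have "(\<lambda>t. c t * R (B t) $$ (i, j)) \<longlonglongrightarrow> pt l0 $ i * dual m1 $ j" using lim i by simp
    then show "(\<lambda>t. c t * R (B t) $$ (i, j) * v $ j) \<longlonglongrightarrow> pt l0 $ i * dual m1 $ j * v $ j" by (rule tendsto_mult_right)
  qed
  moreover have "(c t \<cdot>\<^sub>v (R (B t) *\<^sub>v v)) $ i = (\<Sum>j<N. c t * R (B t) $$ (i, j) * v $ j)" for t
  proof -
    have "(c t \<cdot>\<^sub>v (R (B t) *\<^sub>v v)) $ i = c t * (R (B t) *\<^sub>v v) $ i"
      using carrier_vecD[OF mult_mat_vec_carrier[OF R_carrier v]] i by (intro index_smult_vec(1)) simp
    also have "\<dots> = (\<Sum>j<N. c t * R (B t) $$ (i, j) * v $ j)"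
      unfolding mult_vec_index[OF R_carrier v i] by (simp add: sum_distrib_left mult.assoc)
    finally show ?thesis .
  qed
  moreover have "((dual m1 \<bullet> v) \<cdot>\<^sub>v pt l0) $ i = (\<Sum>j<N. pt l0 $ i * dual m1 $ j * v $ j)"
  proof -
    have "((dual m1 \<bullet> v) \<cdot>\<^sub>v pt l0) $ i = (dual m1 \<bullet> v) * pt l0 $ i"
      using i by (simp add: carrier_vecD[OF pt_carrier])
    also have "\<dots> = (\<Sum>j<N. pt l0 $ i * dual m1 $ j * v $ j)"
      unfolding scalar_prod_sum[OF v] sum_distrib_right by (intro sum.cong refl) (simp add: mult_ac)
    finally show ?thesis .
  qed
  ultimately show "(\<lambda>t. (c t \<cdot>\<^sub>v (R (B t) *\<^sub>v v)) $ i) \<longlonglongrightarrow> ((dual m1 \<bullet> v) \<cdot>\<^sub>v pt l0) $ i" by simp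
qed

lemma Cone_carrier: "v \<in> Cone \<Longrightarrow> v \<in> carrier_vec N"
  by (simp add: Cone_def)

lemma ConeD: "v \<in> Cone \<Longrightarrow> f \<in> ZZ \<Longrightarrow> f \<bullet> v > 0"
  by (simp add: Cone_def)

lemma base_pt_Cone: "base_pt \<in> Cone"
  by (simp add: Cone_def base_pt_pos)

lemma pt_nonneg: "l \<in> lims \<Longrightarrow> f \<in> ZZ \<Longrightarrow> f \<bullet> pt l \<ge> 0"
  unfolding pt_def by (rule ZZ_u_nonneg[OF _ lE_carrier])

lemma orbit_line_limit:
  assumes B: "\<forall>t::nat. B t \<in> carrier_mat d d \<and> det (B t) \<noteq> 0 \<and> \<gamma> t = pcoset (B t) \<and> c t > 0" and \<gamma>: "\<And>t. \<gamma> t \<in> \<Gamma>"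
    and lm: "l0 \<in> lims" "m1 \<in> lims"
    and lim: "\<forall>i<N. \<forall>j<N. (\<lambda>t. c t * R (B t) $$ (i, j)) \<longlonglongrightarrow> pt l0 $ i * dual m1 $ j" and v: "v \<in> Cone"
  obtains y where "\<And>t. y t \<in> carrier_vec N" "\<And>t. line (y t) = act (rho0 (\<gamma> t)) (line v)" "\<And>t. line (y t) \<in> Omega"
    "vlim N y (pt l0)" "limitin (proj_topology N) (\<lambda>t. act (rho0 (\<gamma> t)) (line v)) (line (pt l0)) sequentially"
proof -
  define \<beta> where "\<beta> = dual m1 \<bullet> v"
  have \<beta>: "\<beta> > 0" unfolding \<beta>_def by (rule ConeD[OF v]) (simp add: ZZ_def dual_Z1[OF lm(2)])
  note vc = Cone_carrier[OF v]
  have Rv: "R M *\<^sub>v v \<in> carrier_vec N" for M by (rule mult_mat_vec_carrier[OF R_carrier vc])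
  \<comment> \<open>Dividing by the positive number \<open>\<beta>\<close> makes these lifts
    converge to \<open>pt l0\<close> itself.\<close>
  define y where "y t = (c t / \<beta>) \<cdot>\<^sub>v (R (B t) *\<^sub>v v)" for t
  have yc: "y t \<in> carrier_vec N" for t using Rv by (simp add: y_def)
  have ly: "line (y t) = line (R (B t) *\<^sub>v v)" for t
  proof -
    have "c t > 0" using B by blast
    then show ?thesis unfolding y_def using \<beta> by (intro line_smult) simp
  qed
  have act: "line (y t) = act (rho0 (\<gamma> t)) (line v)" for t
  proof -
    have t: "B t \<in> carrier_mat d d" "\<gamma> t = pcoset (B t)" using B by auto
    show ?thesis unfolding ly t(2) rho0_pcoset[OF t(1)] act_pcoset_line[OF R_carrier vc] ..
  qed
  have Om: "line (y t) \<in> Omega" for t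
  proof -
    have t: "B t \<in> carrier_mat d d" "det (B t) \<noteq> 0" "\<gamma> t = pcoset (B t)" using B by auto
    have "R (B t) *\<^sub>v v \<in> Cone" by (rule Cone_invariant[OF t(1,2) _ v]) (use \<gamma>[of t] t(3) in simp)
    then show ?thesis unfolding ly Omega_def by (rule imageI)
  qed
  have vl: "vlim N y (pt l0)"
    unfolding vlim_def
  proof (intro allI impI)
    fix i assume i: "i < N"
    have "(\<lambda>t. (c t \<cdot>\<^sub>v (R (B t) *\<^sub>v v)) $ i / \<beta>) \<longlonglongrightarrow> (\<beta> \<cdot>\<^sub>v pt l0) $ i / \<beta>"
      using orbit_limit[OF lim vc] i \<beta> unfolding vlim_def \<beta>_def by (intro tendsto_divide tendsto_const) auto
    moreover have "(c t \<cdot>\<^sub>v (R (B t) *\<^sub>v v)) $ i / \<beta> = y t $ i" for t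
      using i by (simp add: y_def carrier_vecD[OF Rv] del: index_mult_mat_vec dim_mult_mat_vec)
    moreover have "(\<beta> \<cdot>\<^sub>v pt l0) $ i / \<beta> = pt l0 $ i"
      using i \<beta> by (simp add: carrier_vecD[OF pt_carrier])
    ultimately show "(\<lambda>t. y t $ i) \<longlonglongrightarrow> pt l0 $ i" by simp
  qed
  have "limitin (proj_topology N) (\<lambda>t. line (y t)) (line (pt l0)) sequentially"
    by (rule limitin_projI[OF pt_carrier pt_nonzero[OF lm(1)] yc vl])
  then show ?thesis using that[of y, OF yc act Om vl] by (simp add: act)
qed

text \<open>Elements of \<Gamma> whose left factors tend to \<open>l\<close> move the line of
  \<open>base_pt\<close> towards that of \<open>pt l\<close>, so the latter is a limit of points of
  the domain; it is not in the domain because \<open>dual l\<close> vanishes there.\<close>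

lemma pt_frontier:
  assumes l: "l \<in> lims"
  shows "line (pt l) \<in> proj_topology N frontier_of Omega" "line (pt l) \<in> orbital_limit_set N Omega (rho0 ` \<Gamma>)"
proof -
  obtain \<gamma> l' s m where \<gamma>: "inj \<gamma>" "\<And>t::nat. \<gamma> t \<in> \<Gamma>" and svd: "\<And>t. svd_of d (\<gamma> t) (l' t) (s t) (m t)" and lim: "mlim d d l' l"
    by (rule seq_of_lims[OF l]) (rule that)
  obtain m0 r where r: "m0 \<in> unitary_mats d" "strict_mono r" "mlim d d (\<lambda>t. m (r t)) m0"
    using unitary_subseq[of m, OF svd_ofD(2)[OF svd]] .
  obtain B c m1 where B: "\<forall>t::nat. B t \<in> carrier_mat d d \<and> det (B t) \<noteq> 0 \<and> \<gamma> (r t) = pcoset (B t) \<and> c t > 0"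
    and m1: "m1 \<in> lims" and cl: "\<forall>i<N. \<forall>j<N. (\<lambda>t. c t * R (B t) $$ (i, j)) \<longlonglongrightarrow> pt l $ i * dual m1 $ j"
    using R_limit[of "\<lambda>t. \<gamma> (r t)" "\<lambda>t. l' (r t)" "\<lambda>t. s (r t)" "\<lambda>t. m (r t)" l m0,
      OF inj_subseq[OF \<gamma>(1) r(2)] \<gamma>(2) svd mlim_subseq[OF lim r(2)] lims_unitary[OF l] r(3,1)] .
  obtain y where y: "\<And>t. y t \<in> carrier_vec N" "\<And>t. line (y t) = act (rho0 (\<gamma> (r t))) (line base_pt)" "\<And>t. line (y t) \<in> Omega"
    "vlim N y (pt l)" and li: "limitin (proj_topology N) (\<lambda>t. act (rho0 (\<gamma> (r t))) (line base_pt)) (line (pt l)) sequentially"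
    by (rule orbit_line_limit[OF B \<gamma>(2) l m1 cl base_pt_Cone]) (rule that)
  show fr: "line (pt l) \<in> proj_topology N frontier_of Omega"
    by (rule frontierI[OF pt_carrier pt_nonzero[OF l] y(4,3,1), of "dual l"]) (use dual_Z1[OF l] dual_pt[OF l l] in \<open>auto simp: ZZ_def\<close>)
  have "line base_pt \<in> Omega" unfolding Omega_def by (rule imageI[OF base_pt_Cone])
  moreover have "range (\<lambda>t. rho0 (\<gamma> (r t))) \<subseteq> rho0 ` \<Gamma>" using \<gamma>(2) by auto
  ultimately show "line (pt l) \<in> orbital_limit_set N Omega (rho0 ` \<Gamma>)"
    unfolding orbital_limit_set_def mem_Collect_eq
    by (intro conjI fr bexI[of _ "line base_pt"] exI[of _ "\<lambda>t. rho0 (\<gamma> (r t))"] li)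
qed

lemma orbital_limit_set_eq: "orbital_limit_set N Omega (rho0 ` \<Gamma>) = (\<lambda>l. line (pt l)) ` lims"
proof (intro equalityI subsetI)
  fix z assume "z \<in> orbital_limit_set N Omega (rho0 ` \<Gamma>)"
  then obtain x \<gamma> where fr: "z \<in> proj_topology N frontier_of Omega" and x: "x \<in> Omega" and \<gamma>: "range \<gamma> \<subseteq> rho0 ` \<Gamma>"
    and lim: "limitin (proj_topology N) (\<lambda>i. act (\<gamma> i) x) z sequentially"
    unfolding orbital_limit_set_def by (elim CollectE conjE bexE exE)
  obtain v where v: "v \<in> Cone" "x = line v" using x by (auto simp: Omega_def)
  have "\<exists>h. h \<in> \<Gamma> \<and> \<gamma> t = rho0 h" for t using \<gamma> by (metis imageE range_subsetD)
  then have "\<forall>t. \<exists>h. h \<in> \<Gamma> \<and> \<gamma> t = rho0 h" by (rule allI)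
  from choice[OF this] obtain h where h: "\<forall>t. h t \<in> \<Gamma> \<and> \<gamma> t = rho0 (h t)" by (elim exE)
  obtain r where r: "strict_mono (r::nat\<Rightarrow>nat)" "(\<forall>t. h (r t) = h (r 0)) \<or> inj (\<lambda>t. h (r t))"
    using const_or_inj_subseq[of h] by (elim exE conjE)
  have limr: "limitin (proj_topology N) (\<lambda>i. act (\<gamma> (r (q i))) x) z sequentially" if "strict_mono q" for q
    using limitin_subsequence[OF strict_mono_o[OF r(1) that] lim] by (simp add: o_def)
  from r(2) show "z \<in> (\<lambda>l. line (pt l)) ` lims"
  proof
    \<comment> \<open>A repeated element would put the limit into the open domain, away from its
      frontier.\<close>
    assume const: "\<forall>t. h (r t) = h (r 0)"
    define L where "L = act (\<gamma> (r 0)) x"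
    have "act (\<gamma> (r t)) x = L" for t using h spec[OF const, of t] by (simp add: L_def)
    then have lim': "limitin (proj_topology N) (\<lambda>i. L) z sequentially" using limr[of "\<lambda>i. i"] by (simp add: strict_mono_def)
    obtain A where A: "A \<in> carrier_mat d d" "det A \<noteq> 0" "pcoset A \<in> \<Gamma>" "\<gamma> (r 0) = pcoset (R A)"
      by (rule image_mat[of "\<gamma> (r 0)"]) (use \<gamma> in auto)
    have L: "L \<in> Omega" using imageI[OF x, of "act (pcoset (R A))"] unfolding act_Omega[OF A(1-3)] L_def A(4) .
    have "limitin (proj_topology N) (\<lambda>i::nat. L) L sequentially" using L openin_subset[OF openin_Omega] by auto
    from limitin_Gr_unique[OF this lim'] have "L = z" by simp
    then have "z \<in> proj_topology N interior_of Omega" using L interior_of_openin[OF openin_Omega] by simp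
    then show ?thesis using fr by (simp add: frontier_of_def)
  next
    assume inj: "inj (\<lambda>t. h (r t))"
    have hG: "h (r t) \<in> \<Gamma>" for t using h by blast
    obtain q B c l0 m1 where q: "strict_mono (q::nat\<Rightarrow>nat)"
      and B: "\<forall>t::nat. B t \<in> carrier_mat d d \<and> det (B t) \<noteq> 0 \<and> h (r (q t)) = pcoset (B t) \<and> c t > 0"
      and lm: "l0 \<in> lims" "m1 \<in> lims" and cl: "\<forall>i<N. \<forall>j<N. (\<lambda>t. c t * R (B t) $$ (i, j)) \<longlonglongrightarrow> pt l0 $ i * dual m1 $ j"
      by (rule R_limit_subseq[of "\<lambda>t. h (r t)", OF inj hG]) (rule that)
    have "limitin (proj_topology N) (\<lambda>t. act (rho0 (h (r (q t)))) (line v)) (line (pt l0)) sequentially"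
      by (rule orbit_line_limit[OF B hG lm cl v(1)])
    moreover have "\<gamma> t = rho0 (h t)" for t using h by blast
    ultimately have "limitin (proj_topology N) (\<lambda>t. act (\<gamma> (r (q t))) x) (line (pt l0)) sequentially" by (simp add: v(2))
    from limitin_Gr_unique[OF limr[OF q] this] have "z = line (pt l0)" by simp
    then show ?thesis using lm(1) by blast
  qed
qed (use pt_frontier(2) in auto)

text \<open>Elements of \<open>Z2\<close> are positive on the points of all frames, so a functional
  that vanishes at \<open>pt l\<close> belongs to a limit flag, and by \<open>incidence\<close> this
  is the flag of \<open>l\<close>.\<close>

lemma zero_flag:
  assumes f: "f \<in> ZZ" and l: "l \<in> lims" and z: "f \<bullet> pt l = 0"
  obtains Y l' where "frame d k Y" "f = wv Y" "l' \<in> lims" "ann d Y = cspace d (l' * std_frame d (d - k))" "flag l' = flag l"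
proof -
  have "f \<notin> Z2" using Z2_u_pos[OF _ lE_frame[OF l], of f] z by (auto simp: pt_def)
  then have "f \<in> Z1" using f by (simp add: ZZ_def)
  then obtain Y l' where Y: "frame d k Y" "f = wv Y" "l' \<in> lims" "ann d Y = cspace d (l' * std_frame d (d - k))"
    unfolding Z1_def by blast
  have "flag l' = flag l" using incidence[OF Y(1,3,4) l] z unfolding Y(2) by simp
  then show ?thesis by (rule that[OF Y])
qed

lemma flag_eqD: "flag l = flag l' \<Longrightarrow> j \<in> \<theta> \<Longrightarrow> cspace d (l * std_frame d j) = cspace d (l' * std_frame d j)"
  using flag_theta by metis

text \<open>\<open>dual l\<close> vanishes at \<open>pt l'\<close> only for equal flags. So the
  line, which is built from the \<open>k\<close>-plane alone, determines the planes of all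
  dimensions in \<theta>, and \<open>xi\<close> is well defined.\<close>

lemma line_pt_eq_iff:
  assumes l: "l \<in> lims" "l' \<in> lims"
  shows "line (pt l) = line (pt l') \<longleftrightarrow> flag l = flag l'"
proof
  assume "line (pt l) = line (pt l')"
  then obtain c where c: "c \<noteq> 0" "pt l = c \<cdot>\<^sub>v pt l'" by (rule line_eqD[OF _ pt_carrier pt_nonzero[OF l(1)]])
  have "dual l \<bullet> pt l = c * (dual l \<bullet> pt l')" unfolding c(2) by (rule scalar_prod_smult_distrib[OF dual_carrier pt_carrier])
  moreover have "dual l \<bullet> pt l = 0" using dual_pt[OF l(1,1)] by simp
  ultimately have "dual l \<bullet> pt l' = 0" using c(1) by simp
  then show "flag l = flag l'" using dual_pt[OF l] by simp
next
  assume "flag l = flag l'"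
  from flag_eqD[OF this k(1)] obtain c where c: "c > 0" "u (l' * E) = c \<cdot>\<^sub>v u (l * E)"
    by (rule u_smult_frame[OF lE_frame[OF l(1)] lE_frame[OF l(2)]])
  show "line (pt l) = line (pt l')" unfolding pt_def c(2) by (rule line_smult[symmetric]) (use c(1) in simp)
qed

lemma visible: "projectively_visible N Omega (rho0 ` \<Gamma>)"
  unfolding projectively_visible_def orbital_limit_set_eq
proof (intro conjI ballI allI impI subgroup_image image_Aut discrete)
  fix x assume "x \<in> (\<lambda>l. line (pt l)) ` lims"
  then obtain l where l: "l \<in> lims" "x = line (pt l)" by blast
  have dl: "dual l \<in> ZZ" using dual_Z1[OF l(1)] by (simp add: ZZ_def)
  \<comment> \<open>A functional that vanishes at this point comes from the same flag; its frame has
    the same orthogonal complement, which makes it a multiple of \<open>dual l\<close>.\<close>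
  have uniq: "\<exists>c. f = c \<cdot>\<^sub>v dual l" if f: "f \<in> ZZ" "f \<bullet> pt l = 0" for f
  proof -
    obtain Y l' where Y: "frame d k Y" "f = wv Y" "l' \<in> lims" "ann d Y = cspace d (l' * std_frame d (d - k))" "flag l' = flag l"
      by (rule zero_flag[OF f(1) l(1) f(2)])
    have "ann d (l * (J * E)) = ann d Y" unfolding ann_lJE[OF l(1)] Y(4) by (rule flag_eqD[OF Y(5) kd(3), symmetric])
    from cspace_eq_of_ann[OF lJE_frame[OF l(1)] Y(1) this]
    obtain c where "wv Y = c \<cdot>\<^sub>v wv (l * (J * E))" by (rule u_smult_frame[OF lJE_frame[OF l(1)] Y(1)])
    then show ?thesis unfolding Y(2) dual_def by blast
  qed
  show "\<exists>!H. supporting_hyperplane N Omega H \<and> x \<subseteq> H" unfolding l(2)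
    by (rule unique_supporting_hyperplane[OF pt_carrier pt_nonzero[OF l(1)] pt_nonneg[OF l(1)] dl _ uniq pt_frontier(1)[OF l(1)]])
      (use dual_pt[OF l(1,1)] in auto)
  fix y S assume "y \<in> (\<lambda>l. line (pt l)) ` lims" and ne: "x \<noteq> y"
    and S: "open_proj_segment N x y S \<and> S \<subseteq> proj_topology N closure_of Omega"
  then obtain l' where l': "l' \<in> lims" "y = line (pt l')" by blast
  have dl': "dual l' \<in> ZZ" using dual_Z1[OF l'(1)] by (simp add: ZZ_def)
  have nf: "flag l \<noteq> flag l'" using ne line_pt_eq_iff[OF l(1) l'(1)] l(2) l'(2) by blast
  \<comment> \<open>A functional that vanishes at both points would belong to both flags.\<close>
  have pos: "f \<bullet> pt l > 0 \<or> f \<bullet> pt l' > 0" if f: "f \<in> ZZ" for f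
  proof (rule ccontr)
    assume "\<not> ?thesis"
    then have z: "f \<bullet> pt l = 0" "f \<bullet> pt l' = 0" using pt_nonneg[OF l(1) f] pt_nonneg[OF l'(1) f] by auto
    obtain Y l'' where Y: "frame d k Y" "f = wv Y" "l'' \<in> lims" "ann d Y = cspace d (l'' * std_frame d (d - k))" "flag l'' = flag l"
      by (rule zero_flag[OF f l(1) z(1)])
    have "flag l'' = flag l'" using incidence[OF Y(1,3,4) l'(1)] z(2) unfolding Y(2) by simp
    then show False using Y(5) nf by simp
  qed
  have d0: "dual l \<bullet> pt l = 0" "dual l' \<bullet> pt l' = 0" using dual_pt[OF l(1,1)] dual_pt[OF l'(1,1)] by auto
  show "S \<subseteq> Omega"
    by (rule segment_in_Omega[OF pt_carrier pt_nonneg[OF l(1)] pt_carrier pt_nonneg[OF l'(1)] pos dl d0(1) dl' d0(2),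
        of S, OF _ _ _ S[THEN conjunct1, unfolded l(2) l'(2)] S[THEN conjunct2]])
qed

section \<open>The boundary map\<close>

definition xi :: "real vec set \<Rightarrow> nat \<Rightarrow> 'k vec set" where
  "xi L = flag (SOME l. l \<in> lims \<and> L = line (pt l))"

lemma xi_pt:
  assumes l: "l \<in> lims"
  shows "xi (line (pt l)) = flag l"
proof -
  define l' where "l' = (SOME l'. l' \<in> lims \<and> line (pt l) = line (pt l'))"
  have l': "l' \<in> lims \<and> line (pt l) = line (pt l')" unfolding l'_def by (rule someI[of _ l]) (use l in simp)
  then have "flag l = flag l'" using line_pt_eq_iff[OF l] by blast
  then show ?thesis by (simp add: xi_def l'_def)
qed

text \<open>\<open>lims_invariant\<close> provides one matrix \<open>l1\<close> for all dimensions
  in \<theta>, so the \<open>k\<close>-plane that determines the line and the remaining planes of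
  the flag are moved consistently.\<close>

lemma xi_equivariant:
  assumes A: "A \<in> carrier_mat d d" "det A \<noteq> 0" "pcoset A \<in> \<Gamma>" and l: "l \<in> lims"
  shows "xi (act (pcoset (R A)) (line (pt l))) = act_flag \<theta> (pcoset A) (flag l)"
proof -
  obtain l1 where l1: "l1 \<in> lims" "\<And>j. j \<in> \<theta> \<Longrightarrow> cspace d (A * (l * std_frame d j)) = cspace d (l1 * std_frame d j)"
    by (rule lims_invariant[OF l A]) (rule that)
  obtain c where c: "c > 0" "u (l1 * E) = c \<cdot>\<^sub>v u (A * (l * E))"
    by (rule u_smult_frame[OF frame_mult_invertible[OF A(1,2) lE_frame[OF l]] lE_frame[OF l1(1)] l1(2)[OF k(1)]])
  have "act (pcoset (R A)) (line (pt l)) = line (R A *\<^sub>v pt l)" by (rule act_pcoset_line[OF R_carrier pt_carrier])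
  also have "R A *\<^sub>v pt l = u (A * (l * E))" unfolding pt_def by (rule R_u[OF A(1) lE_carrier[OF l]])
  also have "line \<dots> = line (pt l1)" unfolding pt_def c(2) by (rule line_smult[symmetric]) (use c(1) in simp)
  finally have "xi (act (pcoset (R A)) (line (pt l))) = flag l1" using xi_pt[OF l1(1)] by simp
  also have "\<dots> = act_flag \<theta> (pcoset A) (flag l)"
    unfolding act_flag_def flag_def[of l1]
  proof (rule restrict_ext)
    fix j assume j: "j \<in> \<theta>"
    have "act (pcoset A) (flag l j) = cspace d (A * (l * std_frame d j))"
      unfolding flag_theta[OF j] by (rule act_pcoset_image[OF A(1) mult_carrier_mat[OF lims_carrier[OF l] std_frame_carrier]])
    then show "cspace d (l1 * std_frame d j) = act (pcoset A) (flag l j)" using l1(2)[OF j] by simp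
  qed
  finally show ?thesis .
qed

lemma vlim_pt:
  assumes l: "\<And>t::nat. l t \<in> lims" "mlim d d l l0" "l0 \<in> lims"
  shows "vlim N (\<lambda>t. pt (l t)) (pt l0)"
  unfolding vlim_def pt_def
proof (intro allI impI)
  fix i assume i: "i < N"
  have ml: "mlim d k (\<lambda>t. l t * E) (l0 * E)"
    by (rule mlim_mult[OF l(2) mlim_const lims_carrier[OF l(1)] lims_carrier[OF l(3)] std_frame_carrier std_frame_carrier])
  show "(\<lambda>t. u (l t * E) $ i) \<longlonglongrightarrow> u (l0 * E) $ i"
    by (rule tendsto_u[OF ml lE_carrier[OF l(1)] lE_carrier[OF l(3)] i])
qed

text \<open>\<open>xi\<close> is induced by the continuous map \<open>flag\<close> on the compact
  set \<open>lims\<close>: matrices representing a convergent sequence of limit points have a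
  subsequence converging in \<open>lims\<close>, and its limit represents the limit point.\<close>

lemma xi_continuous:
  "continuous_map (subtopology (proj_topology N) ((\<lambda>l. line (pt l)) ` lims)) (flag_topology d \<theta>) xi"
proof -
  let ?L = "(\<lambda>l. line (pt l)) ` lims"
  have Gr: "?L \<subseteq> Gr N 1" unfolding Gr_lines using pt_carrier pt_nonzero by blast
  then have ts: "topspace (subtopology (proj_topology N) ?L) = ?L" by (auto simp: topspace_Gr_topology)
  show ?thesis unfolding continuous_map_def ts
  proof (intro conjI allI impI)
    show "xi \<in> ?L \<rightarrow> topspace (flag_topology d \<theta>)"
    proof (rule funcsetI)
      fix x assume "x \<in> ?L"
      then obtain l where l: "l \<in> lims" "x = line (pt l)" by blast
      have "limitin (flag_topology d \<theta>) (\<lambda>t::nat. flag l) (flag l) sequentially"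
        by (rule limitin_flag_topology[of "\<lambda>_. l", OF lims_unitary[OF l(1)] mlim_const lims_unitary[OF l(1)]])
      then show "xi x \<in> topspace (flag_topology d \<theta>)" unfolding l(2) xi_pt[OF l(1)] by (rule limitin_topspace)
    qed
    fix U :: "(nat \<Rightarrow> 'k vec set) set" assume U: "openin (flag_topology d \<theta>) U"
    \<comment> \<open>Lines outside the limit set belong to \<open>T\<close> as well, which allows
      \<open>T\<close> to be open in the whole projective space; its trace on the limit set is the
      preimage of \<open>U\<close>.\<close>
    define T where "T = {L \<in> Gr N 1. \<forall>l\<in>lims. L = line (pt l) \<longrightarrow> flag l \<in> U}"
    have "openin (proj_topology N) T"
    proof (rule openin_projI)
      fix L assume "L \<in> T"
      then show "\<exists>v\<in>carrier_vec N. v \<noteq> 0\<^sub>v N \<and> L = line v" unfolding T_def Gr_lines by blast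
    next
      fix v :: "nat \<Rightarrow> real vec" and x assume x: "x \<in> carrier_vec N" "x \<noteq> 0\<^sub>v N" "line x \<in> T"
        and v: "\<And>t. v t \<in> carrier_vec N" "\<And>t. v t \<noteq> 0\<^sub>v N" "vlim N v x"
      show "\<exists>t. line (v t) \<in> T"
      proof (rule ccontr)
        assume neg: "\<not> ?thesis"
        have "\<exists>l. l \<in> lims \<and> line (v t) = line (pt l) \<and> flag l \<notin> U" for t
        proof -
          have "line (v t) \<in> Gr N 1" unfolding Gr_lines using v(1,2) by blast
          moreover have "line (v t) \<notin> T" using neg by blast
          ultimately show ?thesis unfolding T_def by simp blast
        qed
        then have "\<forall>t. \<exists>l. l \<in> lims \<and> line (v t) = line (pt l) \<and> flag l \<notin> U" by (rule allI)
        from choice[OF this] obtain l where l: "\<forall>t. l t \<in> lims \<and> line (v t) = line (pt (l t)) \<and> flag (l t) \<notin> U" by (elim exE)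
        have ll: "l t \<in> lims" for t using l by blast
        obtain l0 r where r: "l0 \<in> unitary_mats d" "strict_mono r" "mlim d d (\<lambda>t. l (r t)) l0"
          using unitary_subseq[of l, OF lims_unitary[OF ll]] .
        have l0: "l0 \<in> lims" by (rule lims_closed[OF ll r(3) unitary_carrier[OF r(1)]])
        have "\<exists>s. v (r t) = s \<cdot>\<^sub>v pt (l (r t))" for t
        proof -
          have "line (v (r t)) = line (pt (l (r t)))" using l by blast
          then show ?thesis by (rule line_eqD[OF _ v(1,2)]) blast
        qed
        then have "\<forall>t. \<exists>s. v (r t) = s \<cdot>\<^sub>v pt (l (r t))" by (rule allI)
        from choice[OF this] obtain s where s: "\<forall>t. v (r t) = s t \<cdot>\<^sub>v pt (l (r t))" by (elim exE)
        obtain i0 where i0: "i0 < N" "pt l0 $ i0 \<noteq> 0" by (rule nonzero_entry[OF pt_carrier pt_nonzero[OF l0]])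
        obtain c where c: "\<And>i. i \<in> {..<N} \<Longrightarrow> x $ i = c * pt l0 $ i"
        proof (rule proportional_limit[where a = "\<lambda>t i. v (r t) $ i" and b = "\<lambda>t i. pt (l (r t)) $ i" and I = "{..<N}"
              and x = "\<lambda>i. x $ i" and y = "\<lambda>i. pt l0 $ i" and s = s and ?i0.0 = i0])
          fix i assume "i \<in> {..<N}"
          then have i: "i < N" by simp
          show "(\<lambda>t. v (r t) $ i) \<longlonglongrightarrow> x $ i" using vlim_subseq[OF v(3) r(2)] i by (simp add: vlim_def)
          show "(\<lambda>t. pt (l (r t)) $ i) \<longlonglongrightarrow> pt l0 $ i" using vlim_pt[OF ll r(3) l0] i by (simp add: vlim_def)
          fix t show "v (r t) $ i = s t * pt (l (r t)) $ i" unfolding spec[OF s, of t] using i by (simp add: carrier_vecD[OF pt_carrier])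
        qed (use i0 in auto)
        have xc: "x = c \<cdot>\<^sub>v pt l0" by (rule eq_vecI) (use x(1) c in \<open>auto simp: carrier_vecD[OF pt_carrier]\<close>)
        have "c \<noteq> 0"
        proof
          assume "c = 0"
          then have "x = 0\<^sub>v N" unfolding xc by (intro eq_vecI) (auto simp: carrier_vecD[OF pt_carrier])
          then show False using x(2) by contradiction
        qed
        then have lx: "line x = line (pt l0)" unfolding xc by (rule line_smult)
        then have "flag l0 \<in> U" using x(3) l0 unfolding T_def by blast
        moreover have "limitin (flag_topology d \<theta>) (\<lambda>t. flag (l (r t))) (flag l0) sequentially"
          by (rule limitin_flag_topology[of "\<lambda>t. l (r t)", OF lims_unitary[OF ll] r(3,1)])
        ultimately have "\<forall>\<^sub>F t in sequentially. flag (l (r t)) \<in> U" using U unfolding limitin_def by blast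
        then obtain t where "flag (l (r t)) \<in> U" using eventually_happens sequentially_bot by blast
        then show False using l by blast
      qed
    qed
    moreover have "{x \<in> ?L. xi x \<in> U} = T \<inter> ?L"
    proof (intro equalityI subsetI)
      fix x assume "x \<in> {x \<in> ?L. xi x \<in> U}"
      then obtain l where l: "l \<in> lims" "x = line (pt l)" "flag l \<in> U" using xi_pt by auto
      have "flag l' \<in> U" if "l' \<in> lims" "x = line (pt l')" for l'
        using line_pt_eq_iff[OF l(1) that(1)] that(2) l(2,3) by simp
      then show "x \<in> T \<inter> ?L" using l(1,2) Gr unfolding T_def by blast
    next
      fix x assume "x \<in> T \<inter> ?L"
      then obtain l where l: "l \<in> lims" "x = line (pt l)" "flag l \<in> U" unfolding T_def by blast
      then show "x \<in> {x \<in> ?L. xi x \<in> U}" using xi_pt[OF l(1)] by simp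
    qed
    ultimately show "openin (subtopology (proj_topology N) ?L) {x \<in> ?L. xi x \<in> U}" unfolding openin_subtopology by blast
  qed
qed

text \<open>The construction yields \<open>rho0\<close> from \<Gamma> to the automorphism group of
  the domain; the representation asked for goes the other way.\<close>

definition rho :: "real mat set \<Rightarrow> 'k mat set" where "rho = inv_into \<Gamma> rho0"

lemma rho_rho0: "g \<in> \<Gamma> \<Longrightarrow> rho (rho0 g) = g"
  unfolding rho_def by (rule inv_into_f_f[OF Gamma_inj])

lemma rho_hom: "rho \<in> hom (PGL N\<lparr>carrier := rho0 ` \<Gamma>\<rparr>) (PGL d)"
proof (rule homI)
  fix x assume "x \<in> carrier (PGL N\<lparr>carrier := rho0 ` \<Gamma>\<rparr>)"
  then obtain g where g: "g \<in> \<Gamma>" "x = rho0 g" by auto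
  show "rho x \<in> carrier (PGL d)" unfolding g(2) rho_rho0[OF g(1)] by (rule Gamma_PGL[OF g(1)])
  fix y assume "y \<in> carrier (PGL N\<lparr>carrier := rho0 ` \<Gamma>\<rparr>)"
  then obtain h where h: "h \<in> \<Gamma>" "y = rho0 h" by auto
  have "rho0 g \<otimes>\<^bsub>PGL N\<^esub> rho0 h = rho0 (g \<otimes>\<^bsub>PGL d\<^esub> h)"
    by (rule hom_mult[OF rho0_hom Gamma_PGL[OF g(1)] Gamma_PGL[OF h(1)], symmetric])
  then show "rho (x \<otimes>\<^bsub>PGL N\<lparr>carrier := rho0 ` \<Gamma>\<rparr>\<^esub> y) = rho x \<otimes>\<^bsub>PGL d\<^esub> rho y"
    using g h rho_rho0 subgroup.m_closed[OF Gamma_subgroup g(1) h(1)] by simp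
qed

lemma rho_equivariant:
  assumes g: "g \<in> rho0 ` \<Gamma>" and x: "x \<in> (\<lambda>l. line (pt l)) ` lims"
  shows "xi (act g x) = act_flag \<theta> (rho g) (xi x)"
proof -
  obtain A where A: "A \<in> carrier_mat d d" "det A \<noteq> 0" "pcoset A \<in> \<Gamma>" "g = pcoset (R A)" by (rule image_mat[OF g])
  obtain l where l: "l \<in> lims" "x = line (pt l)" using x by blast
  have "rho g = pcoset A" using rho_rho0[OF A(3)] rho0_pcoset[OF A(1)] A(4) by simp
  then show ?thesis using xi_equivariant[OF A(1-3) l(1)] xi_pt[OF l(1)] by (simp add: A(4) l(2))
qed

end

lemma transverse_group_visible_model:
  fixes \<Gamma> :: "'k::rc_field mat set set"
  assumes "symmetric_subset d \<theta>" "\<theta> \<noteq> {}" "transverse_group d \<theta> \<Gamma>"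
  shows "\<exists>(d\<^sub>0::nat) \<Omega> \<Gamma>\<^sub>0 (\<rho> :: real mat set \<Rightarrow> 'k mat set) (\<xi> :: real vec set \<Rightarrow> nat \<Rightarrow> 'k vec set).
     properly_convex_domain d\<^sub>0 \<Omega> \<and> projectively_visible d\<^sub>0 \<Omega> \<Gamma>\<^sub>0 \<and>
     \<rho> \<in> hom (PGL d\<^sub>0\<lparr>carrier := \<Gamma>\<^sub>0\<rparr>) (PGL d) \<and> inj_on \<rho> \<Gamma>\<^sub>0 \<and>
     continuous_map (subtopology (proj_topology d\<^sub>0) (orbital_limit_set d\<^sub>0 \<Omega> \<Gamma>\<^sub>0)) (flag_topology d \<theta>) \<xi> \<and>
     (\<forall>g\<in>\<Gamma>\<^sub>0. \<forall>x\<in>orbital_limit_set d\<^sub>0 \<Omega> \<Gamma>\<^sub>0. \<xi> (act g x) = act_flag \<theta> (\<rho> g) (\<xi> x)) \<and>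
     \<rho> ` \<Gamma>\<^sub>0 = \<Gamma> \<and> \<xi> ` orbital_limit_set d\<^sub>0 \<Omega> \<Gamma>\<^sub>0 = limit_set d \<theta> \<Gamma>"
proof -
  interpret transverse d \<theta> \<Gamma> by unfold_locales (fact assms)+
  obtain j where j: "j \<in> \<theta>" using nonempty by blast
  \<comment> \<open>By symmetry of \<theta>, either \<open>j\<close> or \<open>d - j\<close> is at
    most half of \<open>d\<close>.\<close>
  obtain k where k: "k \<in> \<theta>" "2 * k \<le> d"
  proof (cases "2 * j \<le> d")
    case False
    then show ?thesis using that[of "d - j"] theta(3)[OF j] by simp
  qed (use j that in blast)
  obtain N X w where pb: "pairing_basis d k N (X :: nat \<Rightarrow> 'k mat) w" using pairing_basis_exists by blast
  interpret transverse_rep d k N \<theta> \<Gamma> X w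
    by (intro transverse_rep.intro transverse_rep_axioms.intro transverse_axioms pb k)
  have inj: "inj_on rho (rho0 ` \<Gamma>)" by (rule inj_onI) (use rho_rho0 in auto)
  have im: "rho ` rho0 ` \<Gamma> = \<Gamma>" using rho_rho0 by (auto simp: image_iff)
  have lim: "xi ` (\<lambda>l. line (pt l)) ` lims = limit_set d \<theta> \<Gamma>"
    unfolding limit_set_eq image_image by (rule image_cong[OF refl xi_pt])
  show ?thesis
    by (intro exI[of _ N] exI[of _ Omega] exI[of _ "rho0 ` \<Gamma>"] exI[of _ rho] exI[of _ xi],
        unfold orbital_limit_set_eq, intro conjI ballI properly_convex visible rho_hom xi_continuous rho_equivariant inj im lim)
qed

theorem theorem1p2:
  fixes d :: nat and \<theta> :: "nat set"
    and \<Gamma>\<^sub>R :: "real mat set set" and \<Gamma>\<^sub>C :: "complex mat set set"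
  assumes "symmetric_subset d \<theta>" and "\<theta> \<noteq> {}"
  shows
    "(transverse_group d \<theta> \<Gamma>\<^sub>R \<longrightarrow>
       (\<exists>(d\<^sub>0::nat) \<Omega> \<Gamma>\<^sub>0 (\<rho> :: real mat set \<Rightarrow> real mat set) (\<xi> :: real vec set \<Rightarrow> nat \<Rightarrow> real vec set).
          properly_convex_domain d\<^sub>0 \<Omega> \<and> projectively_visible d\<^sub>0 \<Omega> \<Gamma>\<^sub>0 \<and>
          \<rho> \<in> hom (PGL d\<^sub>0\<lparr>carrier := \<Gamma>\<^sub>0\<rparr>) (PGL d) \<and> inj_on \<rho> \<Gamma>\<^sub>0 \<and>
          continuous_map (subtopology (proj_topology d\<^sub>0) (orbital_limit_set d\<^sub>0 \<Omega> \<Gamma>\<^sub>0))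
            (flag_topology d \<theta>) \<xi> \<and>
          (\<forall>g\<in>\<Gamma>\<^sub>0. \<forall>x\<in>orbital_limit_set d\<^sub>0 \<Omega> \<Gamma>\<^sub>0. \<xi> (act g x) = act_flag \<theta> (\<rho> g) (\<xi> x)) \<and>
          \<rho> ` \<Gamma>\<^sub>0 = \<Gamma>\<^sub>R \<and> \<xi> ` orbital_limit_set d\<^sub>0 \<Omega> \<Gamma>\<^sub>0 = limit_set d \<theta> \<Gamma>\<^sub>R)) \<and>
     (transverse_group d \<theta> \<Gamma>\<^sub>C \<longrightarrow>
       (\<exists>(d\<^sub>0::nat) \<Omega> \<Gamma>\<^sub>0 (\<rho> :: real mat set \<Rightarrow> complex mat set) (\<xi> :: real vec set \<Rightarrow> nat \<Rightarrow> complex vec set).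
          properly_convex_domain d\<^sub>0 \<Omega> \<and> projectively_visible d\<^sub>0 \<Omega> \<Gamma>\<^sub>0 \<and>
          \<rho> \<in> hom (PGL d\<^sub>0\<lparr>carrier := \<Gamma>\<^sub>0\<rparr>) (PGL d) \<and> inj_on \<rho> \<Gamma>\<^sub>0 \<and>
          continuous_map (subtopology (proj_topology d\<^sub>0) (orbital_limit_set d\<^sub>0 \<Omega> \<Gamma>\<^sub>0))
            (flag_topology d \<theta>) \<xi> \<and>
          (\<forall>g\<in>\<Gamma>\<^sub>0. \<forall>x\<in>orbital_limit_set d\<^sub>0 \<Omega> \<Gamma>\<^sub>0. \<xi> (act g x) = act_flag \<theta> (\<rho> g) (\<xi> x)) \<and>
          \<rho> ` \<Gamma>\<^sub>0 = \<Gamma>\<^sub>C \<and> \<xi> ` orbital_limit_set d\<^sub>0 \<Omega> \<Gamma>\<^sub>0 = limit_set d \<theta> \<Gamma>\<^sub>C))"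
  using transverse_group_visible_model[OF assms, of \<Gamma>\<^sub>R] transverse_group_visible_model[OF assms, of \<Gamma>\<^sub>C]
  by (intro conjI impI)

end
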